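(* Let $(G,\omega)$ be a saturated $p$-valued group with ordered basis $(g_1,\dots,g_d)$. Assume $\omega$ takes values in $\mathbb{Q}$, and for a positive integer $N$ let $\tau_{N,i}=\frac{1}{N+1}\big(\omega(g_i)-\frac{1}{p-1}\big)$ for $i=1,\dots,d$. Then the rigid analytic polydisc $\mathbb{B}(p^{\tau_{N,1}},\dots,p^{\tau_{N,d}})$ over $\mathbb{Q}_p$ has a unique rigid analytic group structure which is compatible with the group structure on the dagger group $\mathbb{G}$ attached to $(G,\omega)$ and $(g_1,\dots,g_d)$.
   Context: $p$ is a prime; $v$ is the $p$-adic valuation on $\mathbb{Z}_p$ with $v(p)=1$, $v(0)=\infty$; $|p|=1/p$. A $p$-valued group $(G,\omega)$ is a pro-$p$ group $G$ with a function $\omega:G\setminus\{1\}\to(0,\infty)$ (convention $\omega(1)=\infty$) such that for all $g,h\in G$: (a) $\omega(g)>\frac{1}{p-1}$; (b) $\omega(g^{-1}h)\ge\min\{\omega(g),\omega(h)\}$; (c) $\omega([g,h])\ge\omega(g)+\omega(h)$; (d) $\omega(g^p)=\omega(g)+1$; and such that the topology of $G$ is defined by $\omega$ (the subgroups $\{g:\omega(g)\ge\nu\}$, $\nu>0$, form a neighborhood basis of $1$). It is saturated if $\omega(g)>\frac{p}{p-1}$ implies that $g$ is a $p$-th power in $G$. An ordered basis is a sequence $(g_1,\dots,g_d)$ in $G$ such that $\mathbb{Z}_p^d\to G$, $x\mapsto g_1^{x_1}\cdots g_d^{x_d}$, is a homeomorphism and $\omega(g_1^{x_1}\cdots g_d^{x_d})=\min_i\{\omega(g_i)+v(x_i)\}$.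 For $r_1,\dots,r_d\in p^{\mathbb{Q}}$, $\mathbb{B}(r_1,\dots,r_d)=\{(x_1,\dots,x_d)\in\mathbb{A}^d_{\mathrm{rig}}:|x_i|\le r_i\ \forall i\}$ is the affinoid rigid space over $\mathbb{Q}_p$ with functions the power series $\sum_\alpha c_\alpha Z^\alpha$ satisfying $|c_\alpha|r_1^{\alpha_1}\cdots r_d^{\alpha_d}\to0$ as $|\alpha|\to\infty$. $\mathbb{Q}_p\langle Z_1,\dots,Z_d\rangle^\dagger$ is the Washnitzer algebra of power series $\sum_\alpha c_\alpha Z^\alpha$ over $\mathbb{Q}_p$ with $|c_\alpha|r^{|\alpha|}\to0$ as $|\alpha|\to\infty$ for some $r>1$. The dagger group $\mathbb{G}$ is the unique group object in the category of (Grosse-Klönne) dagger spaces over $\mathbb{Q}_p$ with underlying space $\mathrm{Sp}(\mathbb{Q}_p\langle Z_1,\dots,Z_d\rangle^\dagger)$ such that $\varphi\mapsto g_1^{\varphi(Z_1)}\cdots g_d^{\varphi(Z_d)}$ is a group isomorphism $\mathrm{Hom}_{\mathbb{Q}_p\text{-alg}}(\mathbb{Q}_p\langle Z_1,\dots,Z_d\rangle^\dagger,\mathbb{Q}_p)\to G$. Concretely, its comultiplication $m^*:\mathbb{Q}_p\langle Z\rangle^\dagger\to\mathbb{Q}_p\langle X,Y\rangle^\dagger$ sends $Z_i$ to the power series $F_i$ with $(g_1^{x_1}\cdots g_d^{x_d})(g_1^{y_1}\cdots g_d^{y_d})=g_1^{F_1(x,y)}\cdots g_d^{F_d(x,y)}$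 for all $x,y\in\mathbb{Z}_p^d$; the antipode $i^*$ sends $Z_i$ to $I_i$ with $(g_1^{x_1}\cdots g_d^{x_d})^{-1}=g_1^{I_1(x)}\cdots g_d^{I_d(x)}$; and the counit $e^*$ is evaluation at the origin. Compatible means that the comultiplication, counit and antipode on the affinoid algebra of the polydisc (a subalgebra of $\mathbb{Q}_p\langle Z_1,\dots,Z_d\rangle^\dagger$) are the restrictions of those of $\mathbb{G}$. *)

theory Defs
  imports
    "HOL-Analysis.Analysis"
    "HOL-Algebra.Coset"
    "HOL-Computational_Algebra.Fraction_Field"
    "HOL-Library.Poly_Mapping"
    "Berlekamp_Zassenhaus.Finite_Field"
begin

section \<open>The ring of p-adic integers\<close>

text \<open>
  The prime is the cardinality of the type parameter of class \<^class>\<open>prime_card\<close>. A p-adic integer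
  is a coherent sequence of residues: entry n is the representative in [0, p^n) of its class
  modulo p^n.
\<close>

typedef (overloaded) 'p::prime_card padic_int =
  "{x :: nat \<Rightarrow> int. \<forall>n. 0 \<le> x n \<and> x n < int CARD('p) ^ n \<and> x (Suc n) mod int CARD('p) ^ n = x n}"
  morphisms padic_residue Abs_padic_int
  by (rule exI[of _ "\<lambda>_. 0"]) (auto simp: prime_card prime_gt_0_nat)

setup_lifting type_definition_padic_int

lemma prime_card_gt_0 [simp]: "0 < int CARD('p::prime_card)"
  using prime_gt_0_nat[OF prime_card] by simp

lemma mod_mod_power_Suc: "(a mod (q::int) ^ Suc n) mod q ^ n = a mod q ^ n"
  by (rule mod_mod_cancel) (simp add: le_imp_power_dvd)

instantiation padic_int :: (prime_card) comm_ring_1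
begin

lift_definition zero_padic_int :: "'a padic_int" is "\<lambda>_. 0"
  by simp

lift_definition one_padic_int :: "'a padic_int" is "\<lambda>n. 1 mod int CARD('a) ^ n"
  using mod_mod_power_Suc by simp

lift_definition plus_padic_int :: "'a padic_int \<Rightarrow> 'a padic_int \<Rightarrow> 'a padic_int"
  is "\<lambda>x y n. (x n + y n) mod int CARD('a) ^ n"
  by (auto simp only: mod_mod_power_Suc) (simp_all, metis mod_add_eq)

lift_definition uminus_padic_int :: "'a padic_int \<Rightarrow> 'a padic_int"
  is "\<lambda>x n. (- x n) mod int CARD('a) ^ n"
  by (auto simp only: mod_mod_power_Suc) (simp_all, metis mod_minus_eq)

lift_definition times_padic_int :: "'a padic_int \<Rightarrow> 'a padic_int \<Rightarrow> 'a padic_int"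
  is "\<lambda>x y n. (x n * y n) mod int CARD('a) ^ n"
  by (auto simp only: mod_mod_power_Suc) (simp_all, metis mod_mult_eq)

definition minus_padic_int :: "'a padic_int \<Rightarrow> 'a padic_int \<Rightarrow> 'a padic_int"
  where "x - y = x + - (y :: 'a padic_int)"

instance
proof
  fix a b c :: "'a padic_int"
  show "a * b * c = a * (b * c)"
    by transfer (simp add: mod_simps mult.assoc)
  show "a * b = b * a"
    by transfer (simp add: mult.commute)
  show "1 * a = a"
    by transfer (simp add: mod_simps fun_eq_iff)
  show "a + b + c = a + (b + c)"
    by transfer (simp add: mod_simps add.assoc)
  show "a + b = b + a"
    by transfer (simp add: add.commute)
  show "0 + a = a"
    by transfer (simp add: fun_eq_iff)
  show "- a + a = 0"
    by transfer (simp add: mod_simps fun_eq_iff)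
  show "a - b = a + - b"
    by (rule minus_padic_int_def)
  show "(a + b) * c = a * c + b * c"
    by transfer (simp add: mod_simps distrib_right)
  show "(0 :: 'a padic_int) \<noteq> 1"
  proof
    assume "(0 :: 'a padic_int) = 1"
    then have "padic_residue (0 :: 'a padic_int) 1 = padic_residue (1 :: 'a padic_int) 1"
      by simp
    then show False
      using prime_gt_1_nat[OF prime_card[where 'a='a]]
      by (simp add: zero_padic_int.rep_eq one_padic_int.rep_eq)
  qed
qed

end

lemma padic_residue_bounds:
  "0 \<le> padic_residue (x :: 'p::prime_card padic_int) n"
  "padic_residue (x :: 'p::prime_card padic_int) n < int CARD('p) ^ n"
  using padic_residue[of x] by auto

lemma padic_residue_add_mod:
  "padic_residue (x :: 'p::prime_card padic_int) (n + k) mod int CARD('p) ^ n = padic_residue x n"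
proof (induction k)
  case 0
  show ?case using padic_residue_bounds[of x n] by simp
next
  case (Suc k)
  have "padic_residue x (n + Suc k) mod int CARD('p) ^ (n + k) = padic_residue x (n + k)"
    using padic_residue[of x] by auto
  then have "padic_residue x (n + Suc k) mod int CARD('p) ^ (n + k) mod int CARD('p) ^ n
      = padic_residue x n"
    using Suc by simp
  moreover have "int CARD('p) ^ n dvd int CARD('p) ^ (n + k)"
    by (simp add: le_imp_power_dvd)
  ultimately show ?case
    by (simp add: mod_mod_cancel)
qed

lemma padic_residue_of_nat:
  "padic_residue (of_nat m :: 'p::prime_card padic_int) n = int m mod int CARD('p) ^ n"
  by (induction m)
    (simp_all add: zero_padic_int.rep_eq one_padic_int.rep_eq plus_padic_int.rep_eq mod_simps)

lemma padic_residue_p_power_mult: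
  "padic_residue (of_nat CARD('p) ^ k * y :: 'p::prime_card padic_int) n
    = int CARD('p) ^ k * padic_residue y n mod int CARD('p) ^ n"
  by (simp add: times_padic_int.rep_eq padic_residue_of_nat mod_simps flip: of_nat_power)

lemma padic_p_power_dvd_iff:
  "of_nat CARD('p) ^ n dvd (x :: 'p::prime_card padic_int) \<longleftrightarrow> padic_residue x n = 0"
proof
  assume "of_nat CARD('p) ^ n dvd x"
  then obtain y where "x = of_nat CARD('p) ^ n * y" ..
  then show "padic_residue x n = 0"
    by (simp add: padic_residue_p_power_mult)
next
  assume 0: "padic_residue x n = 0"
  let ?q = "int CARD('p)"
  define y where "y = (\<lambda>k. padic_residue x (n + k) div ?q ^ n)"
  have pos: "0 < ?q ^ n" by simp
  have "0 \<le> y k \<and> y k < ?q ^ k \<and> y (Suc k) mod ?q ^ k = y k" for k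
  proof (intro conjI)
    show "0 \<le> y k"
      using padic_residue_bounds[of x "n + k"] pos by (simp add: y_def pos_imp_zdiv_nonneg_iff)
    have "y k * ?q ^ n \<le> padic_residue x (n + k)"
      using div_mult_mod_eq[of "padic_residue x (n + k)" "?q ^ n"]
        pos_mod_sign[OF pos, of "padic_residue x (n + k)"] unfolding y_def by linarith
    also have "\<dots> < ?q ^ k * ?q ^ n"
      using padic_residue_bounds(2)[of x "n + k"] by (simp add: power_add mult.commute)
    finally show "y k < ?q ^ k"
      using pos by (simp add: mult_less_cancel_right)
    have "padic_residue x (n + Suc k) mod (?q ^ n * ?q ^ k) = padic_residue x (n + k)"
      using padic_residue[of x] by (auto simp flip: power_add)
    moreover have "padic_residue x (n + Suc k) mod (?q ^ n * ?q ^ k)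
        = ?q ^ n * (y (Suc k) mod ?q ^ k) + padic_residue x (n + Suc k) mod ?q ^ n"
      unfolding y_def by (rule zmod_zmult2_eq) simp
    ultimately have "padic_residue x (n + k) = ?q ^ n * (y (Suc k) mod ?q ^ k)"
      using padic_residue_add_mod[of x n "Suc k"] 0 by simp
    then show "y (Suc k) mod ?q ^ k = y k"
      using pos by (simp add: y_def)
  qed
  then have y: "padic_residue (Abs_padic_int y :: 'p padic_int) = y"
    by (intro Abs_padic_int_inverse) blast
  have "padic_residue (of_nat CARD('p) ^ n * Abs_padic_int y :: 'p padic_int) k = padic_residue x k"
    for k
  proof -
    have "?q ^ n dvd padic_residue x (n + k)"
      using padic_residue_add_mod[of x n k] 0 by (simp add: dvd_eq_mod_eq_0)
    then have "?q ^ n * y k = padic_residue x (n + k)"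
      by (simp add: y_def)
    then show ?thesis
      using padic_residue_add_mod[of x k n] by (simp add: padic_residue_p_power_mult y add.commute)
  qed
  then have "x = of_nat CARD('p) ^ n * Abs_padic_int y"
    by (metis ext padic_residue_inject)
  then show "of_nat CARD('p) ^ n dvd x" ..
qed

text \<open>The valuation of a nonzero element; the value at 0 is junk.\<close>

definition padic_ord :: "'p::prime_card padic_int \<Rightarrow> nat" where
  "padic_ord x = Max {n. of_nat CARD('p) ^ n dvd x}"

definition padic_val :: "'p::prime_card padic_int \<Rightarrow> ereal" where
  "padic_val x = (if x = 0 then \<infinity> else ereal (real (padic_ord x)))"

definition padic_int_norm :: "'p::prime_card padic_int \<Rightarrow> real" where
  "padic_int_norm x = (if x = 0 then 0 else (1 / real CARD('p)) ^ padic_ord x)"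

lemma padic_p_power_dvd_iff_ord:
  assumes "x \<noteq> (0 :: 'p::prime_card padic_int)"
  shows "of_nat CARD('p) ^ n dvd x \<longleftrightarrow> n \<le> padic_ord x"
proof -
  let ?S = "{n. of_nat CARD('p) ^ n dvd x}"
  obtain m where m: "padic_residue x m \<noteq> 0"
    using assms by (metis ext padic_residue_inject zero_padic_int.rep_eq)
  have "n < m" if "n \<in> ?S" for n
  proof (rule ccontr)
    assume "\<not> n < m"
    then have "of_nat CARD('p) ^ m dvd x"
      using that power_le_dvd[of "of_nat CARD('p)" n x m] by simp
    then show False
      using m by (simp add: padic_p_power_dvd_iff)
  qed
  then have fin: "finite ?S"
    by (meson bounded_nat_set_is_finite)
  have "0 \<in> ?S" by simp
  then have "padic_ord x \<in> ?S"
    unfolding padic_ord_def using Max_in[OF fin] by blast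
  then show ?thesis
    using Max_ge[OF fin, folded padic_ord_def] power_le_dvd[of "of_nat CARD('p)" "padic_ord x" x n]
    by auto
qed

lemma padic_p_power_cancel:
  assumes "of_nat CARD('p) ^ k * (z :: 'p::prime_card padic_int) = 0"
  shows "z = 0"
proof -
  let ?q = "int CARD('p)"
  have "padic_residue z n = 0" for n
  proof -
    have "?q ^ k * padic_residue z (n + k) mod ?q ^ (n + k) = 0"
      using padic_residue_p_power_mult[of k z "n + k"] assms by (simp add: zero_padic_int.rep_eq)
    then have "?q ^ k * ?q ^ n dvd ?q ^ k * padic_residue z (n + k)"
      by (simp add: dvd_eq_mod_eq_0 power_add mult.commute)
    then have "?q ^ n dvd padic_residue z (n + k)"
      by simp
    then show ?thesis
      using padic_residue_add_mod[of z n k] by (simp add: dvd_eq_mod_eq_0)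
  qed
  then show ?thesis
    by (metis ext padic_residue_inject zero_padic_int.rep_eq)
qed

lemma padic_p_dvd_mult:
  assumes "of_nat CARD('p) dvd (u * w :: 'p::prime_card padic_int)"
  shows "of_nat CARD('p) dvd u \<or> of_nat CARD('p) dvd w"
proof -
  have "int CARD('p) dvd padic_residue u 1 * padic_residue w 1"
    using assms padic_p_power_dvd_iff[of 1 "u * w"]
    by (simp add: times_padic_int.rep_eq dvd_eq_mod_eq_0)
  then have "int CARD('p) dvd padic_residue u 1 \<or> int CARD('p) dvd padic_residue w 1"
    using prime_card_int[where 'a='p] by (metis prime_dvd_mult_iff)
  then have "padic_residue u 1 = 0 \<or> padic_residue w 1 = 0"
    using padic_residue_bounds[of u 1] padic_residue_bounds[of w 1]
    by (auto dest: zdvd_imp_le)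
  then show ?thesis
    using padic_p_power_dvd_iff[of 1 u] padic_p_power_dvd_iff[of 1 w] by simp
qed

lemma padic_decompose:
  assumes "x \<noteq> (0 :: 'p::prime_card padic_int)"
  obtains u where "x = of_nat CARD('p) ^ padic_ord x * u" "\<not> of_nat CARD('p) dvd u"
proof -
  obtain u where u: "x = of_nat CARD('p) ^ padic_ord x * u"
    using padic_p_power_dvd_iff_ord[OF assms, of "padic_ord x"] by (auto elim: dvdE)
  moreover have "\<not> of_nat CARD('p) dvd u"
  proof
    assume "of_nat CARD('p) dvd u"
    then have "of_nat CARD('p) ^ Suc (padic_ord x) dvd x"
      by (subst u) (metis dvd_refl mult_dvd_mono power_Suc2)
    then show False
      using padic_p_power_dvd_iff_ord[OF assms] by (metis Suc_n_not_le_n)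
  qed
  ultimately show ?thesis by (rule that)
qed

instance padic_int :: (prime_card) idom
proof
  fix a b :: "'a padic_int"
  assume a: "a \<noteq> 0" and b: "b \<noteq> 0"
  obtain u where u: "a = of_nat CARD('a) ^ padic_ord a * u" "\<not> of_nat CARD('a) dvd u"
    by (rule padic_decompose[OF a])
  obtain w where w: "b = of_nat CARD('a) ^ padic_ord b * w" "\<not> of_nat CARD('a) dvd w"
    by (rule padic_decompose[OF b])
  have eq: "a * b = of_nat CARD('a) ^ (padic_ord a + padic_ord b) * (u * w)"
    by (subst u, subst w) (simp add: power_add algebra_simps)
  show "a * b \<noteq> 0"
  proof
    assume "a * b = 0"
    then have "u * w = 0"
      using eq padic_p_power_cancel by metis
    then show False
      using padic_p_dvd_mult[of u w] u w by simp
  qed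
qed

lemma padic_ord_mult:
  assumes "x \<noteq> 0" "y \<noteq> (0 :: 'p::prime_card padic_int)"
  shows "padic_ord (x * y) = padic_ord x + padic_ord y"
proof -
  obtain u where u: "x = of_nat CARD('p) ^ padic_ord x * u" "\<not> of_nat CARD('p) dvd u"
    by (rule padic_decompose[OF assms(1)])
  obtain w where w: "y = of_nat CARD('p) ^ padic_ord y * w" "\<not> of_nat CARD('p) dvd w"
    by (rule padic_decompose[OF assms(2)])
  let ?s = "padic_ord x + padic_ord y"
  have eq: "x * y = of_nat CARD('p) ^ ?s * (u * w)"
    by (subst u, subst w) (simp add: power_add algebra_simps)
  have ne: "x * y \<noteq> 0" using assms by simp
  then have "of_nat CARD('p) ^ ?s \<noteq> (0 :: 'p padic_int)"
    using eq by auto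
  then have "\<not> of_nat CARD('p) ^ Suc ?s dvd x * y"
    using padic_p_dvd_mult[of u w] u(2) w(2)
    unfolding eq power_Suc2 dvd_mult_cancel_left by blast
  moreover have "of_nat CARD('p) ^ ?s dvd x * y"
    using eq by simp
  ultimately show ?thesis
    using padic_p_power_dvd_iff_ord[OF ne] by (metis le_antisym not_less_eq_eq)
qed

lemma padic_int_norm_mult: "padic_int_norm (x * y) = padic_int_norm x * padic_int_norm y"
  by (simp add: padic_int_norm_def padic_ord_mult power_add)

lemma padic_int_norm_uminus: "padic_int_norm (- x) = padic_int_norm x"
  by (simp add: padic_int_norm_def padic_ord_def)

lemma padic_int_norm_nonneg: "0 \<le> padic_int_norm x"
  by (simp add: padic_int_norm_def)

lemma padic_int_norm_eq_0_iff: "padic_int_norm x = 0 \<longleftrightarrow> x = 0"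
  by (simp add: padic_int_norm_def)

lemma padic_int_norm_add:
  "padic_int_norm (x + y) \<le> max (padic_int_norm x) (padic_int_norm (y :: 'p::prime_card padic_int))"
proof (cases "x = 0 \<or> y = 0 \<or> x + y = 0")
  case True
  then show ?thesis
    using padic_int_norm_nonneg[of x] by (auto simp: padic_int_norm_def le_max_iff_disj)
next
  case False
  let ?m = "min (padic_ord x) (padic_ord y)"
  have "of_nat CARD('p) ^ ?m dvd x + y"
    using False by (intro dvd_add) (simp_all add: padic_p_power_dvd_iff_ord)
  then have le: "?m \<le> padic_ord (x + y)"
    using False padic_p_power_dvd_iff_ord[of "x + y"] by blast
  have "1 / real CARD('p) \<le> 1" by simp
  then have "(1 / real CARD('p)) ^ padic_ord (x + y) \<le> (1 / real CARD('p)) ^ ?m"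
    by (intro power_decreasing le) simp_all
  also have "\<dots> \<le> max ((1 / real CARD('p)) ^ padic_ord x) ((1 / real CARD('p)) ^ padic_ord y)"
    by (simp add: min_def)
  finally show ?thesis
    using False by (simp add: padic_int_norm_def)
qed

instantiation padic_int :: (prime_card) metric_space
begin

definition dist_padic_int :: "'a padic_int \<Rightarrow> 'a padic_int \<Rightarrow> real"
  where "dist x y = padic_int_norm (x - y)"

definition uniformity_padic_int :: "('a padic_int \<times> 'a padic_int) filter"
  where "uniformity = (INF e\<in>{0 <..}. principal {(x :: 'a padic_int, y). dist x y < e})"

definition open_padic_int :: "'a padic_int set \<Rightarrow> bool"
  where "open U \<longleftrightarrow> (\<forall>x\<in>U. eventually (\<lambda>(x', y :: 'a padic_int). x' = x \<longrightarrow> y \<in> U) uniformity)"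

instance
proof
  fix x y z :: "'a padic_int"
  show "dist x y = 0 \<longleftrightarrow> x = y"
    by (simp add: dist_padic_int_def padic_int_norm_eq_0_iff)
  have "dist x y \<le> max (dist x z) (dist y z)"
    using padic_int_norm_add[of "x - z" "- (y - z)"]
    unfolding dist_padic_int_def padic_int_norm_uminus by simp
  then show "dist x y \<le> dist x z + dist y z"
    using padic_int_norm_nonneg[of "x - z"] padic_int_norm_nonneg[of "y - z"]
    unfolding dist_padic_int_def by linarith
qed (fact uniformity_padic_int_def open_padic_int_def)+

end

section \<open>The field of p-adic numbers\<close>

type_synonym 'p padic = "'p padic_int fract"

definition padic_norm :: "'p::prime_card padic \<Rightarrow> real" where
  "padic_norm q =
     (THE r. \<exists>a b. b \<noteq> 0 \<and> q = Fract a b \<and> r = padic_int_norm a / padic_int_norm b)"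

lemma padic_norm_Fract:
  assumes "b \<noteq> (0 :: 'p::prime_card padic_int)"
  shows "padic_norm (Fract a b) = padic_int_norm a / padic_int_norm b"
  unfolding padic_norm_def
proof (rule the_equality)
  fix r
  assume "\<exists>c d. d \<noteq> 0 \<and> Fract a b = Fract c d \<and> r = padic_int_norm c / padic_int_norm d"
  then obtain c d where cd: "d \<noteq> 0" "Fract a b = Fract c d" "r = padic_int_norm c / padic_int_norm d"
    by blast
  then have "a * d = c * b"
    using assms by (simp add: eq_fract)
  then show "r = padic_int_norm a / padic_int_norm b"
    using assms cd by (simp add: padic_int_norm_eq_0_iff frac_eq_eq flip: padic_int_norm_mult)
qed (use assms in blast)

definition padic_int_of_padic :: "'p::prime_card padic \<Rightarrow> 'p padic_int" where
  "padic_int_of_padic q = (THE z. Fract z 1 = q)"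

section \<open>Formal power series in several variables\<close>

typedef ('v, 'a) mps = "UNIV :: (('v \<Rightarrow>\<^sub>0 nat) \<Rightarrow> 'a) set"
  morphisms mps_coeff Abs_mps ..

setup_lifting type_definition_mps

lemma finite_antidiagonal: "finite {(b, c). b + c = (a :: 'v \<Rightarrow>\<^sub>0 nat)}"
proof -
  let ?L = "\<lambda>b. \<lambda>v\<in>Poly_Mapping.keys a. poly_mapping.lookup b v"
  let ?B = "{b. \<forall>v. poly_mapping.lookup b v \<le> poly_mapping.lookup a v}"
  have "inj_on ?L ?B"
  proof (rule inj_onI)
    fix b c assume b: "b \<in> ?B" and c: "c \<in> ?B" and eq: "?L b = ?L c"
    have "poly_mapping.lookup b v = poly_mapping.lookup c v" for v
    proof (cases "v \<in> Poly_Mapping.keys a")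
      case True
      then show ?thesis using fun_cong[OF eq, of v] by simp
    next
      case False
      then have "poly_mapping.lookup a v = 0" by (simp add: in_keys_iff)
      moreover have "poly_mapping.lookup b v \<le> poly_mapping.lookup a v"
        "poly_mapping.lookup c v \<le> poly_mapping.lookup a v"
        using b c by auto
      ultimately show ?thesis by simp
    qed
    then show "b = c" by (rule poly_mapping_eqI)
  qed
  moreover have "?L ` ?B \<subseteq> (\<Pi>\<^sub>E v\<in>Poly_Mapping.keys a. {..poly_mapping.lookup a v})"
    by auto
  then have "finite (?L ` ?B)"
    by (rule finite_subset) (intro finite_PiE finite_keys finite_atMost)
  ultimately have "finite ?B" by (rule finite_imageD[rotated])
  moreover have "{(b, c). b + c = a} \<subseteq> ?B \<times> ?B"
    by (auto simp: lookup_add)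
  ultimately show ?thesis
    using finite_subset finite_SigmaI by blast
qed

instantiation mps :: (type, comm_ring_1) comm_ring_1
begin

lift_definition zero_mps :: "('a, 'b) mps" is "\<lambda>_. 0" .

lift_definition one_mps :: "('a, 'b) mps" is "\<lambda>a. if a = 0 then 1 else 0" .

lift_definition plus_mps :: "('a, 'b) mps \<Rightarrow> ('a, 'b) mps \<Rightarrow> ('a, 'b) mps"
  is "\<lambda>f g a. f a + g a" .

lift_definition uminus_mps :: "('a, 'b) mps \<Rightarrow> ('a, 'b) mps" is "\<lambda>f a. - f a" .

lift_definition minus_mps :: "('a, 'b) mps \<Rightarrow> ('a, 'b) mps \<Rightarrow> ('a, 'b) mps"
  is "\<lambda>f g a. f a - g a" .

lift_definition times_mps :: "('a, 'b) mps \<Rightarrow> ('a, 'b) mps \<Rightarrow> ('a, 'b) mps"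
  is "\<lambda>f g a. \<Sum>(b, c) | b + c = a. f b * g c" .

instance
proof
  fix f g h :: "('a, 'b) mps"
  show "f * g * h = f * (g * h)"
  proof (transfer, rule ext)
    fix f g h :: "('a \<Rightarrow>\<^sub>0 nat) \<Rightarrow> 'b" and a
    have "(\<Sum>(b, c) | b + c = a. (\<Sum>(d, e) | d + e = b. f d * g e) * h c)
        = (\<Sum>((b, c), (d, e)) \<in> (SIGMA (b, c):{(b, c). b + c = a}. {(d, e). d + e = b}).
            f d * g e * h c)"
      by (subst sum.Sigma[symmetric])
        (auto simp: finite_antidiagonal[unfolded split_def] sum_distrib_right split_def intro!: sum.cong)
    also have "\<dots> = (\<Sum>((b, c), (d, e)) \<in> (SIGMA (b, c):{(b, c). b + c = a}. {(d, e). d + e = c}).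
            f b * (g d * h e))"
      by (rule sum.reindex_bij_witness[of _
            "\<lambda>((b, c), (d, e)). ((b + d, e), (b, d))" "\<lambda>((b, c), (d, e)). ((d, e + c), (e, c))"])
        (auto simp: add.assoc mult.assoc)
    also have "\<dots> = (\<Sum>(b, c) | b + c = a. f b * (\<Sum>(d, e) | d + e = c. g d * h e))"
      by (subst sum.Sigma[symmetric])
        (auto simp: finite_antidiagonal[unfolded split_def] sum_distrib_left split_def intro!: sum.cong)
    finally show "(\<Sum>(b, c) | b + c = a. (\<Sum>(d, e) | d + e = b. f d * g e) * h c)
        = (\<Sum>(b, c) | b + c = a. f b * (\<Sum>(d, e) | d + e = c. g d * h e))" .
  qed
  show "f * g = g * f"
    by (transfer, rule ext)
      (rule sum.reindex_bij_witness[of _ "\<lambda>(b, c). (c, b)" "\<lambda>(b, c). (c, b)"],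
        auto simp: ac_simps)
  show "1 * f = f"
  proof (transfer, rule ext)
    fix f :: "('a \<Rightarrow>\<^sub>0 nat) \<Rightarrow> 'b" and a
    have "(\<Sum>(b, c) | b + c = a. (if b = 0 then 1 else 0) * f c)
        = (\<Sum>(b, c) \<in> {(0 :: 'a \<Rightarrow>\<^sub>0 nat, a)}. (if b = 0 then 1 else 0) * f c)"
      by (rule sum.mono_neutral_right) (auto simp: finite_antidiagonal split: if_splits)
    then show "(\<Sum>(b, c) | b + c = a. (if b = 0 then 1 else 0) * f c) = f a"
      by simp
  qed
  show "f + g + h = f + (g + h)" by transfer (simp add: add.assoc)
  show "f + g = g + f" by transfer (simp add: add.commute)
  show "0 + f = f" by transfer simp
  show "- f + f = 0" by transfer simp
  show "f - g = f + - g" by transfer simp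
  show "(f + g) * h = f * h + g * h"
    by transfer (simp add: sum.distrib distrib_right split_def)
  show "(0 :: ('a, 'b) mps) \<noteq> 1" by transfer (auto simp: fun_eq_iff)
qed

end

lift_definition mps_const :: "'a::zero \<Rightarrow> ('v, 'a) mps"
  is "\<lambda>c a. if a = 0 then c else 0" .

lift_definition mps_var :: "'v \<Rightarrow> ('v, 'a::zero_neq_one) mps"
  is "\<lambda>v a. if a = Poly_Mapping.single v 1 then 1 else 0" .

text \<open>For injective s: replace every variable v by the variable s v.\<close>

lift_definition mps_rename :: "('v \<Rightarrow> 'w) \<Rightarrow> ('v, 'a::zero) mps \<Rightarrow> ('w, 'a) mps"
  is "\<lambda>s f a. if Poly_Mapping.keys a \<subseteq> range s then f (Poly_Mapping.map_key s a) else 0" .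

definition total_deg :: "('v \<Rightarrow>\<^sub>0 nat) \<Rightarrow> nat" where
  "total_deg a = (\<Sum>v\<in>Poly_Mapping.keys a. poly_mapping.lookup a v)"

section \<open>Functions on polydiscs\<close>

text \<open>
  The affinoid algebra of the closed polydisc of polyradius r in the variables V. The filter is
  the passage of the total degree to infinity.
\<close>

definition tate_algebra :: "'v set \<Rightarrow> ('v \<Rightarrow> real) \<Rightarrow> ('v, 'p::prime_card padic) mps set" where
  "tate_algebra V r = {f.
     (\<forall>a. mps_coeff f a \<noteq> 0 \<longrightarrow> Poly_Mapping.keys a \<subseteq> V) \<and>
     ((\<lambda>a. padic_norm (mps_coeff f a) * (\<Prod>v\<in>Poly_Mapping.keys a. r v ^ poly_mapping.lookup a v))
        \<longlongrightarrow> 0) (filtercomap total_deg at_top)}"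

definition washnitzer_algebra :: "'v set \<Rightarrow> ('v, 'p::prime_card padic) mps set" where
  "washnitzer_algebra V = (\<Union>\<rho>\<in>{1<..}. tate_algebra V (\<lambda>_. \<rho>))"

text \<open>
  For X a polydisc of dimension d, a variable (b, i) is the i-th coordinate on the b-th factor of
  a power of X. The function algebra of the k-th power of X consists of series in the
  variables with b < k and i < d. For k = 0 these are the constants, so the 0-th member of each
  family below is the field of p-adic numbers, embedded as constant series.
\<close>

type_synonym 'p series = "(nat \<times> nat, 'p padic) mps"

definition polydisc_powers :: "nat \<Rightarrow> (nat \<Rightarrow> real) \<Rightarrow> nat \<Rightarrow> 'p::prime_card series set" where
  "polydisc_powers d r k = tate_algebra ({..<k} \<times> {..<d}) (\<lambda>(b, i). r i)"

definition dagger_disc_powers :: "nat \<Rightarrow> nat \<Rightarrow> 'p::prime_card series set" where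
  "dagger_disc_powers d k = washnitzer_algebra ({..<k} \<times> {..<d})"

section \<open>Group objects\<close>

text \<open>
  Morphisms of affinoid (respectively dagger affinoid) spaces are the algebra homomorphisms in the
  opposite direction; continuity is automatic and not imposed. As functions they are normalised to be \<open>undefined\<close> outside the source
  algebra, so that equality of functions is equality of morphisms.
\<close>

definition alg_homs :: "'p::prime_card series set \<Rightarrow> 'p series set \<Rightarrow> ('p series \<Rightarrow> 'p series) set"
  where
  "alg_homs A B = {h \<in> A \<rightarrow>\<^sub>E B.
     (\<forall>f\<in>A. \<forall>g\<in>A. h (f + g) = h f + h g \<and> h (f * g) = h f * h g) \<and>
     (\<forall>c. h (mps_const c) = mps_const c)}"

text \<open>
  Below, A k is the function algebra of the k-th power of a space X. The first function is the
  pullback along the j-th projection from a power of X to X.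
\<close>

definition proj_pullback :: "(nat \<Rightarrow> 'p::prime_card series set) \<Rightarrow> nat \<Rightarrow> 'p series \<Rightarrow> 'p series"
  where "proj_pullback A j = restrict (mps_rename (\<lambda>(b, i). (b + j, i))) (A 1)"

text \<open>
  The pullback along the morphism Sp B \<open>\<rightarrow>\<close> X \<open>\<times>\<close> X whose two components have the
  pullbacks \<phi> and \<psi> (universal property of the product).
\<close>

definition pair_pullback ::
  "(nat \<Rightarrow> 'p::prime_card series set) \<Rightarrow> 'p series set \<Rightarrow>
    ('p series \<Rightarrow> 'p series) \<Rightarrow> ('p series \<Rightarrow> 'p series) \<Rightarrow> 'p series \<Rightarrow> 'p series" where
  "pair_pullback A B \<phi> \<psi> = (THE h. h \<in> alg_homs (A 2) B \<and>
     compose (A 1) h (proj_pullback A 0) = \<phi> \<and> compose (A 1) h (proj_pullback A 1) = \<psi>)"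

record 'p group_law =
  comult :: "'p series \<Rightarrow> 'p series"
  counit :: "'p series \<Rightarrow> 'p series"
  antipode :: "'p series \<Rightarrow> 'p series"

text \<open>The product of two Sp B-valued points of X.\<close>

definition point_mult ::
  "(nat \<Rightarrow> 'p::prime_card series set) \<Rightarrow> 'p group_law \<Rightarrow> 'p series set \<Rightarrow>
    ('p series \<Rightarrow> 'p series) \<Rightarrow> ('p series \<Rightarrow> 'p series) \<Rightarrow> 'p series \<Rightarrow> 'p series" where
  "point_mult A S B \<phi> \<psi> = compose (A 1) (pair_pullback A B \<phi> \<psi>) (comult S)"

text \<open>
  The group axioms are the usual commutative diagrams, read as identities between morphisms from
  the third power of X (associativity) and from X (unit and inverse) to X. The constant morphism
  from X to X at the unit section has the same pullback function as the counit, because the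
  algebra A 0 of constants is contained in A 1.
\<close>

definition group_object :: "(nat \<Rightarrow> 'p::prime_card series set) \<Rightarrow> 'p group_law \<Rightarrow> bool" where
  "group_object A S \<longleftrightarrow>
     comult S \<in> alg_homs (A 1) (A 2) \<and>
     counit S \<in> alg_homs (A 1) (A 0) \<and>
     antipode S \<in> alg_homs (A 1) (A 1) \<and>
     point_mult A S (A 3)
         (point_mult A S (A 3) (proj_pullback A 0) (proj_pullback A 1)) (proj_pullback A 2)
       = point_mult A S (A 3)
         (proj_pullback A 0) (point_mult A S (A 3) (proj_pullback A 1) (proj_pullback A 2)) \<and>
     point_mult A S (A 1) (counit S) (restrict id (A 1)) = restrict id (A 1) \<and>
     point_mult A S (A 1) (restrict id (A 1)) (counit S) = restrict id (A 1) \<and>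
     point_mult A S (A 1) (antipode S) (restrict id (A 1)) = counit S \<and>
     point_mult A S (A 1) (restrict id (A 1)) (antipode S) = counit S"

definition rational_points ::
  "(nat \<Rightarrow> 'p::prime_card series set) \<Rightarrow> 'p group_law \<Rightarrow> ('p series \<Rightarrow> 'p series) monoid" where
  "rational_points A S =
     \<lparr>carrier = alg_homs (A 1) (A 0), mult = point_mult A S (A 0), one = counit S\<rparr>"

section \<open>p-valued groups\<close>

definition topological_group :: "('g, 'b) monoid_scheme \<Rightarrow> 'g topology \<Rightarrow> bool" where
  "topological_group G T \<longleftrightarrow> group G \<and> topspace T = carrier G \<and>
     continuous_map (prod_topology T T) T (\<lambda>(x, y). x \<otimes>\<^bsub>G\<^esub> y) \<and>
     continuous_map T T (\<lambda>x. inv\<^bsub>G\<^esub> x)"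

definition pro_p_group :: "nat \<Rightarrow> ('g, 'b) monoid_scheme \<Rightarrow> 'g topology \<Rightarrow> bool" where
  "pro_p_group p G T \<longleftrightarrow> topological_group G T \<and> compact_space T \<and> Hausdorff_space T \<and>
     (\<forall>U. openin T U \<and> \<one>\<^bsub>G\<^esub> \<in> U \<longrightarrow> (\<exists>H\<subseteq>U. subgroup H G \<and> openin T H)) \<and>
     (\<forall>H. H \<lhd> G \<and> openin T H \<longrightarrow> (\<exists>k. card (rcosets\<^bsub>G\<^esub> H) = p ^ k))"

text \<open>The other convention for commutators gives the same condition, as \<omega> is invariant under inversion.\<close>

definition group_commutator :: "('g, 'b) monoid_scheme \<Rightarrow> 'g \<Rightarrow> 'g \<Rightarrow> 'g" where
  "group_commutator G g h = g \<otimes>\<^bsub>G\<^esub> h \<otimes>\<^bsub>G\<^esub> inv\<^bsub>G\<^esub> g \<otimes>\<^bsub>G\<^esub> inv\<^bsub>G\<^esub> h"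

definition p_valued_group ::
  "nat \<Rightarrow> ('g, 'b) monoid_scheme \<Rightarrow> 'g topology \<Rightarrow> ('g \<Rightarrow> ereal) \<Rightarrow> bool" where
  "p_valued_group p G T \<omega> \<longleftrightarrow> pro_p_group p G T \<and>
     \<omega> \<one>\<^bsub>G\<^esub> = \<infinity> \<and>
     (\<forall>g\<in>carrier G - {\<one>\<^bsub>G\<^esub>}. 0 < \<omega> g \<and> \<omega> g < \<infinity>) \<and>
     (\<forall>g\<in>carrier G. \<omega> g > ereal (1 / (real p - 1))) \<and>
     (\<forall>g\<in>carrier G. \<forall>h\<in>carrier G. \<omega> (inv\<^bsub>G\<^esub> g \<otimes>\<^bsub>G\<^esub> h) \<ge> min (\<omega> g) (\<omega> h)) \<and>
     (\<forall>g\<in>carrier G. \<forall>h\<in>carrier G. \<omega> (group_commutator G g h) \<ge> \<omega> g + \<omega> h) \<and>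
     (\<forall>g\<in>carrier G. \<omega> (g [^]\<^bsub>G\<^esub> p) = \<omega> g + 1) \<and>
     (\<forall>W\<subseteq>carrier G. (\<exists>U. openin T U \<and> \<one>\<^bsub>G\<^esub> \<in> U \<and> U \<subseteq> W) \<longleftrightarrow>
        (\<exists>\<nu>::real. \<nu> > 0 \<and> {g \<in> carrier G. \<omega> g \<ge> ereal \<nu>} \<subseteq> W))"

definition saturated :: "nat \<Rightarrow> ('g, 'b) monoid_scheme \<Rightarrow> ('g \<Rightarrow> ereal) \<Rightarrow> bool" where
  "saturated p G \<omega> \<longleftrightarrow>
     (\<forall>g\<in>carrier G. \<omega> g > ereal (real p / (real p - 1)) \<longrightarrow> (\<exists>h\<in>carrier G. g = h [^]\<^bsub>G\<^esub> p))"

text \<open>g raised to a p-adic integer x, as the limit of the powers of g by the residues of x.\<close>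

definition padic_pow ::
  "('g, 'b) monoid_scheme \<Rightarrow> 'g topology \<Rightarrow> 'g \<Rightarrow> 'p::prime_card padic_int \<Rightarrow> 'g" where
  "padic_pow G T g x = (THE y. limitin T (\<lambda>n. g [^]\<^bsub>G\<^esub> padic_residue x n) y sequentially)"

definition basis_product ::
  "('g, 'b) monoid_scheme \<Rightarrow> 'g topology \<Rightarrow> 'g list \<Rightarrow> (nat \<Rightarrow> 'p::prime_card padic_int) \<Rightarrow> 'g" where
  "basis_product G T gs x =
     foldr (\<lambda>i y. padic_pow G T (gs ! i) (x i) \<otimes>\<^bsub>G\<^esub> y) [0..<length gs] \<one>\<^bsub>G\<^esub>"

definition ordered_basis ::
  "'p::prime_card itself \<Rightarrow> ('g, 'b) monoid_scheme \<Rightarrow> 'g topology \<Rightarrow> ('g \<Rightarrow> ereal) \<Rightarrow> 'g list \<Rightarrow> bool"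
  where
  "ordered_basis _ G T \<omega> gs \<longleftrightarrow> set gs \<subseteq> carrier G \<and>
     homeomorphic_map (product_topology (\<lambda>_. euclidean :: 'p padic_int topology) {..<length gs}) T
       (basis_product G T gs) \<and>
     (\<forall>x :: nat \<Rightarrow> 'p padic_int.
        \<omega> (basis_product G T gs x) = (INF i\<in>{..<length gs}. \<omega> (gs ! i) + padic_val (x i)))"

section \<open>The dagger group and compatibility\<close>

text \<open>
  A rational point \<phi> sends each coordinate to a constant series, which is an element of the p-adic
  integers; its coefficient at exponent 0 is read off.
\<close>

definition attached_dagger_group ::
  "('g, 'b) monoid_scheme \<Rightarrow> 'g topology \<Rightarrow> 'g list \<Rightarrow> 'p::prime_card group_law \<Rightarrow> bool" where
  "attached_dagger_group G T gs S \<longleftrightarrow>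
     group_object (dagger_disc_powers (length gs)) S \<and>
     (\<lambda>\<phi>. basis_product G T gs
         (\<lambda>i. padic_int_of_padic (mps_coeff (\<phi> (mps_var (0, i))) 0)))
       \<in> iso (rational_points (dagger_disc_powers (length gs)) S) G"

definition dagger_group ::
  "('g, 'b) monoid_scheme \<Rightarrow> 'g topology \<Rightarrow> 'g list \<Rightarrow> 'p::prime_card group_law" where
  "dagger_group G T gs = (THE S. attached_dagger_group G T gs S)"

definition restricts_to :: "'p::prime_card series set \<Rightarrow> 'p group_law \<Rightarrow> 'p group_law \<Rightarrow> bool" where
  "restricts_to A S' S \<longleftrightarrow>
     (\<forall>f\<in>A. comult S f = comult S' f \<and> counit S f = counit S' f \<and> antipode S f = antipode S' f)"

definition radius_exponent :: "nat \<Rightarrow> ('g \<Rightarrow> ereal) \<Rightarrow> 'g list \<Rightarrow> nat \<Rightarrow> nat \<Rightarrow> real" where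
  "radius_exponent p \<omega> gs N i =
     1 / (real N + 1) * (real_of_ereal (\<omega> (gs ! i)) - 1 / (real p - 1))"

end

(*
  Write |h| = p^(-omega h), kappa = p^(-1/(p-1)) and rho_j = kappa / |g_j|. For a word in powers of
  group elements, such as a product or an inverse of elements in coordinates, the i-th coordinate is
  a function of the exponents whose Mahler coefficients are iterated differences, on the group, of
  the coordinate function X_i. A difference along h_1, ..., h_m has absolute value at most
  |h_1| ... |h_m| / |g_i|. Together with |n!| >= kappa^(n-1), and with rho_i <= p (saturation) for
  small exponents, this bounds the Mahler series by rho_i^s on the polydisc of radii rho_j^s, for
  every 0 < s < 1. One and the same tuple of power series thus defines, by substitution, a group
  law on each of these polydiscs and on the dagger disc, which is their intersection; s = 1/(N+1) is
  the polydisc of the theorem. Identities between morphisms are tested at the integral points, where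
  they become the group axioms of G. On the dagger disc every algebra homomorphism is continuous and
  preserves integral points, so the isomorphism with G determines the group law.
*)
theory Submission
  imports Defs
begin

section \<open>Null families of p-adic numbers\<close>

text \<open>The difference bound does not come out of one expansion: rewriting a list of group
  elements in the basis creates commutators and higher binomial terms, which are differences again.
  Each of them is shorter, or lighter by a fixed ratio \<eta>/\<kappa> < 1, so for each l the bound
  modulo p^l is carried upwards from small weights. The start is a separate pigeonhole argument:
  modulo p^l the coordinates are invariant under an open subgroup, and differences of small weight
  vanish. The ratio exists because the norms on the group stay away from \<kappa>. The restriction s
  < 1, which N \<ge> 1 ensures, makes the Mahler terms tend to 0: they are at most \<rho>_i K^(s-1),
  with K the monomial of the \<rho>_j, and for s = 1 this bound is constant. A norm bound on the
  series is needed besides convergence, since pairings of morphisms are built by substitution, which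
  requires the images of the coordinates to stay in the closed polydisc. On the dagger disc, where a
  group law is given by mere algebra homomorphisms, such bounds come from Gauss's lemma applied to
  units.\<close>

lemma CARD_gt_1 [simp]: "Suc 0 < CARD('p::prime_card)"
  using prime_gt_1_nat[OF prime_card[where 'a='p]] by simp

section \<open>The field of p-adic numbers and its absolute value\<close>

definition padic_of :: "'p::prime_card padic_int \<Rightarrow> 'p padic" where
  "padic_of x = Fract x 1"

lemma padic_of_simps [simp]:
  "padic_of 0 = 0" "padic_of 1 = 1"
  "padic_of (x + y) = padic_of x + padic_of y"
  "padic_of (x * y) = padic_of x * padic_of y"
  "padic_of (- x) = - padic_of x"
  "padic_of (x - y) = padic_of x - padic_of y"
  by (simp_all add: padic_of_def Zero_fract_def One_fract_def)

lemma padic_of_of_nat [simp]: "padic_of (of_nat n) = of_nat n"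
  by (induction n) simp_all

lemma padic_of_eq_iff [simp]: "padic_of x = padic_of y \<longleftrightarrow> x = y"
  by (simp add: padic_of_def eq_fract)

lemma padic_of_eq_0_iff [simp]: "padic_of x = 0 \<longleftrightarrow> x = 0"
  using padic_of_eq_iff[of x 0] by (simp del: padic_of_eq_iff)

lemma padic_of_sum [simp]: "padic_of (sum f A) = (\<Sum>i\<in>A. padic_of (f i))"
  by (induction A rule: infinite_finite_induct) simp_all

lemma Fract_eq_padic_of: "b \<noteq> 0 \<Longrightarrow> Fract a b = padic_of a / padic_of b"
  by (simp add: padic_of_def)

lemma padic_int_norm_0 [simp]: "padic_int_norm 0 = 0"
  by (simp add: padic_int_norm_def)

lemma padic_ord_1 [simp]: "padic_ord (1 :: 'p::prime_card padic_int) = 0"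
  using padic_ord_mult[of 1 "1 :: 'p padic_int"] by simp

lemma padic_int_norm_1 [simp]: "padic_int_norm (1 :: 'p::prime_card padic_int) = 1"
  by (simp add: padic_int_norm_def)

lemma padic_int_norm_le_1: "padic_int_norm (x :: 'p::prime_card padic_int) \<le> 1"
  by (simp add: padic_int_norm_def power_le_one)

lemma padic_int_norm_le_power_iff:
  "padic_int_norm x \<le> (1 / real CARD('p)) ^ n \<longleftrightarrow> of_nat CARD('p) ^ n dvd (x :: 'p::prime_card padic_int)"
proof (cases "x = 0")
  case False
  have "(1 / real CARD('p)) ^ padic_ord x \<le> (1 / real CARD('p)) ^ n \<longleftrightarrow> n \<le> padic_ord x"
    by (rule power_decreasing_iff) simp_all
  then show ?thesis
    using False by (simp add: padic_int_norm_def padic_p_power_dvd_iff_ord)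
qed simp

lemma padic_norm_padic_of [simp]: "padic_norm (padic_of x) = padic_int_norm x"
  by (simp add: padic_of_def padic_norm_Fract)

lemma padic_norm_0 [simp]: "padic_norm 0 = 0"
  using padic_norm_padic_of[of 0] by simp

lemma padic_norm_1 [simp]: "padic_norm 1 = 1"
  using padic_norm_padic_of[of 1] by simp

lemma padic_cases:
  obtains a b where "b \<noteq> 0" "q = padic_of a / padic_of b"
  by (cases q) (metis Fract_eq_padic_of)

lemma padic_norm_divide_of:
  "b \<noteq> 0 \<Longrightarrow> padic_norm (padic_of a / padic_of b) = padic_int_norm a / padic_int_norm b"
  by (metis Fract_eq_padic_of padic_norm_Fract)

lemma padic_norm_mult [simp]: "padic_norm (x * y) = padic_norm x * padic_norm y"
proof -
  obtain a b c d where *: "b \<noteq> 0" "x = padic_of a / padic_of b" "d \<noteq> 0" "y = padic_of c / padic_of d"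
    by (metis padic_cases)
  then have "x * y = padic_of (a * c) / padic_of (b * d)" by simp
  then show ?thesis
    using * padic_norm_divide_of[of "b * d" "a * c"] by (simp add: padic_norm_divide_of padic_int_norm_mult)
qed

lemma padic_norm_nonneg [simp]: "0 \<le> padic_norm x"
  by (cases x rule: padic_cases) (simp add: padic_norm_divide_of padic_int_norm_nonneg)

lemma padic_norm_eq_0_iff [simp]: "padic_norm x = 0 \<longleftrightarrow> x = 0"
  by (cases x rule: padic_cases) (simp add: padic_norm_divide_of padic_int_norm_eq_0_iff)

lemma padic_norm_pos_iff [simp]: "0 < padic_norm x \<longleftrightarrow> x \<noteq> 0"
  using padic_norm_nonneg[of x] padic_norm_eq_0_iff[of x] by linarith

lemma padic_norm_uminus [simp]: "padic_norm (- x) = padic_norm x"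
proof -
  have "padic_norm (-1 :: 'a padic) = 1"
    using padic_norm_padic_of[of "-1 :: 'a padic_int"] by (simp add: padic_int_norm_uminus)
  then show ?thesis
    using padic_norm_mult[of "-1" x] by simp
qed

lemma padic_norm_add: "padic_norm (x + y) \<le> max (padic_norm x) (padic_norm y)"
proof -
  obtain a b c d where *: "b \<noteq> 0" "x = padic_of a / padic_of b" "d \<noteq> 0" "y = padic_of c / padic_of d"
    by (metis padic_cases)
  let ?q = "padic_of b * padic_of d"
  have q: "?q \<noteq> 0" using * by simp
  have "(x + y) * ?q = padic_of (a * d + c * b)"
    using * by (simp add: field_simps)
  then have "padic_norm (x + y) * padic_norm ?q = padic_norm (padic_of (a * d + c * b))"
    by (metis padic_norm_mult)
  also have "\<dots> \<le> max (padic_int_norm (a * d)) (padic_int_norm (c * b))"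
    by (simp only: padic_norm_padic_of padic_int_norm_add)
  also have "padic_int_norm (a * d) = padic_norm (x * ?q)"
    using * by (simp only: padic_norm_padic_of[symmetric]) simp
  also have "padic_int_norm (c * b) = padic_norm (y * ?q)"
    using * by (simp only: padic_norm_padic_of[symmetric]) simp
  also have "max (padic_norm (x * ?q)) (padic_norm (y * ?q)) = max (padic_norm x) (padic_norm y) * padic_norm ?q"
    by (simp only: padic_norm_mult max_mult_distrib_right mult_nonneg_nonneg padic_norm_nonneg) simp
  finally show ?thesis
    using q by (metis mult_le_cancel_right padic_norm_pos_iff not_less_iff_gr_or_eq)
qed

lemma padic_norm_add_le: "padic_norm x \<le> C \<Longrightarrow> padic_norm y \<le> C \<Longrightarrow> padic_norm (x + y) \<le> C"
  using padic_norm_add[of x y] by simp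

lemma padic_norm_diff_le: "padic_norm x \<le> C \<Longrightarrow> padic_norm y \<le> C \<Longrightarrow> padic_norm (x - y) \<le> C"
  using padic_norm_add_le[of x C "- y"] by simp

lemma padic_norm_minus_commute: "padic_norm (x - y) = padic_norm (y - x)"
  using padic_norm_uminus[of "x - y"] by simp

lemma padic_norm_trans_le:
  "padic_norm (x - y) \<le> C \<Longrightarrow> padic_norm (y - z) \<le> C \<Longrightarrow> padic_norm (x - z) \<le> C"
  using padic_norm_add_le[of "x - y" C "y - z"] by simp

lemma padic_norm_sum_le:
  "0 \<le> C \<Longrightarrow> (\<And>i. i \<in> A \<Longrightarrow> padic_norm (f i) \<le> C) \<Longrightarrow> padic_norm (sum f A) \<le> C"
  by (induction A rule: infinite_finite_induct) (auto intro: padic_norm_add_le)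

lemma padic_norm_power [simp]: "padic_norm (x ^ n) = padic_norm x ^ n"
  by (induction n) simp_all

lemma padic_norm_prod [simp]: "padic_norm (prod f A) = (\<Prod>i\<in>A. padic_norm (f i))"
  by (induction A rule: infinite_finite_induct) simp_all

lemma padic_norm_inverse [simp]: "padic_norm (inverse x) = inverse (padic_norm x)"
proof (cases "x = 0")
  case False
  then have "padic_norm (inverse x) * padic_norm x = 1"
    by (simp flip: padic_norm_mult)
  then show ?thesis by (metis inverse_unique mult.commute)
qed simp

lemma padic_norm_divide [simp]: "padic_norm (x / y) = padic_norm x / padic_norm y"
  by (simp add: divide_inverse)

lemma padic_norm_of_nat_le_1: "padic_norm (of_nat n :: 'p::prime_card padic) \<le> 1"
  using padic_int_norm_le_1[of "of_nat n :: 'p padic_int"] by (metis padic_norm_padic_of padic_of_of_nat)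

lemma padic_of_nat_eq_0_iff [simp]: "(of_nat n :: 'p::prime_card padic_int) = 0 \<longleftrightarrow> n = 0"
proof
  assume *: "(of_nat n :: 'p padic_int) = 0"
  have "n < CARD('p) ^ n" by (rule power_gt_expt) simp
  moreover have "int n mod int CARD('p) ^ n = 0"
    using padic_residue_of_nat[of n n, where 'p='p] * by (simp add: zero_padic_int.rep_eq)
  ultimately show "n = 0"
    by (metis mod_less of_nat_0_eq_iff of_nat_mod of_nat_power)
qed simp

lemma padic_of_nat_neq_0 [simp]: "(of_nat n :: 'p::prime_card padic) = 0 \<longleftrightarrow> n = 0"
  by (metis padic_of_of_nat padic_of_eq_0_iff padic_of_nat_eq_0_iff)

lemma padic_int_norm_p_power [simp]:
  "padic_int_norm (of_nat CARD('p) ^ n :: 'p::prime_card padic_int) = (1 / real CARD('p)) ^ n"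
proof (rule antisym)
  let ?x = "of_nat CARD('p) ^ n :: 'p padic_int"
  show "padic_int_norm ?x \<le> (1 / real CARD('p)) ^ n"
    by (subst padic_int_norm_le_power_iff) simp
  have nz: "?x \<noteq> 0" by simp
  have "\<not> of_nat CARD('p) ^ Suc n dvd ?x"
  proof
    assume "of_nat CARD('p) ^ Suc n dvd ?x"
    then have "padic_residue ?x (Suc n) = 0"
      by (rule padic_p_power_dvd_iff[THEN iffD1])
    moreover have "padic_residue ?x (Suc n) = int CARD('p) ^ n"
      using padic_residue_of_nat[of "CARD('p) ^ n" "Suc n", where 'p='p]
        power_strict_increasing[of n "Suc n" "int CARD('p)"] by (simp del: power_Suc)
    ultimately show False by simp
  qed
  then have "padic_ord ?x \<le> n"
    using padic_p_power_dvd_iff_ord[OF nz, of "Suc n"] by simp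
  then show "(1 / real CARD('p)) ^ n \<le> padic_int_norm ?x"
    using nz by (simp add: padic_int_norm_def power_decreasing)
qed

lemma padic_norm_p [simp]: "padic_norm (of_nat CARD('p) :: 'p::prime_card padic) = 1 / real CARD('p)"
  using padic_int_norm_p_power[of 1, where 'p='p] by (metis padic_norm_padic_of padic_of_of_nat power_one_right)

lemma padic_norm_values:
  "x \<noteq> 0 \<Longrightarrow> \<exists>n::int. padic_norm (x :: 'p::prime_card padic) = real CARD('p) powi n"
proof (cases x rule: padic_cases)
  case (1 a b)
  assume "x \<noteq> 0"
  then have "a \<noteq> 0" "b \<noteq> 0" using 1 by auto
  then have "padic_norm x = real CARD('p) powi (int (padic_ord b) - int (padic_ord a))"
    unfolding 1(2) padic_norm_divide_of[OF 1(1)]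
    by (simp add: padic_int_norm_def power_int_diff power_divide)
  then show ?thesis ..
qed

text \<open>The value group is discrete: no absolute value lies strictly between 1 and p. This gap
  later turns a strict bound by p on Mahler coefficients into the bound 1.\<close>

lemma padic_norm_lt_p_imp_le_1:
  assumes "padic_norm (x :: 'p::prime_card padic) < real CARD('p)"
  shows "padic_norm x \<le> 1"
proof (cases "x = 0")
  case False
  then obtain n :: int where n: "padic_norm x = real CARD('p) powi n"
    using padic_norm_values by blast
  have "n < 1"
  proof (rule ccontr)
    assume "\<not> n < 1"
    then have "real CARD('p) powi 1 \<le> real CARD('p) powi n"
      by (intro power_int_increasing) auto
    then show False using assms n by simp
  qed
  then have "real CARD('p) powi n \<le> real CARD('p) powi 0"
    by (intro power_int_increasing) auto
  then show ?thesis using n by simp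
qed simp

lemma padic_norm_lt_1_imp_le:
  assumes "padic_norm (x :: 'p::prime_card padic) < 1"
  shows "padic_norm x \<le> 1 / real CARD('p)"
  using padic_norm_lt_p_imp_le_1[of "x / of_nat CARD('p)"] assms by (simp add: field_simps)

text \<open>The p-adic numbers are formal fractions, so integrality is a divisibility in the ring:
  comparing orders takes care of the power of p in \<open>b\<close>, and the cofactor prime to p is
  a unit.\<close>

lemma padic_integral:
  assumes "padic_norm (x :: 'p::prime_card padic) \<le> 1"
  obtains z where "x = padic_of z"
proof (cases x rule: padic_cases)
  case (1 a b)
  have "b dvd a"
  proof (cases "a = 0")
    case False
    have "padic_int_norm a \<le> padic_int_norm b"
      using assms 1 padic_int_norm_nonneg[of b] padic_int_norm_eq_0_iff[of b]
      by (simp add: padic_norm_divide_of divide_le_eq_1)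
    then have le: "padic_ord b \<le> padic_ord a"
      using False 1 power_decreasing_iff[of "1 / real CARD('p)" "padic_ord a" "padic_ord b"]
      by (simp add: padic_int_norm_def)
    obtain u where u: "b = of_nat CARD('p) ^ padic_ord b * u" "\<not> of_nat CARD('p) dvd u"
      by (rule padic_decompose[OF 1(1)])
    have "u dvd 1"
    proof -
      have *: "padic_residue u k \<noteq> 0 \<and> coprime (padic_residue u k) (int CARD('p) ^ k)" if "k > 0" for k
      proof -
        have "\<not> int CARD('p) dvd padic_residue u k"
        proof
          assume "int CARD('p) dvd padic_residue u k"
          then have "padic_residue u 1 = 0"
            using padic_residue_add_mod[of u 1 "k - 1"] that by simp
          then show False using u(2) padic_p_power_dvd_iff[of 1 u] by simp
        qed
        then have "coprime (padic_residue u k) (int CARD('p))"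
          using prime_card_int[where 'a='p] by (metis coprime_commute prime_imp_coprime)
        then show ?thesis
          using \<open>\<not> int CARD('p) dvd padic_residue u k\<close> by auto
      qed
      \<comment> \<open>An inverse of \<open>u\<close> modulo each p^k. It is unique in the interval
        from 0 to p^k, which makes the independent choices coherent.\<close>
      define w where "w k = (SOME y. 0 \<le> y \<and> y < int CARD('p) ^ k \<and> (padic_residue u k * y) mod int CARD('p) ^ k = 1 mod int CARD('p) ^ k)" for k
      have ex: "\<exists>y. 0 \<le> y \<and> y < int CARD('p) ^ k \<and> (padic_residue u k * y) mod int CARD('p) ^ k = 1 mod int CARD('p) ^ k" for k
      proof (cases "k = 0")
        case False
        then have "coprime (padic_residue u k) (int CARD('p) ^ k)" using * by simp
        then obtain y where "[padic_residue u k * y = 1] (mod int CARD('p) ^ k)"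
          using cong_solve_coprime_int by blast
        then have "(padic_residue u k * (y mod int CARD('p) ^ k)) mod int CARD('p) ^ k = 1 mod int CARD('p) ^ k"
          by (simp add: cong_def mod_mult_right_eq)
        then show ?thesis
          by (intro exI[of _ "y mod int CARD('p) ^ k"]) simp
      qed auto
      have w: "0 \<le> w k" "w k < int CARD('p) ^ k" "(padic_residue u k * w k) mod int CARD('p) ^ k = 1 mod int CARD('p) ^ k" for k
        using someI_ex[OF ex[of k]] unfolding w_def by blast+
      have coh: "w (Suc k) mod int CARD('p) ^ k = w k" for k
      proof (cases "k = 0")
        case True
        then show ?thesis using w(1,2)[of 0] by simp
      next
        case False
        let ?q = "int CARD('p) ^ k"
        have res: "padic_residue u (Suc k) mod ?q = padic_residue u k"
          using padic_residue_add_mod[of u k 1] by simp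
        have "(padic_residue u (Suc k) * w (Suc k)) mod ?q = 1 mod ?q"
          using arg_cong[OF w(3)[of "Suc k"], of "\<lambda>t. t mod ?q"] by (simp only: mod_mod_power_Suc)
        then have "(padic_residue u k * w (Suc k)) mod ?q = 1 mod ?q"
          by (metis res mod_mult_left_eq)
        then have "[padic_residue u k * w (Suc k) = padic_residue u k * w k] (mod ?q)"
          using w(3)[of k] by (simp add: cong_def)
        then have "[w (Suc k) = w k] (mod ?q)"
          using *[of k] False by (simp add: cong_mult_lcancel)
        then show ?thesis
          using w(1,2)[of k] by (simp add: cong_def)
      qed
      have W: "padic_residue (Abs_padic_int w :: 'p padic_int) = w"
        using w coh by (intro Abs_padic_int_inverse) simp
      have "u * Abs_padic_int w = 1"
        by (rule padic_residue_inject[THEN iffD1], rule ext)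
          (simp add: times_padic_int.rep_eq one_padic_int.rep_eq W w)
      then show ?thesis by (metis dvdI)
    qed
    moreover have "of_nat CARD('p) ^ padic_ord b dvd a"
      using False le by (simp add: padic_p_power_dvd_iff_ord)
    ultimately have "b dvd a * 1"
      by (subst u(1)) (rule mult_dvd_mono)
    then show ?thesis by simp
  qed simp
  then obtain z where "a = b * z" ..
  then have "x = padic_of z" using 1 by simp
  then show ?thesis by (rule that)
qed

section \<open>Unconditional sums of null families\<close>

definition null_family :: "('i \<Rightarrow> 'p::prime_card padic) \<Rightarrow> bool" where
  "null_family f \<longleftrightarrow> (\<forall>e>0. finite {i. padic_norm (f i) > e})"

text \<open>The index type carries no order, so the finite set of terms above e serves as the
  canonical partial sum of precision e.\<close>

definition has_nsum :: "('i \<Rightarrow> 'p::prime_card padic) \<Rightarrow> 'p padic \<Rightarrow> bool" where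
  "has_nsum f s \<longleftrightarrow> null_family f \<and> (\<forall>e>0. padic_norm (s - (\<Sum>i | padic_norm (f i) > e. f i)) \<le> e)"

definition nsum :: "('i \<Rightarrow> 'p::prime_card padic) \<Rightarrow> 'p padic" where
  "nsum f = (THE s. has_nsum f s)"

text \<open>By the ultrametric inequality any finite set containing the large terms approximates as
  well as the canonical one.\<close>

lemma has_nsum_approx:
  assumes "has_nsum f s" "finite F" "0 < e" "\<And>i. i \<notin> F \<Longrightarrow> padic_norm (f i) \<le> e"
  shows "padic_norm (s - sum f F) \<le> e"
proof -
  let ?S = "{i. padic_norm (f i) > e}"
  have sub: "?S \<subseteq> F" using assms(4) by force
  have "sum f F - sum f ?S = sum f (F - ?S)"
    using sub assms(2) by (simp add: sum_diff)
  moreover have "padic_norm (sum f (F - ?S)) \<le> e"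
    using assms(3) by (intro padic_norm_sum_le) auto
  moreover have "padic_norm (s - sum f ?S) \<le> e"
    using assms by (simp add: has_nsum_def)
  ultimately show ?thesis
    using padic_norm_trans_le[of s "sum f ?S" e "sum f F"] padic_norm_minus_commute by metis
qed

lemma padic_norm_le_all_imp_0:
  assumes "\<And>e. 0 < e \<Longrightarrow> padic_norm x \<le> e"
  shows "x = 0"
  using assms[of "padic_norm x / 2"] by (cases "x = 0") auto

lemma has_nsum_unique: "has_nsum f s \<Longrightarrow> has_nsum f t \<Longrightarrow> s = t"
proof -
  assume *: "has_nsum f s" "has_nsum f t"
  have "padic_norm (s - t) \<le> e" if "0 < e" for e
    using * that padic_norm_trans_le[of s _ e t] padic_norm_minus_commute
    unfolding has_nsum_def by metis
  from padic_norm_le_all_imp_0[OF this] show ?thesis by simp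
qed

lemma nsum_eqI: "has_nsum f s \<Longrightarrow> nsum f = s"
  unfolding nsum_def using has_nsum_unique by blast

lemma p_power_small:
  assumes "0 < (e::real)"
  shows "\<exists>n. (1 / real CARD('p::prime_card)) ^ n < e"
  using real_arch_pow_inv[OF assms, of "1 / real CARD('p)"] by simp

text \<open>Completeness of the field, through residues: after multiplication by a power of p the
  partial sums are p-adic integers, and from the k-th on they agree modulo p^k.\<close>

lemma has_nsum_exists:
  fixes f :: "'i \<Rightarrow> 'p::prime_card padic"
  assumes null: "null_family f"
  shows "has_nsum f (nsum f)"
proof -
  let ?q = "1 / real CARD('p)"
  define S where "S k = {i. padic_norm (f i) > ?q ^ k}" for k
  have fin: "finite (S k)" for k
    using null by (simp add: S_def null_family_def)
  have mono: "S k \<subseteq> S (k + j)" for k j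
  proof -
    have "?q ^ (k + j) \<le> ?q ^ k" by (intro power_decreasing) auto
    then show ?thesis unfolding S_def by (intro Collect_mono impI) (rule le_less_trans)
  qed
  have "\<exists>m. \<forall>i. padic_norm (f i) \<le> real CARD('p) ^ m"
  proof -
    define B where "B = Max (insert 1 ((\<lambda>i. padic_norm (f i)) ` S 0))"
    have B: "padic_norm (f i) \<le> B" for i
    proof (cases "i \<in> S 0")
      case True
      then show ?thesis unfolding B_def using fin by (intro Max_ge) auto
    next
      case False
      then have "padic_norm (f i) \<le> 1" by (simp add: S_def)
      also have "1 \<le> B" unfolding B_def using fin by (intro Max_ge) auto
      finally show ?thesis .
    qed
    obtain m where "B < real CARD('p) ^ m"
      using real_arch_pow[of "real CARD('p)" B] by auto
    then show ?thesis using B by (meson less_eq_real_def order_trans)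
  qed
  then obtain m where m: "padic_norm (f i) \<le> real CARD('p) ^ m" for i by blast
  let ?pm = "of_nat CARD('p) ^ m :: 'p padic"
  define s where "s k = ?pm * sum f (S k)" for k
  have "padic_norm (s k) \<le> 1" for k
  proof -
    have "padic_norm (sum f (S k)) \<le> real CARD('p) ^ m"
      using m by (intro padic_norm_sum_le) auto
    then show ?thesis by (simp add: s_def field_simps)
  qed
  then have "\<exists>z. s k = padic_of z" for k
    by (rule padic_integral[of "s k"]) (rule exI)
  then have "\<exists>z. \<forall>k. s k = padic_of (z k)"
    by (intro choice allI)
  then obtain z where z: "s k = padic_of (z k)" for k by blast
  have near: "padic_int_norm (z (k + j) - z k) \<le> ?q ^ k" for k j
  proof -
    have "sum f (S (k + j)) - sum f (S k) = sum f (S (k + j) - S k)"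
      using mono fin by (simp add: sum_diff)
    moreover have "padic_norm (sum f (S (k + j) - S k)) \<le> ?q ^ k"
      by (intro padic_norm_sum_le) (auto simp: S_def)
    ultimately have *: "padic_norm (sum f (S (k + j)) - sum f (S k)) \<le> ?q ^ k" by simp
    have "padic_norm (s (k + j) - s k) \<le> ?q ^ m * ?q ^ k"
      unfolding s_def right_diff_distrib[symmetric] padic_norm_mult padic_norm_power padic_norm_p
      by (intro mult_left_mono *) simp
    also have "\<dots> \<le> 1 * ?q ^ k"
      by (intro mult_right_mono) (simp_all add: power_le_one)
    finally show ?thesis
      by (simp add: z flip: padic_norm_padic_of)
  qed
  have res: "padic_residue (z (k + j)) k = padic_residue (z k) k" for k j
  proof -
    have "of_nat CARD('p) ^ k dvd z (k + j) - z k"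
      using near padic_int_norm_le_power_iff by blast
    then obtain y where "z (k + j) - z k = of_nat CARD('p) ^ k * y" ..
    then have "z (k + j) = z k + of_nat CARD('p) ^ k * y"
      by (simp add: algebra_simps)
    then show ?thesis
      using padic_residue_bounds[of "z k" k]
      by (simp add: plus_padic_int.rep_eq padic_residue_p_power_mult)
  qed
  \<comment> \<open>The diagonal of the residues is the coherent sequence of the limit.\<close>
  define l where "l k = padic_residue (z k) k" for k
  have L: "padic_residue (Abs_padic_int l :: 'p padic_int) = l"
  proof (intro Abs_padic_int_inverse CollectI allI conjI)
    fix n
    show "0 \<le> l n" "l n < int CARD('p) ^ n"
      by (simp_all add: l_def padic_residue_bounds)
    show "l (Suc n) mod int CARD('p) ^ n = l n"
      using padic_residue_add_mod[of "z (Suc n)" n 1] res[of n 1] by (simp add: l_def)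
  qed
  let ?l = "Abs_padic_int l :: 'p padic_int"
  have lim: "padic_int_norm (?l - z k) \<le> ?q ^ k" for k
  proof -
    have "padic_residue (?l - z k) k = 0"
    proof -
      have "padic_residue (?l - z k) k = (l k + (- l k) mod int CARD('p) ^ k) mod int CARD('p) ^ k"
        unfolding minus_padic_int_def plus_padic_int.rep_eq uminus_padic_int.rep_eq L by (simp add: l_def)
      also have "\<dots> = (l k + - l k) mod int CARD('p) ^ k" by (rule mod_add_right_eq)
      finally show ?thesis by simp
    qed
    then have "of_nat CARD('p) ^ k dvd ?l - z k"
      using padic_p_power_dvd_iff by blast
    then show ?thesis using padic_int_norm_le_power_iff by blast
  qed
  have "has_nsum f (padic_of ?l / ?pm)"
    unfolding has_nsum_def
  proof (intro conjI null allI impI)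
    fix e :: real assume e: "0 < e"
    obtain k0 where k0: "?q ^ k0 < e" using p_power_small[OF e] by blast
    \<comment> \<open>The extra \<open>m\<close> makes up for the division by p^m at the
      end.\<close>
    define k where "k = k0 + m"
    have "?q ^ k \<le> ?q ^ k0" by (intro power_decreasing) (auto simp: k_def)
    then have k: "?q ^ k < e" using k0 by (rule le_less_trans)
    let ?T = "{i. padic_norm (f i) > e}"
    have "?T \<subseteq> S k" using k by (auto simp: S_def)
    then have "sum f (S k) - sum f ?T = sum f (S k - ?T)"
      using fin by (simp add: sum_diff)
    moreover have "padic_norm (sum f (S k - ?T)) \<le> e"
      using e by (intro padic_norm_sum_le) auto
    ultimately have 1: "padic_norm (sum f (S k) - sum f ?T) \<le> e" by simp
    have "padic_norm (padic_of ?l / ?pm - sum f (S k)) = padic_norm ((padic_of ?l - s k) / ?pm)"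
      by (simp add: s_def field_simps)
    also have "\<dots> = padic_int_norm (?l - z k) * real CARD('p) ^ m"
      unfolding z padic_of_simps(6)[symmetric] padic_norm_divide padic_norm_padic_of padic_norm_power
        padic_norm_p by (simp add: field_simps)
    also have "\<dots> \<le> ?q ^ k * real CARD('p) ^ m"
      using lim by (intro mult_right_mono) simp_all
    also have "\<dots> = ?q ^ k0" by (simp add: k_def power_add field_simps)
    also have "\<dots> \<le> e" using k0 by simp
    finally show "padic_norm (padic_of ?l / ?pm - sum f ?T) \<le> e"
      using 1 padic_norm_trans_le by blast
  qed
  moreover from this have "nsum f = padic_of ?l / ?pm" by (rule nsum_eqI)
  ultimately show ?thesis by simp
qed

lemma null_family_cmult: "null_family f \<Longrightarrow> null_family (\<lambda>i. c * f i)"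
proof (cases "c = 0")
  case False
  assume "null_family f"
  then have "finite {i. padic_norm (f i) > e / padic_norm c}" if "0 < e" for e
    using that False by (simp add: null_family_def)
  moreover have "{i. padic_norm (f i) > e / padic_norm c} = {i. padic_norm (c * f i) > e}" for e
    using False by (simp add: divide_less_eq mult.commute)
  ultimately show ?thesis unfolding null_family_def by metis
qed (simp add: null_family_def)

lemma null_family_add: 
  assumes "null_family f" "null_family g"
  shows "null_family (\<lambda>i. f i + g i)"
  unfolding null_family_def
proof (intro allI impI)
  fix e :: real assume "0 < e"
  then have "finite ({i. padic_norm (f i) > e} \<union> {i. padic_norm (g i) > e})"
    using assms by (simp add: null_family_def)
  moreover have "{i. padic_norm (f i + g i) > e} \<subseteq> {i. padic_norm (f i) > e} \<union> {i. padic_norm (g i) > e}"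
    using padic_norm_add_le[of _ e] by (auto simp: not_less[symmetric] simp del: not_less)
  ultimately show "finite {i. padic_norm (f i + g i) > e}" by (rule finite_subset[rotated])
qed

lemma null_familyI_finite: "finite {i. f i \<noteq> 0} \<Longrightarrow> null_family f"
  unfolding null_family_def by (auto elim!: rev_finite_subset)

lemma nsumI:
  assumes "null_family f"
    and "\<And>e. 0 < e \<Longrightarrow> \<exists>F. finite F \<and> (\<forall>i. i \<notin> F \<longrightarrow> padic_norm (f i) \<le> e) \<and> padic_norm (s - sum f F) \<le> e"
  shows "nsum f = s"
proof -
  have h: "has_nsum f (nsum f)" using assms has_nsum_exists by blast
  have "padic_norm (nsum f - s) \<le> e" if e: "0 < e" for e
  proof -
    obtain F where F: "finite F" "\<forall>i. i \<notin> F \<longrightarrow> padic_norm (f i) \<le> e" "padic_norm (s - sum f F) \<le> e"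
      using assms(2)[OF e] by blast
    have "padic_norm (nsum f - sum f F) \<le> e"
      using has_nsum_approx[OF h F(1) e] F(2) by blast
    then show ?thesis
      using F(3) padic_norm_trans_le padic_norm_minus_commute by metis
  qed
  from padic_norm_le_all_imp_0[OF this] show ?thesis by simp
qed

lemma nsum_approx:
  assumes "null_family f" "0 < e" "finite A"
  obtains F where "finite F" "A \<subseteq> F" "\<And>i. i \<notin> F \<Longrightarrow> padic_norm (f i) \<le> e" "padic_norm (nsum f - sum f F) \<le> e"
proof -
  let ?F = "A \<union> {i. padic_norm (f i) > e}"
  have "finite ?F" using assms by (simp add: null_family_def)
  moreover have "padic_norm (f i) \<le> e" if "i \<notin> ?F" for i using that by simp
  moreover have "padic_norm (nsum f - sum f ?F) \<le> e"
    using has_nsum_approx[OF has_nsum_exists[OF assms(1)] \<open>finite ?F\<close> assms(2)] by simp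
  ultimately show ?thesis using that[of ?F] by blast
qed

lemma nsum_finite:
  assumes "finite F" "\<And>i. i \<notin> F \<Longrightarrow> f i = 0"
  shows "nsum f = sum f F"
proof (rule nsumI)
  show "null_family f"
    using assms by (intro null_familyI_finite) (auto elim!: rev_finite_subset)
qed (use assms in \<open>auto intro!: exI[of _ F]\<close>)

lemma nsum_single: "nsum (\<lambda>i. if i = j then c else 0) = c"
  using nsum_finite[of "{j}" "\<lambda>i. if i = j then c else 0"] by simp

lemma nsum_cmult: "null_family f \<Longrightarrow> nsum (\<lambda>i. c * f i) = c * nsum f"
proof (cases "c = 0")
  case False
  assume f: "null_family f"
  show ?thesis
  proof (rule nsumI[OF null_family_cmult[OF f]])
    fix e :: real assume "0 < e"
    then have e: "0 < e / padic_norm c" using False by simp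
    obtain F where F: "finite F" "{} \<subseteq> F" "\<And>i. i \<notin> F \<Longrightarrow> padic_norm (f i) \<le> e / padic_norm c"
      "padic_norm (nsum f - sum f F) \<le> e / padic_norm c"
      using nsum_approx[OF f e] by blast
    have "padic_norm (c * nsum f - (\<Sum>i\<in>F. c * f i)) \<le> e"
      using F(4) False unfolding sum_distrib_left[symmetric] right_diff_distrib[symmetric] padic_norm_mult
      by (simp add: le_divide_eq mult.commute)
    moreover have "\<forall>i. i \<notin> F \<longrightarrow> padic_norm (c * f i) \<le> e"
      using F(3) False by (simp add: le_divide_eq mult.commute)
    ultimately show "\<exists>F. finite F \<and> (\<forall>i. i \<notin> F \<longrightarrow> padic_norm (c * f i) \<le> e) \<and>
        padic_norm (c * nsum f - (\<Sum>i\<in>F. c * f i)) \<le> e"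
      using F(1) by blast
  qed
qed (use nsum_finite[of "{}" "\<lambda>_. 0"] in simp)

lemma nsum_add:
  assumes "null_family f" "null_family g"
  shows "nsum (\<lambda>i. f i + g i) = nsum f + nsum g"
proof (rule nsumI[OF null_family_add[OF assms]])
  fix e :: real assume e: "0 < e"
  obtain F where F: "finite F" "{} \<subseteq> F" "\<And>i. i \<notin> F \<Longrightarrow> padic_norm (f i) \<le> e" "padic_norm (nsum f - sum f F) \<le> e"
    using nsum_approx[OF assms(1) e] by blast
  obtain F' where F': "finite F'" "F \<subseteq> F'" "\<And>i. i \<notin> F' \<Longrightarrow> padic_norm (g i) \<le> e" "padic_norm (nsum g - sum g F') \<le> e"
    using nsum_approx[OF assms(2) e F(1)] by blast
  have "padic_norm (nsum f - sum f F') \<le> e"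
    using has_nsum_approx[OF has_nsum_exists[OF assms(1)] F'(1) e] F F' by blast
  then have "padic_norm ((nsum f - sum f F') + (nsum g - sum g F')) \<le> e"
    using F' by (intro padic_norm_add_le)
  then have "padic_norm (nsum f + nsum g - (\<Sum>i\<in>F'. f i + g i)) \<le> e"
    by (simp add: sum.distrib algebra_simps)
  moreover have "\<forall>i. i \<notin> F' \<longrightarrow> padic_norm (f i + g i) \<le> e"
    using F F' by (auto intro!: padic_norm_add_le)
  ultimately show "\<exists>F. finite F \<and> (\<forall>i. i \<notin> F \<longrightarrow> padic_norm (f i + g i) \<le> e) \<and>
      padic_norm (nsum f + nsum g - (\<Sum>i\<in>F. f i + g i)) \<le> e"
    using F' by blast
qed

lemma nsum_norm_le:
  assumes "null_family f" "0 \<le> C" "\<And>i. padic_norm (f i) \<le> C"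
  shows "padic_norm (nsum f) \<le> C"
proof (cases "nsum f = 0")
  case False
  then have e: "0 < padic_norm (nsum f) / 2" and pos: "0 < padic_norm (nsum f)" by simp_all
  obtain F where F: "finite F" "padic_norm (nsum f - sum f F) \<le> padic_norm (nsum f) / 2"
    by (rule nsum_approx[OF assms(1) e finite.emptyI]) blast
  have "padic_norm (sum f F) \<le> C" using assms by (intro padic_norm_sum_le)
  then show ?thesis
    using padic_norm_add[of "nsum f - sum f F" "sum f F"] F(2) pos unfolding diff_add_cancel le_max_iff_disj by linarith
qed (use assms in simp)

lemma null_family_reindex:
  assumes "bij h" "null_family f"
  shows "null_family (f \<circ> h)"
  unfolding null_family_def
proof (intro allI impI)
  fix e :: real assume "0 < e"
  then have "finite {i. padic_norm (f i) > e}" using assms by (simp add: null_family_def)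
  then have "finite (h -` {i. padic_norm (f i) > e})"
    using assms(1) by (intro finite_vimageI) (auto simp: bij_def)
  then show "finite {i. padic_norm ((f \<circ> h) i) > e}" by (simp add: vimage_def)
qed

lemma null_family_nsum_rows:
  fixes f :: "'i \<times> 'j \<Rightarrow> 'p::prime_card padic"
  assumes "null_family f"
  shows "null_family (\<lambda>j. f (i, j))" and "null_family (\<lambda>i. nsum (\<lambda>j. f (i, j)))"
proof -
  show *: "null_family (\<lambda>j. f (i, j))" for i
    unfolding null_family_def
  proof (intro allI impI)
    fix e :: real assume "0 < e"
    then have "finite {x. padic_norm (f x) > e}" using assms by (simp add: null_family_def)
    then have "finite (Pair i -` {x. padic_norm (f x) > e})"
      by (intro finite_vimageI) (auto simp: inj_on_def)
    then show "finite {j. padic_norm (f (i, j)) > e}" by (simp add: vimage_def)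
  qed
  show "null_family (\<lambda>i. nsum (\<lambda>j. f (i, j)))"
    unfolding null_family_def
  proof (intro allI impI)
    fix e :: real assume e: "0 < e"
    then have "finite {x. padic_norm (f x) > e}" using assms by (simp add: null_family_def)
    then have "finite (fst ` {x. padic_norm (f x) > e})" by simp
    moreover have "{i. padic_norm (nsum (\<lambda>j. f (i, j))) > e} \<subseteq> fst ` {x. padic_norm (f x) > e}"
    proof
      fix i assume i: "i \<in> {i. padic_norm (nsum (\<lambda>j. f (i, j))) > e}"
      then have "\<not> (\<forall>j. padic_norm (f (i, j)) \<le> e)"
        using nsum_norm_le[OF *[of i], of e] e by auto
      then show "i \<in> fst ` {x. padic_norm (f x) > e}" by (force simp: not_le)
    qed
    ultimately show "finite {i. padic_norm (nsum (\<lambda>j. f (i, j))) > e}" by (rule finite_subset[rotated])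
  qed
qed

text \<open>The finite rectangle spanned by the rows and columns of the large entries approximates
  the iterated sum and the total sum alike.\<close>

lemma nsum_Fubini:
  fixes f :: "'i \<times> 'j \<Rightarrow> 'p::prime_card padic"
  assumes "null_family f"
  shows "nsum (\<lambda>i. nsum (\<lambda>j. f (i, j))) = nsum f"
proof (rule nsumI[OF null_family_nsum_rows(2)[OF assms]])
  fix e :: real assume e: "0 < e"
  let ?F = "{x. padic_norm (f x) > e}"
  have fin: "finite ?F" using assms e by (simp add: null_family_def)
  let ?I = "fst ` ?F" and ?J = "snd ` ?F"
  have row: "padic_norm (nsum (\<lambda>j. f (i, j)) - (\<Sum>j\<in>?J. f (i, j))) \<le> e" for i
    using fin e by (intro has_nsum_approx has_nsum_exists null_family_nsum_rows(1)[OF assms])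
      (auto simp: image_iff not_less)
  have out: "padic_norm (nsum (\<lambda>j. f (i, j))) \<le> e" if "i \<notin> ?I" for i
    using e that by (intro nsum_norm_le null_family_nsum_rows(1)[OF assms]) (auto simp: image_iff not_less)
  have tot: "padic_norm (nsum f - sum f (?I \<times> ?J)) \<le> e"
  proof (rule has_nsum_approx[OF has_nsum_exists[OF assms] _ e])
    show "finite (?I \<times> ?J)" using fin by blast
    show "padic_norm (f x) \<le> e" if "x \<notin> ?I \<times> ?J" for x
    proof (rule ccontr)
      assume "\<not> padic_norm (f x) \<le> e"
      then have "x \<in> ?F" by simp
      then have "(fst x, snd x) \<in> ?I \<times> ?J" by blast
      then show False using that by simp
    qed
  qed
  have "padic_norm ((\<Sum>i\<in>?I. nsum (\<lambda>j. f (i, j)) - (\<Sum>j\<in>?J. f (i, j)))) \<le> e"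
    using e row by (intro padic_norm_sum_le) auto
  then have "padic_norm ((\<Sum>i\<in>?I. nsum (\<lambda>j. f (i, j))) - sum f (?I \<times> ?J)) \<le> e"
    by (simp add: sum_subtractf sum.cartesian_product)
  then have "padic_norm (nsum f - (\<Sum>i\<in>?I. nsum (\<lambda>j. f (i, j)))) \<le> e"
    using tot padic_norm_trans_le padic_norm_minus_commute by metis
  then show "\<exists>F. finite F \<and> (\<forall>i. i \<notin> F \<longrightarrow> padic_norm (nsum (\<lambda>j. f (i, j))) \<le> e) \<and>
      padic_norm (nsum f - (\<Sum>i\<in>F. nsum (\<lambda>j. f (i, j)))) \<le> e"
    using fin out by blast
qed

lemma nsum_reindex:
  assumes "bij h" "null_family f"
  shows "nsum (f \<circ> h) = nsum f"
proof (rule nsumI[OF null_family_reindex[OF assms]])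
  fix e :: real assume e: "0 < e"
  obtain F where F: "finite F" "\<And>i. i \<notin> F \<Longrightarrow> padic_norm (f i) \<le> e" "padic_norm (nsum f - sum f F) \<le> e"
    by (rule nsum_approx[OF assms(2) e finite.emptyI]) blast
  have inj: "inj h" using assms(1) bij_def by blast
  have img: "h ` (h -` F) = F" using assms(1) by (simp add: bij_is_surj surj_image_vimage_eq)
  have "sum f F = sum (f \<circ> h) (h -` F)"
    by (subst img[symmetric]) (rule sum.reindex, use inj in \<open>auto simp: inj_on_def\<close>)
  moreover have "finite (h -` F)" using F(1) inj by (rule finite_vimageI)
  ultimately show "\<exists>F. finite F \<and> (\<forall>i. i \<notin> F \<longrightarrow> padic_norm ((f \<circ> h) i) \<le> e) \<and>
      padic_norm (nsum f - sum (f \<circ> h) F) \<le> e"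
    using F by (intro exI[of _ "h -` F"]) auto
qed

lemma nsum_swap:
  fixes f :: "'i \<Rightarrow> 'j \<Rightarrow> 'p::prime_card padic"
  assumes "null_family (\<lambda>(i, j). f i j)"
  shows "nsum (\<lambda>i. nsum (\<lambda>j. f i j)) = nsum (\<lambda>j. nsum (\<lambda>i. f i j))"
proof -
  have b: "bij (prod.swap :: 'j \<times> 'i \<Rightarrow> 'i \<times> 'j)" by (rule bij_swap)
  have "nsum (\<lambda>i. nsum (\<lambda>j. f i j)) = nsum (\<lambda>(i, j). f i j)"
    using nsum_Fubini[OF assms] by simp
  also have "\<dots> = nsum ((\<lambda>(i, j). f i j) \<circ> prod.swap)"
    using nsum_reindex[OF b assms] by simp
  also have "\<dots> = nsum (\<lambda>j. nsum (\<lambda>i. f i j))"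
    using nsum_Fubini[OF null_family_reindex[OF b assms]] by simp
  finally show ?thesis .
qed

section \<open>Evaluation and substitution of power series\<close>

definition mpow :: "('v \<Rightarrow> 'a::comm_monoid_mult) \<Rightarrow> ('v \<Rightarrow>\<^sub>0 nat) \<Rightarrow> 'a" where
  "mpow x a = (\<Prod>v\<in>Poly_Mapping.keys a. x v ^ poly_mapping.lookup a v)"

lemma mpow_superset:
  "finite S \<Longrightarrow> Poly_Mapping.keys a \<subseteq> S \<Longrightarrow> mpow x a = (\<Prod>v\<in>S. x v ^ poly_mapping.lookup a v)"
  unfolding mpow_def by (rule prod.mono_neutral_left) (auto simp: in_keys_iff)

lemma mpow_0 [simp]: "mpow x 0 = 1"
  by (simp add: mpow_def)

lemma mpow_add: "mpow x (a + b) = mpow x a * mpow x b"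
proof -
  let ?S = "Poly_Mapping.keys a \<union> Poly_Mapping.keys b"
  have "Poly_Mapping.keys (a + b) \<subseteq> ?S" by (rule keys_add)
  then show ?thesis
    by (simp add: mpow_superset[of ?S] lookup_add power_add prod.distrib)
qed

lemma mpow_single [simp]: "mpow x (Poly_Mapping.single v n) = x v ^ n"
  by (simp add: mpow_superset[of "{v}"] )

lemma mpow_cong: "(\<And>v. v \<in> Poly_Mapping.keys a \<Longrightarrow> x v = y v) \<Longrightarrow> mpow x a = mpow y a"
  unfolding mpow_def by (rule prod.cong) auto

lemma padic_norm_mpow: "padic_norm (mpow x a) = mpow (\<lambda>v. padic_norm (x v)) a"
  by (simp add: mpow_def)

lemma mpow_mono:
  fixes x y :: "'v \<Rightarrow> real"
  shows "(\<And>v. v \<in> Poly_Mapping.keys a \<Longrightarrow> 0 \<le> x v \<and> x v \<le> y v) \<Longrightarrow> mpow x a \<le> mpow y a"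
  unfolding mpow_def by (rule prod_mono) (auto intro: power_mono)

lemma mpow_pos: "(\<And>v. 0 < r v) \<Longrightarrow> 0 < mpow (r :: 'v \<Rightarrow> real) a"
  unfolding mpow_def by (rule prod_pos) auto

lemma mpow_ge_1: "(\<And>v. v \<in> Poly_Mapping.keys a \<Longrightarrow> 1 \<le> r v) \<Longrightarrow> 1 \<le> mpow (r :: 'v \<Rightarrow> real) a"
  unfolding mpow_def by (rule prod_ge_1) auto

lemma mpow_const: "mpow (\<lambda>_. c) a = c ^ total_deg a"
  by (simp add: mpow_def total_deg_def power_sum)

text \<open>Convergence to 0 along the cofinite filter, for real majorants: a family of numbers or
  series is controlled by a vanishing family of bounds.\<close>

definition vanishing :: "('i \<Rightarrow> real) \<Rightarrow> bool" where
  "vanishing \<phi> \<longleftrightarrow> (\<forall>e>0. finite {i. \<phi> i > e})"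

lemma null_family_iff_vanishing: "null_family f \<longleftrightarrow> vanishing (\<lambda>i. padic_norm (f i))"
  by (simp add: null_family_def vanishing_def)

lemma vanishing_le: "vanishing \<phi> \<Longrightarrow> (\<And>i. \<psi> i \<le> \<phi> i) \<Longrightarrow> vanishing \<psi>"
  unfolding vanishing_def
  by (metis (mono_tags, lifting) Collect_mono finite_subset less_le_trans)

lemma vanishing_bounded:
  assumes "vanishing \<phi>"
  obtains C where "0 < C" "\<And>i. \<phi> i \<le> C"
proof -
  let ?S = "{i. \<phi> i > 1}"
  have fin: "finite (insert 1 (\<phi> ` ?S))" using assms by (simp add: vanishing_def)
  have "\<phi> i \<le> Max (insert 1 (\<phi> ` ?S))" for i
  proof (cases "i \<in> ?S")
    case True
    then show ?thesis using fin by (intro Max_ge) auto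
  next
    case False
    then have "\<phi> i \<le> 1" by simp
    also have "1 \<le> Max (insert 1 (\<phi> ` ?S))" using fin by (intro Max_ge) auto
    finally show ?thesis .
  qed
  moreover have "1 \<le> Max (insert 1 (\<phi> ` ?S))" using fin by (intro Max_ge) auto
  ultimately show ?thesis by (intro that[of "Max (insert 1 (\<phi> ` ?S))"]) auto
qed

lemma vanishing_mult:
  assumes "vanishing \<phi>" "vanishing \<psi>" "\<And>i. 0 \<le> \<phi> i" "\<And>j. 0 \<le> \<psi> j"
  shows "vanishing (\<lambda>(i, j). \<phi> i * \<psi> j)"
  unfolding vanishing_def
proof (intro allI impI)
  fix e :: real assume e: "0 < e"
  obtain A where A: "0 < A" "\<And>i. \<phi> i \<le> A" using vanishing_bounded[OF assms(1)] by blast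
  obtain B where B: "0 < B" "\<And>i. \<psi> i \<le> B" using vanishing_bounded[OF assms(2)] by blast
  have "finite ({i. \<phi> i > e / B} \<times> {j. \<psi> j > e / A})"
    using assms(1,2) e A B by (intro finite_cartesian_product) (auto simp: vanishing_def)
  moreover have "i \<in> {i. \<phi> i > e / B} \<and> j \<in> {j. \<psi> j > e / A}" if "\<phi> i * \<psi> j > e" for i j
  proof -
    have "\<phi> i * \<psi> j \<le> \<phi> i * B" "\<phi> i * \<psi> j \<le> A * \<psi> j"
      using A B assms(3,4) by (auto intro: mult_left_mono mult_right_mono)
    then show ?thesis using that A(1) B(1) by (auto simp: divide_less_eq mult.commute)
  qed
  then have "{x. (case x of (i, j) \<Rightarrow> \<phi> i * \<psi> j) > e} \<subseteq> {i. \<phi> i > e / B} \<times> {j. \<psi> j > e / A}"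
    by auto
  ultimately show "finite {x. (case x of (i, j) \<Rightarrow> \<phi> i * \<psi> j) > e}"
    by (rule finite_subset[rotated])
qed

lemma finite_total_deg_less:
  assumes "finite V"
  shows "finite {a :: 'v \<Rightarrow>\<^sub>0 nat. Poly_Mapping.keys a \<subseteq> V \<and> total_deg a < n}"
proof -
  let ?L = "\<lambda>a. \<lambda>v\<in>V. poly_mapping.lookup a v"
  let ?B = "{a :: 'v \<Rightarrow>\<^sub>0 nat. Poly_Mapping.keys a \<subseteq> V \<and> total_deg a < n}"
  have "inj_on ?L ?B"
  proof (rule inj_onI)
    fix b c assume b: "b \<in> ?B" and c: "c \<in> ?B" and eq: "?L b = ?L c"
    have "poly_mapping.lookup b v = poly_mapping.lookup c v" for v
    proof (cases "v \<in> V")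
      case True
      then show ?thesis using fun_cong[OF eq, of v] by simp
    next
      case False
      then have "poly_mapping.lookup b v = 0" "poly_mapping.lookup c v = 0"
        using b c by (auto simp: in_keys_iff)
      then show ?thesis by simp
    qed
    then show "b = c" by (rule poly_mapping_eqI)
  qed
  moreover have "?L ` ?B \<subseteq> (\<Pi>\<^sub>E v\<in>V. {..n})"
  proof (intro image_subsetI restrict_PiE_iff[THEN iffD2] ballI)
    fix a v assume a: "a \<in> ?B" and "v \<in> V"
    have "poly_mapping.lookup a v \<le> total_deg a"
    proof (cases "v \<in> Poly_Mapping.keys a")
      case True
      then show ?thesis unfolding total_deg_def by (intro member_le_sum) auto
    qed (simp add: in_keys_iff)
    then show "poly_mapping.lookup a v \<in> {..n}" using a by simp
  qed
  then have "finite (?L ` ?B)"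
    by (rule finite_subset) (intro finite_PiE assms finite_atMost)
  ultimately show ?thesis by (rule finite_imageD[rotated])
qed

section \<open>Coefficients, monomials and Gauss norms of formal series\<close>

lemma mps_eqI: "(\<And>a. mps_coeff f a = mps_coeff g a) \<Longrightarrow> f = g"
  by (metis ext mps_coeff_inject)

lemmas mps_coeff_simps [simp] =
  zero_mps.rep_eq one_mps.rep_eq plus_mps.rep_eq uminus_mps.rep_eq minus_mps.rep_eq
  mps_const.rep_eq mps_var.rep_eq

lemma mps_coeff_mult: "mps_coeff (f * g) a = (\<Sum>(b, c) | b + c = a. mps_coeff f b * mps_coeff g c)"
  by (simp add: times_mps.rep_eq)

lemma mps_coeff_const_mult [simp]:
  fixes f :: "('v, 'a::comm_ring_1) mps"
  shows "mps_coeff (mps_const c * f) a = c * mps_coeff f a"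
proof -
  have "mps_coeff (mps_const c * f) a = (\<Sum>(b, d) \<in> {(0 :: 'v \<Rightarrow>\<^sub>0 nat, a)}. mps_coeff (mps_const c) b * mps_coeff f d)"
    unfolding mps_coeff_mult
    by (rule sum.mono_neutral_right) (auto simp: finite_antidiagonal split: if_splits)
  then show ?thesis by simp
qed

lemma mps_const_simps:
  "mps_const 0 = 0" "mps_const 1 = 1"
  "mps_const (c + d) = mps_const c + (mps_const d :: ('v, 'a::comm_ring_1) mps)"
  "mps_const (c * d) = mps_const c * (mps_const d :: ('v, 'a::comm_ring_1) mps)"
  "mps_const (- c) = - (mps_const c :: ('v, 'a::comm_ring_1) mps)"
  by (auto intro!: mps_eqI simp del: mps_coeff_const_mult simp: mps_coeff_const_mult)

lemma mps_coeff_sum [simp]: "mps_coeff (sum f A) a = (\<Sum>i\<in>A. mps_coeff (f i) a)"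
  by (induction A rule: infinite_finite_induct) simp_all

definition mps_monom :: "('v \<Rightarrow>\<^sub>0 nat) \<Rightarrow> ('v, 'a::zero_neq_one) mps" where
  "mps_monom a = Abs_mps (\<lambda>b. if b = a then 1 else 0)"

lemma mps_coeff_monom [simp]: "mps_coeff (mps_monom a) b = (if b = a then 1 else 0)"
  by (simp add: mps_monom_def Abs_mps_inverse)

lemma mps_monom_0: "mps_monom 0 = (1 :: ('v, 'a::comm_ring_1) mps)"
  by (rule mps_eqI) simp

lemma mps_monom_add: "mps_monom (a + b) = mps_monom a * (mps_monom b :: ('v, 'a::comm_ring_1) mps)"
proof (rule mps_eqI)
  fix c
  have "mps_coeff (mps_monom a * mps_monom b :: ('v, 'a) mps) c
      = (\<Sum>(d, e) \<in> (if a + b = c then {(a, b)} else {}). mps_coeff (mps_monom a) d * mps_coeff (mps_monom b) e)"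
    unfolding mps_coeff_mult
    by (rule sum.mono_neutral_right) (auto simp: finite_antidiagonal split: if_splits)
  then show "mps_coeff (mps_monom (a + b) :: ('v, 'a) mps) c = mps_coeff (mps_monom a * mps_monom b) c"
    by auto
qed

lemma mps_var_eq_monom: "mps_var v = mps_monom (Poly_Mapping.single v 1)"
  by (rule mps_eqI) simp

lemma mps_monom_single: "mps_monom (Poly_Mapping.single v n) = (mps_var v ^ n :: ('v, 'a::comm_ring_1) mps)"
proof (induction n)
  case (Suc n)
  have "Poly_Mapping.single v (Suc n) = Poly_Mapping.single v 1 + Poly_Mapping.single v n"
    by (simp flip: single_add)
  then show ?case using Suc by (simp add: mps_monom_add mps_var_eq_monom)
qed (simp add: mps_monom_0)

lemma poly_mapping_sum_single:
  "(\<Sum>v\<in>Poly_Mapping.keys a. Poly_Mapping.single v (poly_mapping.lookup a v)) = (a :: 'v \<Rightarrow>\<^sub>0 nat)"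
  by (rule poly_mapping_eqI) (auto simp: lookup_sum lookup_single when_def in_keys_iff)

lemma mpow_mps_var: "mpow mps_var a = (mps_monom a :: ('v, 'a::comm_ring_1) mps)"
proof -
  have "(\<Prod>v\<in>S. mps_var v ^ poly_mapping.lookup a v)
      = (mps_monom (\<Sum>v\<in>S. Poly_Mapping.single v (poly_mapping.lookup a v)) :: ('v, 'a) mps)"
    if "finite S" for S
    using that by (induction S) (simp_all add: mps_monom_0 mps_monom_add mps_monom_single)
  then show ?thesis unfolding mpow_def by (simp add: poly_mapping_sum_single)
qed

text \<open>The Gauss norm enters only through its upper bounds, so no supremum has to be
  formed.\<close>

definition norm_le :: "('v \<Rightarrow> real) \<Rightarrow> ('v, 'p::prime_card padic) mps \<Rightarrow> real \<Rightarrow> bool" where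
  "norm_le r f C \<longleftrightarrow> (\<forall>a. padic_norm (mps_coeff f a) * mpow r a \<le> C)"

text \<open>In finitely many variables only finitely many exponents have bounded total degree, so
  letting the degree tend to infinity is the same as leaving every finite set of exponents.\<close>

lemma tate_algebra_iff:
  assumes "finite V" "\<And>v. 0 < r v"
  shows "f \<in> tate_algebra V r \<longleftrightarrow>
    (\<forall>a. mps_coeff f a \<noteq> 0 \<longrightarrow> Poly_Mapping.keys a \<subseteq> V) \<and>
    vanishing (\<lambda>a. padic_norm (mps_coeff f a) * mpow r a)"
proof (cases "\<forall>a. mps_coeff f a \<noteq> 0 \<longrightarrow> Poly_Mapping.keys a \<subseteq> V")
  case True
  let ?\<phi> = "\<lambda>a. padic_norm (mps_coeff f a) * mpow r a"
  have nonneg: "0 \<le> ?\<phi> a" for a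
    using mpow_pos[of r a] assms(2) by simp
  have "(?\<phi> \<longlongrightarrow> 0) (filtercomap total_deg at_top) \<longleftrightarrow> vanishing ?\<phi>"
  proof
    assume lim: "(?\<phi> \<longlongrightarrow> 0) (filtercomap total_deg at_top)"
    show "vanishing ?\<phi>"
      unfolding vanishing_def
    proof (intro allI impI)
      fix e :: real assume "0 < e"
      then have "eventually (\<lambda>a. ?\<phi> a < e) (filtercomap total_deg at_top)"
        using order_tendstoD(2)[OF lim] by blast
      then obtain N where N: "\<And>a. total_deg a \<ge> N \<Longrightarrow> ?\<phi> a < e"
        unfolding eventually_filtercomap eventually_at_top_linorder by blast
      have "{a. ?\<phi> a > e} \<subseteq> {a. Poly_Mapping.keys a \<subseteq> V \<and> total_deg a < N}"
      proof
        fix a assume a: "a \<in> {a. ?\<phi> a > e}"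
        then have "mps_coeff f a \<noteq> 0" using \<open>0 < e\<close> by auto
        then have "Poly_Mapping.keys a \<subseteq> V" using True by blast
        moreover have "total_deg a < N" using N[of a] a by (force simp: not_less[symmetric])
        ultimately show "a \<in> {a. Poly_Mapping.keys a \<subseteq> V \<and> total_deg a < N}" by simp
      qed
      then show "finite {a. ?\<phi> a > e}"
        using finite_total_deg_less[OF assms(1)] by (rule finite_subset)
    qed
  next
    assume van: "vanishing ?\<phi>"
    show "(?\<phi> \<longlongrightarrow> 0) (filtercomap total_deg at_top)"
    proof (rule order_tendstoI)
      fix e :: real assume "e < 0"
      then show "eventually (\<lambda>a. e < ?\<phi> a) (filtercomap total_deg at_top)"
        using nonneg by (intro always_eventually allI) (meson less_le_trans)
    next
      fix e :: real assume "0 < e"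
      then have "finite {a. ?\<phi> a > e / 2}"
        using van half_gt_zero unfolding vanishing_def by blast
      then have fin: "finite (total_deg ` {a. ?\<phi> a > e / 2})" by (rule finite_imageI)
      have "?\<phi> a < e" if "total_deg a \<ge> Suc (Max (total_deg ` {a. ?\<phi> a > e / 2}))" for a
      proof (rule ccontr)
        assume "\<not> ?\<phi> a < e"
        then have "total_deg a \<in> total_deg ` {a. ?\<phi> a > e / 2}" using \<open>0 < e\<close> by auto
        then have "total_deg a \<le> Max (total_deg ` {a. ?\<phi> a > e / 2})" using fin by (rule Max_ge[rotated])
        then show False using that by simp
      qed
      then show "eventually (\<lambda>a. ?\<phi> a < e) (filtercomap total_deg at_top)"
        unfolding eventually_filtercomap eventually_at_top_linorder by blast
    qed
  qed
  then show ?thesis using True by (simp add: tate_algebra_def mpow_def)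
qed (auto simp: tate_algebra_def)

definition ev :: "('v \<Rightarrow> 'p::prime_card padic) \<Rightarrow> ('v, 'p padic) mps \<Rightarrow> 'p padic" where
  "ev x f = nsum (\<lambda>a. mps_coeff f a * mpow x a)"

definition mps_nsum :: "('i \<Rightarrow> ('v, 'p::prime_card padic) mps) \<Rightarrow> ('v, 'p padic) mps" where
  "mps_nsum f = Abs_mps (\<lambda>a. nsum (\<lambda>i. mps_coeff (f i) a))"

lemma mps_coeff_nsum: "mps_coeff (mps_nsum f) a = nsum (\<lambda>i. mps_coeff (f i) a)"
  by (simp add: mps_nsum_def Abs_mps_inverse)

lemma norm_le_mono: "norm_le r f C \<Longrightarrow> C \<le> D \<Longrightarrow> norm_le r f D"
  unfolding norm_le_def by (meson order_trans)

text \<open>Exponents are read as digits: with a base \<open>B\<close> above all values at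
  \<open>w\<close>, the new variable gets weight 1 and the old weights are multiplied by
  \<open>B\<close>. Such weights single out one exponent among finitely many.\<close>

lemma ex_weights_separating:
  assumes "finite V" "finite S"
  shows "\<exists>u :: 'v \<Rightarrow> nat. \<forall>a\<in>S. \<forall>b\<in>S. (\<Sum>v\<in>V. a v * u v) = (\<Sum>v\<in>V. b v * u v) \<longrightarrow> (\<forall>v\<in>V. a v = b v)"
  using assms(1)
proof (induction V)
  case (insert w V)
  then obtain u where u: "\<And>a b. a \<in> S \<Longrightarrow> b \<in> S \<Longrightarrow> (\<Sum>v\<in>V. a v * u v) = (\<Sum>v\<in>V. b v * u v) \<Longrightarrow> \<forall>v\<in>V. a v = b v"
    by blast
  define B where "B = Suc (Max ((\<lambda>a. a w) ` S))"
  have B: "a w < B" if "a \<in> S" for a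
    using that assms(2) by (simp add: B_def le_imp_less_Suc)
  define u' where "u' v = (if v = w then 1 else B * u v)" for v
  have sum: "(\<Sum>v\<in>insert w V. a v * u' v) = a w + B * (\<Sum>v\<in>V. a v * u v)" for a
  proof -
    have "(\<Sum>v\<in>V. a v * u' v) = B * (\<Sum>v\<in>V. a v * u v)"
      unfolding sum_distrib_left using insert by (intro sum.cong) (auto simp: u'_def)
    then show ?thesis using insert by (simp add: u'_def)
  qed
  have "\<forall>v\<in>insert w V. a v = b v"
    if ab: "a \<in> S" "b \<in> S" "(\<Sum>v\<in>insert w V. a v * u' v) = (\<Sum>v\<in>insert w V. b v * u' v)" for a b
  proof -
    have eq: "a w + B * (\<Sum>v\<in>V. a v * u v) = b w + B * (\<Sum>v\<in>V. b v * u v)"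
      using ab(3) unfolding sum .
    have "a w = b w"
      using arg_cong[OF eq, of "\<lambda>n. n mod B"] B ab by simp
    moreover have "B \<noteq> 0" by (simp add: B_def)
    ultimately have "(\<Sum>v\<in>V. a v * u v) = (\<Sum>v\<in>V. b v * u v)"
      using eq by simp
    then show ?thesis using u ab \<open>a w = b w\<close> by blast
  qed
  then show ?case by blast
qed simp

section \<open>Tate algebras and evaluation on a polydisc\<close>

locale polyradius =
  fixes V :: "'v set" and r :: "'v \<Rightarrow> real"
  assumes finite_V [simp]: "finite V" and r_pos [simp]: "\<And>v. 0 < r v"
begin

lemma mpow_r_pos [simp]: "0 < mpow r a"
  by (rule mpow_pos) simp

lemma mpow_r_nonneg [simp]: "0 \<le> mpow r a"
  using mpow_r_pos[of a] by linarith

lemma norm_le_nonneg: "norm_le r f C \<Longrightarrow> 0 \<le> C"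
  unfolding norm_le_def by (meson mpow_r_nonneg mult_nonneg_nonneg order_trans padic_norm_nonneg)

lemma tate_iff:
  "f \<in> tate_algebra V r \<longleftrightarrow>
    (\<forall>a. mps_coeff f a \<noteq> 0 \<longrightarrow> Poly_Mapping.keys a \<subseteq> V) \<and>
    vanishing (\<lambda>a. padic_norm (mps_coeff f a) * mpow r a)"
  by (rule tate_algebra_iff) simp_all

lemma tate_keys: "f \<in> tate_algebra V r \<Longrightarrow> mps_coeff f a \<noteq> 0 \<Longrightarrow> Poly_Mapping.keys a \<subseteq> V"
  by (simp add: tate_iff)

lemma tate_norm_bounded:
  assumes "f \<in> tate_algebra V r"
  obtains C where "0 < C" "norm_le r f C"
  using assms vanishing_bounded[of "\<lambda>a. padic_norm (mps_coeff f a) * mpow r a"]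
  unfolding tate_iff norm_le_def by metis

lemma tate_0 [simp]: "0 \<in> tate_algebra V r"
  by (simp add: tate_iff vanishing_def)

lemma tate_const [simp]: "mps_const c \<in> tate_algebra V r"
proof -
  have "{a. padic_norm (mps_coeff (mps_const c) a) * mpow r a > e} \<subseteq> {0}" if "0 < e" for e
    using that by (auto split: if_splits)
  then show ?thesis
    by (auto simp: tate_iff vanishing_def intro: finite_subset split: if_splits)
qed

lemma tate_1 [simp]: "1 \<in> tate_algebra V r"
  using tate_const[of 1] by (simp add: mps_const_simps)

lemma tate_var [simp]: "v \<in> V \<Longrightarrow> mps_var v \<in> tate_algebra V r"
proof -
  assume v: "v \<in> V"
  have "{a. padic_norm (mps_coeff (mps_var v) a) * mpow r a > e} \<subseteq> {Poly_Mapping.single v 1}" if "0 < e" for e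
    using that by (auto split: if_splits)
  then show ?thesis
    using v by (auto simp: tate_iff vanishing_def intro: finite_subset split: if_splits)
qed

lemma tate_uminus: "f \<in> tate_algebra V r \<Longrightarrow> - f \<in> tate_algebra V r"
  by (simp add: tate_iff)

lemma norm_le_uminus: "norm_le r f C \<Longrightarrow> norm_le r (- f) C"
  by (simp add: norm_le_def)

lemma norm_le_add:
  assumes "norm_le r f C" "norm_le r g C"
  shows "norm_le r (f + g) C"
  unfolding norm_le_def
proof
  fix a
  have "padic_norm (mps_coeff f a) \<le> C / mpow r a" "padic_norm (mps_coeff g a) \<le> C / mpow r a"
    using assms by (simp_all add: norm_le_def le_divide_eq)
  then have "padic_norm (mps_coeff f a + mps_coeff g a) \<le> C / mpow r a"
    by (rule padic_norm_add_le)
  then show "padic_norm (mps_coeff (f + g) a) * mpow r a \<le> C"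
    by (simp add: le_divide_eq)
qed

lemma tate_add:
  assumes f: "f \<in> tate_algebra V r" and g: "g \<in> tate_algebra V r"
  shows "f + g \<in> tate_algebra V r"
proof -
  let ?\<phi> = "\<lambda>f a. padic_norm (mps_coeff f a) * mpow r a"
  have "finite {a. ?\<phi> (f + g) a > e}" if "0 < e" for e
  proof (rule finite_subset)
    show "finite ({a. ?\<phi> f a > e} \<union> {a. ?\<phi> g a > e})"
      using f g that by (simp add: tate_iff vanishing_def)
    have "?\<phi> (f + g) a \<le> max (?\<phi> f a) (?\<phi> g a)" for a
      using mult_right_mono[OF padic_norm_add mpow_r_nonneg, of "mps_coeff f a" "mps_coeff g a" a]
      by (simp add: max_mult_distrib_right)
    then show "{a. ?\<phi> (f + g) a > e} \<subseteq> {a. ?\<phi> f a > e} \<union> {a. ?\<phi> g a > e}"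
      using less_le_trans by (fastforce simp: less_max_iff_disj)
  qed
  moreover have "Poly_Mapping.keys a \<subseteq> V" if "mps_coeff (f + g) a \<noteq> 0" for a
    using that f g by (cases "mps_coeff f a = 0") (auto simp: tate_iff)
  ultimately show ?thesis by (simp add: tate_iff vanishing_def)
qed

lemma tate_diff: "f \<in> tate_algebra V r \<Longrightarrow> g \<in> tate_algebra V r \<Longrightarrow> f - g \<in> tate_algebra V r"
  using tate_add[of f "- g"] tate_uminus[of g] by simp

lemma norm_le_diff: "norm_le r f C \<Longrightarrow> norm_le r g C \<Longrightarrow> norm_le r (f - g) C"
  using norm_le_add[of f C "- g"] norm_le_uminus[of g C] by simp

lemma norm_mult_coeff:
  assumes "0 \<le> e" "\<And>b c. b + c = a \<Longrightarrow>
    (padic_norm (mps_coeff f b) * mpow r b) * (padic_norm (mps_coeff g c) * mpow r c) \<le> e"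
  shows "padic_norm (mps_coeff (f * g) a) * mpow r a \<le> e"
proof -
  have "padic_norm (mps_coeff (f * g) a) \<le> e / mpow r a"
    unfolding mps_coeff_mult
  proof (rule padic_norm_sum_le)
    fix x assume x: "x \<in> {(b, c). b + c = a}"
    obtain b c where bc: "x = (b, c)" by force
    show "padic_norm (case x of (b, c) \<Rightarrow> mps_coeff f b * mps_coeff g c) \<le> e / mpow r a"
      using assms(2)[of b c] x bc by (auto simp: le_divide_eq mpow_add mult_ac)
  qed (use assms(1) in simp)
  then show ?thesis by (simp add: le_divide_eq)
qed

lemma norm_le_mult:
  assumes "norm_le r f C" "norm_le r g D"
  shows "norm_le r (f * g) (C * D)"
  unfolding norm_le_def
  using assms norm_le_nonneg[OF assms(1)] norm_le_nonneg[OF assms(2)]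
  by (intro allI norm_mult_coeff mult_mono mult_nonneg_nonneg) (auto simp: norm_le_def)

lemma tate_mult:
  assumes f: "f \<in> tate_algebra V r" and g: "g \<in> tate_algebra V r"
  shows "f * g \<in> tate_algebra V r"
proof -
  let ?\<phi> = "\<lambda>f a. padic_norm (mps_coeff f a) * mpow r a"
  have van: "vanishing (\<lambda>(b, c). ?\<phi> f b * ?\<phi> g c)"
    using f g by (intro vanishing_mult) (auto simp: tate_iff)
  have "finite {a. ?\<phi> (f * g) a > e}" if "0 < e" for e
  proof (rule finite_subset)
    let ?S = "{x. (case x of (b, c) \<Rightarrow> ?\<phi> f b * ?\<phi> g c) > e}"
    show "finite ((\<lambda>(b, c). b + c) ` ?S)"
      using van that by (simp add: vanishing_def)
    show "{a. ?\<phi> (f * g) a > e} \<subseteq> (\<lambda>(b, c). b + c) ` ?S"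
    proof
      fix a assume "a \<in> {a. ?\<phi> (f * g) a > e}"
      then have "\<not> (\<forall>b c. b + c = a \<longrightarrow> ?\<phi> f b * ?\<phi> g c \<le> e)"
        using norm_mult_coeff[of e a f g] that by auto
      then obtain b c where "b + c = a" "(b, c) \<in> ?S" by force
      then show "a \<in> (\<lambda>(b, c). b + c) ` ?S" by force
    qed
  qed
  moreover have "Poly_Mapping.keys a \<subseteq> V" if "mps_coeff (f * g) a \<noteq> 0" for a
  proof -
    have "\<exists>x\<in>{(b, c). b + c = a}. (case x of (b, c) \<Rightarrow> mps_coeff f b * mps_coeff g c) \<noteq> 0"
      using that unfolding mps_coeff_mult by (rule contrapos_np) (auto intro: sum.neutral)
    then obtain b c where bc: "b + c = a" "mps_coeff f b \<noteq> 0" "mps_coeff g c \<noteq> 0" by auto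
    then have "Poly_Mapping.keys b \<union> Poly_Mapping.keys c \<subseteq> V"
      using f g by (simp add: tate_iff)
    then show ?thesis using keys_add[of b c] bc(1) by blast
  qed
  ultimately show ?thesis by (simp add: tate_iff vanishing_def)
qed

lemma tate_power: "f \<in> tate_algebra V r \<Longrightarrow> f ^ n \<in> tate_algebra V r"
  by (induction n) (simp_all add: tate_mult)

lemma tate_sum: "(\<And>i. i \<in> A \<Longrightarrow> f i \<in> tate_algebra V r) \<Longrightarrow> sum f A \<in> tate_algebra V r"
  by (induction A rule: infinite_finite_induct) (simp_all add: tate_add)

lemma tate_prod: "(\<And>i. i \<in> A \<Longrightarrow> f i \<in> tate_algebra V r) \<Longrightarrow> prod f A \<in> tate_algebra V r"
  by (induction A rule: infinite_finite_induct) (simp_all add: tate_mult)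

lemma norm_le_const: "padic_norm c \<le> C \<Longrightarrow> norm_le r (mps_const c) C"
  using order_trans[OF padic_norm_nonneg[of c]] by (auto simp: norm_le_def)

lemma norm_le_1: "norm_le r 1 1"
  using norm_le_const[of 1 1] by (simp add: mps_const_simps)

lemma norm_le_var: "norm_le r (mps_var v) (r v)"
  using less_imp_le[OF r_pos] by (auto simp: norm_le_def)

lemma norm_le_power: "norm_le r f C \<Longrightarrow> norm_le r (f ^ n) (C ^ n)"
  by (induction n) (simp_all add: norm_le_1 norm_le_mult)

lemma norm_le_prod: "(\<And>i. i \<in> A \<Longrightarrow> norm_le r (f i) (C i)) \<Longrightarrow> norm_le r (prod f A) (prod C A)"
  by (induction A rule: infinite_finite_induct) (simp_all add: norm_le_1 norm_le_mult)

lemma norm_le_mpow: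
  "(\<And>v. v \<in> Poly_Mapping.keys a \<Longrightarrow> norm_le r (G v) (C v)) \<Longrightarrow> norm_le r (mpow G a) (mpow C a)"
  unfolding mpow_def by (intro norm_le_prod norm_le_power)

lemma tate_mpow:
  "(\<And>v. v \<in> Poly_Mapping.keys a \<Longrightarrow> G v \<in> tate_algebra V r) \<Longrightarrow> mpow G a \<in> tate_algebra V r"
  unfolding mpow_def by (intro tate_prod tate_power)

lemma norm_le_const_mult:
  assumes "norm_le r f C"
  shows "norm_le r (mps_const c * f) (padic_norm c * C)"
  by (intro norm_le_mult norm_le_const assms order_refl)

definition in_disc :: "('v \<Rightarrow> 'p::prime_card padic) \<Rightarrow> bool" where
  "in_disc x \<longleftrightarrow> (\<forall>v\<in>V. padic_norm (x v) \<le> r v)"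

lemma term_le:
  assumes "f \<in> tate_algebra V r" "in_disc x"
  shows "padic_norm (mps_coeff f a * mpow x a) \<le> padic_norm (mps_coeff f a) * mpow r a"
proof (cases "mps_coeff f a = 0")
  case False
  then have "Poly_Mapping.keys a \<subseteq> V" using assms tate_keys by blast
  then have "mpow (\<lambda>v. padic_norm (x v)) a \<le> mpow r a"
    using assms(2) by (intro mpow_mono) (auto simp: in_disc_def)
  then show ?thesis by (auto simp: padic_norm_mpow intro: mult_left_mono)
qed simp

lemma ev_null:
  assumes "f \<in> tate_algebra V r" "in_disc x"
  shows "null_family (\<lambda>a. mps_coeff f a * mpow x a)"
  unfolding null_family_iff_vanishing
  using assms(1) term_le[OF assms] by (auto simp: tate_iff intro: vanishing_le)

lemma ev_add:
  "f \<in> tate_algebra V r \<Longrightarrow> g \<in> tate_algebra V r \<Longrightarrow> in_disc x \<Longrightarrow> ev x (f + g) = ev x f + ev x g"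
  unfolding ev_def by (subst nsum_add[symmetric]) (auto intro: ev_null simp: distrib_right)

lemma ev_const [simp]: "ev x (mps_const c) = c"
  unfolding ev_def by (subst nsum_finite[of "{0}"]) auto

lemma ev_0 [simp]: "ev x 0 = 0"
  using ev_const[of x 0] by (simp add: mps_const_simps)

lemma ev_1 [simp]: "ev x 1 = 1"
  using ev_const[of x 1] by (simp add: mps_const_simps)

lemma ev_var [simp]: "ev x (mps_var v) = x v"
  unfolding ev_def by (subst nsum_finite[of "{Poly_Mapping.single v 1}"]) auto

lemma ev_const_mult:
  "f \<in> tate_algebra V r \<Longrightarrow> in_disc x \<Longrightarrow> ev x (mps_const c * f) = c * ev x f"
  unfolding ev_def by (subst nsum_cmult[symmetric]) (auto intro: ev_null simp: mult.assoc)

lemma ev_diff: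
  assumes "f \<in> tate_algebra V r" "g \<in> tate_algebra V r" "in_disc x"
  shows "ev x (f - g) = ev x f - ev x g"
  using ev_add[OF tate_diff[OF assms(1,2)] assms(2,3)] by simp

lemma ev_mult:
  assumes f: "f \<in> tate_algebra V r" and g: "g \<in> tate_algebra V r" and x: "in_disc x"
  shows "ev x (f * g) = ev x f * ev x g"
proof -
  let ?f = "\<lambda>b. mps_coeff f b * mpow x b" and ?g = "\<lambda>c. mps_coeff g c * mpow x c"
  \<comment> \<open>The Cauchy product as a double sum over an exponent and a pair, supported where
    the pair adds up to the exponent; exchanging the two sums leaves the product of the
    values.\<close>
  define P where "P a q = (if fst q + snd q = a then ?f (fst q) * ?g (snd q) else 0)" for a q
  have nf: "null_family ?f" and ng: "null_family ?g" using assms by (auto intro: ev_null)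
  have pair: "null_family (\<lambda>(b, c). ?f b * ?g c)"
    using vanishing_mult[OF nf[unfolded null_family_iff_vanishing] ng[unfolded null_family_iff_vanishing]]
    by (simp add: null_family_iff_vanishing case_prod_unfold)
  have null: "null_family (\<lambda>(a, q). P a q)"
    unfolding null_family_def
  proof (intro allI impI)
    fix e :: real assume e: "0 < e"
    let ?S = "{q. padic_norm (case q of (b, c) \<Rightarrow> ?f b * ?g c) > e}"
    have "finite ((\<lambda>q. (fst q + snd q, q)) ` ?S)" using pair e by (simp add: null_family_def)
    moreover have "{i. padic_norm (case i of (a, q) \<Rightarrow> P a q) > e} \<subseteq> (\<lambda>q. (fst q + snd q, q)) ` ?S"
      using e by (auto simp: P_def image_iff split: if_splits)
    ultimately show "finite {i. padic_norm (case i of (a, q) \<Rightarrow> P a q) > e}"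
      by (rule finite_subset[rotated])
  qed
  have "ev x (f * g) = nsum (\<lambda>a. nsum (\<lambda>q. P a q))"
    unfolding ev_def
  proof (rule arg_cong[where f=nsum], rule ext)
    fix a
    have "nsum (\<lambda>q. P a q) = (\<Sum>q\<in>{(b, c). b + c = a}. P a q)"
      by (rule nsum_finite[OF finite_antidiagonal]) (auto simp: P_def)
    also have "\<dots> = (\<Sum>(b, c) | b + c = a. mps_coeff f b * mps_coeff g c) * mpow x a"
      unfolding sum_distrib_right by (rule sum.cong) (auto simp: P_def mpow_add)
    finally show "mps_coeff (f * g) a * mpow x a = nsum (\<lambda>q. P a q)"
      by (simp add: mps_coeff_mult)
  qed
  also have "\<dots> = nsum (\<lambda>q. nsum (\<lambda>a. P a q))"
    by (rule nsum_swap[OF null])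
  also have "\<dots> = nsum (\<lambda>(b, c). ?f b * ?g c)"
  proof (rule arg_cong[where f=nsum], rule ext)
    fix q
    have "(\<lambda>a. P a q) = (\<lambda>a. if a = fst q + snd q then ?f (fst q) * ?g (snd q) else 0)"
      by (auto simp: P_def)
    then show "nsum (\<lambda>a. P a q) = (case q of (b, c) \<Rightarrow> ?f b * ?g c)"
      by (simp add: nsum_single case_prod_unfold)
  qed
  also have "\<dots> = nsum (\<lambda>b. nsum (\<lambda>c. ?f b * ?g c))"
    using nsum_Fubini[OF pair] by simp
  also have "\<dots> = nsum (\<lambda>b. nsum ?g * ?f b)"
    using nsum_cmult[OF ng] by (simp add: mult.commute)
  also have "\<dots> = nsum ?g * nsum ?f"
    by (rule nsum_cmult[OF nf])
  also have "\<dots> = ev x f * ev x g"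
    by (simp only: ev_def mult.commute)
  finally show ?thesis .
qed

lemma ev_power: "f \<in> tate_algebra V r \<Longrightarrow> in_disc x \<Longrightarrow> ev x (f ^ n) = ev x f ^ n"
  by (induction n) (simp_all add: ev_mult tate_power)

lemma ev_prod:
  "in_disc x \<Longrightarrow> (\<And>i. i \<in> A \<Longrightarrow> f i \<in> tate_algebra V r) \<Longrightarrow> ev x (prod f A) = (\<Prod>i\<in>A. ev x (f i))"
  by (induction A rule: infinite_finite_induct) (simp_all add: ev_mult tate_prod)

lemma ev_mpow:
  "in_disc x \<Longrightarrow> (\<And>v. v \<in> Poly_Mapping.keys a \<Longrightarrow> G v \<in> tate_algebra V r) \<Longrightarrow>
    ev x (mpow G a) = mpow (\<lambda>v. ev x (G v)) a"
  unfolding mpow_def by (subst ev_prod) (auto intro!: tate_power simp: ev_power)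

lemma ev_norm_le:
  assumes "f \<in> tate_algebra V r" "in_disc x" "norm_le r f C"
  shows "padic_norm (ev x f) \<le> C"
  unfolding ev_def
proof (rule nsum_norm_le[OF ev_null[OF assms(1,2)] norm_le_nonneg[OF assms(3)]])
  show "padic_norm (mps_coeff f a * mpow x a) \<le> C" for a
    using term_le[OF assms(1,2), of a] assms(3) by (auto simp: norm_le_def intro: order_trans)
qed

lemma ev_cong:
  assumes "f \<in> tate_algebra V r" "\<And>v. v \<in> V \<Longrightarrow> x v = y v"
  shows "ev x f = ev y f"
  unfolding ev_def
proof (rule arg_cong[where f=nsum], rule ext)
  fix a
  show "mps_coeff f a * mpow x a = mps_coeff f a * mpow y a"
    using tate_keys[OF assms(1), of a] assms(2) mpow_cong[of a x y]
    by (cases "mps_coeff f a = 0") auto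
qed

text \<open>A vanishing majorant of the Gauss norms makes the coefficients, indexed jointly by term
  and exponent, a null family, so summation over terms and evaluation can be exchanged.\<close>

lemma
  fixes f :: "'i \<Rightarrow> ('v, 'p::prime_card padic) mps"
  assumes f: "\<And>i. f i \<in> tate_algebra V r" and le: "\<And>i. norm_le r (f i) (\<phi> i)" and van: "vanishing \<phi>"
  shows mps_nsum_tate: "mps_nsum f \<in> tate_algebra V r"
    and mps_nsum_norm_le: "(\<And>i. norm_le r (f i) C) \<Longrightarrow> norm_le r (mps_nsum f) C"
    and ev_mps_nsum: "in_disc x \<Longrightarrow> ev x (mps_nsum f) = nsum (\<lambda>i. ev x (f i))"
    and ev_mps_nsum_null: "in_disc x \<Longrightarrow> null_family (\<lambda>i. ev x (f i))"
proof -
  let ?c = "\<lambda>i a. padic_norm (mps_coeff (f i) a) * mpow r a"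
  have joint: "vanishing (\<lambda>(i, a). ?c i a)"
    unfolding vanishing_def
  proof (intro allI impI)
    fix e :: real assume e: "0 < e"
    have "finite (SIGMA i:{i. \<phi> i > e}. {a. ?c i a > e})"
      using van f e by (intro finite_SigmaI) (auto simp: vanishing_def tate_iff)
    moreover have "{x. (case x of (i, a) \<Rightarrow> ?c i a) > e} \<subseteq> (SIGMA i:{i. \<phi> i > e}. {a. ?c i a > e})"
      using le by (auto simp: norm_le_def intro: less_le_trans)
    ultimately show "finite {x. (case x of (i, a) \<Rightarrow> ?c i a) > e}" by (rule finite_subset[rotated])
  qed
  have coeff_null: "null_family (\<lambda>i. mps_coeff (f i) a)" for a
    unfolding null_family_def
  proof (intro allI impI)
    fix e :: real assume "0 < e"
    then have "finite {i. \<phi> i > e * mpow r a}" using van by (simp add: vanishing_def)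
    moreover have "{i. padic_norm (mps_coeff (f i) a) > e} \<subseteq> {i. \<phi> i > e * mpow r a}"
    proof clarify
      fix i assume "padic_norm (mps_coeff (f i) a) > e"
      then have "e * mpow r a < ?c i a" by simp
      also have "\<dots> \<le> \<phi> i" using le by (simp add: norm_le_def)
      finally show "e * mpow r a < \<phi> i" .
    qed
    ultimately show "finite {i. padic_norm (mps_coeff (f i) a) > e}" by (rule finite_subset[rotated])
  qed
  have bound: "padic_norm (mps_coeff (mps_nsum f) a) * mpow r a \<le> e"
    if "0 \<le> e" "\<And>i. ?c i a \<le> e" for e a
  proof -
    have "padic_norm (mps_coeff (mps_nsum f) a) \<le> e / mpow r a"
      unfolding mps_coeff_nsum using that by (intro nsum_norm_le coeff_null) (simp_all add: le_divide_eq)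
    then show ?thesis by (simp add: le_divide_eq)
  qed
  show "norm_le r (mps_nsum f) C" if "\<And>i. norm_le r (f i) C"
    unfolding norm_le_def using that norm_le_nonneg[OF that] by (intro allI bound) (auto simp: norm_le_def)
  show "mps_nsum f \<in> tate_algebra V r"
    unfolding tate_iff vanishing_def
  proof (intro conjI allI impI)
    fix a assume "mps_coeff (mps_nsum f) a \<noteq> 0"
    then have "\<exists>i. mps_coeff (f i) a \<noteq> 0"
      unfolding mps_coeff_nsum by (rule contrapos_np) (subst nsum_finite[of "{}"], auto)
    then show "Poly_Mapping.keys a \<subseteq> V" using f tate_keys by blast
  next
    fix e :: real assume e: "0 < e"
    have "finite (snd ` {x. (case x of (i, a) \<Rightarrow> ?c i a) > e})"
      using joint e by (simp add: vanishing_def)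
    moreover have "{a. padic_norm (mps_coeff (mps_nsum f) a) * mpow r a > e}
        \<subseteq> snd ` {x. (case x of (i, a) \<Rightarrow> ?c i a) > e}"
    proof
      fix a assume "a \<in> {a. padic_norm (mps_coeff (mps_nsum f) a) * mpow r a > e}"
      then have "\<not> (\<forall>i. ?c i a \<le> e)" using bound[of e a] e by auto
      then obtain i where "(i, a) \<in> {x. (case x of (i, a) \<Rightarrow> ?c i a) > e}" by (auto simp: not_le)
      then show "a \<in> snd ` {x. (case x of (i, a) \<Rightarrow> ?c i a) > e}"
        by (rule image_eqI[rotated]) simp
    qed
    ultimately show "finite {a. padic_norm (mps_coeff (mps_nsum f) a) * mpow r a > e}"
      by (rule finite_subset[rotated])
  qed
  assume x: "in_disc x"
  have null: "null_family (\<lambda>(i, a). mps_coeff (f i) a * mpow x a)"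
    unfolding null_family_iff_vanishing
    using term_le[OF f x] by (intro vanishing_le[OF joint]) auto
  have "ev x (mps_nsum f) = nsum (\<lambda>a. nsum (\<lambda>i. mps_coeff (f i) a * mpow x a))"
    unfolding ev_def mps_coeff_nsum
    by (subst (2) mult.commute, subst nsum_cmult[OF coeff_null]) (simp add: mult.commute)
  also have "\<dots> = nsum (\<lambda>i. ev x (f i))"
    unfolding ev_def by (rule nsum_swap[OF null, symmetric])
  finally show "ev x (mps_nsum f) = nsum (\<lambda>i. ev x (f i))" .
  show "null_family (\<lambda>i. ev x (f i))"
    using null_family_nsum_rows(2)[OF null] by (simp add: ev_def)
qed

text \<open>At the points x_v = p^(k w_v), with weights chosen for the exponents of least total
  degree, exactly one exponent has the least weighted degree, and for large k its term dominates all
  others together.\<close>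

lemma ev_separates:
  fixes f :: "('v, 'p::prime_card padic) mps"
  assumes f: "f \<in> tate_algebra V r" and r: "\<And>v. v \<in> V \<Longrightarrow> 1 \<le> r v"
    and ev: "\<And>x. (\<And>v. padic_norm (x v) \<le> 1) \<Longrightarrow> ev x f = 0"
  shows "f = 0"
proof (rule ccontr)
  assume "f \<noteq> 0"
  then have "\<exists>a. mps_coeff f a \<noteq> 0" by (metis mps_eqI zero_mps.rep_eq)
  define S where "S = {a. mps_coeff f a \<noteq> 0}"
  have keys: "Poly_Mapping.keys a \<subseteq> V" if "a \<in> S" for a
    using that f tate_keys by (auto simp: S_def)
  define m where "m = (LEAST m. \<exists>a\<in>S. total_deg a = m)"
  have "\<exists>m. \<exists>a\<in>S. total_deg a = m"
    using \<open>\<exists>a. mps_coeff f a \<noteq> 0\<close> by (auto simp: S_def)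
  then have "\<exists>a\<in>S. total_deg a = m" unfolding m_def by (rule LeastI_ex)
  have m_le: "m \<le> total_deg a" if "a \<in> S" for a
    unfolding m_def using that by (intro Least_le) blast
  define M where "M = {a\<in>S. total_deg a = m}"
  have "M \<subseteq> {a. Poly_Mapping.keys a \<subseteq> V \<and> total_deg a < Suc m}"
    using keys by (auto simp: M_def)
  then have finM: "finite M" using finite_total_deg_less[OF finite_V] by (rule finite_subset)
  obtain u :: "'v \<Rightarrow> nat" where u: "\<forall>a\<in>poly_mapping.lookup ` M. \<forall>b\<in>poly_mapping.lookup ` M.
      (\<Sum>v\<in>V. a v * u v) = (\<Sum>v\<in>V. b v * u v) \<longrightarrow> (\<forall>v\<in>V. a v = b v)"
    using ex_weights_separating[OF finite_V finite_imageI[OF finM]] by blast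
  define U where "U a = (\<Sum>v\<in>V. poly_mapping.lookup a v * u v)" for a
  have injU: "a = b" if "a \<in> M" "b \<in> M" "U a = U b" for a b
  proof (rule poly_mapping_eqI)
    fix v
    show "poly_mapping.lookup a v = poly_mapping.lookup b v"
    proof (cases "v \<in> V")
      case True
      have "(\<Sum>v\<in>V. poly_mapping.lookup a v * u v) = (\<Sum>v\<in>V. poly_mapping.lookup b v * u v)"
        using that(3) by (simp only: U_def)
      then have "\<forall>v\<in>V. poly_mapping.lookup a v = poly_mapping.lookup b v"
        by (rule u[THEN bspec, THEN bspec, THEN mp, OF imageI imageI, OF that(1,2)])
      then show ?thesis using True by blast
    next
      case False
      then have "v \<notin> Poly_Mapping.keys a" "v \<notin> Poly_Mapping.keys b"
        using keys that by (auto simp: M_def)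
      then show ?thesis by (simp add: in_keys_iff)
    qed
  qed
  have "M \<noteq> {}" using \<open>\<exists>a\<in>S. total_deg a = m\<close> by (auto simp: M_def)
  define a where "a = arg_min_on U M"
  have a: "a \<in> M" and a_min: "\<And>b. b \<in> M \<Longrightarrow> U a \<le> U b"
    unfolding a_def using arg_min_if_finite[OF finM \<open>M \<noteq> {}\<close>, of U] by (auto simp: not_less)
  have aS: "a \<in> S" "total_deg a = m" using a by (auto simp: M_def)
  \<comment> \<open>Since \<open>B\<close> exceeds \<open>U a\<close>, every exponent of larger
    total degree is heavier than \<open>a\<close>, whatever its value under
    \<open>U\<close>.\<close>
  define B where "B = Suc (U a)"
  define w where "w v = B + u v" for v
  define W where "W b = (\<Sum>v\<in>V. poly_mapping.lookup b v * w v)" for b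
  have W: "W b = B * total_deg b + U b" if "b \<in> S" for b
  proof -
    have "total_deg b = (\<Sum>v\<in>V. poly_mapping.lookup b v)"
      unfolding total_deg_def using keys[OF that] by (intro sum.mono_neutral_left) (auto simp: in_keys_iff)
    then show ?thesis
      by (simp add: W_def U_def w_def distrib_left sum.distrib sum_distrib_left mult.commute)
  qed
  have W_less: "W b \<ge> Suc (W a)" if "b \<in> S" "b \<noteq> a" for b
  proof (cases "total_deg b = m")
    case True
    then have "b \<in> M" using that by (simp add: M_def)
    then have "U a < U b" using a_min injU a that(2) by (metis le_neq_implies_less)
    then show ?thesis using W aS that True by simp
  next
    case False
    then have "m + 1 \<le> total_deg b" using m_le[OF that(1)] by simp
    then have "B * (m + 1) \<le> B * total_deg b" by (rule mult_le_mono2)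
    then show ?thesis using W[OF that(1)] W[OF aS(1)] aS by (simp add: B_def)
  qed
  obtain C where C: "0 < C" "norm_le r f C" using tate_norm_bounded[OF f] by blast
  have coeff: "padic_norm (mps_coeff f b) \<le> C" for b
  proof (cases "b \<in> S")
    case True
    then have "1 \<le> mpow r b" using keys r by (intro mpow_ge_1) blast
    then have "padic_norm (mps_coeff f b) * 1 \<le> padic_norm (mps_coeff f b) * mpow r b"
      by (intro mult_left_mono) auto
    then show ?thesis using C(2) by (auto simp: norm_le_def intro: order_trans)
  qed (use C in \<open>simp add: S_def\<close>)
  let ?q = "1 / real CARD('p)"
  have nz: "mps_coeff f a \<noteq> 0" using aS by (simp add: S_def)
  then have "0 < padic_norm (mps_coeff f a) / C" using C by simp
  then obtain k where k: "?q ^ k < padic_norm (mps_coeff f a) / C" using p_power_small by blast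
  define x where "x v = (of_nat CARD('p) ^ (k * w v) :: 'p padic)" for v
  have x1: "padic_norm (x v) \<le> 1" for v by (simp add: x_def power_le_one)
  have xW: "padic_norm (mpow x b) = ?q ^ (k * W b)" if "b \<in> S" for b
  proof -
    have "padic_norm (mpow x b) = (\<Prod>v\<in>V. ?q ^ (k * (poly_mapping.lookup b v * w v)))"
      unfolding mpow_superset[OF finite_V keys[OF that]] padic_norm_prod
      by (rule prod.cong) (simp_all add: x_def power_mult[symmetric] mult_ac)
    then show ?thesis by (simp add: W_def sum_distrib_left flip: power_sum)
  qed
  define e where "e = C * ?q ^ (k * Suc (W a))"
  have "padic_norm (ev x f - (\<Sum>b\<in>{a}. mps_coeff f b * mpow x b)) \<le> e"
    unfolding ev_def
  proof (intro has_nsum_approx has_nsum_exists ev_null f)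
    show "in_disc x" unfolding in_disc_def using x1 r order_trans by blast
    show "0 < e" using C by (simp add: e_def)
    fix b assume b: "b \<notin> {a}"
    show "padic_norm (mps_coeff f b * mpow x b) \<le> e"
    proof (cases "b \<in> S")
      case True
      then have "?q ^ (k * W b) \<le> ?q ^ (k * Suc (W a))"
        using W_less b by (intro power_decreasing mult_le_mono2) auto
      then show ?thesis
        unfolding e_def padic_norm_mult xW[OF True] using coeff[of b] C by (intro mult_mono) auto
    qed (use C in \<open>simp add: S_def e_def\<close>)
  qed simp
  moreover have "ev x f = 0" using x1 by (rule ev)
  ultimately have "padic_norm (mps_coeff f a) * ?q ^ (k * W a) \<le> C * ?q ^ (k * Suc (W a))"
    using xW[OF aS(1)] by (simp add: e_def)
  also have "\<dots> = (C * ?q ^ k) * ?q ^ (k * W a)" by (simp add: power_add)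
  finally have "padic_norm (mps_coeff f a) \<le> C * ?q ^ k" by simp
  then show False using k C by (simp add: field_simps)
qed

end

section \<open>Substitution of series into series\<close>

definition mps_subst :: "('v \<Rightarrow> ('w, 'p::prime_card padic) mps) \<Rightarrow> ('v, 'p padic) mps \<Rightarrow> ('w, 'p padic) mps" where
  "mps_subst G f = mps_nsum (\<lambda>a. mps_const (mps_coeff f a) * mpow G a)"

locale polyradius_pair = dom: polyradius V r + cod: polyradius W r'
  for V :: "'v set" and r and W :: "'w set" and r'
begin

context
  fixes G :: "'v \<Rightarrow> ('w, 'p::prime_card padic) mps"
  assumes G: "\<And>v. v \<in> V \<Longrightarrow> G v \<in> tate_algebra W r'" "\<And>v. v \<in> V \<Longrightarrow> norm_le r' (G v) (r v)"
begin

lemma subst_terms: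
  assumes f: "f \<in> tate_algebra V r"
  shows "mps_const (mps_coeff f a) * mpow G a \<in> tate_algebra W r'"
    and "norm_le r' (mps_const (mps_coeff f a) * mpow G a) (padic_norm (mps_coeff f a) * mpow r a)"
proof -
  \<comment> \<open>\<open>G\<close> is controlled only on \<open>V\<close>; a nonzero coefficient
    forces the exponent into \<open>V\<close>, and a zero coefficient kills the term.\<close>
  show "mps_const (mps_coeff f a) * mpow G a \<in> tate_algebra W r'"
  proof (cases "mps_coeff f a = 0")
    case False
    then show ?thesis
      using G dom.tate_keys[OF f] by (intro cod.tate_mult cod.tate_const cod.tate_mpow) blast
  qed (simp add: mps_const_simps)
  show "norm_le r' (mps_const (mps_coeff f a) * mpow G a) (padic_norm (mps_coeff f a) * mpow r a)"
  proof (cases "mps_coeff f a = 0")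
    case False
    then show ?thesis
      using G dom.tate_keys[OF f] by (intro cod.norm_le_const_mult cod.norm_le_mpow) blast
  qed (simp add: mps_const_simps norm_le_def)
qed

lemma subst_vanishing:
  "f \<in> tate_algebra V r \<Longrightarrow> vanishing (\<lambda>a. padic_norm (mps_coeff f a) * mpow r a)"
  by (simp add: dom.tate_iff)

lemma subst_tate: "f \<in> tate_algebra V r \<Longrightarrow> mps_subst G f \<in> tate_algebra W r'"
  unfolding mps_subst_def by (rule cod.mps_nsum_tate[OF subst_terms subst_vanishing])

lemma subst_norm_le:
  assumes "f \<in> tate_algebra V r" "norm_le r f C"
  shows "norm_le r' (mps_subst G f) C"
  unfolding mps_subst_def
proof (rule cod.mps_nsum_norm_le[OF subst_terms subst_vanishing])
  show "norm_le r' (mps_const (mps_coeff f a) * mpow G a) C" for a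
    using norm_le_mono[OF subst_terms(2)[OF assms(1), of a]] assms(2) by (simp add: norm_le_def)
qed (rule assms(1))+

lemma ev_subst:
  assumes f: "f \<in> tate_algebra V r" and x: "cod.in_disc x"
  shows "ev x (mps_subst G f) = ev (\<lambda>v. ev x (G v)) f"
proof -
  have "ev x (mps_subst G f) = nsum (\<lambda>a. ev x (mps_const (mps_coeff f a) * mpow G a))"
    unfolding mps_subst_def by (rule cod.ev_mps_nsum[OF subst_terms subst_vanishing]) (rule f x)+
  also have "\<dots> = ev (\<lambda>v. ev x (G v)) f"
    unfolding ev_def[of "\<lambda>v. ev x (G v)"]
  proof (rule arg_cong[where f=nsum], rule ext)
    fix a
    show "ev x (mps_const (mps_coeff f a) * mpow G a) = mps_coeff f a * mpow (\<lambda>v. ev x (G v)) a"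
    proof (cases "mps_coeff f a = 0")
      case False
      then have *: "G v \<in> tate_algebra W r'" if "v \<in> Poly_Mapping.keys a" for v
        using G dom.tate_keys[OF f] that by blast
      then show ?thesis
        by (simp add: cod.ev_const_mult cod.tate_mpow x cod.ev_mpow)
    qed (simp add: mps_const_simps)
  qed
  finally show ?thesis .
qed

end

end

section \<open>Units, automatic continuity and Gauss's lemma\<close>

lemma geometric_nsum:
  fixes y :: "'p::prime_card padic"
  assumes null: "null_family (\<lambda>k::nat. y ^ k)" and y: "padic_norm y < 1"
  shows "nsum (\<lambda>k. y ^ k) * (1 - y) = 1"
proof -
  have "padic_norm (nsum (\<lambda>k. y ^ k) * (1 - y) - 1) \<le> e" if e: "0 < e" for e
  proof -
    obtain n where n: "padic_norm y ^ n < e" using real_arch_pow_inv[OF e y] by blast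
    have "padic_norm (nsum (\<lambda>k. y ^ k) - (\<Sum>k<n. y ^ k)) \<le> e"
    proof (rule has_nsum_approx[OF has_nsum_exists[OF null]])
      show "padic_norm (y ^ k) \<le> e" if "k \<notin> {..<n}" for k
      proof -
        have "padic_norm y ^ k \<le> padic_norm y ^ n"
          using that y by (intro power_decreasing) auto
        then show ?thesis using n by simp
      qed
    qed (use e in auto)
    moreover have "padic_norm (1 - y) \<le> 1"
      using y by (intro padic_norm_diff_le) auto
    ultimately have "padic_norm ((nsum (\<lambda>k. y ^ k) - (\<Sum>k<n. y ^ k)) * (1 - y)) \<le> e * 1"
      unfolding padic_norm_mult using e by (intro mult_mono) auto
    moreover have "(\<Sum>k<n. y ^ k) * (1 - y) = 1 - y ^ n"
      using one_diff_power_eq[of y n] by (simp add: mult.commute)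
    ultimately have "padic_norm (nsum (\<lambda>k. y ^ k) * (1 - y) - (1 - y ^ n)) \<le> e"
      by (simp add: left_diff_distrib)
    moreover have "padic_norm ((1 - y ^ n) - 1) \<le> e" using n by simp
    ultimately show ?thesis by (rule padic_norm_trans_le)
  qed
  from padic_norm_le_all_imp_0[OF this] show ?thesis by simp
qed

lemma vanishing_power:
  assumes "0 \<le> t" "t < (1::real)"
  shows "vanishing (\<lambda>k::nat. t ^ k)"
  unfolding vanishing_def
proof (intro allI impI)
  fix e :: real assume "0 < e"
  then obtain n where n: "t ^ n < e" using real_arch_pow_inv assms by blast
  have "{k. t ^ k > e} \<subseteq> {..<n}"
  proof
    fix k assume k: "k \<in> {k. t ^ k > e}"
    have "\<not> n \<le> k"
    proof
      assume "n \<le> k"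
      then have "t ^ k \<le> t ^ n" using assms by (intro power_decreasing) auto
      then show False using k n by simp
    qed
    then show "k \<in> {..<n}" by simp
  qed
  then show "finite {k. t ^ k > e}" by (rule finite_subset) simp
qed

context polyradius
begin

text \<open>The inverse is the Neumann series. The identity is tested at integral points, where it
  is the geometric series of numbers.\<close>

lemma one_minus_inverse:
  fixes u :: "('v, 'p::prime_card padic) mps"
  assumes r: "\<And>v. v \<in> V \<Longrightarrow> 1 \<le> r v" and u: "u \<in> tate_algebra V r" and nu: "norm_le r u t" and t: "t < 1"
  obtains g where "g \<in> tate_algebra V r" "g * (1 - u) = 1"
proof -
  have t0: "0 \<le> t" using nu by (rule norm_le_nonneg)
  have pow: "u ^ k \<in> tate_algebra V r" "norm_le r (u ^ k) (t ^ k)" for k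
    by (intro tate_power u norm_le_power nu)+
  define g where "g = mps_nsum (\<lambda>k. u ^ k)"
  have g: "g \<in> tate_algebra V r"
    unfolding g_def by (rule mps_nsum_tate[OF pow vanishing_power[OF t0 t]])
  have "g * (1 - u) - 1 = 0"
  proof (rule ev_separates)
    show "g * (1 - u) - 1 \<in> tate_algebra V r" by (intro tate_diff tate_mult g u tate_1)
    fix x :: "'v \<Rightarrow> 'p padic" assume "\<And>v. padic_norm (x v) \<le> 1"
    then have x: "in_disc x" using r order_trans unfolding in_disc_def by blast
    have "ev x g = nsum (\<lambda>k. ev x (u ^ k))" "null_family (\<lambda>k. ev x (u ^ k))"
      unfolding g_def using ev_mps_nsum[OF pow vanishing_power[OF t0 t] x]
        ev_mps_nsum_null[OF pow vanishing_power[OF t0 t] x] by auto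
    moreover have "ev x (u ^ k) = ev x u ^ k" for k by (rule ev_power[OF u x])
    moreover have "padic_norm (ev x u) < 1" using ev_norm_le[OF u x nu] t by simp
    ultimately have "ev x g * (1 - ev x u) = 1" using geometric_nsum by simp
    then show "ev x (g * (1 - u) - 1) = 0"
      using g u x by (simp add: ev_diff ev_mult tate_mult tate_diff)
  qed (rule r)
  then show ?thesis using that[OF g] by simp
qed

text \<open>Automatic continuity: a character chi with |chi f| larger than the norm of f would send the
  unit 1 - f / chi f to 0.\<close>

lemma
  fixes chi :: "('v, 'p::prime_card padic) mps \<Rightarrow> 'p padic"
  assumes r: "\<And>v. v \<in> V \<Longrightarrow> 1 \<le> r v"
    and add: "\<And>f g. f \<in> tate_algebra V r \<Longrightarrow> g \<in> tate_algebra V r \<Longrightarrow> chi (f + g) = chi f + chi g"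
    and mult: "\<And>f g. f \<in> tate_algebra V r \<Longrightarrow> g \<in> tate_algebra V r \<Longrightarrow> chi (f * g) = chi f * chi g"
    and const: "\<And>c. chi (mps_const c) = c"
    and f: "f \<in> tate_algebra V r"
  shows character_norm_le: "norm_le r f C \<Longrightarrow> padic_norm (chi f) \<le> C"
    and character_eq_ev: "chi f = ev (\<lambda>v. chi (mps_var v)) f"
proof -
  have bound: "padic_norm (chi f) \<le> C" if f: "f \<in> tate_algebra V r" and C: "norm_le r f C" for f C
  proof (rule ccontr)
    assume "\<not> padic_norm (chi f) \<le> C"
    then have less: "C < padic_norm (chi f)" by simp
    have "0 \<le> C" using C by (rule norm_le_nonneg)
    then have nz: "chi f \<noteq> 0" using less by auto
    define u where "u = mps_const (1 / chi f) * f"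
    define t where "t = C / padic_norm (chi f)"
    have t: "0 \<le> t" "t < 1" using less \<open>0 \<le> C\<close> nz by (simp_all add: t_def)
    have u: "u \<in> tate_algebra V r" unfolding u_def by (intro tate_mult tate_const f)
    have nu: "norm_le r u t"
      using norm_le_const_mult[OF C, of "1 / chi f"] by (simp add: u_def t_def)
    obtain g where g: "g \<in> tate_algebra V r" "g * (1 - u) = 1"
      by (rule one_minus_inverse[OF r u nu t(2)])
    then have "chi g * chi (1 - u) = chi 1" using g mult[OF g(1) tate_diff[OF tate_1 u]] by simp
    moreover have "chi 1 = 1" using const[of 1] by (simp add: mps_const_simps)
    moreover have "chi u = 1" using nz f mult by (simp add: u_def const)
    moreover have "chi (1 - u) + chi u = chi 1" using add[of "1 - u" u] u by (simp add: tate_diff)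
    ultimately show False by simp
  qed
  show "padic_norm (chi f) \<le> C" if "norm_le r f C" using bound f that .
  let ?x = "\<lambda>v. chi (mps_var v)"
  have x: "in_disc ?x" unfolding in_disc_def by (auto intro: bound norm_le_var)
  have pow: "chi (g ^ n) = chi g ^ n" if "g \<in> tate_algebra V r" for g n
    using that const[of 1] by (induction n) (simp_all add: mps_const_simps mult tate_power)
  have prod: "chi (prod g A) = (\<Prod>i\<in>A. chi (g i))" if "\<And>i. i \<in> A \<Longrightarrow> g i \<in> tate_algebra V r" for g :: "'v \<Rightarrow> _" and A
    using that const[of 1]
    by (induction A rule: infinite_finite_induct) (simp_all add: mps_const_simps mult tate_prod)
  have sum: "chi (sum g A) = (\<Sum>i\<in>A. chi (g i))" if "\<And>i. i \<in> A \<Longrightarrow> g i \<in> tate_algebra V r"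
    for g :: "('v \<Rightarrow>\<^sub>0 nat) \<Rightarrow> _" and A
    using that const[of 0]
    by (induction A rule: infinite_finite_induct) (simp_all add: mps_const_simps add tate_sum)
  have "nsum (\<lambda>a. mps_coeff f a * mpow ?x a) = chi f"
  proof (rule nsumI[OF ev_null[OF f x]])
    fix e :: real assume e: "0 < e"
    \<comment> \<open>Truncation at precision e: on the polynomial \<open>h\<close> the character is
      evaluation by multiplicativity, and on f - h the norm bound just proved makes it at most
      e.\<close>
    define F where "F = {a. padic_norm (mps_coeff f a) * mpow r a > e}"
    have fin: "finite F" using f e by (simp add: tate_iff vanishing_def F_def)
    define h where "h = (\<Sum>a\<in>F. mps_const (mps_coeff f a) * mps_monom a)"
    have F_keys: "Poly_Mapping.keys a \<subseteq> V" if "a \<in> F" for a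
      using that f e by (cases "mps_coeff f a = 0") (auto simp: F_def tate_iff)
    have trm: "mps_const (mps_coeff f a) * mps_monom a \<in> tate_algebra V r"
      "chi (mps_const (mps_coeff f a) * mps_monom a) = mps_coeff f a * mpow ?x a" if "a \<in> F" for a
    proof -
      have m: "(mps_monom a :: ('v, 'p padic) mps) \<in> tate_algebra V r"
        unfolding mpow_mps_var[symmetric] using F_keys[OF that] by (intro tate_mpow tate_var) blast
      then show "mps_const (mps_coeff f a) * mps_monom a \<in> tate_algebra V r" by (intro tate_mult tate_const)
      have "chi (mps_monom a) = mpow ?x a"
        unfolding mpow_mps_var[symmetric] mpow_def using F_keys[OF that]
        by (subst prod) (auto intro!: tate_power tate_var prod.cong pow)
      then show "chi (mps_const (mps_coeff f a) * mps_monom a) = mps_coeff f a * mpow ?x a"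
        using m by (simp add: mult const)
    qed
    have h: "h \<in> tate_algebra V r" unfolding h_def using trm by (intro tate_sum)
    have chih: "chi h = (\<Sum>a\<in>F. mps_coeff f a * mpow ?x a)"
      unfolding h_def using trm by (subst sum) auto
    have "mps_coeff h b = (if b \<in> F then mps_coeff f b else 0)" for b
      unfolding h_def using fin by (simp add: if_distrib[of "\<lambda>t. _ * t"] cong: if_cong)
    then have "norm_le r (f - h) e" using e by (auto simp: norm_le_def F_def)
    then have "padic_norm (chi (f - h)) \<le> e" using f h by (intro bound tate_diff)
    moreover have "chi (f - h) = chi f - chi h"
      using add[OF tate_diff[OF f h] h] by simp
    moreover have "padic_norm (mps_coeff f a * mpow ?x a) \<le> e" if "a \<notin> F" for a
      using term_le[OF f x, of a] that by (simp add: F_def)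
    ultimately show "\<exists>F. finite F \<and> (\<forall>a. a \<notin> F \<longrightarrow> padic_norm (mps_coeff f a * mpow ?x a) \<le> e) \<and>
        padic_norm (chi f - (\<Sum>a\<in>F. mps_coeff f a * mpow ?x a)) \<le> e"
      using fin chih by auto
  qed
  then show "chi f = ev ?x f" by (simp add: ev_def)
qed

text \<open>Half the size of some nonzero term cuts out finitely many candidates, so the Gauss norm
  is attained, and only finitely often.\<close>

lemma max_terms:
  assumes f: "f \<in> tate_algebra V r" and nz: "f \<noteq> 0"
  obtains m where "0 < m" "norm_le r f m"
    "finite {a. padic_norm (mps_coeff f a) * mpow r a = m}" "{a. padic_norm (mps_coeff f a) * mpow r a = m} \<noteq> {}"
proof -
  let ?\<phi> = "\<lambda>a. padic_norm (mps_coeff f a) * mpow r a"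
  obtain a0 where a0: "mps_coeff f a0 \<noteq> 0" using nz by (metis mps_eqI zero_mps.rep_eq)
  then have pos: "0 < ?\<phi> a0" by simp
  define S where "S = {a. ?\<phi> a > ?\<phi> a0 / 2}"
  have fin: "finite S" using f pos half_gt_zero unfolding S_def tate_iff vanishing_def by blast
  have a0S: "a0 \<in> S" unfolding S_def mem_Collect_eq using pos by linarith
  define m where "m = Max (?\<phi> ` S)"
  have ge: "?\<phi> a \<le> m" if "a \<in> S" for a unfolding m_def using fin that by (intro Max_ge) auto
  have le: "?\<phi> a \<le> m" for a
  proof (cases "a \<in> S")
    case False
    then have "?\<phi> a \<le> ?\<phi> a0 / 2" by (simp add: S_def)
    then show ?thesis using ge[OF a0S] pos by linarith
  qed (rule ge)
  have "m \<in> ?\<phi> ` S" unfolding m_def using fin a0S by (intro Max_in) auto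
  moreover have "{a. ?\<phi> a = m} \<subseteq> S" using ge[OF a0S] pos by (auto simp: S_def)
  ultimately show ?thesis
    using that[of m] le pos ge[OF a0S] finite_subset[OF _ fin] by (force simp: norm_le_def)
qed

text \<open>Gauss's lemma: weights that separate the dominant exponents of f and g single out a product of
  dominant terms that is not cancelled.\<close>

lemma gauss_dominant:
  fixes f g :: "('v, 'p::prime_card padic) mps"
  assumes f: "f \<in> tate_algebra V r" "f \<noteq> 0" and g: "g \<in> tate_algebra V r" "g \<noteq> 0"
  obtains a b where
    "norm_le r f (padic_norm (mps_coeff f a) * mpow r a)" "mps_coeff f a \<noteq> 0"
    "norm_le r g (padic_norm (mps_coeff g b) * mpow r b)" "mps_coeff g b \<noteq> 0"
    "padic_norm (mps_coeff (f * g) (a + b)) = padic_norm (mps_coeff f a) * padic_norm (mps_coeff g b)"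
proof -
  let ?\<phi> = "\<lambda>f a. padic_norm (mps_coeff f a) * mpow r a"
  obtain m where m: "0 < m" "norm_le r f m" "finite {a. ?\<phi> f a = m}" "{a. ?\<phi> f a = m} \<noteq> {}"
    by (rule max_terms[OF f])
  obtain n where n: "0 < n" "norm_le r g n" "finite {a. ?\<phi> g a = n}" "{a. ?\<phi> g a = n} \<noteq> {}"
    by (rule max_terms[OF g])
  define M where "M = {a. ?\<phi> f a = m}"
  define N where "N = {a. ?\<phi> g a = n}"
  have keys: "Poly_Mapping.keys a \<subseteq> V" if "a \<in> M \<union> N" for a
  proof -
    have "mps_coeff f a \<noteq> 0 \<or> mps_coeff g a \<noteq> 0" using that m(1) n(1) by (auto simp: M_def N_def)
    then show ?thesis using tate_keys[OF f(1), of a] tate_keys[OF g(1), of a] by blast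
  qed
  obtain u :: "'v \<Rightarrow> nat" where u: "\<forall>a\<in>poly_mapping.lookup ` (M \<union> N). \<forall>b\<in>poly_mapping.lookup ` (M \<union> N).
      (\<Sum>v\<in>V. a v * u v) = (\<Sum>v\<in>V. b v * u v) \<longrightarrow> (\<forall>v\<in>V. a v = b v)"
    using ex_weights_separating[OF finite_V, of "poly_mapping.lookup ` (M \<union> N)"] m(3) n(3)
    unfolding M_def N_def by blast
  define U where "U a = (\<Sum>v\<in>V. poly_mapping.lookup a v * u v)" for a
  have inj: "a = b" if "a \<in> M \<union> N" "b \<in> M \<union> N" "U a = U b" for a b
  proof (rule poly_mapping_eqI)
    fix v
    show "poly_mapping.lookup a v = poly_mapping.lookup b v"
    proof (cases "v \<in> V")
      case True
      have "(\<Sum>v\<in>V. poly_mapping.lookup a v * u v) = (\<Sum>v\<in>V. poly_mapping.lookup b v * u v)"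
        using that(3) by (simp only: U_def)
      then have "\<forall>v\<in>V. poly_mapping.lookup a v = poly_mapping.lookup b v"
        by (rule u[THEN bspec, THEN bspec, THEN mp, OF imageI imageI, OF that(1,2)])
      then show ?thesis using True by blast
    next
      case False
      then show ?thesis using keys[OF that(1)] keys[OF that(2)] in_keys_iff by (metis subsetD)
    qed
  qed
  have U_add: "U (a + b) = U a + U b" for a b
    by (simp add: U_def lookup_add distrib_right sum.distrib)
  have fin: "finite M" "finite N" "M \<noteq> {}" "N \<noteq> {}" using m n by (simp_all add: M_def N_def)
  obtain a where a: "a \<in> M" "\<And>a'. a' \<in> M \<Longrightarrow> U a' \<le> U a"
    using Max_in[of "U ` M"] Max_ge[of "U ` M"] fin by (metis (no_types, lifting) finite_imageI image_iff image_is_empty imageI)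
  obtain b where b: "b \<in> N" "\<And>b'. b' \<in> N \<Longrightarrow> U b' \<le> U b"
    using Max_in[of "U ` N"] Max_ge[of "U ` N"] fin by (metis (no_types, lifting) finite_imageI image_iff image_is_empty imageI)
  have eq: "padic_norm (mps_coeff f c * mps_coeff g d) * mpow r (c + d) = ?\<phi> f c * ?\<phi> g d" for c d
    unfolding padic_norm_mult mpow_add by (simp only: mult.assoc mult.left_commute)
  have less: "padic_norm (mps_coeff f a' * mps_coeff g b') < padic_norm (mps_coeff f a * mps_coeff g b)"
    if ab: "a' + b' = a + b" "(a', b') \<noteq> (a, b)" for a' b'
  proof -
    \<comment> \<open>As \<open>a\<close> and \<open>b\<close> maximise \<open>U\<close> on the
      dominant exponents, a + b has no other decomposition into dominant exponents.\<close>
    have "a' \<notin> M \<or> b' \<notin> N"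
    proof (rule ccontr)
      assume "\<not> (a' \<notin> M \<or> b' \<notin> N)"
      then have in': "a' \<in> M" "b' \<in> N" by auto
      then have "U a' = U a" "U b' = U b"
        using a(2)[OF in'(1)] b(2)[OF in'(2)] U_add[of a' b'] U_add[of a b] ab(1) by auto
      then have "a' = a" "b' = b" using inj a(1) b(1) in' by blast+
      then show False using ab(2) by simp
    qed
    moreover have le: "?\<phi> f a' \<le> m" "?\<phi> g b' \<le> n" using m n by (auto simp: norm_le_def)
    ultimately have "?\<phi> f a' < m \<or> ?\<phi> g b' < n" by (auto simp: M_def N_def)
    then have "?\<phi> f a' * ?\<phi> g b' < m * n"
    proof
      assume *: "?\<phi> f a' < m"
      have "?\<phi> f a' * ?\<phi> g b' \<le> ?\<phi> f a' * n" by (rule mult_left_mono[OF le(2)]) simp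
      also have "\<dots> < m * n" by (rule mult_strict_right_mono[OF * n(1)])
      finally show ?thesis .
    next
      assume *: "?\<phi> g b' < n"
      have "?\<phi> f a' * ?\<phi> g b' \<le> m * ?\<phi> g b'" by (rule mult_right_mono[OF le(1)]) simp
      also have "\<dots> < m * n" by (rule mult_strict_left_mono[OF * m(1)])
      finally show ?thesis .
    qed
    also have "m * n = ?\<phi> f a * ?\<phi> g b" using a b by (simp add: M_def N_def)
    finally have "?\<phi> f a' * ?\<phi> g b' < ?\<phi> f a * ?\<phi> g b" .
    then have "padic_norm (mps_coeff f a' * mps_coeff g b') * mpow r (a + b)
        < padic_norm (mps_coeff f a * mps_coeff g b) * mpow r (a + b)"
      using eq[of a' b'] eq[of a b] by (simp only: ab(1))
    then show ?thesis by (rule mult_less_cancel_right_pos[OF mpow_r_pos, THEN iffD1])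
  qed
  let ?P = "{(b', c'). b' + c' = a + b}" and ?t = "\<lambda>(b', c'). mps_coeff f b' * mps_coeff g c'"
  have nz: "mps_coeff f a \<noteq> 0" "mps_coeff g b \<noteq> 0" using a b m n by (auto simp: M_def N_def)
  have split: "mps_coeff (f * g) (a + b) = ?t (a, b) + sum ?t (?P - {(a, b)})"
    unfolding mps_coeff_mult by (rule sum.remove[OF finite_antidiagonal]) simp
  have rest: "padic_norm (sum ?t (?P - {(a, b)})) < padic_norm (?t (a, b))"
  proof (cases "?P - {(a, b)} = {}")
    case False
    let ?R = "?P - {(a, b)}"
    have finR: "finite ?R" using finite_antidiagonal by blast
    have "padic_norm (sum ?t ?R) \<le> Max ((\<lambda>q. padic_norm (?t q)) ` ?R)"
    proof (rule padic_norm_sum_le)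
      obtain q where "q \<in> ?R" using False by blast
      then have "padic_norm (?t q) \<le> Max ((\<lambda>q. padic_norm (?t q)) ` ?R)"
        using finR by (intro Max_ge) auto
      then show "0 \<le> Max ((\<lambda>q. padic_norm (?t q)) ` ?R)" using padic_norm_nonneg order_trans by blast
    qed (use finR in auto)
    also have "\<dots> < padic_norm (?t (a, b))"
    proof (subst Max_less_iff)
      show "\<forall>t\<in>(\<lambda>q. padic_norm (?t q)) ` ?R. t < padic_norm (?t (a, b))"
      proof (rule ballI, elim imageE)
        fix t q assume q: "q \<in> ?R" "t = padic_norm (?t q)"
        obtain b' c' where "q = (b', c')" by force
        then show "t < padic_norm (?t (a, b))" using less[of b' c'] q by auto
      qed
    qed (use finR False in auto)
    finally show ?thesis .
  qed (use nz in \<open>simp only: sum.empty, simp\<close>)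
  have eq: "padic_norm (mps_coeff (f * g) (a + b)) = padic_norm (?t (a, b))"
  proof (rule antisym)
    show "padic_norm (mps_coeff (f * g) (a + b)) \<le> padic_norm (?t (a, b))"
      unfolding split using rest by (intro padic_norm_add_le) auto
    show "padic_norm (?t (a, b)) \<le> padic_norm (mps_coeff (f * g) (a + b))"
    proof (rule ccontr)
      assume "\<not> padic_norm (?t (a, b)) \<le> padic_norm (mps_coeff (f * g) (a + b))"
      then have "max (padic_norm (mps_coeff (f * g) (a + b))) (padic_norm (sum ?t (?P - {(a, b)})))
          < padic_norm (?t (a, b))" using rest by simp
      moreover have "padic_norm (?t (a, b)) \<le>
          max (padic_norm (mps_coeff (f * g) (a + b))) (padic_norm (sum ?t (?P - {(a, b)})))"
        using padic_norm_add[of "mps_coeff (f * g) (a + b)" "- sum ?t (?P - {(a, b)})"]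
        unfolding split by simp
      ultimately show False using not_le by blast
    qed
  qed
  show ?thesis
    using that[of a b] m n a b nz eq by (simp add: M_def N_def)
qed

end

section \<open>Change of radii outside the variables, and renaming of variables\<close>

lemma tate_algebra_cong:
  assumes "\<And>v. v \<in> V \<Longrightarrow> r v = r' v"
  shows "tate_algebra V r = (tate_algebra V r' :: ('v, 'p::prime_card padic) mps set)"
proof -
  have "(\<lambda>a. padic_norm (mps_coeff f a) * (\<Prod>v\<in>Poly_Mapping.keys a. r v ^ poly_mapping.lookup a v))
      = (\<lambda>a. padic_norm (mps_coeff f a) * (\<Prod>v\<in>Poly_Mapping.keys a. r' v ^ poly_mapping.lookup a v))"
    if f: "\<forall>a. mps_coeff f a \<noteq> 0 \<longrightarrow> Poly_Mapping.keys a \<subseteq> V" for f :: "('v, 'p padic) mps"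
  proof
    fix a
    show "padic_norm (mps_coeff f a) * (\<Prod>v\<in>Poly_Mapping.keys a. r v ^ poly_mapping.lookup a v)
      = padic_norm (mps_coeff f a) * (\<Prod>v\<in>Poly_Mapping.keys a. r' v ^ poly_mapping.lookup a v)"
    proof (cases "mps_coeff f a = 0")
      case False
      then have "Poly_Mapping.keys a \<subseteq> V" using f by blast
      then have "r v = r' v" if "v \<in> Poly_Mapping.keys a" for v using assms that by blast
      then show ?thesis by (simp cong: prod.cong)
    qed simp
  qed
  then show ?thesis unfolding tate_algebra_def by (auto cong: conj_cong)
qed

text \<open>Projections are defined by relabelling exponents; presented as substitutions they fall
  under the results on substitution. \<open>push\<close> inverts the relabelling.\<close>

lemma mps_rename_eq_subst:
  fixes f :: "('v, 'p::prime_card padic) mps"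
  assumes s: "inj s"
  shows "mps_rename s f = mps_subst (\<lambda>v. mps_var (s v)) f"
proof (rule mps_eqI)
  fix a
  define push where "push b = (\<Sum>v\<in>Poly_Mapping.keys b. Poly_Mapping.single (s v) (poly_mapping.lookup b v))"
    for b :: "'v \<Rightarrow>\<^sub>0 nat"
  have push1: "poly_mapping.lookup (push b) (s v) = poly_mapping.lookup b v" for b v
    using s by (auto simp: push_def lookup_sum lookup_single when_def inj_eq in_keys_iff)
  have push2: "poly_mapping.lookup (push b) w = 0" if "w \<notin> range s" for b w
    using that by (auto simp: push_def lookup_sum lookup_single when_def intro!: sum.neutral)
  have "mpow (\<lambda>v. mps_var (s v)) b = (mps_monom (push b) :: (_, 'p padic) mps)" for b
  proof -
    have "(\<Prod>v\<in>S. mps_var (s v) ^ poly_mapping.lookup b v)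
        = (mps_monom (\<Sum>v\<in>S. Poly_Mapping.single (s v) (poly_mapping.lookup b v)) :: (_, 'p padic) mps)"
      if "finite S" for S
      using that by (induction S) (simp_all add: mps_monom_0 mps_monom_add mps_monom_single)
    then show ?thesis unfolding mpow_def push_def by simp
  qed
  then have coeff: "mps_coeff (mps_subst (\<lambda>v. mps_var (s v)) f) a
      = nsum (\<lambda>b. mps_coeff f b * (if a = push b then 1 else 0))"
    by (simp add: mps_subst_def mps_coeff_nsum)
  have inv: "a = push b \<longleftrightarrow> Poly_Mapping.keys a \<subseteq> range s \<and> b = Poly_Mapping.map_key s a" for b
  proof
    assume a: "a = push b"
    have "w \<in> range s" if "w \<in> Poly_Mapping.keys a" for w
      using that push2[of w b] a by (auto simp: in_keys_iff)
    moreover have "b = Poly_Mapping.map_key s a"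
      by (rule poly_mapping_eqI) (simp add: a map_key.rep_eq s push1)
    ultimately show "Poly_Mapping.keys a \<subseteq> range s \<and> b = Poly_Mapping.map_key s a" by blast
  next
    assume *: "Poly_Mapping.keys a \<subseteq> range s \<and> b = Poly_Mapping.map_key s a"
    show "a = push b"
    proof (rule poly_mapping_eqI)
      fix w
      show "poly_mapping.lookup a w = poly_mapping.lookup (push b) w"
      proof (cases "w \<in> range s")
        case True
        then show ?thesis using * by (auto simp: push1 map_key.rep_eq s)
      next
        case False
        then show ?thesis using * by (auto simp: push2 in_keys_iff)
      qed
    qed
  qed
  show "mps_coeff (mps_rename s f) a = mps_coeff (mps_subst (\<lambda>v. mps_var (s v)) f) a"
  proof (cases "Poly_Mapping.keys a \<subseteq> range s")
    case True
    then have "nsum (\<lambda>b. mps_coeff f b * (if a = push b then 1 else 0))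
        = nsum (\<lambda>b. if b = Poly_Mapping.map_key s a then mps_coeff f (Poly_Mapping.map_key s a) else 0)"
      by (intro arg_cong[where f=nsum] ext) (simp add: inv)
    then show ?thesis using True by (simp add: coeff nsum_single mps_rename.rep_eq)
  next
    case False
    then show ?thesis
      using nsum_finite[of "{}" "\<lambda>_. 0 :: 'p padic"] by (simp add: coeff inv mps_rename.rep_eq)
  qed
qed

section \<open>Group objects on polydiscs through their integral points\<close>

text \<open>Integrality is asked in every variable, so that one point can be used on all powers of
  the disc.\<close>

definition integral_pt :: "('v \<Rightarrow> 'p::prime_card padic) \<Rightarrow> bool" where
  "integral_pt x \<longleftrightarrow> (\<forall>v. padic_norm (x v) \<le> 1)"

definition coords :: "nat \<Rightarrow> nat \<Rightarrow> (nat \<times> nat) set" where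
  "coords d k = {..<k} \<times> {..<d}"

lemma finite_coords [simp]: "finite (coords d k)"
  by (simp add: coords_def)

lemma coords_mono: "k \<le> l \<Longrightarrow> coords d k \<subseteq> coords d l"
  by (auto simp: coords_def)

text \<open>For an index set of one element the family below consists of the functions on the powers of a
  rational polydisc, and for the open unit interval it consists of the overconvergent functions on the
  powers of the unit polydisc. The radii shrink to 1 as s tends to 0.\<close>

locale disc_family =
  fixes d :: nat and A :: "nat \<Rightarrow> 'p::prime_card series set" and \<rho> :: "nat \<Rightarrow> real" and I :: "real set"
  assumes \<rho>: "\<And>i. 1 < \<rho> i"
    and I_pos: "\<And>s. s \<in> I \<Longrightarrow> 0 < s" and I_nonempty: "I \<noteq> {}"
    and A_eq: "\<And>k. A k = (\<Union>s\<in>I. tate_algebra (coords d k) (\<lambda>(b, i). \<rho> i powr s))"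
begin

definition rad :: "real \<Rightarrow> nat \<times> nat \<Rightarrow> real" where
  "rad s = (\<lambda>(b, i). \<rho> i powr s)"

sublocale pr: polyradius "coords d k" "rad s" for k s
proof
  show "0 < rad s v" for v using \<rho>[of "snd v"] by (simp add: rad_def split_def)
qed simp

abbreviation T :: "nat \<Rightarrow> real \<Rightarrow> 'p series set" where
  "T k s \<equiv> tate_algebra (coords d k) (rad s)"

lemma A_iff: "f \<in> A k \<longleftrightarrow> (\<exists>s\<in>I. f \<in> T k s)"
  by (simp add: A_eq rad_def)

lemma rad_ge_1: "s \<in> I \<Longrightarrow> 1 \<le> rad s v"
  using \<rho>[of "snd v"] I_pos[of s] ge_one_powr_ge_zero[of "\<rho> (snd v)" s] by (simp add: rad_def split_def)

lemma rad_mono: "s \<le> s' \<Longrightarrow> rad s v \<le> rad s' v"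
  using \<rho>[of "snd v"] by (auto simp: rad_def split_def intro: powr_mono)

lemma mpow_rad_mono: "s \<le> s' \<Longrightarrow> mpow (rad s) a \<le> mpow (rad s') a"
  by (intro mpow_mono conjI rad_mono less_imp_le[OF pr.r_pos])

lemma norm_le_rad_mono: "s \<le> s' \<Longrightarrow> norm_le (rad s') f C \<Longrightarrow> norm_le (rad s) f C"
  unfolding norm_le_def by (rule allI, rule order_trans[OF mult_left_mono[OF mpow_rad_mono]]) auto

lemma T_mono:
  assumes "k \<le> l" "s \<le> s'" "f \<in> T k s'"
  shows "f \<in> T l s"
proof -
  have "vanishing (\<lambda>a. padic_norm (mps_coeff f a) * mpow (rad s) a)"
  proof (rule vanishing_le)
    show "vanishing (\<lambda>a. padic_norm (mps_coeff f a) * mpow (rad s') a)"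
      using assms(3) unfolding pr.tate_iff by blast
  qed (rule mult_left_mono[OF mpow_rad_mono[OF assms(2)] padic_norm_nonneg])
  then show ?thesis
    using assms(3) coords_mono[OF assms(1), of d] unfolding pr.tate_iff by blast
qed

lemma A_mono: "k \<le> l \<Longrightarrow> A k \<subseteq> A l"
  using T_mono unfolding A_iff subset_iff by blast

text \<open>The smaller of two indices is again an index, so two functions always share a disc of
  convergence.\<close>

lemma A_common:
  assumes "f \<in> A k" "g \<in> A l"
  obtains s where "s \<in> I" "f \<in> T k s" "g \<in> T l s"
proof -
  obtain s t where st: "s \<in> I" "f \<in> T k s" "t \<in> I" "g \<in> T l t" using assms by (auto simp: A_iff)
  show ?thesis
  proof (rule that[of "min s t"])
    show "min s t \<in> I" using st by (simp add: min_def)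
    show "f \<in> T k (min s t)" using T_mono[OF order_refl _ st(2)] by simp
    show "g \<in> T l (min s t)" using T_mono[OF order_refl _ st(4)] by simp
  qed
qed

lemma T_subset_A: "s \<in> I \<Longrightarrow> f \<in> T k s \<Longrightarrow> f \<in> A k"
  by (auto simp: A_iff)

lemma A_const [simp]: "mps_const c \<in> A k"
  using I_nonempty by (auto simp: A_iff)

lemma A_var [simp]: "v \<in> coords d k \<Longrightarrow> mps_var v \<in> A k"
  using I_nonempty by (auto simp: A_iff)

lemma A_add: "f \<in> A k \<Longrightarrow> g \<in> A k \<Longrightarrow> f + g \<in> A k"
  by (erule (1) A_common) (rule T_subset_A, assumption, rule pr.tate_add)

lemma A_mult: "f \<in> A k \<Longrightarrow> g \<in> A k \<Longrightarrow> f * g \<in> A k"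
  by (erule (1) A_common) (rule T_subset_A, assumption, rule pr.tate_mult)

lemma integral_in_disc: "integral_pt x \<Longrightarrow> s \<in> I \<Longrightarrow> pr.in_disc k s x"
  unfolding integral_pt_def pr.in_disc_def by (intro ballI order_trans[OF _ rad_ge_1]) auto

lemma
  assumes f: "f \<in> A k" and g: "g \<in> A k" and x: "integral_pt x"
  shows evA_add: "ev x (f + g) = ev x f + ev x g"
    and evA_mult: "ev x (f * g) = ev x f * ev x g"
proof -
  obtain s where s: "s \<in> I" "f \<in> T k s" "g \<in> T k s" by (rule A_common[OF f g])
  show "ev x (f + g) = ev x f + ev x g" by (rule pr.ev_add[OF s(2,3) integral_in_disc[OF x s(1)]])
  show "ev x (f * g) = ev x f * ev x g" by (rule pr.ev_mult[OF s(2,3) integral_in_disc[OF x s(1)]])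
qed

lemma ev_const [simp]: "ev x (mps_const c) = c" by (rule pr.ev_const)

lemma evA_cong:
  assumes "f \<in> A k" "\<And>v. v \<in> coords d k \<Longrightarrow> x v = y v"
  shows "ev x f = ev y f"
proof -
  obtain s where "f \<in> T k s" using assms(1) unfolding A_iff by blast
  then show ?thesis using assms(2) by (rule pr.ev_cong)
qed

lemma A_separated:
  assumes "f \<in> A k" "g \<in> A k" "\<And>x. integral_pt x \<Longrightarrow> ev x f = ev x g"
  shows "f = g"
proof -
  obtain s where s: "s \<in> I" "f \<in> T k s" "g \<in> T k s" by (rule A_common[OF assms(1,2)])
  have "f - g = 0"
  proof (rule pr.ev_separates)
    show "f - g \<in> T k s" using s by (intro pr.tate_diff)
    show "1 \<le> rad s v" for v using rad_ge_1 s(1) .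
    fix x :: "nat \<times> nat \<Rightarrow> 'p padic" assume "\<And>v. padic_norm (x v) \<le> 1"
    then have "integral_pt x" by (simp add: integral_pt_def)
    then show "ev x (f - g) = 0"
      using assms(3) pr.ev_diff[OF s(2,3) integral_in_disc[OF _ s(1)]] by simp
  qed
  then show ?thesis by simp
qed

lemma alg_homD:
  assumes "h \<in> alg_homs (A k) (A l)"
  shows "f \<in> A k \<Longrightarrow> h f \<in> A l" "h (mps_const c) = mps_const c"
    "f \<in> A k \<Longrightarrow> g \<in> A k \<Longrightarrow> h (f + g) = h f + h g"
    "f \<in> A k \<Longrightarrow> g \<in> A k \<Longrightarrow> h (f * g) = h f * h g"
    "f \<notin> A k \<Longrightarrow> h f = undefined"
  using assms unfolding alg_homs_def by (auto simp: PiE_iff extensional_def)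

text \<open>A homomorphism followed by evaluation at an integral point is a character of
  \<open>T k s\<close>, to which automatic continuity applies.\<close>

lemma
  assumes h: "h \<in> alg_homs (A k) (A l)" and x: "integral_pt x" and s: "s \<in> I"
  shows ev_alg_hom_T: "f \<in> T k s \<Longrightarrow> ev x (h f) = ev (\<lambda>v. ev x (h (mps_var v))) f"
    and alg_hom_point_norm: "v \<in> coords d k \<Longrightarrow> padic_norm (ev x (h (mps_var v))) \<le> rad s v"
proof -
  let ?chi = "\<lambda>f. ev x (h f)"
  have r: "1 \<le> rad s v" for v by (rule rad_ge_1[OF s])
  have mem: "h f \<in> A l" if "f \<in> T k s" for f
    by (rule alg_homD(1)[OF h T_subset_A[OF s that]])
  have add: "?chi (f + g) = ?chi f + ?chi g" if "f \<in> T k s" "g \<in> T k s" for f g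
    using alg_homD(3)[OF h T_subset_A[OF s that(1)] T_subset_A[OF s that(2)]]
      evA_add[OF mem[OF that(1)] mem[OF that(2)] x] by simp
  have mult: "?chi (f * g) = ?chi f * ?chi g" if "f \<in> T k s" "g \<in> T k s" for f g
    using alg_homD(4)[OF h T_subset_A[OF s that(1)] T_subset_A[OF s that(2)]]
      evA_mult[OF mem[OF that(1)] mem[OF that(2)] x] by simp
  have const: "?chi (mps_const c) = c" for c
    using alg_homD(2)[OF h] by simp
  show "ev x (h f) = ev (\<lambda>v. ev x (h (mps_var v))) f" if "f \<in> T k s"
    using pr.character_eq_ev[where chi="?chi", OF r add mult const that] .
  show "padic_norm (ev x (h (mps_var v))) \<le> rad s v" if "v \<in> coords d k"
    using pr.character_norm_le[where chi="?chi", OF r add mult const pr.tate_var[OF that] pr.norm_le_var] .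
qed

lemma ev_alg_hom:
  "h \<in> alg_homs (A k) (A l) \<Longrightarrow> f \<in> A k \<Longrightarrow> integral_pt x \<Longrightarrow> ev x (h f) = ev (\<lambda>v. ev x (h (mps_var v))) f"
  unfolding A_iff by (elim bexE) (rule ev_alg_hom_T)

text \<open>The coordinates generate only the polynomials; the passage to all series is automatic
  continuity, in the form of \<open>ev_alg_hom\<close>.\<close>

lemma alg_hom_eqI:
  assumes h: "h \<in> alg_homs (A k) (A l)" and h': "h' \<in> alg_homs (A k) (A l)"
    and eq: "\<And>v. v \<in> coords d k \<Longrightarrow> h (mps_var v) = h' (mps_var v)"
  shows "h = h'"
proof
  fix f
  show "h f = h' f"
  proof (cases "f \<in> A k")
    case True
    show ?thesis
    proof (rule A_separated)
      fix x :: "nat \<times> nat \<Rightarrow> 'p padic" assume x: "integral_pt x"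
      show "ev x (h f) = ev x (h' f)"
        unfolding ev_alg_hom[OF h True x] ev_alg_hom[OF h' True x] using eq by (intro evA_cong[OF True]) simp
    qed (use True alg_homD(1) h h' in auto)
  qed (simp add: alg_homD(5)[OF h] alg_homD(5)[OF h'])
qed

section \<open>Morphisms realised by maps of integral points\<close>

definition contractive :: "nat \<Rightarrow> nat \<Rightarrow> ('p series \<Rightarrow> 'p series) \<Rightarrow> bool" where
  "contractive k l h \<longleftrightarrow> (\<forall>s\<in>I. \<exists>t\<in>I. \<forall>f\<in>T k s. h f \<in> T l t \<and>
     (\<forall>C. norm_le (rad s) f C \<longrightarrow> norm_le (rad t) (h f) C))"

text \<open>Contractivity is what allows to construct the pairing of two morphisms by substitution.\<close>

definition realizes ::
  "nat \<Rightarrow> nat \<Rightarrow> ('p series \<Rightarrow> 'p series) \<Rightarrow> ((nat \<times> nat \<Rightarrow> 'p padic) \<Rightarrow> nat \<times> nat \<Rightarrow> 'p padic) \<Rightarrow> bool" where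
  "realizes k l h P \<longleftrightarrow> h \<in> alg_homs (A k) (A l) \<and> contractive k l h \<and>
     (\<forall>x. integral_pt x \<longrightarrow> integral_pt (P x) \<and> (\<forall>f\<in>A k. ev x (h f) = ev (P x) f))"

lemma realizesD:
  assumes "realizes k l h P"
  shows "h \<in> alg_homs (A k) (A l)" "contractive k l h" "integral_pt x \<Longrightarrow> integral_pt (P x)"
    "integral_pt x \<Longrightarrow> f \<in> A k \<Longrightarrow> ev x (h f) = ev (P x) f"
    "f \<in> A k \<Longrightarrow> h f \<in> A l"
  using assms alg_homD(1) by (auto simp: realizes_def)

lemma realizes_unique:
  assumes h: "realizes k l h P" and h': "realizes k l h' Q"
    and eq: "\<And>x v. integral_pt x \<Longrightarrow> v \<in> coords d k \<Longrightarrow> P x v = Q x v"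
  shows "h = h'"
proof (rule alg_hom_eqI)
  fix v assume v: "v \<in> coords d k"
  show "h (mps_var v) = h' (mps_var v)"
  proof (rule A_separated)
    show "h (mps_var v) \<in> A l" by (rule realizesD(5)[OF h A_var[OF v]])
    show "h' (mps_var v) \<in> A l" by (rule realizesD(5)[OF h' A_var[OF v]])
    fix x :: "nat \<times> nat \<Rightarrow> 'p padic" assume x: "integral_pt x"
    show "ev x (h (mps_var v)) = ev x (h' (mps_var v))"
      unfolding realizesD(4)[OF h x A_var[OF v]] realizesD(4)[OF h' x A_var[OF v]] using eq[OF x v] by simp
  qed
qed (use h h' realizesD in auto)

lemma realizes_compose:
  assumes h: "realizes k l h P" and h': "realizes l m h' Q"
  shows "realizes k m (compose (A k) h' h) (\<lambda>x. P (Q x))"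
  unfolding realizes_def
proof (intro conjI allI impI ballI)
  note D = realizesD[OF h] realizesD[OF h']
  show "compose (A k) h' h \<in> alg_homs (A k) (A m)"
    unfolding alg_homs_def
    using D(5,10) alg_homD[OF D(1)] alg_homD[OF D(6)] A_add[of _ k] A_mult[of _ k]
    by (auto simp: compose_def)
  show "contractive k m (compose (A k) h' h)"
    unfolding contractive_def
  proof
    fix s assume s: "s \<in> I"
    obtain t where t: "t \<in> I" "\<And>f. f \<in> T k s \<Longrightarrow> h f \<in> T l t"
      "\<And>f C. f \<in> T k s \<Longrightarrow> norm_le (rad s) f C \<Longrightarrow> norm_le (rad t) (h f) C"
      using D(2) s unfolding contractive_def by blast
    obtain u where u: "u \<in> I" "\<And>f. f \<in> T l t \<Longrightarrow> h' f \<in> T m u"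
      "\<And>f C. f \<in> T l t \<Longrightarrow> norm_le (rad t) f C \<Longrightarrow> norm_le (rad u) (h' f) C"
      using D(7) t(1) unfolding contractive_def by blast
    show "\<exists>t\<in>I. \<forall>f\<in>T k s. compose (A k) h' h f \<in> T m t \<and>
        (\<forall>C. norm_le (rad s) f C \<longrightarrow> norm_le (rad t) (compose (A k) h' h f) C)"
      using t u T_subset_A[OF s] by (intro bexI[OF _ u(1)]) (simp add: compose_def)
  qed
  fix x :: "nat \<times> nat \<Rightarrow> 'p padic" assume x: "integral_pt x"
  then show "integral_pt (P (Q x))" using D by blast
  fix f assume "f \<in> A k"
  then show "ev x (compose (A k) h' h f) = ev (P (Q x)) f"
    using x D by (simp add: compose_def)
qed

text \<open>Geometrically: for every s the tuple maps the polydisc of some index t into the polydisc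
  of index s.\<close>

definition contracting_tuple :: "nat \<Rightarrow> nat \<Rightarrow> (nat \<times> nat \<Rightarrow> 'p series) \<Rightarrow> bool" where
  "contracting_tuple k l G \<longleftrightarrow> (\<forall>s\<in>I. \<exists>t\<in>I. \<forall>v\<in>coords d k. G v \<in> T l t \<and> norm_le (rad t) (G v) (rad s v))"

lemma subst_contractive:
  assumes "contracting_tuple k l G"
  shows "contractive k l (restrict (mps_subst G) (A k))" "f \<in> A k \<Longrightarrow> mps_subst G f \<in> A l"
    "f \<in> A k \<Longrightarrow> integral_pt x \<Longrightarrow> ev x (mps_subst G f) = ev (\<lambda>v. ev x (G v)) f"
proof -
  have main: "\<exists>t\<in>I. \<forall>f\<in>T k s. mps_subst G f \<in> T l t \<and>
     (\<forall>C. norm_le (rad s) f C \<longrightarrow> norm_le (rad t) (mps_subst G f) C) \<and>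
     (\<forall>x. integral_pt x \<longrightarrow> ev x (mps_subst G f) = ev (\<lambda>v. ev x (G v)) f)" if s: "s \<in> I" for s
  proof -
    obtain t where t: "t \<in> I" "\<And>v. v \<in> coords d k \<Longrightarrow> G v \<in> T l t"
      "\<And>v. v \<in> coords d k \<Longrightarrow> norm_le (rad t) (G v) (rad s v)"
      using assms s unfolding contracting_tuple_def by blast
    interpret pp: polyradius_pair "coords d k" "rad s" "coords d l" "rad t" ..
    show ?thesis
      using pp.subst_tate[of G] pp.subst_norm_le[of G] pp.ev_subst[of G] t integral_in_disc[OF _ t(1)]
      by (intro bexI[OF _ t(1)]) blast
  qed
  show "contractive k l (restrict (mps_subst G) (A k))"
    unfolding contractive_def
  proof
    fix s assume s: "s \<in> I"
    then show "\<exists>t\<in>I. \<forall>f\<in>T k s. restrict (mps_subst G) (A k) f \<in> T l t \<and>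
       (\<forall>C. norm_le (rad s) f C \<longrightarrow> norm_le (rad t) (restrict (mps_subst G) (A k) f) C)"
      using main[OF s] T_subset_A[OF s] by (auto simp: restrict_def)
  qed
  show "mps_subst G f \<in> A l" if "f \<in> A k"
    using that main unfolding A_iff by blast
  show "ev x (mps_subst G f) = ev (\<lambda>v. ev x (G v)) f" if "f \<in> A k" "integral_pt x"
    using that main unfolding A_iff by blast
qed

lemma realizes_subst:
  assumes G: "contracting_tuple k l G"
    and P: "\<And>x. integral_pt x \<Longrightarrow> integral_pt (P x)"
      "\<And>x v. integral_pt x \<Longrightarrow> v \<in> coords d k \<Longrightarrow> ev x (G v) = P x v"
  shows "realizes k l (restrict (mps_subst G) (A k)) P"
proof -
  let ?h = "restrict (mps_subst G) (A k)"
  have ev: "ev x (mps_subst G f) = ev (P x) f" if "f \<in> A k" "integral_pt x" for f x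
    by (rule trans[OF subst_contractive(3)[OF G that] evA_cong[OF that(1) P(2)[OF that(2)]]])
  have "?h \<in> alg_homs (A k) (A l)"
    unfolding alg_homs_def
  proof (intro CollectI conjI ballI allI)
    show "?h \<in> A k \<rightarrow>\<^sub>E A l" using subst_contractive(2)[OF G] by auto
    fix f g assume f: "f \<in> A k" and g: "g \<in> A k"
    note mem = subst_contractive(2)[OF G]
    have "mps_subst G (f + g) = mps_subst G f + mps_subst G g"
    proof (rule A_separated[OF mem[OF A_add[OF f g]] A_add[OF mem[OF f] mem[OF g]]])
      fix x :: "nat \<times> nat \<Rightarrow> 'p padic" assume x: "integral_pt x"
      show "ev x (mps_subst G (f + g)) = ev x (mps_subst G f + mps_subst G g)"
        unfolding evA_add[OF mem[OF f] mem[OF g] x] ev[OF f x] ev[OF g x] ev[OF A_add[OF f g] x]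
        by (rule evA_add[OF f g P(1)[OF x]])
    qed
    then show "?h (f + g) = ?h f + ?h g" using f g A_add[OF f g] by simp
    have "mps_subst G (f * g) = mps_subst G f * mps_subst G g"
    proof (rule A_separated[OF mem[OF A_mult[OF f g]] A_mult[OF mem[OF f] mem[OF g]]])
      fix x :: "nat \<times> nat \<Rightarrow> 'p padic" assume x: "integral_pt x"
      show "ev x (mps_subst G (f * g)) = ev x (mps_subst G f * mps_subst G g)"
        unfolding evA_mult[OF mem[OF f] mem[OF g] x] ev[OF f x] ev[OF g x] ev[OF A_mult[OF f g] x]
        by (rule evA_mult[OF f g P(1)[OF x]])
    qed
    then show "?h (f * g) = ?h f * ?h g" using f g A_mult[OF f g] by simp
  next
    fix c
    show "?h (mps_const c) = mps_const c"
    proof -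
      have "mps_subst G (mps_const c) = mps_const c"
        by (rule A_separated[OF subst_contractive(2)[OF G A_const] A_const]) (simp add: ev[OF A_const])
      then show ?thesis by simp
    qed
  qed
  then show ?thesis
    unfolding realizes_def using subst_contractive(1)[OF G] P ev by auto
qed

lemma realizes_var:
  assumes "realizes k l h P" "v \<in> coords d k" "integral_pt x"
  shows "ev x (h (mps_var v)) = P x v"
  using realizesD(4)[OF assms(1,3), of "mps_var v"] assms(2) by simp

lemma contracting_tuple_vars:
  assumes "\<And>v. v \<in> coords d k \<Longrightarrow> s v \<in> coords d l \<and> snd (s v) = snd v"
  shows "contracting_tuple k l (\<lambda>v. mps_var (s v))"
  unfolding contracting_tuple_def
proof (intro ballI bexI conjI)
  fix t v assume "t \<in> I" "v \<in> coords d k"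
  then show "mps_var (s v) \<in> T l t" using assms by simp
  have "rad t (s v) = rad t v" using assms[OF \<open>v \<in> coords d k\<close>] by (simp add: rad_def split_def)
  then show "norm_le (rad t) (mps_var (s v)) (rad t v)" using pr.norm_le_var by metis
qed

lemma realizes_proj:
  assumes "j < k"
  shows "realizes 1 k (proj_pullback A j) (\<lambda>x (b, i). x (b + j, i))"
proof -
  have eq: "proj_pullback A j = restrict (mps_subst (\<lambda>v. mps_var (case v of (b, i) \<Rightarrow> (b + j, i)))) (A 1)"
  proof -
    have "inj (\<lambda>(b, i). (b + j, i) :: nat \<times> nat)" by (auto simp: inj_on_def)
    from mps_rename_eq_subst[OF this, where 'p='p] show ?thesis
      unfolding proj_pullback_def by (intro restrict_ext) simp
  qed
  show ?thesis
    unfolding eq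
    by (rule realizes_subst[OF contracting_tuple_vars])
      (use assms in \<open>auto simp: integral_pt_def coords_def split_def\<close>)
qed

lemma realizes_id: "realizes 1 1 (restrict id (A 1)) (\<lambda>x. x)"
proof -
  have "restrict id (A 1) \<in> alg_homs (A 1) (A 1)"
    by (auto simp: alg_homs_def A_add A_mult)
  moreover have "contractive 1 1 (restrict id (A 1))"
    unfolding contractive_def
  proof
    fix s assume s: "s \<in> I"
    then show "\<exists>t\<in>I. \<forall>f\<in>T 1 s. restrict id (A 1) f \<in> T 1 t \<and>
       (\<forall>C. norm_le (rad s) f C \<longrightarrow> norm_le (rad t) (restrict id (A 1) f) C)"
      using T_subset_A[OF s] by (intro bexI[OF _ s]) auto
  qed
  ultimately show ?thesis by (auto simp: realizes_def)
qed

lemma realizes_mono: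
  assumes "realizes k l h P" "l \<le> m"
  shows "realizes k m h P"
proof -
  note D = realizesD[OF assms(1)]
  have "h \<in> alg_homs (A k) (A m)"
    using D(1) A_mono[OF assms(2)] by (auto simp: alg_homs_def PiE_iff)
  moreover have "contractive k m h"
    using D(2) T_mono[OF assms(2) order_refl] unfolding contractive_def by blast
  ultimately show ?thesis using D by (auto simp: realizes_def)
qed

section \<open>Pairing of morphisms, and the group axioms at points\<close>

definition pair_point :: "(nat \<times> nat \<Rightarrow> 'p padic) \<Rightarrow> (nat \<times> nat \<Rightarrow> 'p padic) \<Rightarrow> nat \<times> nat \<Rightarrow> 'p padic" where
  "pair_point x y = (\<lambda>(b, i). if b = 0 then x (0, i) else y (0, i))"

lemma pair_point_simps [simp]: "pair_point x y (0, i) = x (0, i)" "pair_point x y (Suc 0, i) = y (0, i)"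
  by (simp_all add: pair_point_def)

lemma integral_pair_point: "integral_pt x \<Longrightarrow> integral_pt y \<Longrightarrow> integral_pt (pair_point x y)"
  by (auto simp: integral_pt_def pair_point_def)

lemma contractive_var:
  assumes "contractive 1 l h" "s \<in> I"
  obtains t where "t \<in> I" "\<And>u v. u \<le> t \<Longrightarrow> v \<in> coords d 1 \<Longrightarrow> h (mps_var v) \<in> T l u \<and> norm_le (rad u) (h (mps_var v)) (rad s v)"
proof -
  obtain t where "t \<in> I" "\<And>f. f \<in> T 1 s \<Longrightarrow> h f \<in> T l t"
      "\<And>f C. f \<in> T 1 s \<Longrightarrow> norm_le (rad s) f C \<Longrightarrow> norm_le (rad t) (h f) C"
    using assms unfolding contractive_def by blast
  then show ?thesis
  proof (intro that[of t] conjI)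
    fix u v assume t: "t \<in> I" "\<And>f. f \<in> T 1 s \<Longrightarrow> h f \<in> T l t"
      "\<And>f C. f \<in> T 1 s \<Longrightarrow> norm_le (rad s) f C \<Longrightarrow> norm_le (rad t) (h f) C"
      and u: "u \<le> t" and v: "v \<in> coords d 1"
    show "h (mps_var v) \<in> T l u" by (rule T_mono[OF order_refl u t(2)[OF pr.tate_var[OF v]]])
    show "norm_le (rad u) (h (mps_var v)) (rad s v)"
      by (rule norm_le_rad_mono[OF u t(3)[OF pr.tate_var[OF v] pr.norm_le_var]])
  qed
qed

text \<open>This resolves the definite description in \<open>pair_pullback\<close>: substituting the
  images of the coordinates gives a homomorphism with the two prescribed components, and any other
  agrees with it on the coordinates.\<close>

lemma realizes_pair:
  assumes \<phi>: "realizes 1 l \<phi> P" and \<psi>: "realizes 1 l \<psi> Q"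
  shows "realizes 2 l (pair_pullback A (A l) \<phi> \<psi>) (\<lambda>x. pair_point (P x) (Q x))"
proof -
  let ?G = "\<lambda>(b, i). if b = (0 :: nat) then \<phi> (mps_var (0, i)) else \<psi> (mps_var (0, i))"
  have tuple: "contracting_tuple 2 l ?G"
    unfolding contracting_tuple_def
  proof
    fix s assume s: "s \<in> I"
    obtain t where t: "t \<in> I" "\<And>u v. u \<le> t \<Longrightarrow> v \<in> coords d 1 \<Longrightarrow> \<phi> (mps_var v) \<in> T l u \<and> norm_le (rad u) (\<phi> (mps_var v)) (rad s v)"
      by (rule contractive_var[OF realizesD(2)[OF \<phi>] s]) blast
    obtain t' where t': "t' \<in> I" "\<And>u v. u \<le> t' \<Longrightarrow> v \<in> coords d 1 \<Longrightarrow> \<psi> (mps_var v) \<in> T l u \<and> norm_le (rad u) (\<psi> (mps_var v)) (rad s v)"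
      by (rule contractive_var[OF realizesD(2)[OF \<psi>] s]) blast
    have "min t t' \<in> I" using t(1) t'(1) by (simp add: min_def)
    then show "\<exists>t\<in>I. \<forall>v\<in>coords d 2. ?G v \<in> T l t \<and> norm_le (rad t) (?G v) (rad s v)"
    proof (rule bexI[rotated], intro ballI)
      fix v assume "v \<in> coords d 2"
      then obtain b i where v: "v = (b, i)" "(0, i) \<in> coords d 1" by (auto simp: coords_def)
      have "rad s v = rad s (0, i)" by (simp add: rad_def v)
      then show "?G v \<in> T l (min t t') \<and> norm_le (rad (min t t')) (?G v) (rad s v)"
        using t(2)[OF min.cobounded1 v(2), of t'] t'(2)[OF min.cobounded2 v(2), of t] v(1)
        by (cases "b = 0") simp_all
    qed
  qed
  have R: "realizes 2 l (restrict (mps_subst ?G) (A 2)) (\<lambda>x. pair_point (P x) (Q x))"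
  proof (rule realizes_subst[OF tuple])
    fix x :: "nat \<times> nat \<Rightarrow> 'p padic" assume x: "integral_pt x"
    then show "integral_pt (pair_point (P x) (Q x))"
      using realizesD(3)[OF \<phi>] realizesD(3)[OF \<psi>] by (intro integral_pair_point)
    fix v assume "v \<in> coords d 2"
    then show "ev x (?G v) = pair_point (P x) (Q x) v"
      using realizes_var[OF \<phi> _ x] realizes_var[OF \<psi> _ x]
      by (auto simp: coords_def pair_point_def)
  qed
  let ?h = "restrict (mps_subst ?G) (A 2)"
  have "pair_pullback A (A l) \<phi> \<psi> = ?h"
    unfolding pair_pullback_def
  proof (rule the_equality)
    have "compose (A 1) ?h (proj_pullback A 0) = \<phi>" "compose (A 1) ?h (proj_pullback A 1) = \<psi>"
      by (rule realizes_unique[OF realizes_compose[OF realizes_proj R] \<phi>]; force simp: coords_def)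
        (rule realizes_unique[OF realizes_compose[OF realizes_proj R] \<psi>]; force simp: coords_def)
    then show "?h \<in> alg_homs (A 2) (A l) \<and> compose (A 1) ?h (proj_pullback A 0) = \<phi> \<and>
        compose (A 1) ?h (proj_pullback A 1) = \<psi>"
      using realizesD(1)[OF R] by blast
  next
    fix h assume h: "h \<in> alg_homs (A 2) (A l) \<and> compose (A 1) h (proj_pullback A 0) = \<phi> \<and>
        compose (A 1) h (proj_pullback A 1) = \<psi>"
    have proj: "proj_pullback A j (mps_var (0, i)) = mps_var (j, i)" if "i < d" "j < 2" for i j
    proof (rule A_separated[of _ 2])
      show "proj_pullback A j (mps_var (0, i)) \<in> A 2"
        using realizesD(5)[OF realizes_proj[of j 2]] that by (simp add: coords_def)
      fix x :: "nat \<times> nat \<Rightarrow> 'p padic" assume "integral_pt x"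
      then show "ev x (proj_pullback A j (mps_var (0, i))) = ev x (mps_var (j, i))"
        using realizes_var[OF realizes_proj[of j 2], of "(0, i)" x] that by (simp add: coords_def)
    qed (use that in \<open>simp add: coords_def\<close>)
    show "h = ?h"
    proof (rule alg_hom_eqI)
      show "h \<in> alg_homs (A 2) (A l)" using h by blast
      show "?h \<in> alg_homs (A 2) (A l)" by (rule realizesD(1)[OF R])
      fix v assume v: "v \<in> coords d 2"
      obtain b i where bi: "v = (b, i)" "b < 2" "i < d" using v by (auto simp: coords_def)
      have "\<phi> (mps_var (0, i)) = h (mps_var (0, i))" "\<psi> (mps_var (0, i)) = h (mps_var (1, i))"
        using h proj[of i 0] proj[of i 1] bi by (auto simp: compose_def coords_def)
      then have hv: "h (mps_var v) = ?G v" using bi by (cases "b = 0") (auto simp: less_Suc_eq numeral_2_eq_2)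
      show "h (mps_var v) = ?h (mps_var v)"
      proof (rule A_separated[of _ l])
        show "h (mps_var v) \<in> A l" using h v alg_homD(1) by auto
        show "?h (mps_var v) \<in> A l" using realizesD(5)[OF R] v by auto
        fix x :: "nat \<times> nat \<Rightarrow> 'p padic" assume "integral_pt x"
        then show "ev x (h (mps_var v)) = ev x (?h (mps_var v))"
          unfolding hv using realizes_var[OF R v] realizes_var[OF \<phi>] realizes_var[OF \<psi>] bi
          by (auto simp: coords_def pair_point_def)
      qed
    qed
  qed
  then show ?thesis using R by simp
qed

lemma realizes_point_mult:
  assumes "realizes 1 2 (comult S) M" "realizes 1 l \<phi> P" "realizes 1 l \<psi> Q"
  shows "realizes 1 l (point_mult A S (A l) \<phi> \<psi>) (\<lambda>x. M (pair_point (P x) (Q x)))"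
  unfolding point_mult_def by (rule realizes_compose[OF assms(1) realizes_pair[OF assms(2,3)]])

lemma group_objectI:
  assumes M: "realizes 1 2 (comult S) M" and E: "realizes 1 0 (counit S) E" and J: "realizes 1 1 (antipode S) J"
    and assoc: "\<And>x y z v. integral_pt x \<Longrightarrow> integral_pt y \<Longrightarrow> integral_pt z \<Longrightarrow> v \<in> coords d 1 \<Longrightarrow>
      M (pair_point (M (pair_point x y)) z) v = M (pair_point x (M (pair_point y z))) v"
    and unit: "\<And>x v. integral_pt x \<Longrightarrow> v \<in> coords d 1 \<Longrightarrow> M (pair_point (E x) x) v = x v"
      "\<And>x v. integral_pt x \<Longrightarrow> v \<in> coords d 1 \<Longrightarrow> M (pair_point x (E x)) v = x v"
    and inv: "\<And>x v. integral_pt x \<Longrightarrow> v \<in> coords d 1 \<Longrightarrow> M (pair_point (J x) x) v = E x v"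
      "\<And>x v. integral_pt x \<Longrightarrow> v \<in> coords d 1 \<Longrightarrow> M (pair_point x (J x)) v = E x v"
  shows "group_object A S"
proof -
  \<comment> \<open>Constants are functions on X, which turns the counit into the constant morphism
    from X to X.\<close>
  note E1 = realizes_mono[OF E zero_le_one]
  let ?p = "\<lambda>j. \<lambda>x (b, i). x (b + j, i) :: 'p padic"
  have int1: "integral_pt (\<lambda>(b, i). x (Suc b, i) :: 'p padic)"
    and int2: "integral_pt (\<lambda>(b, i). x (Suc (Suc b), i) :: 'p padic)" if "integral_pt x" for x
    using that by (auto simp: integral_pt_def)
  have p: "realizes 1 3 (proj_pullback A 0) (?p 0)" "realizes 1 3 (proj_pullback A 1) (?p 1)"
    "realizes 1 3 (proj_pullback A 2) (?p 2)"
    by (rule realizes_proj, simp)+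
  show ?thesis
    unfolding group_object_def
  proof (intro conjI)
    show "comult S \<in> alg_homs (A 1) (A 2)" "counit S \<in> alg_homs (A 1) (A 0)"
      "antipode S \<in> alg_homs (A 1) (A 1)"
      using M E J by (auto simp: realizes_def)
    show "point_mult A S (A 3) (point_mult A S (A 3) (proj_pullback A 0) (proj_pullback A 1)) (proj_pullback A 2)
       = point_mult A S (A 3) (proj_pullback A 0) (point_mult A S (A 3) (proj_pullback A 1) (proj_pullback A 2))"
      by (rule realizes_unique[OF realizes_point_mult[OF M realizes_point_mult[OF M p(1,2)] p(3)]
            realizes_point_mult[OF M p(1) realizes_point_mult[OF M p(2,3)]]])
        (rule assoc; use int1 int2 in simp)
    show "point_mult A S (A 1) (counit S) (restrict id (A 1)) = restrict id (A 1)"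
      by (rule realizes_unique[OF realizes_point_mult[OF M E1 realizes_id] realizes_id]) (rule unit)
    show "point_mult A S (A 1) (restrict id (A 1)) (counit S) = restrict id (A 1)"
      by (rule realizes_unique[OF realizes_point_mult[OF M realizes_id E1] realizes_id]) (rule unit)
    show "point_mult A S (A 1) (antipode S) (restrict id (A 1)) = counit S"
      by (rule realizes_unique[OF realizes_point_mult[OF M J realizes_id] E1]) (rule inv)
    show "point_mult A S (A 1) (restrict id (A 1)) (antipode S) = counit S"
      by (rule realizes_unique[OF realizes_point_mult[OF M realizes_id J] E1]) (rule inv)
  qed
qed

end

section \<open>The norm of a p-valued group\<close>

text \<open>The values of \<omega> are turned into the absolute values p^(-\<omega>), which avoids the infinite value.\<close>

definition pmag :: "real \<Rightarrow> ereal \<Rightarrow> real" where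
  "pmag q e = (if e = \<infinity> then 0 else q powr - real_of_ereal e)"

lemma pmag_le_iff:
  assumes "1 < q" "e \<noteq> -\<infinity>" "e' \<noteq> -\<infinity>"
  shows "pmag q e \<le> pmag q e' \<longleftrightarrow> e' \<le> e"
  using assms by (cases e; cases e') (auto simp: pmag_def not_le)

lemma pmag_add:
  assumes "e \<noteq> -\<infinity>" "e' \<noteq> -\<infinity>"
  shows "pmag q (e + e') = pmag q e * pmag q e'"
  using assms by (cases e; cases e') (auto simp: pmag_def simp flip: powr_add)

lemma pmag_nonneg [simp]: "0 \<le> pmag q e"
  by (simp add: pmag_def)

lemma pmag_ereal [simp]: "pmag q (ereal x) = q powr - x"
  by (simp add: pmag_def)

lemma pmag_infty [simp]: "pmag q \<infinity> = 0"
  by (simp add: pmag_def)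

text \<open>Moves a bound on the norm back to the valuation, where it commutes with the infimum in
  the definition of an ordered basis.\<close>

lemma pmag_threshold:
  assumes "1 < q" "0 \<le> t"
  shows "\<exists>c. \<forall>e. e \<noteq> -\<infinity> \<longrightarrow> (pmag q e \<le> t \<longleftrightarrow> c \<le> e)"
proof (cases "t = 0")
  case True
  then show ?thesis using assms(1) by (intro exI[of _ \<infinity>]) (auto simp: pmag_def)
next
  case False
  have "pmag q (ereal (- log q t)) = t" using assms False by simp
  then show ?thesis using pmag_le_iff[OF assms(1), of _ "ereal (- log q t)"] by force
qed

lemma pmag_padic_val: "pmag (real CARD('p)) (padic_val x) = padic_int_norm (x :: 'p::prime_card padic_int)"
  by (simp add: padic_val_def padic_int_norm_def powr_minus powr_realpow power_one_over inverse_eq_divide)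

lemma padic_val_neq_minf [simp]: "padic_val x \<noteq> -\<infinity>"
  by (simp add: padic_val_def)

lemma padic_int_norm_nonneg' [simp]: "0 \<le> padic_int_norm x"
  by (rule padic_int_norm_nonneg)

lemma padic_int_norm_add_le: "padic_int_norm x \<le> C \<Longrightarrow> padic_int_norm y \<le> C \<Longrightarrow> padic_int_norm (x + y) \<le> C"
  using padic_int_norm_add[of x y] by simp

lemma padic_int_norm_diff_le: "padic_int_norm x \<le> C \<Longrightarrow> padic_int_norm y \<le> C \<Longrightarrow> padic_int_norm (x - y) \<le> C"
  using padic_int_norm_add_le[of x C "- y"] by (simp add: padic_int_norm_uminus)

lemma padic_int_norm_minus_commute: "padic_int_norm (x - y) = padic_int_norm (y - x)"
  using padic_int_norm_uminus[of "x - y"] by simp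

lemma padic_int_norm_sum_le:
  "0 \<le> C \<Longrightarrow> (\<And>i. i \<in> S \<Longrightarrow> padic_int_norm (f i) \<le> C) \<Longrightarrow> padic_int_norm (sum f S) \<le> C"
  by (induction S rule: infinite_finite_induct) (auto intro: padic_int_norm_add_le)

lemma padic_residue_approx:
  "padic_int_norm (x - of_nat (nat (padic_residue x k))) \<le> (1 / real CARD('p)) ^ k"
  for x :: "'p::prime_card padic_int"
proof -
  let ?q = "int CARD('p) ^ k" and ?y = "of_nat (nat (padic_residue x k)) :: 'p padic_int"
  have "padic_residue ?y k = padic_residue x k"
    unfolding padic_residue_of_nat using padic_residue_bounds[of x k] by simp
  then have "padic_residue (x - ?y) k = (padic_residue x k + (- padic_residue x k) mod ?q) mod ?q"
    unfolding minus_padic_int_def plus_padic_int.rep_eq uminus_padic_int.rep_eq by simp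
  also have "\<dots> = (padic_residue x k + - padic_residue x k) mod ?q" by (rule mod_add_right_eq)
  finally have "of_nat CARD('p) ^ k dvd x - ?y" using padic_p_power_dvd_iff[of k "x - ?y"] by simp
  then show ?thesis using padic_int_norm_le_power_iff by blast
qed

lemma tendsto_padic_residue:
  "(\<lambda>k. of_nat (nat (padic_residue x k))) \<longlonglongrightarrow> (x :: 'p::prime_card padic_int)"
proof (rule metric_LIMSEQ_I)
  fix e :: real assume "0 < e"
  then obtain n where n: "(1 / real CARD('p)) ^ n < e" using p_power_small by blast
  have "dist (of_nat (nat (padic_residue x k))) x < e" if "n \<le> k" for k
  proof -
    have "(1 / real CARD('p)) ^ k \<le> (1 / real CARD('p)) ^ n" using that by (intro power_decreasing) auto
    then show ?thesis
      using padic_residue_approx[of x k] n unfolding dist_padic_int_def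
      by (subst padic_int_norm_minus_commute) linarith
  qed
  then show "\<exists>n0. \<forall>k\<ge>n0. dist (of_nat (nat (padic_residue x k))) x < e" by blast
qed

text \<open>\<open>\<kappa>\<close> is the lower bound 1/(p-1) for \<omega>, written as an absolute
  value. The relation \<kappa>^(p-1) = 1/p ties it to the divisibility of factorials.\<close>

locale p_valued_basis =
  fixes P :: "'p::prime_card itself" and G :: "('g, 'b) monoid_scheme" (structure)
    and Top :: "'g topology" and \<omega> :: "'g \<Rightarrow> ereal" and gs :: "'g list" and q \<kappa> :: real
  assumes valued: "p_valued_group CARD('p) G Top \<omega>" and basis: "ordered_basis P G Top \<omega> gs"
    and q_eq: "q = real CARD('p)" and \<kappa>_def: "\<kappa> = q powr (- 1 / (q - 1))"
begin

lemma card_eq_q [simp]: "real CARD('p) = q" by (simp add: q_eq)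

lemmas p_small = p_power_small[where 'p='p, folded q_eq]
lemmas residue_approx = padic_residue_approx[where 'p='p, folded q_eq]
lemmas norm_p_power = padic_int_norm_p_power[where 'p='p, folded q_eq]
lemmas norm_le_power_iff = padic_int_norm_le_power_iff[where 'p='p, folded q_eq]

lemma top_group: "topological_group G Top" and Hausdorff: "Hausdorff_space Top"
  using valued by (auto simp: p_valued_group_def pro_p_group_def)

sublocale group G
  using top_group by (simp add: topological_group_def)

lemma inv_cancel [simp]:
  "h \<in> carrier G \<Longrightarrow> k \<in> carrier G \<Longrightarrow> h \<otimes> (inv h \<otimes> k) = k"
  "h \<in> carrier G \<Longrightarrow> k \<in> carrier G \<Longrightarrow> inv h \<otimes> (h \<otimes> k) = k"
  by (simp_all flip: m_assoc)

lemma topspace_Top [simp]: "topspace Top = carrier G"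
  using top_group by (simp add: topological_group_def)

abbreviation d :: nat where "d \<equiv> length gs"
abbreviation g :: "nat \<Rightarrow> 'g" where "g i \<equiv> gs ! i"
abbreviation E :: "(nat \<Rightarrow> 'p padic_int) \<Rightarrow> 'g" where "E \<equiv> basis_product G Top gs"

definition nrm :: "'g \<Rightarrow> real" where "nrm h = pmag q (\<omega> h)"

lemma q_gt_1 [simp]: "1 < q"
proof -
  have "real 1 < real CARD('p)" unfolding of_nat_less_iff by simp
  then show ?thesis unfolding q_eq by simp
qed

lemma q_pos [simp]: "0 < q" "0 \<le> q" "1 \<le> q" "q \<noteq> 0" using q_gt_1 by linarith+

lemma \<kappa>: "0 < \<kappa>" "\<kappa> < 1" and \<kappa>_power: "\<kappa> ^ (CARD('p) - 1) = 1 / q"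
proof -
  show "0 < \<kappa>" by (simp add: \<kappa>_def)
  have "0 < q - 1" using q_gt_1 by linarith
  then have "q powr (- 1 / (q - 1)) < q powr 0" by (intro powr_less_mono) simp_all
  then show "\<kappa> < 1" by (simp add: \<kappa>_def)
  have "\<kappa> ^ (CARD('p) - 1) = \<kappa> powr (q - 1)"
    using \<open>0 < \<kappa>\<close> by (subst powr_realpow[symmetric]) (simp_all add: of_nat_diff)
  also have "\<dots> = q powr (- 1)"
    using \<open>0 < q - 1\<close> by (simp add: \<kappa>_def powr_powr)
  finally show "\<kappa> ^ (CARD('p) - 1) = 1 / q" by (simp add: powr_minus_divide)
qed

lemma \<omega>_gt: "h \<in> carrier G \<Longrightarrow> ereal (1 / (q - 1)) < \<omega> h"
  using valued by (simp add: p_valued_group_def)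

lemma \<omega>_neq_minf [simp]: "h \<in> carrier G \<Longrightarrow> \<omega> h \<noteq> -\<infinity>"
  using \<omega>_gt[of h] by auto

lemma nrm_nonneg [simp]: "0 \<le> nrm h" by (simp add: nrm_def)

lemma nrm_one [simp]: "nrm \<one> = 0"
  using valued by (simp add: p_valued_group_def nrm_def)

lemma nrm_eq_0_iff [simp]: "h \<in> carrier G \<Longrightarrow> nrm h = 0 \<longleftrightarrow> h = \<one>"
  using valued by (auto simp: p_valued_group_def nrm_def pmag_def split: if_splits)

lemma nrm_le_iff: "h \<in> carrier G \<Longrightarrow> k \<in> carrier G \<Longrightarrow> nrm h \<le> nrm k \<longleftrightarrow> \<omega> k \<le> \<omega> h"
  by (simp add: nrm_def pmag_le_iff)

lemma nrm_less_\<kappa>: "h \<in> carrier G \<Longrightarrow> nrm h < \<kappa>"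
proof -
  assume h: "h \<in> carrier G"
  have "\<not> pmag q (ereal (1 / (q - 1))) \<le> pmag q (\<omega> h)"
    using \<omega>_gt[OF h] h by (subst pmag_le_iff) auto
  then show ?thesis by (simp add: nrm_def \<kappa>_def)
qed

lemma nrm_less_1: "h \<in> carrier G \<Longrightarrow> nrm h < 1"
  using nrm_less_\<kappa> \<kappa>(2) by force

lemma nrm_inv_mult_le:
  assumes "h \<in> carrier G" "k \<in> carrier G" "nrm h \<le> t" "nrm k \<le> t"
  shows "nrm (inv h \<otimes> k) \<le> t"
proof -
  have "min (\<omega> h) (\<omega> k) \<le> \<omega> (inv h \<otimes> k)"
    using valued assms by (simp add: p_valued_group_def)
  then have "\<omega> h \<le> \<omega> (inv h \<otimes> k) \<or> \<omega> k \<le> \<omega> (inv h \<otimes> k)" by (auto simp: min_def split: if_splits)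
  then have "nrm (inv h \<otimes> k) \<le> nrm h \<or> nrm (inv h \<otimes> k) \<le> nrm k"
    using assms by (simp add: nrm_le_iff)
  then show ?thesis using assms by auto
qed

lemma nrm_inv [simp]: "h \<in> carrier G \<Longrightarrow> nrm (inv h) = nrm h"
  using nrm_inv_mult_le[of h \<one> "nrm h"] nrm_inv_mult_le[of "inv h" \<one> "nrm (inv h)"] by simp

lemma nrm_mult_le:
  "h \<in> carrier G \<Longrightarrow> k \<in> carrier G \<Longrightarrow> nrm h \<le> t \<Longrightarrow> nrm k \<le> t \<Longrightarrow> nrm (h \<otimes> k) \<le> t"
  using nrm_inv_mult_le[of "inv h" k t] by simp

lemma commutator_closed [simp]: "h \<in> carrier G \<Longrightarrow> k \<in> carrier G \<Longrightarrow> group_commutator G h k \<in> carrier G"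
  by (simp add: group_commutator_def)

lemma nrm_commutator: "h \<in> carrier G \<Longrightarrow> k \<in> carrier G \<Longrightarrow> nrm (group_commutator G h k) \<le> nrm h * nrm k"
proof -
  assume hk: "h \<in> carrier G" "k \<in> carrier G"
  have "\<omega> h + \<omega> k \<noteq> -\<infinity>" using hk by simp
  then have "pmag q (\<omega> (group_commutator G h k)) \<le> pmag q (\<omega> h + \<omega> k)"
    using valued hk by (subst pmag_le_iff) (auto simp: p_valued_group_def)
  then show ?thesis using hk by (simp add: nrm_def pmag_add)
qed

lemma commutator_mult:
  assumes "h \<in> carrier G" "k \<in> carrier G"
  shows "group_commutator G h k \<otimes> (k \<otimes> h) = h \<otimes> k"
  using assms by (simp add: group_commutator_def m_assoc)

text \<open>A conjugate of \<open>k\<close> differs from \<open>k\<close> by a commutator of no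
  larger norm. Hence the balls of the norm are normal subgroups.\<close>

lemma nrm_conj_le:
  assumes h: "h \<in> carrier G" and k: "k \<in> carrier G"
  shows "nrm (h \<otimes> k \<otimes> inv h) \<le> nrm k"
proof -
  have "h \<otimes> k \<otimes> inv h = group_commutator G h k \<otimes> k"
    using h k by (simp add: group_commutator_def m_assoc)
  moreover have "nrm (group_commutator G h k) \<le> nrm k"
    using nrm_commutator[OF h k] mult_right_mono[of "nrm h" 1 "nrm k"] nrm_less_1[OF h] by simp
  ultimately show ?thesis using h k by (simp add: nrm_mult_le)
qed

lemma nrm_conj_le': "h \<in> carrier G \<Longrightarrow> k \<in> carrier G \<Longrightarrow> nrm (inv h \<otimes> k \<otimes> h) \<le> nrm k"
  using nrm_conj_le[of "inv h" k] by simp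

lemma nrm_pow_p: "h \<in> carrier G \<Longrightarrow> nrm (h [^] CARD('p)) = nrm h / q"
proof -
  assume h: "h \<in> carrier G"
  have "\<omega> (h [^] CARD('p)) = \<omega> h + 1" using valued h by (simp add: p_valued_group_def)
  then show ?thesis
    using h pmag_add[of "\<omega> h" 1 q] pmag_ereal[of q 1] by (simp add: nrm_def powr_minus_divide flip: one_ereal_def)
qed

lemma nrm_pow_p_power: "h \<in> carrier G \<Longrightarrow> nrm (h [^] (CARD('p) ^ k)) = nrm h / q ^ k"
proof (induction k)
  case (Suc k)
  have "h [^] (CARD('p) ^ Suc k) = (h [^] (CARD('p) ^ k)) [^] CARD('p)"
    using Suc.prems by (simp add: nat_pow_pow mult.commute)
  then show ?case using Suc by (simp add: nrm_pow_p)
qed simp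

lemma nrm_pow_le: "h \<in> carrier G \<Longrightarrow> nrm (h [^] (n :: nat)) \<le> nrm h"
  by (induction n) (simp_all add: nrm_mult_le)

text \<open>Congruence modulo the normal subgroup of the elements of norm at most t.\<close>

definition ceq :: "real \<Rightarrow> 'g \<Rightarrow> 'g \<Rightarrow> bool" where
  "ceq t h k \<longleftrightarrow> nrm (inv h \<otimes> k) \<le> t"

lemma ceq_refl [simp]: "h \<in> carrier G \<Longrightarrow> 0 \<le> t \<Longrightarrow> ceq t h h"
  by (simp add: ceq_def)

lemma ceq_sym: "h \<in> carrier G \<Longrightarrow> k \<in> carrier G \<Longrightarrow> ceq t h k \<Longrightarrow> ceq t k h"
  using nrm_inv[of "inv h \<otimes> k"] by (simp add: ceq_def inv_mult_group)

lemma ceq_trans: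
  assumes "h \<in> carrier G" "k \<in> carrier G" "l \<in> carrier G" "ceq t h k" "ceq t k l"
  shows "ceq t h l"
proof -
  have "inv h \<otimes> l = (inv h \<otimes> k) \<otimes> (inv k \<otimes> l)"
    using assms by (simp add: m_assoc)
  then show ?thesis using assms by (simp add: ceq_def nrm_mult_le)
qed

lemma ceq_mult:
  assumes c: "h \<in> carrier G" "k \<in> carrier G" "h' \<in> carrier G" "k' \<in> carrier G"
    and "ceq t h k" "ceq t h' k'"
  shows "ceq t (h \<otimes> h') (k \<otimes> k')"
proof -
  have "inv (h \<otimes> h') \<otimes> (k \<otimes> k') = (inv h' \<otimes> (inv h \<otimes> k) \<otimes> h') \<otimes> (inv h' \<otimes> k')"
    using c by (simp add: inv_mult_group m_assoc)
  moreover have "nrm (inv h' \<otimes> (inv h \<otimes> k) \<otimes> h') \<le> t"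
    using nrm_conj_le'[of h' "inv h \<otimes> k"] c assms(5) by (simp add: ceq_def)
  ultimately show ?thesis using c assms(6) by (simp add: ceq_def nrm_mult_le)
qed

lemma ceq_0:
  assumes "h \<in> carrier G" "k \<in> carrier G" "ceq 0 h k"
  shows "h = k"
proof -
  have "nrm (inv h \<otimes> k) = 0" using assms nrm_nonneg[of "inv h \<otimes> k"] by (simp add: ceq_def)
  then have "inv h \<otimes> k = \<one>" using assms by simp
  then have "h \<otimes> (inv h \<otimes> k) = h" using assms by simp
  then show ?thesis using assms by (simp flip: m_assoc)
qed

lemma ceq_all_imp_eq:
  assumes "h \<in> carrier G" "k \<in> carrier G" "\<And>t. 0 < t \<Longrightarrow> ceq t h k"
  shows "h = k"
proof (rule ccontr)
  assume "h \<noteq> k"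
  then have "nrm (inv h \<otimes> k) \<noteq> 0" using ceq_0[OF assms(1,2)] by (auto simp: ceq_def)
  then have "0 < nrm (inv h \<otimes> k)" using nrm_nonneg[of "inv h \<otimes> k"] by linarith
  then show False using assms(3)[of "nrm (inv h \<otimes> k) / 2"] by (simp add: ceq_def)
qed

text \<open>Turns convergence in the topology into congruences: left translation by
  \<open>inv y\<close> is continuous, and the balls are neighbourhoods of the neutral
  element.\<close>

lemma limitin_ceq:
  assumes lim: "limitin Top s y sequentially" and t: "0 < t"
  shows "\<exists>K. \<forall>k\<ge>K. ceq t y (s k)"
proof -
  have y: "y \<in> carrier G" using limitin_topspace[OF lim] by simp
  \<comment> \<open>The maximum with 1 is for t \<ge> 1, because the neighbourhood basis is indexed
    by positive numbers.\<close>
  define \<nu> where "\<nu> = max 1 (- log q t)"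
  have \<nu>: "0 < \<nu>" "q powr - \<nu> \<le> t"
  proof -
    have "q powr - \<nu> \<le> q powr (log q t)" by (intro powr_mono less_imp_le[OF q_gt_1]) (auto simp: \<nu>_def)
    also have "\<dots> = t" using t less_imp_neq[OF q_gt_1] by (intro powr_log_cancel) auto
    finally show "q powr - \<nu> \<le> t" .
  qed (simp add: \<nu>_def)
  let ?W = "{h \<in> carrier G. \<omega> h \<ge> ereal \<nu>}"
  have "\<forall>W\<subseteq>carrier G. (\<exists>U. openin Top U \<and> \<one> \<in> U \<and> U \<subseteq> W) \<longleftrightarrow>
        (\<exists>\<nu>::real. \<nu> > 0 \<and> {g \<in> carrier G. \<omega> g \<ge> ereal \<nu>} \<subseteq> W)"
    using valued by (simp add: p_valued_group_def)
  from this[rule_format, of ?W] have "\<exists>U. openin Top U \<and> \<one> \<in> U \<and> U \<subseteq> ?W"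
    using \<nu>(1) by (auto simp del: not_less)
  then obtain U where U: "openin Top U" "\<one> \<in> U" "U \<subseteq> ?W" by blast
  have mult: "continuous_map (prod_topology Top Top) Top (\<lambda>(x, y). x \<otimes> y)"
    using top_group by (simp add: topological_group_def)
  have "continuous_map Top (prod_topology Top Top) (\<lambda>z. (inv y, z))"
    using y by (intro continuous_map_pairedI) (auto simp: continuous_map_const)
  from continuous_map_compose[OF this mult]
  have "continuous_map Top Top (\<lambda>z. inv y \<otimes> z)" by (simp add: o_def)
  then have "openin Top {z \<in> topspace Top. inv y \<otimes> z \<in> U}"
    using U(1) by (rule openin_continuous_map_preimage)
  moreover have "y \<in> {z \<in> topspace Top. inv y \<otimes> z \<in> U}" using y U(2) by simp
  ultimately obtain K where K: "\<And>k. k \<ge> K \<Longrightarrow> s k \<in> {z \<in> topspace Top. inv y \<otimes> z \<in> U}"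
    using lim unfolding limitin_sequentially by meson
  have "ceq t y (s k)" if "k \<ge> K" for k
  proof -
    have "inv y \<otimes> s k \<in> ?W" using K[OF that] U(3) by blast
    then have "pmag q (\<omega> (inv y \<otimes> s k)) \<le> pmag q (ereal \<nu>)"
      by (subst pmag_le_iff) auto
    then show ?thesis using \<nu>(2) by (simp add: ceq_def nrm_def)
  qed
  then show ?thesis by blast
qed

subsection \<open>Coordinates\<close>

lemma g_closed [simp]: "i < d \<Longrightarrow> g i \<in> carrier G"
  using basis nth_mem by (force simp: ordered_basis_def)

lemma E_homeo: "homeomorphic_map (product_topology (\<lambda>_. euclidean) {..<d}) Top E"
  and \<omega>_E: "\<omega> (E x) = (INF i\<in>{..<d}. \<omega> (g i) + padic_val (x i))"
  using basis by (simp_all add: ordered_basis_def)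

lemma E_cong: "(\<And>i. i < d \<Longrightarrow> x i = y i) \<Longrightarrow> E x = E y"
  unfolding basis_product_def by (rule foldr_cong) auto

lemma E_restrict: "E (restrict x {..<d}) = E x"
  by (rule E_cong) simp

lemma E_closed [simp]: "E x \<in> carrier G"
proof -
  have "E (restrict x {..<d}) \<in> carrier G"
    using homeomorphic_imp_surjective_map[OF E_homeo] by (auto simp: PiE_def)
  then show ?thesis by (simp add: E_restrict)
qed

lemma E_surj:
  assumes "h \<in> carrier G"
  obtains x where "h = E x"
proof -
  have "h \<in> E ` topspace (product_topology (\<lambda>_. euclidean :: 'p padic_int topology) {..<d})"
    using homeomorphic_imp_surjective_map[OF E_homeo] assms by simp
  then show ?thesis using that by blast
qed

lemma E_inj:
  assumes "E x = E y" "i < d"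
  shows "x i = y i"
proof -
  have "restrict x {..<d} = restrict y {..<d}"
    by (rule inj_onD[OF homeomorphic_imp_injective_map[OF E_homeo]])
      (use assms(1) in \<open>auto simp: E_restrict\<close>)
  then show ?thesis using assms(2) by (metis lessThan_iff restrict_apply')
qed

definition X :: "nat \<Rightarrow> 'g \<Rightarrow> 'p padic_int" where "X i h = (SOME x. E x = h) i"

lemma X_E [simp]: "i < d \<Longrightarrow> X i (E x) = x i"
  unfolding X_def by (rule E_inj[OF someI[of "\<lambda>y. E y = E x" x]]) auto

lemma E_X [simp]:
  assumes "h \<in> carrier G"
  shows "E (\<lambda>i. X i h) = h"
proof -
  obtain x where x: "h = E x" by (rule E_surj[OF assms])
  show ?thesis unfolding x by (rule E_cong) simp
qed

lemma nrm_E_le_iff: "0 \<le> t \<Longrightarrow> nrm (E x) \<le> t \<longleftrightarrow> (\<forall>i<d. nrm (g i) * padic_int_norm (x i) \<le> t)"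
proof -
  assume t: "0 \<le> t"
  obtain c where c: "\<And>e. e \<noteq> -\<infinity> \<Longrightarrow> pmag q e \<le> t \<longleftrightarrow> c \<le> e"
    using pmag_threshold[OF q_gt_1 t] by blast
  have "nrm (E x) \<le> t \<longleftrightarrow> c \<le> (INF i\<in>{..<d}. \<omega> (g i) + padic_val (x i))"
    unfolding nrm_def by (subst c) (simp_all add: \<omega>_E[symmetric])
  also have "\<dots> \<longleftrightarrow> (\<forall>i<d. c \<le> \<omega> (g i) + padic_val (x i))" by (auto simp: le_INF_iff)
  also have "\<dots> \<longleftrightarrow> (\<forall>i<d. pmag q (\<omega> (g i) + padic_val (x i)) \<le> t)"
    by (intro all_cong1 imp_cong refl c[symmetric]) simp
  also have "\<dots> \<longleftrightarrow> (\<forall>i<d. nrm (g i) * padic_int_norm (x i) \<le> t)"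
    by (simp add: pmag_add nrm_def pmag_padic_val[where 'p='p, folded q_eq])
  finally show ?thesis .
qed

lemma E_limit:
  assumes "\<And>i. i < d \<Longrightarrow> (\<lambda>k. s k i) \<longlonglongrightarrow> x i"
  shows "limitin Top (\<lambda>k. E (s k)) (E x) sequentially"
proof -
  have "limitin (product_topology (\<lambda>_. euclidean) {..<d}) (\<lambda>k. restrict (s k) {..<d}) (restrict x {..<d}) sequentially"
    using assms by (auto simp: limitin_componentwise)
  from continuous_map_limit[OF homeomorphic_imp_continuous_map[OF E_homeo] this]
  show ?thesis by (simp add: o_def E_restrict)
qed

definition pw :: "nat \<Rightarrow> 'p padic_int \<Rightarrow> 'g" where "pw i t = padic_pow G Top (g i) t"

lemma E_foldr: "E x = foldr (\<lambda>i y. pw i (x i) \<otimes> y) [0..<d] \<one>"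
  by (simp add: basis_product_def pw_def)

lemma pw_limitI:
  assumes "limitin Top (\<lambda>k. g i [^] padic_residue t k) y sequentially"
  shows "pw i t = y"
  unfolding pw_def padic_pow_def
  using assms limitin_Hausdorff_unique[OF _ assms trivial_limit_sequentially Hausdorff] by blast

lemma pw_of_nat: "i < d \<Longrightarrow> pw i (of_nat n) = g i [^] n"
proof (rule pw_limitI)
  assume i: "i < d"
  have "g i [^] padic_residue (of_nat n :: 'p padic_int) k = g i [^] n" if "n \<le> k" for k
  proof -
    have "k < CARD('p) ^ k" by (rule power_gt_expt) simp
    then have "int n < int CARD('p) ^ k" using that by (metis le_less_trans of_nat_less_iff of_nat_power)
    then have "padic_residue (of_nat n :: 'p padic_int) k = int n" by (simp add: padic_residue_of_nat)
    then show ?thesis by (simp add: int_pow_int)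
  qed
  then show "limitin Top (\<lambda>k. g i [^] padic_residue (of_nat n :: 'p padic_int) k) (g i [^] n) sequentially"
    using i by (intro limitin_eventually) (auto simp: eventually_sequentially)
qed

lemma foldr_mult_closed: "(\<And>i. i \<in> set is \<Longrightarrow> f i \<in> carrier G) \<Longrightarrow> foldr (\<lambda>i y. f i \<otimes> y) is \<one> \<in> carrier G"
  by (induction "is") auto

lemma foldr_mult_single:
  "(\<And>j. j \<in> set is \<Longrightarrow> f j \<in> carrier G) \<Longrightarrow> (\<And>j. j \<in> set is \<Longrightarrow> j \<noteq> i \<Longrightarrow> f j = \<one>) \<Longrightarrow> distinct is \<Longrightarrow>
    foldr (\<lambda>i y. f i \<otimes> y) is \<one> = (if i \<in> set is then f i else \<one>)"
proof (induction "is")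
  case (Cons a "is")
  then show ?case by (cases "a = i") auto
qed simp

text \<open>Identifies the p-adic powers of a basis element with a coordinate axis. Natural
  exponents are computed directly, and continuity of \<open>E\<close> carries the residues of
  \<open>t\<close> to the limit.\<close>

lemma pw_eq_E:
  assumes "i < d"
  shows "pw i t = E (\<lambda>j. if j = i then t else 0)"
proof (rule pw_limitI)
  let ?n = "\<lambda>k. nat (padic_residue t k)"
  have "E (\<lambda>j. if j = i then of_nat (?n k) else 0) = g i [^] padic_residue t k" for k
  proof -
    have "pw j (if j = i then of_nat (?n k) else 0) = (if j = i then g i [^] ?n k else \<one>)" if "j < d" for j
      using pw_of_nat[OF that, of "?n k"] pw_of_nat[OF that, of 0] by (cases "j = i") (simp_all del: of_nat_nat)
    then have "E (\<lambda>j. if j = i then of_nat (?n k) else 0)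
        = foldr (\<lambda>j y. (if j = i then g i [^] ?n k else \<one>) \<otimes> y) [0..<d] \<one>"
      unfolding E_foldr by (intro foldr_cong) auto
    also have "\<dots> = g i [^] ?n k"
      using assms by (subst foldr_mult_single[where i=i]) auto
    also have "\<dots> = g i [^] padic_residue t k"
      using padic_residue_bounds(1)[of t k] by (metis int_pow_int nat_0_le)
    finally show ?thesis .
  qed
  moreover have "limitin Top (\<lambda>k. E (\<lambda>j. if j = i then of_nat (?n k) else 0)) (E (\<lambda>j. if j = i then t else 0)) sequentially"
    by (rule E_limit) (auto intro: tendsto_padic_residue)
  ultimately show "limitin Top (\<lambda>k. g i [^] padic_residue t k) (E (\<lambda>j. if j = i then t else 0)) sequentially"
    by simp
qed

lemma pw_closed [simp]: "i < d \<Longrightarrow> pw i t \<in> carrier G"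
  by (simp add: pw_eq_E)

lemma nrm_pw_le_iff: "i < d \<Longrightarrow> 0 \<le> c \<Longrightarrow> nrm (pw i t) \<le> c \<longleftrightarrow> nrm (g i) * padic_int_norm t \<le> c"
  by (auto simp: pw_eq_E nrm_E_le_iff)

lemma nrm_pw: "i < d \<Longrightarrow> nrm (pw i t) = nrm (g i) * padic_int_norm t"
  using nrm_pw_le_iff[of i "nrm (pw i t)" t] nrm_pw_le_iff[of i "nrm (g i) * padic_int_norm t" t]
  by (intro antisym) simp_all

lemma pw_approx:
  assumes i: "i < d" and t: "0 < t"
  shows "\<exists>K. \<forall>k\<ge>K. ceq t (pw i x) (g i [^] nat (padic_residue x k))"
proof -
  have "limitin Top (\<lambda>k. E (\<lambda>j. if j = i then of_nat (nat (padic_residue x k)) else 0)) (E (\<lambda>j. if j = i then x else 0)) sequentially"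
    by (rule E_limit) (auto intro: tendsto_padic_residue)
  then have "limitin Top (\<lambda>k. g i [^] nat (padic_residue x k)) (pw i x) sequentially"
    using i by (simp add: pw_of_nat flip: pw_eq_E)
  from limitin_ceq[OF this t] show ?thesis .
qed

lemma pw_add:
  assumes i: "i < d"
  shows "pw i (x + y) = pw i x \<otimes> pw i y"
proof (rule ceq_all_imp_eq)
  fix t :: real assume t: "0 < t"
  obtain K1 where K1: "\<And>k. k \<ge> K1 \<Longrightarrow> ceq t (pw i x) (g i [^] nat (padic_residue x k))"
    using pw_approx[OF i t] by blast
  obtain K2 where K2: "\<And>k. k \<ge> K2 \<Longrightarrow> ceq t (pw i y) (g i [^] nat (padic_residue y k))"
    using pw_approx[OF i t] by blast
  obtain K3 where K3: "\<And>k. k \<ge> K3 \<Longrightarrow> ceq t (pw i (x + y)) (g i [^] nat (padic_residue (x + y) k))"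
    using pw_approx[OF i t] by blast
  obtain K4 where K4: "(1 / q) ^ K4 < t" using p_small[OF t] by blast
  define k where "k = max (max K1 K2) (max K3 K4)"
  let ?a = "nat (padic_residue x k)" and ?b = "nat (padic_residue y k)" and ?c = "nat (padic_residue (x + y) k)"
  note b = padic_residue_bounds[of x k] padic_residue_bounds[of y k]
  \<comment> \<open>The residues add up to the residue of the sum plus a multiple of p^k, and the
    p^k-th power of \<open>g i\<close> is small.\<close>
  have "?c = (?a + ?b) mod CARD('p) ^ k"
    using b by (simp add: plus_padic_int.rep_eq nat_mod_distrib nat_add_distrib nat_power_eq)
  then have "?a + ?b = ?c + CARD('p) ^ k * ((?a + ?b) div CARD('p) ^ k)" by simp
  then obtain m where m: "?a + ?b = ?c + CARD('p) ^ k * m" by blast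
  have gi: "g i \<in> carrier G" using i by simp
  have "g i [^] ?a \<otimes> g i [^] ?b = g i [^] ?c \<otimes> (g i [^] (CARD('p) ^ k)) [^] m"
    using gi by (simp add: nat_pow_mult nat_pow_pow m)
  moreover have "nrm ((g i [^] (CARD('p) ^ k)) [^] m) \<le> t"
  proof -
    have "nrm ((g i [^] (CARD('p) ^ k)) [^] m) \<le> nrm (g i) / q ^ k"
      using nrm_pow_le[of "g i [^] (CARD('p) ^ k)" m] nrm_pow_p_power[OF gi, of k] gi by simp
    also have "\<dots> \<le> 1 / q ^ k" using nrm_less_1[OF gi] by (intro divide_right_mono) auto
    also have "\<dots> \<le> (1 / q) ^ K4"
      unfolding power_one_over[symmetric] by (intro power_decreasing) (auto simp: k_def)
    finally show ?thesis using K4 by simp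
  qed
  ultimately have 1: "ceq t (g i [^] ?c) (g i [^] ?a \<otimes> g i [^] ?b)"
    using gi by (simp add: ceq_def flip: m_assoc)
  have 2: "ceq t (pw i x \<otimes> pw i y) (g i [^] ?a \<otimes> g i [^] ?b)"
    using i K1[of k] K2[of k] by (intro ceq_mult) (auto simp: k_def)
  have 3: "ceq t (pw i (x + y)) (g i [^] ?c)" using K3[of k] by (simp add: k_def)
  have A: "ceq t (pw i (x + y)) (g i [^] ?a \<otimes> g i [^] ?b)" using i by (intro ceq_trans[OF _ _ _ 3 1]) auto
  have B: "ceq t (g i [^] ?a \<otimes> g i [^] ?b) (pw i x \<otimes> pw i y)" using i by (intro ceq_sym[OF _ _ 2]) auto
  show "ceq t (pw i (x + y)) (pw i x \<otimes> pw i y)" by (rule ceq_trans[OF _ _ _ A B]) (use i in auto)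
qed (use i in auto)

text \<open>Modulo the elements of norm smaller than that of E z, the factors of E z are central.\<close>

lemma nrm_E_quotient: "nrm (inv (E x) \<otimes> E y) = nrm (E (\<lambda>i. y i - x i))"
proof (cases "E (\<lambda>i. y i - x i) = \<one>")
  case True
  have "E (\<lambda>_. 0) = \<one>"
  proof -
    have "nrm (E (\<lambda>_. 0)) \<le> 0" by (simp add: nrm_E_le_iff)
    then show ?thesis using nrm_nonneg[of "E (\<lambda>_. 0)"] nrm_eq_0_iff[OF E_closed] by force
  qed
  then have "y i - x i = 0" if "i < d" for i using E_inj[of "\<lambda>i. y i - x i" "\<lambda>_. 0"] True that by simp
  then have "E x = E y" by (intro E_cong) simp
  then show ?thesis by (simp add: True)
next
  case False
  define z where "z i = y i - x i" for i
  define \<delta> where "\<delta> = nrm (E z)"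
  have \<delta>: "0 < \<delta>" using False nrm_nonneg[of "E z"] nrm_eq_0_iff[OF E_closed, of z]
    unfolding \<delta>_def z_def[abs_def] by linarith
  have small: "nrm (pw i (z i)) \<le> \<delta>" if "i < d" for i
    using nrm_E_le_iff[of \<delta> z] that \<delta> by (auto simp: \<delta>_def nrm_pw)
  have k\<delta>: "0 \<le> \<kappa> * \<delta>" "\<kappa> * \<delta> < \<delta>" using \<kappa> \<delta> by auto
  let ?F = "\<lambda>x is. foldr (\<lambda>i y. pw i (x i) \<otimes> y) is \<one>"
  have closed: "?F x is \<in> carrier G" if "set is \<subseteq> {..<d}" for x "is"
    using that by (intro foldr_mult_closed) auto
  \<comment> \<open>A factor of \<open>E z\<close> has norm at most \<delta>, so it commutes with
    everything up to norm \<kappa> \<delta> < \<delta>. The factors of E x and E z can therefore be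
    merged one by one into those of E y.\<close>
  have "ceq (\<kappa> * \<delta>) (?F x is \<otimes> ?F z is) (?F y is)" if "set is \<subseteq> {..<d}" for "is"
    using that
  proof (induction "is")
    case Nil
    then show ?case using k\<delta> by simp
  next
    case (Cons i "is")
    then have i: "i < d" and is': "set is \<subseteq> {..<d}" by auto
    let ?a = "pw i (x i)" and ?z = "pw i (z i)" and ?A = "?F x is" and ?B = "?F z is"
    have c: "?a \<in> carrier G" "?z \<in> carrier G" "?A \<in> carrier G" "?B \<in> carrier G" "?F y is \<in> carrier G"
      using i closed[OF is'] by auto
    have "nrm (group_commutator G (inv ?z) (inv ?A)) \<le> nrm ?z * nrm ?A"
      using nrm_commutator[of "inv ?z" "inv ?A"] c by simp
    also have "\<dots> \<le> \<delta> * \<kappa>"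
      using small[OF i] nrm_less_\<kappa>[OF c(3)] \<delta> by (intro mult_mono) auto
    finally have "nrm (group_commutator G (inv ?z) (inv ?A)) \<le> \<kappa> * \<delta>" by (simp add: mult.commute)
    then have swap: "ceq (\<kappa> * \<delta>) (?A \<otimes> ?z) (?z \<otimes> ?A)"
      using c by (simp add: ceq_def group_commutator_def inv_mult_group m_assoc)
    have eq1: "?a \<otimes> ((?z \<otimes> ?A) \<otimes> ?B) = (?a \<otimes> ?z) \<otimes> (?A \<otimes> ?B)"
      using c by (simp add: m_assoc)
    have 1: "ceq (\<kappa> * \<delta>) (?a \<otimes> ((?A \<otimes> ?z) \<otimes> ?B)) ((?a \<otimes> ?z) \<otimes> (?A \<otimes> ?B))"
      unfolding eq1[symmetric]
      by (rule ceq_mult[OF _ _ _ _ ceq_refl ceq_mult[OF _ _ _ _ swap ceq_refl]]) (use c k\<delta> in auto)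
    have 2: "ceq (\<kappa> * \<delta>) ((?a \<otimes> ?z) \<otimes> (?A \<otimes> ?B)) ((?a \<otimes> ?z) \<otimes> ?F y is)"
      by (rule ceq_mult[OF _ _ _ _ ceq_refl Cons.IH[OF is']]) (use c k\<delta> in auto)
    have 3: "?a \<otimes> ?z = pw i (y i)"
      using pw_add[OF i, of "x i" "z i"] by (simp add: z_def)
    have "ceq (\<kappa> * \<delta>) (?a \<otimes> ((?A \<otimes> ?z) \<otimes> ?B)) ((?a \<otimes> ?z) \<otimes> ?F y is)"
      by (rule ceq_trans[OF _ _ _ 1 2]) (use c in \<open>simp_all only: m_closed\<close>)
    moreover have "?a \<otimes> ((?A \<otimes> ?z) \<otimes> ?B) = (?a \<otimes> ?A) \<otimes> (?z \<otimes> ?B)"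
      using c by (simp add: m_assoc)
    ultimately have "ceq (\<kappa> * \<delta>) ((?a \<otimes> ?A) \<otimes> (?z \<otimes> ?B)) (pw i (y i) \<otimes> ?F y is)"
      by (simp only: 3)
    then show ?case by simp
  qed
  from this[of "[0..<d]"] have "ceq (\<kappa> * \<delta>) (E x \<otimes> E z) (E y)"
    by (simp add: E_foldr lessThan_atLeast0)
  then have w: "nrm (inv (E z) \<otimes> (inv (E x) \<otimes> E y)) \<le> \<kappa> * \<delta>"
    by (simp add: ceq_def inv_mult_group m_assoc)
  let ?w = "inv (E x) \<otimes> E y"
  show ?thesis
  proof (rule antisym)
    have "?w = E z \<otimes> (inv (E z) \<otimes> ?w)" by (simp flip: m_assoc)
    then show "nrm ?w \<le> nrm (E (\<lambda>i. y i - x i))"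
      using nrm_mult_le[of "E z" "inv (E z) \<otimes> ?w" \<delta>] w k\<delta> by (simp add: \<delta>_def z_def[abs_def])
    show "nrm (E (\<lambda>i. y i - x i)) \<le> nrm ?w"
    proof (rule ccontr)
      assume "\<not> nrm (E (\<lambda>i. y i - x i)) \<le> nrm ?w"
      then have less: "max (nrm ?w) (\<kappa> * \<delta>) < \<delta>" using k\<delta> by (simp add: \<delta>_def z_def[abs_def])
      have "E z = ?w \<otimes> inv (inv (E z) \<otimes> ?w)" by (simp add: inv_mult_group m_assoc)
      then have "\<delta> \<le> max (nrm ?w) (\<kappa> * \<delta>)"
      proof -
        assume Ez: "E z = ?w \<otimes> inv (inv (E z) \<otimes> ?w)"
        have "nrm (?w \<otimes> inv (inv (E z) \<otimes> ?w)) \<le> max (nrm ?w) (\<kappa> * \<delta>)"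
          by (rule nrm_mult_le) (use w in auto)
        then show ?thesis using Ez unfolding \<delta>_def by metis
      qed
      then show False using less by simp
    qed
  qed
qed

lemma ceq_E_iff: "0 \<le> t \<Longrightarrow> ceq t (E x) (E y) \<longleftrightarrow> (\<forall>i<d. nrm (g i) * padic_int_norm (y i - x i) \<le> t)"
  unfolding ceq_def nrm_E_quotient by (rule nrm_E_le_iff)

lemma E_0: "E (\<lambda>_. 0) = \<one>"
proof -
  have "nrm (E (\<lambda>_. 0)) \<le> 0" by (simp add: nrm_E_le_iff)
  then show ?thesis using nrm_nonneg[of "E (\<lambda>_. 0)"] nrm_eq_0_iff[OF E_closed] by force
qed

lemma X_one [simp]: "i < d \<Longrightarrow> X i \<one> = 0"
  using X_E[of i "\<lambda>_. 0"] by (simp add: E_0)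

lemma g_eq_E: "i < d \<Longrightarrow> g i = E (\<lambda>j. if j = i then 1 else 0)"
  using pw_of_nat[of i 1] by (simp flip: pw_eq_E)

lemma nrm_g_pos: "i < d \<Longrightarrow> 0 < nrm (g i)"
proof -
  assume i: "i < d"
  have "g i \<noteq> \<one>"
  proof
    assume "g i = \<one>"
    then have "X i (g i) = 0" using i by simp
    then show False using i by (simp add: g_eq_E)
  qed
  then show ?thesis using i nrm_nonneg[of "g i"] by (auto simp: order_le_less)
qed

text \<open>Modulo p^l this makes \<open>X i\<close> right-invariant under a ball, which is why
  differences of small weight vanish modulo p^l.\<close>

lemma X_lipschitz:
  assumes "i < d" "h \<in> carrier G" "y \<in> carrier G"
  shows "nrm (g i) * padic_int_norm (X i (h \<otimes> y) - X i h) \<le> nrm y"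
proof -
  have "inv h \<otimes> (h \<otimes> y) = y" using assms by (simp flip: m_assoc)
  then have "ceq (nrm y) (E (\<lambda>i. X i h)) (E (\<lambda>i. X i (h \<otimes> y)))" using assms by (simp add: ceq_def)
  then show ?thesis using assms(1) by (simp add: ceq_E_iff)
qed

lemma nat_approx:
  assumes h: "h \<in> carrier G" and t: "0 < t"
  obtains n :: "nat \<Rightarrow> nat" where "ceq t (E (\<lambda>i. of_nat (n i))) h"
proof -
  obtain k where k: "(1 / q) ^ k < t" using p_small[OF t] by blast
  have "ceq t (E (\<lambda>i. of_nat (nat (padic_residue (X i h) k)))) (E (\<lambda>i. X i h))"
    unfolding ceq_E_iff[OF less_imp_le[OF t]]
  proof (intro allI impI)
    fix i assume i: "i < d"
    have "nrm (g i) * padic_int_norm (X i h - of_nat (nat (padic_residue (X i h) k))) \<le> 1 * (1 / q) ^ k"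
      using nrm_less_1[OF g_closed[OF i]] by (intro mult_mono residue_approx) auto
    then show "nrm (g i) * padic_int_norm (X i h - of_nat (nat (padic_residue (X i h) k))) \<le> t" using k by simp
  qed
  then show ?thesis using that h by simp
qed

lemma E_of_nat: "E (\<lambda>i. of_nat (n i)) = foldr (\<lambda>i y. g i [^] n i \<otimes> y) [0..<d] \<one>"
  unfolding E_foldr by (rule foldr_cong) (auto simp: pw_of_nat)

end

section \<open>Iterated differences on the group\<close>

lemma move_swap_induct:
  assumes refl: "\<And>xs. R xs xs" and trans: "\<And>xs ys zs. R xs ys \<Longrightarrow> R ys zs \<Longrightarrow> R xs zs"
    and swap: "\<And>us x y vs. mset (us @ x # y # vs) = M \<Longrightarrow> R (us @ x # y # vs) (us @ y # x # vs)"
  shows "mset (us @ x # ps @ vs) = M \<Longrightarrow> R (us @ x # ps @ vs) (us @ ps @ x # vs)"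
proof (induction ps arbitrary: us)
  case (Cons a ps)
  have "R (us @ x # a # ps @ vs) (us @ a # x # ps @ vs)" using Cons.prems by (intro swap) simp
  moreover have "R ((us @ [a]) @ x # ps @ vs) ((us @ [a]) @ ps @ x # vs)"
    using Cons.prems by (intro Cons.IH) (simp add: add_mset_commute)
  ultimately show ?case using trans by simp
qed (simp add: refl)

text \<open>Rearrangement by swaps of neighbours. Only swaps inside lists with the given multiset
  have to be treated, which keeps their length and weight known.\<close>

lemma mset_eq_swap_induct:
  assumes refl: "\<And>xs. R xs xs" and trans: "\<And>xs ys zs. R xs ys \<Longrightarrow> R ys zs \<Longrightarrow> R xs zs"
    and swap: "\<And>us x y vs. mset (us @ x # y # vs) = mset xs \<Longrightarrow> R (us @ x # y # vs) (us @ y # x # vs)"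
    and eq: "mset xs = mset ys"
  shows "R xs ys"
proof -
  have "R (us @ zs) (us @ zs')" if "mset (us @ zs) = mset xs" "mset zs = mset zs'" for us zs zs'
    using that
  proof (induction zs arbitrary: us zs')
    case (Cons x zs)
    then have "x \<in> set zs'" by (metis list.set_intros(1) set_mset_mset)
    then obtain ps vs where zs': "zs' = ps @ x # vs" by (meson split_list)
    then have eq: "mset zs = mset (ps @ vs)" using Cons.prems(2) by simp
    have "R ((us @ [x]) @ zs) ((us @ [x]) @ (ps @ vs))"
      using Cons.prems(1) eq by (intro Cons.IH) auto
    moreover have "R (us @ x # ps @ vs) (us @ ps @ x # vs)"
    proof (rule move_swap_induct[of R "mset xs"])
      show "mset (us @ x # ps @ vs) = mset xs" using Cons.prems(1) eq by simp
    qed (fact refl trans swap)+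
    ultimately show ?case using trans zs' by simp
  qed (simp add: refl)
  from this[of "[]" xs ys] show ?thesis using eq by simp
qed

section \<open>Absolute values of natural numbers and binomial coefficients\<close>

lemma padic_int_norm_of_nat_lower:
  "0 < j \<Longrightarrow> \<exists>v. padic_int_norm (of_nat j :: 'p::prime_card padic_int) = (1 / real CARD('p)) ^ v \<and>
    CARD('p) ^ v \<le> j \<and> CARD('p) ^ v dvd j"
proof -
  assume j: "0 < j"
  define v where "v = padic_ord (of_nat j :: 'p padic_int)"
  have nz: "(of_nat j :: 'p padic_int) \<noteq> 0" using j by simp
  have "of_nat CARD('p) ^ v dvd (of_nat j :: 'p padic_int)"
    unfolding v_def using padic_p_power_dvd_iff_ord[OF nz] by simp
  then have "padic_residue (of_nat j :: 'p padic_int) v = 0" by (rule padic_p_power_dvd_iff[THEN iffD1])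
  then have "int j mod int CARD('p) ^ v = 0" by (simp add: padic_residue_of_nat)
  then have "int (CARD('p) ^ v) dvd int j" by (simp add: dvd_eq_mod_eq_0)
  then have "CARD('p) ^ v dvd j" by (simp only: int_dvd_int_iff)
  moreover from this have "CARD('p) ^ v \<le> j" using j by (rule dvd_imp_le)
  ultimately show ?thesis using nz by (auto simp: padic_int_norm_def v_def)
qed

context p_valued_basis
begin

lemma one_plus_le_power: "Suc (v * (CARD('p) - 1)) \<le> CARD('p) ^ v"
proof (induction v)
  case (Suc v)
  have "1 \<le> CARD('p) ^ v" by simp
  then have "Suc (v * (CARD('p) - 1)) + (CARD('p) - 1) \<le> CARD('p) ^ v + (CARD('p) - 1) * CARD('p) ^ v"
    using Suc by (intro add_mono) auto
  also have "\<dots> = CARD('p) ^ Suc v" by (simp add: diff_mult_distrib)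
  finally show ?case by simp
qed simp

text \<open>If p^v is the p-part of j, then v(p-1) \<le> p^v - 1 \<le> j - 1, and 1/p =
  \<kappa>^(p-1).\<close>

lemma of_nat_norm_lower: "0 < j \<Longrightarrow> \<kappa> ^ (j - 1) \<le> padic_int_norm (of_nat j :: 'p padic_int)"
proof -
  assume "0 < j"
  then obtain v where v: "padic_int_norm (of_nat j :: 'p padic_int) = (1 / q) ^ v" "CARD('p) ^ v \<le> j"
    using padic_int_norm_of_nat_lower[of j, where 'p='p] by auto
  have "v * (CARD('p) - 1) \<le> j - 1" using one_plus_le_power[of v] v(2) by linarith
  then have "\<kappa> ^ (j - 1) \<le> \<kappa> ^ (v * (CARD('p) - 1))" using \<kappa> by (intro power_decreasing) auto
  also have "\<dots> = (1 / q) ^ v" by (simp only: mult.commute[of v] power_mult \<kappa>_power)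
  finally show ?thesis using v by simp
qed

text \<open>Take absolute values in j (n choose j) = n (n-1 choose j-1).\<close>

lemma binomial_norm:
  assumes "0 < j"
  shows "padic_int_norm (of_nat j :: 'p padic_int) * padic_int_norm (of_nat (n choose j) :: 'p padic_int)
    \<le> padic_int_norm (of_nat n :: 'p padic_int)"
proof -
  obtain k where k: "j = Suc k" using assms by (cases j) auto
  show ?thesis
  proof (cases n)
    case 0
    then show ?thesis by (simp add: k)
  next
    case (Suc m)
    have "(of_nat j * of_nat (n choose j) :: 'p padic_int) = of_nat n * of_nat (m choose k)"
      unfolding of_nat_mult[symmetric] k Suc using Suc_times_binomial_eq[of m k] by (simp add: mult.commute)
    then show ?thesis
      using mult_left_mono[OF padic_int_norm_le_1 padic_int_norm_nonneg, of "of_nat n :: 'p padic_int" "of_nat (m choose k)"]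
      unfolding padic_int_norm_mult[symmetric] by (simp add: padic_int_norm_mult)
  qed
qed

text \<open>The norm of a group element is at most the largest norm of a basis element, and there
  are finitely many of these; \<kappa>/2 covers the empty basis. The ratio \<eta>/\<kappa> is the
  gain in each step of the main estimate.\<close>

lemma nrm_bound: obtains \<eta> where "0 < \<eta>" "\<eta> < \<kappa>" "\<And>h. h \<in> carrier G \<Longrightarrow> nrm h \<le> \<eta>"
proof -
  define \<eta> where "\<eta> = Max (insert (\<kappa> / 2) ((\<lambda>i. nrm (g i)) ` {..<d}))"
  have fin: "finite (insert (\<kappa> / 2) ((\<lambda>i. nrm (g i)) ` {..<d}))" by simp
  have \<eta>: "\<kappa> / 2 \<le> \<eta>" "\<And>i. i < d \<Longrightarrow> nrm (g i) \<le> \<eta>"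
    unfolding \<eta>_def using fin by (intro Max_ge; blast)+
  have "\<eta> < \<kappa>" unfolding \<eta>_def using fin \<kappa> nrm_less_\<kappa> by (subst Max_less_iff) auto
  moreover have "nrm h \<le> \<eta>" if "h \<in> carrier G" for h
  proof -
    have "nrm (E (\<lambda>i. X i h)) \<le> \<eta>"
    proof (subst nrm_E_le_iff)
      show "\<forall>i<d. nrm (g i) * padic_int_norm (X i h) \<le> \<eta>"
        using \<eta>(2) mult_left_mono[OF padic_int_norm_le_1 nrm_nonneg] by (metis mult.right_neutral order_trans)
    qed (use \<eta>(1) \<kappa>(1) in linarith)
    then show ?thesis using that by simp
  qed
  ultimately show ?thesis using that \<eta>(1) \<kappa>(1) by (metis half_gt_zero less_le_trans)
qed

text \<open>The list h1, ..., hm acts as the product of the h - 1 in the group ring.\<close>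

primrec DL :: "'g list \<Rightarrow> ('g \<Rightarrow> 'p padic_int) \<Rightarrow> 'g \<Rightarrow> 'p padic_int" where
  "DL [] f x = f x"
| "DL (h # hs) f x = DL hs f (x \<otimes> h) - DL hs f x"

lemma DL_append: "DL (as @ bs) f x = DL as (DL bs f) x"
  by (induction as arbitrary: x) simp_all

lemma DL_cong:
  "(\<And>y. y \<in> carrier G \<Longrightarrow> f y = f' y) \<Longrightarrow> set hs \<subseteq> carrier G \<Longrightarrow> x \<in> carrier G \<Longrightarrow> DL hs f x = DL hs f' x"
  by (induction hs arbitrary: x) simp_all

lemma DL_cmult: "DL hs (\<lambda>y. c * f y) x = c * DL hs f x"
  by (induction hs arbitrary: x) (simp_all add: right_diff_distrib)

lemma DL_norm_le:
  "(\<And>y. y \<in> carrier G \<Longrightarrow> padic_int_norm (f y) \<le> C) \<Longrightarrow> set hs \<subseteq> carrier G \<Longrightarrow> x \<in> carrier G \<Longrightarrow>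
    padic_int_norm (DL hs f x) \<le> C"
  by (induction hs arbitrary: x) (auto intro: padic_int_norm_diff_le)

lemma DL_one: "set as \<subseteq> carrier G \<Longrightarrow> x \<in> carrier G \<Longrightarrow> DL (as @ \<one> # bs) f x = 0"
  by (induction as arbitrary: x) simp_all

text \<open>In the group ring: hk - 1 = (h - 1) + (k - 1) + (h - 1)(k - 1).\<close>

lemma DL_mult:
  "h \<in> carrier G \<Longrightarrow> k \<in> carrier G \<Longrightarrow> set as \<subseteq> carrier G \<Longrightarrow> x \<in> carrier G \<Longrightarrow>
    DL (as @ (h \<otimes> k) # bs) f x = DL (as @ h # bs) f x + DL (as @ k # bs) f x + DL (as @ h # k # bs) f x"
  by (induction as arbitrary: x) (simp_all add: m_assoc)

text \<open>With c the commutator, (h - 1)(k - 1) - (k - 1)(h - 1) = hk - kh = (c - 1)kh, and kh = 1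
  + (kh - 1).\<close>

lemma DL_swap:
  assumes "h \<in> carrier G" "k \<in> carrier G"
  shows "set as \<subseteq> carrier G \<Longrightarrow> x \<in> carrier G \<Longrightarrow>
    DL (as @ h # k # bs) f x = DL (as @ k # h # bs) f x + DL (as @ group_commutator G h k # bs) f x
      + DL (as @ group_commutator G h k # (k \<otimes> h) # bs) f x"
proof (induction as arbitrary: x)
  case Nil
  have "x \<otimes> group_commutator G h k \<otimes> (k \<otimes> h) = x \<otimes> h \<otimes> k"
    using Nil assms commutator_mult[of h k] by (simp add: m_assoc)
  then show ?case using Nil assms by (simp add: m_assoc)
qed (simp add: algebra_simps)

lemma DL_right_translate:
  assumes u: "u \<in> carrier G"
  shows "set bs \<subseteq> carrier G \<Longrightarrow> x \<in> carrier G \<Longrightarrow>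
    DL bs f (x \<otimes> u) = DL (map (\<lambda>b. u \<otimes> b \<otimes> inv u) bs) (\<lambda>z. f (z \<otimes> u)) x"
proof (induction bs arbitrary: x)
  case (Cons b bs)
  have "DL bs f (x \<otimes> u \<otimes> b) = DL bs f (x \<otimes> (u \<otimes> b \<otimes> inv u) \<otimes> u)"
    using Cons.prems u by (simp add: m_assoc)
  then show ?case using Cons u by simp
qed simp

text \<open>The factor kh in (c - 1)kh is moved to the right end instead, which conjugates
  \<open>bs\<close> and translates \<open>f\<close>. The error is then a single list, shorter by
  one.\<close>

lemma DL_swap':
  assumes "h \<in> carrier G" "k \<in> carrier G" "set bs \<subseteq> carrier G"
  defines "u \<equiv> k \<otimes> h"
  shows "set as \<subseteq> carrier G \<Longrightarrow> x \<in> carrier G \<Longrightarrow>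
    DL (as @ h # k # bs) f x - DL (as @ k # h # bs) f x
      = DL (as @ group_commutator G h k # map (\<lambda>b. u \<otimes> b \<otimes> inv u) bs) (\<lambda>z. f (z \<otimes> u)) x"
proof (induction as arbitrary: x)
  case Nil
  have u: "u \<in> carrier G" using assms by simp
  have "x \<otimes> h \<otimes> k = (x \<otimes> group_commutator G h k) \<otimes> u"
    using Nil assms commutator_mult[of h k] by (simp add: m_assoc)
  moreover have "x \<otimes> k \<otimes> h = x \<otimes> u" using Nil assms by (simp add: m_assoc)
  ultimately show ?case
    using Nil assms(1-3) DL_right_translate[OF u assms(3), of _ f] by simp
qed (simp add: algebra_simps)

text \<open>The binomial expansion of h^n = (1 + (h - 1))^n in the group ring.\<close>

lemma DL_pow_expand:
  assumes "h \<in> carrier G"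
  shows "x \<in> carrier G \<Longrightarrow> f (x \<otimes> h [^] n) = (\<Sum>j\<le>n. of_nat (n choose j) * DL (replicate j h) f x)"
proof (induction n arbitrary: x)
  case (Suc n)
  let ?D = "\<lambda>j x. DL (replicate j h) f x"
  have D: "?D j (x \<otimes> h) = ?D (Suc j) x + ?D j x" for j by simp
  have "f (x \<otimes> h [^] Suc n) = f (x \<otimes> h \<otimes> h [^] n)"
    using Suc.prems assms by (simp add: m_assoc nat_pow_comm flip: nat_pow_Suc2)
  also have "\<dots> = (\<Sum>j\<le>n. of_nat (n choose j) * (?D (Suc j) x + ?D j x))"
    using Suc.IH[of "x \<otimes> h"] Suc.prems assms unfolding D by simp
  also have "\<dots> = (\<Sum>j\<le>n. of_nat (n choose j) * ?D (Suc j) x) + (\<Sum>j\<le>n. of_nat (n choose j) * ?D j x)"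
    by (simp only: distrib_left sum.distrib)
  also have "(\<Sum>j\<le>n. of_nat (n choose j) * ?D j x) = (\<Sum>j\<le>Suc n. of_nat (n choose j) * ?D j x)"
    by (simp add: binomial_eq_0)
  also have "\<dots> = ?D 0 x + (\<Sum>j\<le>n. of_nat (n choose Suc j) * ?D (Suc j) x)"
    by (subst sum.atMost_Suc_shift) simp
  also have "(\<Sum>j\<le>n. of_nat (n choose j) * ?D (Suc j) x) + \<dots>
      = ?D 0 x + (\<Sum>j\<le>n. of_nat (Suc n choose Suc j) * ?D (Suc j) x)"
    by (simp add: distrib_right sum.distrib add_ac)
  also have "\<dots> = (\<Sum>j\<le>Suc n. of_nat (Suc n choose j) * ?D j x)"
    by (subst sum.atMost_Suc_shift) simp
  finally show ?case .
qed simp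

lemma DL_pow:
  assumes h: "h \<in> carrier G"
  shows "set as \<subseteq> carrier G \<Longrightarrow> x \<in> carrier G \<Longrightarrow>
    DL (as @ (h [^] n) # bs) f x = (\<Sum>j\<in>{1..n}. of_nat (n choose j) * DL (as @ replicate j h @ bs) f x)"
proof (induction as arbitrary: x)
  case Nil
  have "{..n} = insert 0 {1..n}" by auto
  then show ?case
    using DL_pow_expand[OF h, of x "DL bs f" n] Nil by (simp add: DL_append)
qed (simp add: sum_subtractf right_diff_distrib)

primrec wt :: "'g list \<Rightarrow> real" where
  "wt [] = 1"
| "wt (h # hs) = nrm h * wt hs"

lemma wt_append [simp]: "wt (as @ bs) = wt as * wt bs"
  by (induction as) simp_all

lemma wt_nonneg [simp]: "0 \<le> wt hs"
  by (induction hs) simp_all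

lemma wt_replicate [simp]: "wt (replicate n h) = nrm h ^ n"
  by (induction n) simp_all

lemma wt_mset: "mset as = mset bs \<Longrightarrow> wt as = wt bs"
proof -
  have "wt hs = prod_mset (image_mset nrm (mset hs))" for hs by (induction hs) simp_all
  then show "mset as = mset bs \<Longrightarrow> wt as = wt bs" by simp
qed

subsection \<open>Differences of high weight are divisible by powers of p\<close>

text \<open>Modulo p^l the function \<open>F\<close> factors through the cosets xB of the ball B of
  radius \<mu>.\<close>

definition invar :: "real \<Rightarrow> nat \<Rightarrow> ('g \<Rightarrow> 'p padic_int) \<Rightarrow> bool" where
  "invar \<mu> l F \<longleftrightarrow> (\<forall>x\<in>carrier G. \<forall>y\<in>carrier G. nrm y \<le> \<mu> \<longrightarrow> padic_int_norm (F (x \<otimes> y) - F x) \<le> (1 / q) ^ l)"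

lemma invar_shift:
  assumes "invar \<mu> l F" "u \<in> carrier G"
  shows "invar \<mu> l (\<lambda>x. F (x \<otimes> u))"
  unfolding invar_def
proof (intro ballI impI)
  fix x y assume *: "x \<in> carrier G" "y \<in> carrier G" "nrm y \<le> \<mu>"
  have "x \<otimes> y \<otimes> u = (x \<otimes> u) \<otimes> (inv u \<otimes> y \<otimes> u)" using * assms by (simp add: m_assoc)
  moreover have "nrm (inv u \<otimes> y \<otimes> u) \<le> \<mu>" using nrm_conj_le'[of u y] * assms by simp
  ultimately show "padic_int_norm (F (x \<otimes> y \<otimes> u) - F (x \<otimes> u)) \<le> (1 / q) ^ l"
    using * assms unfolding invar_def by simp
qed

lemma invar_DL: "invar \<mu> l F \<Longrightarrow> set hs \<subseteq> carrier G \<Longrightarrow> invar \<mu> l (DL hs F)"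
proof (induction hs)
  case (Cons h hs)
  then have "invar \<mu> l (DL hs F)" by simp
  then have *: "invar \<mu> l (DL hs F)" "invar \<mu> l (\<lambda>x. DL hs F (x \<otimes> h))"
    using Cons.prems(2) by (auto intro: invar_shift)
  show ?case
    unfolding invar_def
  proof (intro ballI impI)
    fix x y assume "x \<in> carrier G" "y \<in> carrier G" "nrm y \<le> \<mu>"
    then have "padic_int_norm (DL hs F (x \<otimes> y \<otimes> h) - DL hs F (x \<otimes> h)) \<le> (1 / q) ^ l"
      "padic_int_norm (DL hs F (x \<otimes> y) - DL hs F x) \<le> (1 / q) ^ l"
      using * unfolding invar_def by blast+
    from padic_int_norm_diff_le[OF this]
    show "padic_int_norm (DL (h # hs) F (x \<otimes> y) - DL (h # hs) F x) \<le> (1 / q) ^ l"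
      by (simp add: algebra_simps)
  qed
next
  case Nil
  have "DL [] F = F" by (rule ext) simp
  then show ?case using Nil by simp
qed

lemma DL_small_element:
  assumes "invar \<mu> l F" "set hs \<subseteq> carrier G" "x \<in> carrier G" "h \<in> set hs" "nrm h \<le> \<mu>"
  shows "padic_int_norm (DL hs F x) \<le> (1 / q) ^ l"
proof -
  obtain as bs where hs: "hs = as @ h # bs" using assms(4) by (meson split_list)
  have "invar \<mu> l (DL bs F)" using assms hs by (intro invar_DL) auto
  then have "padic_int_norm (DL (h # bs) F y) \<le> (1 / q) ^ l" if "y \<in> carrier G" for y
    using assms that by (auto simp: invar_def)
  then show ?thesis unfolding hs DL_append by (rule DL_norm_le) (use assms hs in auto)
qed

lemma norm_power_q: "padic_int_norm x \<le> (1 / q) ^ l \<Longrightarrow> \<exists>y. x = of_nat CARD('p) ^ l * y"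
  for x :: "'p padic_int"
  using norm_le_power_iff by (auto elim: dvdE)

text \<open>Modulo p, (h - 1)^(p^e) is h^(p^e) - 1, as the inner binomial coefficients are divisible
  by p; and h^(p^e) lies in the ball under which \<open>F\<close> is invariant.\<close>

lemma DL_replicate_p_power:
  assumes h: "h \<in> carrier G" and e: "(1 / q) ^ e \<le> \<mu>" and x: "x \<in> carrier G" and F: "invar \<mu> 1 F"
  shows "padic_int_norm (DL (replicate (CARD('p) ^ e) h) F x) \<le> 1 / q"
proof -
  let ?n = "CARD('p) ^ e"
  have "{..?n} = insert 0 (insert ?n {0<..<?n})" by auto
  then have "F (x \<otimes> h [^] ?n) = F x + (DL (replicate ?n h) F x
      + (\<Sum>j\<in>{0<..<?n}. of_nat (?n choose j) * DL (replicate j h) F x))"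
    by (simp add: DL_pow_expand[OF h x])
  then have "DL (replicate ?n h) F x = (F (x \<otimes> h [^] ?n) - F x)
      - (\<Sum>j\<in>{0<..<?n}. of_nat (?n choose j) * DL (replicate j h) F x)"
    by simp
  moreover have "padic_int_norm (F (x \<otimes> h [^] ?n) - F x) \<le> 1 / q"
  proof -
    have "nrm (h [^] ?n) \<le> (1 / q) ^ e"
      using nrm_pow_p_power[OF h, of e] nrm_less_1[OF h] by (simp add: power_one_over divide_right_mono)
    then show ?thesis using F h x e unfolding invar_def by force
  qed
  moreover have "padic_int_norm (\<Sum>j\<in>{0<..<?n}. of_nat (?n choose j) * DL (replicate j h) F x) \<le> 1 / q"
  proof (rule padic_int_norm_sum_le)
    fix j assume j: "j \<in> {0<..<?n}"
    have jpos: "0 < padic_int_norm (of_nat j :: 'p padic_int)"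
      using j padic_int_norm_eq_0_iff[of "of_nat j :: 'p padic_int"] padic_int_norm_nonneg[of "of_nat j :: 'p padic_int"]
      by (auto simp: order_le_less)
    obtain v where v: "padic_int_norm (of_nat j :: 'p padic_int) = (1 / q) ^ v" "CARD('p) ^ v \<le> j"
      using padic_int_norm_of_nat_lower[of j, where 'p='p] j by auto
    have "v < e"
    proof (rule ccontr)
      assume "\<not> v < e"
      then have "?n \<le> CARD('p) ^ v" by (intro power_increasing) auto
      then show False using v(2) j by (auto simp del: power_increasing_iff)
    qed
    have "(1 / q) ^ v * padic_int_norm (of_nat (?n choose j) :: 'p padic_int) \<le> (1 / q) ^ e"
      using binomial_norm[of j ?n] j norm_p_power[of e] v(1) by simp
    also have "\<dots> \<le> (1 / q) ^ Suc v" using \<open>v < e\<close> by (intro power_decreasing) auto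
    finally have "padic_int_norm (of_nat (?n choose j) :: 'p padic_int) \<le> 1 / q"
      by (simp add: field_simps)
    then have "padic_int_norm (of_nat (?n choose j) * DL (replicate j h) F x) \<le> 1 / q * 1"
      unfolding padic_int_norm_mult by (intro mult_mono padic_int_norm_le_1) auto
    then show "padic_int_norm (of_nat (?n choose j) * DL (replicate j h) F x) \<le> 1 / q" by simp
  qed simp
  ultimately show ?thesis by (simp add: padic_int_norm_diff_le)
qed

lemma invar_mono: "invar \<mu> (Suc l) F \<Longrightarrow> invar \<mu> k F" if "k \<le> Suc l"
proof -
  have "(1 / q) ^ Suc l \<le> (1 / q) ^ k" using that by (intro power_decreasing) auto
  then show "invar \<mu> (Suc l) F \<Longrightarrow> invar \<mu> k F" unfolding invar_def using order_trans by blast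
qed

text \<open>Each block of p^e copies yields one factor p. Dividing it out costs one level of
  invariance, so l blocks can be treated.\<close>

lemma DL_replicate_power:
  assumes h: "h \<in> carrier G" and e: "(1 / q) ^ e \<le> \<mu>"
  shows "invar \<mu> l F \<Longrightarrow> x \<in> carrier G \<Longrightarrow> padic_int_norm (DL (replicate (l * CARD('p) ^ e) h) F x) \<le> (1 / q) ^ l"
proof (induction l arbitrary: F x)
  case 0
  then show ?case by (simp add: padic_int_norm_le_1)
next
  case (Suc l)
  let ?n = "CARD('p) ^ e" and ?p = "of_nat CARD('p) :: 'p padic_int"
  have "\<exists>y. DL (replicate ?n h) F z = ?p * y" if "z \<in> carrier G" for z
    using DL_replicate_p_power[OF h e that invar_mono[OF _ Suc.prems(1), of 1]]
      norm_power_q[of "DL (replicate ?n h) F z" 1] by simp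
  then obtain F' where F': "\<And>z. z \<in> carrier G \<Longrightarrow> DL (replicate ?n h) F z = ?p * F' z" by metis
  have norm_p: "padic_int_norm (?p * z) = padic_int_norm z / q" for z
    using norm_p_power[of 1] by (simp add: padic_int_norm_mult)
  have "invar \<mu> l F'"
    unfolding invar_def
  proof (intro ballI impI)
    fix x y assume *: "x \<in> carrier G" "y \<in> carrier G" "nrm y \<le> \<mu>"
    have "invar \<mu> (Suc l) (DL (replicate ?n h) F)" using Suc.prems h by (intro invar_DL) auto
    then have "padic_int_norm (DL (replicate ?n h) F (x \<otimes> y) - DL (replicate ?n h) F x) \<le> (1 / q) ^ Suc l"
      using * unfolding invar_def by blast
    then have "padic_int_norm (?p * (F' (x \<otimes> y) - F' x)) \<le> (1 / q) ^ Suc l"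
      using * by (simp add: F' right_diff_distrib)
    then show "padic_int_norm (F' (x \<otimes> y) - F' x) \<le> (1 / q) ^ l"
      unfolding norm_p by (simp add: field_simps)
  qed
  have "DL (replicate (Suc l * ?n) h) F x = DL (replicate (l * ?n) h) (DL (replicate ?n h) F) x"
    by (simp add: DL_append[symmetric] replicate_add[symmetric] add.commute)
  also have "\<dots> = ?p * DL (replicate (l * ?n) h) F' x"
    unfolding DL_cmult[symmetric] using F' h Suc.prems by (intro DL_cong) auto
  finally show ?case
    using Suc.IH[OF \<open>invar \<mu> l F'\<close> Suc.prems(2)] by (simp add: norm_p divide_right_mono)
qed

lemma DL_same_class:
  assumes F: "invar \<mu> l F" and h: "h \<in> carrier G"
  shows "set hs \<subseteq> carrier G \<Longrightarrow> (\<And>k. k \<in> set hs \<Longrightarrow> ceq \<mu> h k) \<Longrightarrow> x \<in> carrier G \<Longrightarrow>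
    padic_int_norm (DL hs F x - DL (replicate (length hs) h) F x) \<le> (1 / q) ^ l"
proof (induction hs arbitrary: x)
  case (Cons k hs)
  let ?A = "DL hs F" and ?B = "DL (replicate (length hs) h) F"
  have k: "k \<in> carrier G" using Cons.prems by simp
  have "invar \<mu> l ?A" using Cons.prems F by (intro invar_DL) auto
  moreover have "x \<otimes> k = (x \<otimes> h) \<otimes> (inv h \<otimes> k)" using k h Cons.prems by (simp add: m_assoc)
  moreover have "nrm (inv h \<otimes> k) \<le> \<mu>" using Cons.prems(2)[of k] by (simp add: ceq_def)
  ultimately have 1: "padic_int_norm (?A (x \<otimes> k) - ?A (x \<otimes> h)) \<le> (1 / q) ^ l"
    using k h Cons.prems(3) unfolding invar_def by simp
  have 2: "padic_int_norm (?A (x \<otimes> h) - ?B (x \<otimes> h)) \<le> (1 / q) ^ l"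
    using Cons h by (intro Cons.IH) auto
  have 3: "padic_int_norm (?A x - ?B x) \<le> (1 / q) ^ l" using Cons by (intro Cons.IH) auto
  have "DL (k # hs) F x - DL (replicate (length (k # hs)) h) F x
      = ((?A (x \<otimes> k) - ?A (x \<otimes> h)) + (?A (x \<otimes> h) - ?B (x \<otimes> h))) - (?A x - ?B x)"
    by simp
  then show ?case using padic_int_norm_diff_le[OF padic_int_norm_add_le[OF 1 2] 3] by (simp only:)
qed simp

text \<open>A finite set of labels: elements with equal coordinate residues are congruent modulo the
  ball of radius p^(-e).\<close>

definition cls :: "nat \<Rightarrow> 'g \<Rightarrow> nat \<Rightarrow> int" where
  "cls e h = (\<lambda>i\<in>{..<d}. padic_residue (X i h) e)"

lemma finite_cls: "finite (range (cls e))"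
proof (rule finite_subset)
  show "range (cls e) \<subseteq> PiE {..<d} (\<lambda>_. {0..<int CARD('p) ^ e})"
  proof (rule image_subsetI)
    show "cls e h \<in> PiE {..<d} (\<lambda>_. {0..<int CARD('p) ^ e})" for h
      unfolding cls_def restrict_PiE_iff by (simp add: padic_residue_bounds)
  qed
qed (intro finite_PiE; simp)

lemma cls_eq_imp_ceq:
  assumes "h \<in> carrier G" "k \<in> carrier G" "cls e h = cls e k"
  shows "ceq ((1 / q) ^ e) h k"
proof -
  have "ceq ((1 / q) ^ e) (E (\<lambda>i. X i h)) (E (\<lambda>i. X i k))"
  proof (subst ceq_E_iff, simp, intro allI impI)
    fix i assume i: "i < d"
    have eq: "padic_residue (X i h) e = padic_residue (X i k) e"
      using fun_cong[OF assms(3), of i] i by (simp add: cls_def)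
    have "padic_int_norm (X i k - X i h) \<le> (1 / q) ^ e"
      using padic_int_norm_diff_le[OF residue_approx[of "X i k" e] residue_approx[of "X i h" e]] by (simp add: eq)
    then have "nrm (g i) * padic_int_norm (X i k - X i h) \<le> 1 * (1 / q) ^ e"
      using nrm_less_1[OF g_closed[OF i]] by (intro mult_mono) auto
    then show "nrm (g i) * padic_int_norm (X i k - X i h) \<le> (1 / q) ^ e" by simp
  qed
  then show ?thesis using assms by simp
qed

lemma pigeonhole_list:
  assumes "finite C" "\<And>h. h \<in> set hs \<Longrightarrow> c h \<in> C" "card C * M < length hs"
  shows "\<exists>k\<in>C. M < length (filter (\<lambda>h. c h = k) hs)"
proof (rule ccontr)
  assume "\<not> ?thesis"
  then have le: "length (filter (\<lambda>h. c h = k) hs) \<le> M" if "k \<in> C" for k using that by (simp add: not_less)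
  have "length hs = (\<Sum>k\<in>C. length (filter (\<lambda>h. c h = k) hs))"
    using assms(2)
  proof (induction hs)
    case (Cons h hs)
    have "(\<Sum>k\<in>C. length (filter (\<lambda>h. c h = k) (h # hs)))
        = (\<Sum>k\<in>C. length (filter (\<lambda>h. c h = k) hs) + (if k = c h then 1 else 0))"
      by (rule sum.cong) auto
    then show ?case using Cons assms(1) by (simp add: sum.distrib)
  qed simp
  also have "\<dots> \<le> (\<Sum>k\<in>C. M)" using le by (intro sum_mono)
  finally show False using assms(3) by simp
qed

lemma mset_filter_append: "mset (filter c hs @ filter (\<lambda>h. \<not> c h) hs) = mset hs"
  by (induction hs) simp_all

text \<open>If no entry lies in the ball, small weight forces a long list, which by pigeonhole has
  many congruent entries; brought together they yield p^l. Bringing them together costs, for every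
  swap, a shorter list of no larger weight, which induction on the length covers.\<close>

lemma DL_high_weight:
  assumes \<mu>: "0 < \<mu>" "\<mu> < 1"
  obtains t where "0 < t" "\<And>F hs x. invar \<mu> l F \<Longrightarrow> set hs \<subseteq> carrier G \<Longrightarrow> wt hs \<le> t \<Longrightarrow> x \<in> carrier G \<Longrightarrow>
    padic_int_norm (DL hs F x) \<le> (1 / q) ^ l"
proof -
  obtain e where "(1 / q) ^ e < \<mu>" using p_small[OF \<mu>(1)] by blast
  then have e: "(1 / q) ^ e \<le> \<mu>" by simp
  \<comment> \<open>\<open>M\<close> congruent entries give l factors p, and among \<open>K\<close>
    entries there are more than \<open>M\<close> in one class.\<close>
  define M where "M = l * CARD('p) ^ e"
  define K where "K = Suc (card (range (cls e)) * M)"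
  have main: "padic_int_norm (DL hs F x) \<le> (1 / q) ^ l"
    if "length hs = n" "invar \<mu> l F" "set hs \<subseteq> carrier G" "wt hs \<le> \<mu> ^ K" "x \<in> carrier G" for n F hs x
    using that
  proof (induction n arbitrary: F hs x)
    case 0
    then have "1 \<le> \<mu> ^ K" by simp
    moreover have "\<mu> ^ K < 1" using \<mu> by (simp add: K_def power_less_one_iff del: power_Suc)
    ultimately show ?case by simp
  next
    case (Suc n)
    show ?case
    proof (cases "\<exists>h\<in>set hs. nrm h \<le> \<mu>")
      case True
      then show ?thesis using DL_small_element Suc.prems by blast
    next
      case False
      have "\<mu> ^ length hs \<le> wt hs"
        using False
      proof (induction hs)
        case (Cons h hs)
        then have "\<mu> ^ length hs \<le> wt hs" "\<mu> \<le> nrm h" by auto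
        then show ?case using \<mu> by (auto intro: mult_mono)
      qed simp
      then have "\<mu> ^ length hs \<le> \<mu> ^ K" using Suc.prems(4) by linarith
      then have "K \<le> length hs" using \<mu> by (simp add: power_decreasing_iff)
      then have "card (range (cls e)) * M < length hs" by (simp add: K_def)
      from pigeonhole_list[OF finite_cls _ this, of "cls e"]
      obtain c where c: "M < length (filter (\<lambda>h. cls e h = c) hs)" by auto
      let ?P = "\<lambda>h. cls e h = c"
      define us where "us = take M (filter ?P hs)"
      define vs where "vs = drop M (filter ?P hs) @ filter (\<lambda>h. \<not> ?P h) hs"
      have uv: "us @ vs = filter ?P hs @ filter (\<lambda>h. \<not> ?P h) hs" by (simp add: us_def vs_def)
      have len: "length us = M" using c by (simp add: us_def)
      have us: "set us \<subseteq> set (filter ?P hs)" unfolding us_def by (rule set_take_subset)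
      have mset_uv: "mset (us @ vs) = mset hs" unfolding uv by (rule mset_filter_append)
      then have set_uv: "set us \<subseteq> carrier G" "set vs \<subseteq> carrier G"
        using Suc.prems(3) mset_eq_setD[OF mset_uv] by auto
      have "filter ?P hs \<noteq> []" using c by auto
      then obtain h where h: "h \<in> set hs" "cls e h = c" by (auto simp: filter_empty_conv)
      then have hG: "h \<in> carrier G" using Suc.prems(3) by blast
      have "invar \<mu> l (DL vs F)" using Suc.prems(2) set_uv by (intro invar_DL)
      moreover have "ceq \<mu> h k" if "k \<in> set us" for k
      proof -
        have "k \<in> carrier G" "cls e h = cls e k" using that us h set_uv(1) by auto
        from cls_eq_imp_ceq[OF hG this] e show ?thesis unfolding ceq_def by linarith
      qed
      ultimately have "padic_int_norm (DL us (DL vs F) x - DL (replicate (length us) h) (DL vs F) x) \<le> (1 / q) ^ l"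
        using set_uv(1) hG Suc.prems(5) by (intro DL_same_class) auto
      moreover have "padic_int_norm (DL (replicate (length us) h) (DL vs F) x) \<le> (1 / q) ^ l"
        unfolding len M_def using \<open>invar \<mu> l (DL vs F)\<close> hG Suc.prems(5) by (intro DL_replicate_power[OF _ e])
      ultimately have 1: "padic_int_norm (DL (us @ vs) F x) \<le> (1 / q) ^ l"
        using padic_int_norm_add_le by (fastforce simp: DL_append)
      have "padic_int_norm (DL hs F x - DL (us @ vs) F x) \<le> (1 / q) ^ l"
      proof (rule mset_eq_swap_induct[of "\<lambda>as bs. padic_int_norm (DL as F x - DL bs F x) \<le> (1 / q) ^ l"])
        fix as bs cs assume "padic_int_norm (DL as F x - DL bs F x) \<le> (1 / q) ^ l"
          "padic_int_norm (DL bs F x - DL cs F x) \<le> (1 / q) ^ l"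
        from padic_int_norm_add_le[OF this] show "padic_int_norm (DL as F x - DL cs F x) \<le> (1 / q) ^ l" by simp
      next
        fix as a b bs assume eq: "mset (as @ a # b # bs) = mset hs"
        have c: "a \<in> carrier G" "b \<in> carrier G" "set as \<subseteq> carrier G" "set bs \<subseteq> carrier G"
          using Suc.prems(3) mset_eq_setD[OF eq] by auto
        \<comment> \<open>The form \<open>DL_swap'\<close> is used: invariance survives translation
          of the function, the induction ranges over all \<open>F\<close>, and conjugation does not
          raise the weight.\<close>
        let ?u = "b \<otimes> a"
        let ?bs = "map (\<lambda>x. ?u \<otimes> x \<otimes> inv ?u) bs"
        have "wt ?bs \<le> wt bs"
          using c(4) nrm_conj_le[of ?u] c(1,2) by (induction bs) (auto intro!: mult_mono)
        then have "wt (as @ group_commutator G a b # ?bs) \<le> wt (as @ a # b # bs)"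
        proof -
          have "nrm (group_commutator G a b) * wt ?bs \<le> (nrm a * nrm b) * wt bs"
            using nrm_commutator[OF c(1,2)] \<open>wt ?bs \<le> wt bs\<close> by (intro mult_mono) auto
          then show ?thesis by (simp add: mult_left_mono mult.assoc)
        qed
        also have "\<dots> \<le> \<mu> ^ K" using wt_mset[OF eq] Suc.prems(4) by simp
        finally have w: "wt (as @ group_commutator G a b # ?bs) \<le> \<mu> ^ K" .
        have "length (as @ group_commutator G a b # ?bs) = n"
          using Suc.prems(1) mset_eq_length[OF eq] by simp
        moreover have "invar \<mu> l (\<lambda>z. F (z \<otimes> ?u))" using Suc.prems(2) c by (intro invar_shift) auto
        ultimately show "padic_int_norm (DL (as @ a # b # bs) F x - DL (as @ b # a # bs) F x) \<le> (1 / q) ^ l"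
          unfolding DL_swap'[OF c(1,2,4,3) Suc.prems(5)]
          using w c Suc.prems(5) by (intro Suc.IH) auto
      qed (use mset_uv in simp_all)
      from padic_int_norm_add_le[OF this 1] show ?thesis by simp
    qed
  qed
  show ?thesis using that[of "\<mu> ^ K"] main \<mu> by simp
qed

end

context p_valued_basis
begin

subsection \<open>The main estimate\<close>

lemma wt_ctx:
  assumes "b * wt vs \<le> c * (a * wt us)"
  shows "b * wt (as @ vs @ bs) \<le> c * (a * wt (as @ us @ bs))"
proof -
  have "(b * wt vs) * (wt as * wt bs) \<le> (c * (a * wt us)) * (wt as * wt bs)"
    by (rule mult_right_mono[OF assms]) simp
  then show ?thesis by (simp add: mult_ac)
qed

lemma foldr_mult_right:
  "(\<And>i. i \<in> set is \<Longrightarrow> f i \<in> carrier G) \<Longrightarrow> z \<in> carrier G \<Longrightarrow> w \<in> carrier G \<Longrightarrow>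
    foldr (\<lambda>i y. f i \<otimes> y) is z \<in> carrier G \<and>
    foldr (\<lambda>i y. f i \<otimes> y) is z \<otimes> w = foldr (\<lambda>i y. f i \<otimes> y) is (z \<otimes> w)"
  by (induction "is") (auto simp: m_assoc)

lemma foldr_mult_one:
  "(\<And>i. i \<in> set is \<Longrightarrow> f i = \<one>) \<Longrightarrow> foldr (\<lambda>i y. f i \<otimes> y) is \<one> = \<one>"
  by (induction "is") auto

lemma E_mult_g:
  assumes j: "j < d" and n: "\<And>k. j < k \<Longrightarrow> k < d \<Longrightarrow> n k = 0"
  shows "E (\<lambda>i. of_nat (n i)) \<otimes> g j = E (\<lambda>i. of_nat ((n(j := Suc (n j))) i))"
proof -
  have split: "[0..<d] = [0..<j] @ j # [Suc j..<d]"
    using upt_add_eq_append[of 0 j "d - j"] upt_conv_Cons[OF j] j by simp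
  have E: "E (\<lambda>i. of_nat (m i)) = foldr (\<lambda>i y. g i [^] m i \<otimes> y) [0..<j] (g j [^] m j)"
    if m: "\<And>k. j < k \<Longrightarrow> k < d \<Longrightarrow> m k = 0" for m :: "nat \<Rightarrow> nat"
  proof -
    have "foldr (\<lambda>i y. g i [^] m i \<otimes> y) [Suc j..<d] \<one> = \<one>"
      using m by (intro foldr_mult_one) auto
    then show ?thesis unfolding E_of_nat split using j by simp
  qed
  have "E (\<lambda>i. of_nat (n i)) \<otimes> g j = foldr (\<lambda>i y. g i [^] n i \<otimes> y) [0..<j] (g j [^] n j \<otimes> g j)"
    using foldr_mult_right[of "[0..<j]" "\<lambda>i. g i [^] n i" "g j [^] n j" "g j"] E[of n] n j by simp
  also have "\<dots> = foldr (\<lambda>i y. g i [^] (n(j := Suc (n j))) i \<otimes> y) [0..<j] (g j [^] (n(j := Suc (n j))) j)"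
    by (intro foldr_cong) auto
  also have "\<dots> = E (\<lambda>i. of_nat ((n(j := Suc (n j))) i))"
    using n by (intro E[symmetric]) auto
  finally show ?thesis .
qed

text \<open>In basis order, right multiplication by \<open>g j\<close> just raises the j-th exponent
  while the later ones vanish. Along such a path \<open>X i\<close> is linear in the exponents, so
  only the single difference along \<open>g i\<close> survives.\<close>

lemma DL_basis_sorted:
  assumes i: "i < d"
  shows "sorted js \<Longrightarrow> set js \<subseteq> {..<d} \<Longrightarrow> (\<And>j k. j \<in> set js \<Longrightarrow> j < k \<Longrightarrow> k < d \<Longrightarrow> n k = 0) \<Longrightarrow>
    DL (map g js) (X i) (E (\<lambda>i. of_nat (n i)))
      = (if js = [] then of_nat (n i) else if js = [i] then 1 else 0)"
proof (induction js arbitrary: n)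
  case (Cons j js)
  have j: "j < d" using Cons.prems by simp
  have mult: "E (\<lambda>i. of_nat (n i)) \<otimes> g j = E (\<lambda>i. of_nat ((n(j := Suc (n j))) i))"
    using Cons.prems(3) j by (intro E_mult_g) auto
  have IH: "DL (map g js) (X i) (E (\<lambda>i. of_nat (m i)))
      = (if js = [] then of_nat (m i) else if js = [i] then 1 else 0)"
    if "m = n \<or> m = n(j := Suc (n j))" for m
  proof (rule Cons.IH)
    show "sorted js" "set js \<subseteq> {..<d}" using Cons.prems by auto
    fix a k assume a: "a \<in> set js" "a < k" "k < d"
    then have "j \<le> a" using Cons.prems(1) by simp
    then show "m k = 0" using that a Cons.prems(3)[of a k] by auto
  qed
  have "DL (map g (j # js)) (X i) (E (\<lambda>i. of_nat (n i)))
      = DL (map g js) (X i) (E (\<lambda>i. of_nat ((n(j := Suc (n j))) i))) - DL (map g js) (X i) (E (\<lambda>i. of_nat (n i)))"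
    by (simp only: list.map DL.simps mult)
  also have "\<dots> = (if j # js = [] then of_nat (n i) else if j # js = [i] then 1 else 0)"
    by (subst (1 2) IH) auto
  finally show ?case .
qed (use i in simp)

text \<open>One step from the weight (\<eta>/\<kappa>) t up to t. The list is rewritten in sorted
  basis elements; every error is either shorter or light enough for \<open>small\<close>. The scalar
  \<open>a\<close> belongs to the statement because the k-th power of \<open>g j\<close> contributes
  k times the difference along \<open>g j\<close>, and only together with the factor k does this
  have the weight of the power.\<close>

lemma estimate_step:
  assumes i: "i < d" and t: "0 < t"
    and \<eta>: "0 < \<eta>" "\<eta> < \<kappa>" "\<And>h. h \<in> carrier G \<Longrightarrow> nrm h \<le> \<eta>"
    and B: "t / nrm (g i) \<le> B"
    and small: "\<And>a hs. set hs \<subseteq> carrier G \<Longrightarrow> padic_int_norm a * wt hs \<le> \<eta> / \<kappa> * t \<Longrightarrow>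
      padic_int_norm (a * DL hs (X i) \<one>) \<le> B"
  shows "set hs \<subseteq> carrier G \<Longrightarrow> padic_int_norm a * wt hs \<le> t \<Longrightarrow> padic_int_norm (a * DL hs (X i) \<one>) \<le> B"
proof (induction "length hs" arbitrary: a hs)
  case 0
  have "0 \<le> B" using B t nrm_g_pos[OF i] by (meson divide_nonneg_nonneg less_imp_le order_trans)
  then show ?case using 0 i by simp
next
  case (Suc m)
  let ?N = padic_int_norm and ?D = "\<lambda>hs. DL hs (X i) \<one>" and ?\<theta> = "\<eta> / \<kappa>"
  have B0: "0 \<le> B" using B t nrm_g_pos[OF i] by (meson divide_nonneg_nonneg less_imp_le order_trans)
  have \<theta>: "0 < ?\<theta>" "?\<theta> < 1" "\<eta> \<le> ?\<theta>" using \<eta> \<kappa> by (auto simp: field_simps)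
  have small': "?N (b * ?D (as @ vs @ bs)) \<le> B"
    if "?N c * wt (as @ us @ bs) \<le> t" "?N b * wt vs \<le> ?\<theta> * (?N c * wt us)" "set (as @ vs @ bs) \<subseteq> carrier G" for as vs us bs b c
  proof (rule small[OF that(3)])
    have "?N b * wt (as @ vs @ bs) \<le> ?\<theta> * (?N c * wt (as @ us @ bs))" by (rule wt_ctx[OF that(2)])
    also have "\<dots> \<le> ?\<theta> * t" using that(1) \<theta> by (intro mult_left_mono) auto
    finally show "?N b * wt (as @ vs @ bs) \<le> ?\<theta> * t" .
  qed
  \<comment> \<open>In the two error terms of \<open>DL_swap\<close>, the first is shorter by one,
    and the second has the extra factor kh of norm at most \<eta> \<le> \<eta>/\<kappa>.\<close>
  have swap: "?N (a * ?D (as @ h # k # bs) - a * ?D (as @ k # h # bs)) \<le> B"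
    if c: "h \<in> carrier G" "k \<in> carrier G" "set as \<subseteq> carrier G" "set bs \<subseteq> carrier G"
      and len: "Suc m = length (as @ h # k # bs)" and w: "?N a * wt (as @ h # k # bs) \<le> t" for as bs h k a
  proof -
    let ?c = "group_commutator G h k"
    have nc: "nrm ?c \<le> nrm h * nrm k" using nrm_commutator[OF c(1,2)] .
    have "?N a * wt (as @ [?c] @ bs) \<le> 1 * (?N a * wt (as @ [h, k] @ bs))"
      using nc by (intro wt_ctx) (simp add: mult_left_mono)
    then have 1: "?N (a * ?D (as @ [?c] @ bs)) \<le> B"
      using c len w by (intro Suc.hyps(1)) auto
    have w': "?N a * wt (as @ [h, k] @ bs) \<le> t" using w by simp
    have "nrm ?c * nrm (k \<otimes> h) \<le> (nrm h * nrm k) * ?\<theta>"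
      using nc \<eta>(3)[of "k \<otimes> h"] \<theta>(3) c by (intro mult_mono) auto
    then have "?N a * (nrm ?c * nrm (k \<otimes> h)) \<le> ?N a * ((nrm h * nrm k) * ?\<theta>)"
      by (intro mult_left_mono) auto
    then have 2: "?N (a * ?D (as @ [?c, k \<otimes> h] @ bs)) \<le> B"
      using c by (intro small'[OF w']) (auto simp: mult_ac)
    have "a * ?D (as @ h # k # bs) - a * ?D (as @ k # h # bs) = a * ?D (as @ [?c] @ bs) + a * ?D (as @ [?c, k \<otimes> h] @ bs)"
      using DL_swap[OF c(1,2,3) one_closed, of bs "X i"] by (simp add: algebra_simps)
    then show ?thesis using padic_int_norm_add_le[OF 1 2] by simp
  qed
  have basis_list: "?N (a * ?D (map g js)) \<le> B"
    if "Suc m = length js" "set js \<subseteq> {..<d}" "?N a * wt (map g js) \<le> t" for js a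
  proof -
    have "?N (a * ?D (map g js) - a * ?D (map g (sort js))) \<le> B"
    proof (rule mset_eq_swap_induct[of "\<lambda>js ks. ?N (a * ?D (map g js) - a * ?D (map g ks)) \<le> B"])
      fix xs ys zs assume "?N (a * ?D (map g xs) - a * ?D (map g ys)) \<le> B" "?N (a * ?D (map g ys) - a * ?D (map g zs)) \<le> B"
      from padic_int_norm_add_le[OF this] show "?N (a * ?D (map g xs) - a * ?D (map g zs)) \<le> B" by simp
    next
      fix us x y vs assume eq: "mset (us @ x # y # vs) = mset js"
      have set: "x < d" "y < d" "set us \<subseteq> {..<d}" "set vs \<subseteq> {..<d}"
        using mset_eq_setD[OF eq] that(2) by auto
      have "wt (map g (us @ x # y # vs)) = wt (map g js)"
        by (rule wt_mset) (simp only: mset_map eq)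
      moreover have "g ` set us \<subseteq> carrier G" "g ` set vs \<subseteq> carrier G" using set by auto
      ultimately show "?N (a * ?D (map g (us @ x # y # vs)) - a * ?D (map g (us @ y # x # vs))) \<le> B"
        using swap[of "g x" "g y" "map g us" "map g vs" a] set that mset_eq_length[OF eq] by auto
    qed (use B0 in simp_all)
    moreover have "?N (a * ?D (map g (sort js))) \<le> B"
    proof -
      have D: "?D (map g (sort js)) = (if sort js = [] then 0 else if sort js = [i] then 1 else 0)"
        using DL_basis_sorted[OF i, of "sort js" "\<lambda>_. 0"] that(2) by (simp add: E_0)
      show ?thesis
      proof (cases "sort js = [i]")
        case True
        then have "js = [i]" by (metis length_sort mset_sort mset_single_iff mset.simps(1,2) add_mset_add_single)
        then have "?N a \<le> t / nrm (g i)" using that(3) nrm_g_pos[OF i] by (simp add: le_divide_eq)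
        moreover have "?D (map g (sort js)) = 1" using D True by simp
        ultimately show ?thesis using B by (simp only: mult_1_right)
      qed (use B0 in \<open>simp add: D\<close>)
    qed
    ultimately show ?thesis using padic_int_norm_add_le by fastforce
  qed
  \<comment> \<open>The right part of the list already consists of basis elements. The last entry of
    the left part is expanded in the basis, so that the left part shrinks.\<close>
  have general: "?N (a * ?D (us @ map g js)) \<le> B"
    if "Suc m = length us + length js" "set us \<subseteq> carrier G" "set js \<subseteq> {..<d}" "?N a * wt (us @ map g js) \<le> t" for us js a
    using that
  proof (induction us arbitrary: js a rule: rev_induct)
    case Nil
    then show ?case using basis_list by simp
  next
    case (snoc h us)
    let ?js = "map g js"
    have c: "h \<in> carrier G" "set us \<subseteq> carrier G" "set ?js \<subseteq> carrier G" using snoc.prems by auto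
    define \<nu> where "\<nu> = nrm h"
    have "0 \<le> \<nu>" by (simp add: \<nu>_def)
    have w: "?N a * wt (us @ [h] @ ?js) \<le> t" using snoc.prems by simp
    have power: "?N (a * ?D (us @ [g j [^] k] @ ?js)) \<le> B"
      if j: "j < d" and k: "nrm (g j) * ?N (of_nat k :: 'p padic_int) \<le> \<nu>" for j k
    proof -
      have gj: "g j \<in> carrier G" using j by simp
      have "?N (a * (of_nat (k choose l) * ?D (us @ replicate l (g j) @ ?js))) \<le> B" if l: "l \<in> {1..k}" for l
      proof (cases "l = 1")
        case True
        \<comment> \<open>The linear term: once k is moved into the scalar, the weight is at most
          the one before.\<close>
        have "?N (a * of_nat k) * wt (us @ [g j] @ ?js) \<le> 1 * (?N a * wt (us @ [h] @ ?js))"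
          using k by (intro wt_ctx) (simp add: padic_int_norm_mult mult_ac \<nu>_def mult_left_mono)
        then have "?N (a * of_nat k * ?D (us @ map g (j # js))) \<le> B"
          using snoc.prems w j by (intro snoc.IH) auto
        then show ?thesis using True by (simp add: mult.assoc)
      next
        case False
        then obtain l' where l': "l = Suc (Suc l')" using l by (cases l; cases "l - 1") auto
        \<comment> \<open>For l \<ge> 2 the bounds |l| \<ge> \<kappa>^(l-1) and |l| |k choose l|
          \<le> |k| leave the factor (\<eta>/\<kappa>)^(l-1), hence at least one gain.\<close>
        have "?N (of_nat (k choose l) :: 'p padic_int) * nrm (g j) ^ l \<le> ?\<theta> * \<nu>"
        proof -
          let ?C = "?N (of_nat (k choose l) :: 'p padic_int)"
          have "nrm (g j) ^ (l - 1) \<le> \<eta> ^ (l - 1)" using \<eta>(3)[OF gj] by (intro power_mono) auto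
          also have "\<dots> = ?\<theta> ^ (l - 1) * \<kappa> ^ (l - 1)" using \<kappa> by (simp add: power_divide)
          also have "\<dots> \<le> ?\<theta> ^ 1 * \<kappa> ^ (l - 1)"
            using \<theta> \<kappa> l' by (intro mult_right_mono power_decreasing) auto
          also have "\<dots> \<le> ?\<theta> * ?N (of_nat l :: 'p padic_int)"
            using mult_left_mono[OF of_nat_norm_lower[of l] less_imp_le[OF \<theta>(1)]] l by simp
          finally have *: "nrm (g j) ^ (l - 1) \<le> ?\<theta> * ?N (of_nat l :: 'p padic_int)" .
          have "?C * nrm (g j) ^ l = ?C * nrm (g j) ^ (l - 1) * nrm (g j)" by (simp add: l')
          also have "\<dots> \<le> ?C * (?\<theta> * ?N (of_nat l :: 'p padic_int)) * nrm (g j)"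
            by (intro mult_right_mono mult_left_mono *) auto
          also have "\<dots> = ?\<theta> * (?N (of_nat l :: 'p padic_int) * ?C) * nrm (g j)" by (simp add: mult_ac)
          also have "\<dots> \<le> ?\<theta> * ?N (of_nat k :: 'p padic_int) * nrm (g j)"
            using binomial_norm[of l k] l \<theta> by (intro mult_right_mono mult_left_mono) auto
          also have "\<dots> \<le> ?\<theta> * \<nu>"
            using mult_left_mono[OF k less_imp_le[OF \<theta>(1)]] by (simp only: mult.commute mult.left_commute)
          finally show ?thesis .
        qed
        then have "?N (a * of_nat (k choose l)) * wt (replicate l (g j)) \<le> ?\<theta> * (?N a * wt [h])"
          using mult_left_mono[of _ _ "?N a"] by (fastforce simp: padic_int_norm_mult mult_ac \<nu>_def)
        then have "?N (a * of_nat (k choose l) * ?D (us @ replicate l (g j) @ ?js)) \<le> B"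
          using c gj by (intro small'[OF w]) auto
        then show ?thesis by (simp add: mult.assoc)
      qed
      then have "?N (\<Sum>l\<in>{1..k}. a * (of_nat (k choose l) * ?D (us @ replicate l (g j) @ ?js))) \<le> B"
        using B0 by (intro padic_int_norm_sum_le)
      then show ?thesis
        using DL_pow[OF gj c(2) one_closed, of k ?js "X i"] by (simp add: sum_distrib_left)
    qed
    have cross: "?N (a * ?D (us @ [u, v] @ ?js)) \<le> B"
      if "u \<in> carrier G" "v \<in> carrier G" "nrm u * nrm v \<le> ?\<theta> * \<nu>" for u v
      using that c mult_left_mono[OF that(3), of "?N a"]
      by (intro small'[OF w]) (auto simp: \<nu>_def mult_ac)
    have product: "?N (a * ?D (us @ [foldr (\<lambda>j y. g j [^] n j \<otimes> y) js' \<one>] @ ?js)) \<le> B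
        \<and> nrm (foldr (\<lambda>j y. g j [^] n j \<otimes> y) js' \<one>) \<le> \<nu>"
      if "set js' \<subseteq> {..<d}" "\<And>j. j \<in> set js' \<Longrightarrow> nrm (g j) * ?N (of_nat (n j) :: 'p padic_int) \<le> \<nu>" for js' n
      using that
    proof (induction js')
      case Nil
      then show ?case using DL_one[OF c(2) one_closed, of ?js "X i"] B0 \<open>0 \<le> \<nu>\<close> by simp
    next
      case (Cons j js')
      let ?u = "g j [^] n j" and ?v = "foldr (\<lambda>j y. g j [^] n j \<otimes> y) js' \<one>"
      have j: "j < d" using Cons.prems by simp
      have uv: "?u \<in> carrier G" "?v \<in> carrier G" using Cons.prems by (auto intro!: foldr_mult_closed)
      have nu: "nrm ?u \<le> \<nu>" using Cons.prems(2)[of j] nrm_pw[OF j, of "of_nat (n j)"] pw_of_nat[OF j, of "n j"] by simp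
      have IH: "?N (a * ?D (us @ [?v] @ ?js)) \<le> B" "nrm ?v \<le> \<nu>" using Cons by auto
      have "nrm ?u * nrm ?v \<le> ?\<theta> * \<nu>"
        using IH(2) \<eta>(3)[OF uv(1)] \<theta>(3) \<theta>(1) by (intro mult_mono) auto
      then have 3: "?N (a * ?D (us @ [?u, ?v] @ ?js)) \<le> B" using uv by (intro cross)
      have "a * ?D (us @ [?u \<otimes> ?v] @ ?js) = a * ?D (us @ [?u] @ ?js) + a * ?D (us @ [?v] @ ?js) + a * ?D (us @ [?u, ?v] @ ?js)"
        using DL_mult[OF uv c(2) one_closed, of ?js "X i"] by (simp add: distrib_left)
      then show ?case
        using padic_int_norm_add_le[OF padic_int_norm_add_le[OF power IH(1)] 3] j Cons.prems(2)[of j]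
          nrm_mult_le[OF uv nu IH(2)] by simp
    qed
    \<comment> \<open>Natural exponents approximate \<open>h\<close> up to an error \<open>y\<close>
      that falls under \<open>small\<close>. For \<open>h\<close> = 1 the required precision would
      be 0, so this case is separate.\<close>
    obtain n y where ny: "y \<in> carrier G" "h = E (\<lambda>i. of_nat (n i)) \<otimes> y" "nrm y \<le> ?\<theta> * \<nu>"
    proof (cases "\<nu> = 0")
      case True
      then have "h = \<one>" using c by (simp add: \<nu>_def)
      then show ?thesis using that[of \<one> "\<lambda>_. 0"] True by (simp add: E_0)
    next
      case False
      then have "0 < \<nu>" using \<open>0 \<le> \<nu>\<close> by simp
      with \<theta>(1) have "0 < ?\<theta> * \<nu>" by (rule mult_pos_pos)
      then obtain n where "ceq (?\<theta> * \<nu>) (E (\<lambda>i. of_nat (n i))) h" using nat_approx[OF c(1)] by blast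
      then show ?thesis using that[of "inv (E (\<lambda>i. of_nat (n i))) \<otimes> h" n] c by (simp add: ceq_def)
    qed
    let ?u = "E (\<lambda>i. of_nat (n i))"
    have "?u = h \<otimes> inv y" using ny c by (simp add: m_assoc)
    moreover have "nrm y \<le> \<nu>"
      using order_trans[OF ny(3) mult_right_mono[OF less_imp_le[OF \<theta>(2)] \<open>0 \<le> \<nu>\<close>]] by simp
    ultimately have nu: "nrm ?u \<le> \<nu>" using nrm_mult_le[of h "inv y" \<nu>] c ny(1) by (simp add: \<nu>_def)
    have "nrm (g j) * ?N (of_nat (n j) :: 'p padic_int) \<le> \<nu>" if "j < d" for j
      by (rule nrm_E_le_iff[OF \<open>0 \<le> \<nu>\<close>, THEN iffD1, OF nu, rule_format, OF that])
    then have 1: "?N (a * ?D (us @ [?u] @ ?js)) \<le> B"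
      using product[of "[0..<d]" n] unfolding E_of_nat by (simp add: lessThan_atLeast0)
    have "?N a * wt [y] \<le> ?\<theta> * (?N a * wt [h])"
      using mult_left_mono[OF ny(3), of "?N a"] by (simp add: \<nu>_def mult_ac)
    then have 2: "?N (a * ?D (us @ [y] @ ?js)) \<le> B" using c ny by (intro small'[OF w]) auto
    have "nrm ?u * nrm y \<le> 1 * (?\<theta> * \<nu>)" using ny nrm_less_1[OF E_closed] by (intro mult_mono) (auto intro: less_imp_le)
    then have 3: "?N (a * ?D (us @ [?u, y] @ ?js)) \<le> B" using ny by (intro cross) auto
    have "a * ?D ((us @ [h]) @ ?js) = a * ?D (us @ [?u] @ ?js) + a * ?D (us @ [y] @ ?js) + a * ?D (us @ [?u, y] @ ?js)"
      by (subst ny(2)) (simp add: DL_mult[OF E_closed ny(1) c(2) one_closed] distrib_left)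
    then show ?case using padic_int_norm_add_le[OF padic_int_norm_add_le[OF 1 2] 3] by simp
  qed
  show ?case using general[of hs "[]" a] Suc by simp
qed

text \<open>The bound is proved up to p^(-l) for fixed l: it holds for small weights by
  \<open>DL_high_weight\<close>, and finitely many uses of \<open>estimate_step\<close> reach any
  weight. Then l is chosen so that p^(-l) lies below the bound.\<close>

theorem DL_coordinate_norm_le:
  assumes i: "i < d" and hs: "set hs \<subseteq> carrier G"
  shows "padic_int_norm (DL hs (X i) \<one>) \<le> wt hs / nrm (g i)"
proof -
  obtain \<eta> where \<eta>: "0 < \<eta>" "\<eta> < \<kappa>" "\<And>h. h \<in> carrier G \<Longrightarrow> nrm h \<le> \<eta>" by (rule nrm_bound) blast
  let ?N = padic_int_norm and ?\<theta> = "\<eta> / \<kappa>" and ?C = "1 / nrm (g i)"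
  have \<theta>: "0 < ?\<theta>" "?\<theta> < 1" using \<eta> \<kappa> by auto
  have C: "0 < ?C" using nrm_g_pos[OF i] by simp
  have all: "?N (a * DL hs (X i) \<one>) \<le> max (t * ?C) ((1 / q) ^ l)"
    if tt: "0 < t" "set hs \<subseteq> carrier G" "?N a * wt hs \<le> t" for l t and a :: "'p padic_int" and hs
  proof -
    obtain l' where l': "(1 / q) ^ l' < nrm (g i) * (1 / q) ^ l" 
      using p_small[of "nrm (g i) * (1 / q) ^ l"] nrm_g_pos[OF i] by auto
    define \<mu> where "\<mu> = (1 / q) ^ Suc l'"
    have \<mu>: "0 < \<mu>" "\<mu> < 1" by (simp_all add: \<mu>_def power_less_one_iff del: power_Suc)
    have "\<mu> \<le> (1 / q) ^ l'" unfolding \<mu>_def by (intro power_decreasing) auto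
    then have inv: "invar \<mu> l (X i)"
      unfolding invar_def
    proof (intro ballI impI)
      fix x y assume "\<mu> \<le> (1 / q) ^ l'" "x \<in> carrier G" "y \<in> carrier G" "nrm y \<le> \<mu>"
      then have "nrm (g i) * ?N (X i (x \<otimes> y) - X i x) \<le> nrm (g i) * (1 / q) ^ l"
        using X_lipschitz[OF i, of x y] l' by linarith
      then show "?N (X i (x \<otimes> y) - X i x) \<le> (1 / q) ^ l" using nrm_g_pos[OF i] by simp
    qed
    obtain t1 where t1: "0 < t1" "\<And>hs. set hs \<subseteq> carrier G \<Longrightarrow> wt hs \<le> t1 \<Longrightarrow> ?N (DL hs (X i) \<one>) \<le> (1 / q) ^ l"
      using DL_high_weight[OF \<mu>, of l] inv one_closed by metis
    \<comment> \<open>Either |a| is at most p^(-l), which suffices, or weight at most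
      \<open>t0\<close> together with |a| > p^(-l) gives \<open>wt hs\<close> \<le>
      \<open>t1\<close>.\<close>
    define t0 where "t0 = (1 / q) ^ l * t1"
    have t0: "0 < t0" using t1 by (simp add: t0_def)
    have base: "?N (a * DL hs (X i) \<one>) \<le> (1 / q) ^ l" if "set hs \<subseteq> carrier G" "?N a * wt hs \<le> t0" for a :: "'p padic_int" and hs
    proof (cases "?N a \<le> (1 / q) ^ l")
      case True
      then have "?N a * ?N (DL hs (X i) \<one>) \<le> (1 / q) ^ l * 1"
        by (intro mult_mono padic_int_norm_le_1) auto
      then show ?thesis by (simp add: padic_int_norm_mult)
    next
      case False
      then have "(1 / q) ^ l * wt hs \<le> ?N a * wt hs" by (intro mult_right_mono) auto
      also have "\<dots> \<le> (1 / q) ^ l * t1" using that(2) by (simp only: t0_def)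
      finally have "(1 / q) ^ l * wt hs \<le> (1 / q) ^ l * t1" .
      then have "wt hs \<le> t1" by (rule mult_left_le_imp_le) simp
      then have "?N a * ?N (DL hs (X i) \<one>) \<le> 1 * (1 / q) ^ l"
        using t1(2)[OF that(1)] by (intro mult_mono padic_int_norm_le_1) auto
      then show ?thesis by (simp add: padic_int_norm_mult)
    qed
    obtain k where "?\<theta> ^ k < t0 / t" using real_arch_pow_inv[OF _ \<theta>(2), of "t0 / t"] t0 tt(1) by auto
    then have k: "?\<theta> ^ k * t \<le> t0" using tt(1) by (simp add: field_simps)
    have "?N (a * DL hs (X i) \<one>) \<le> max (t * ?C) ((1 / q) ^ l)"
      if "0 < t" "?\<theta> ^ k * t \<le> t0" "set hs \<subseteq> carrier G" "?N a * wt hs \<le> t"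
      for k t and a :: "'p padic_int" and hs
      using that
    proof (induction k arbitrary: t a hs)
      case 0
      then show ?case using base[of hs a] by simp
    next
      case (Suc k)
      show ?case
      proof (rule estimate_step[OF i Suc.prems(1) \<eta> _ _ Suc.prems(3,4)])
        show "t / nrm (g i) \<le> max (t * ?C) ((1 / q) ^ l)" by simp
        fix a :: "'p padic_int" and hs assume "set hs \<subseteq> carrier G" "?N a * wt hs \<le> ?\<theta> * t"
        then have "?N (a * DL hs (X i) \<one>) \<le> max (?\<theta> * t * ?C) ((1 / q) ^ l)"
          using Suc.prems(2) by (intro Suc.IH mult_pos_pos[OF \<theta>(1) Suc.prems(1)]) (simp_all add: mult_ac)
        also have "\<dots> \<le> max (t * ?C) ((1 / q) ^ l)"
          using mult_right_mono[of "?\<theta> * t" t ?C] mult_right_mono[of ?\<theta> 1 t] \<theta> C Suc.prems(1) by auto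
        finally show "?N (a * DL hs (X i) \<one>) \<le> max (t * ?C) ((1 / q) ^ l)" .
      qed
    qed
    then show ?thesis using tt k by blast
  qed
  \<comment> \<open>A positive t above the weight is used, because the weight itself may be
    0.\<close>
  have le: "?N (DL hs (X i) \<one>) \<le> t * ?C" if t: "0 < t" "wt hs \<le> t" for t
  proof -
    obtain l where l: "(1 / q) ^ l < t * ?C" using p_small[of "t * ?C"] C t by auto
    then show ?thesis using all[OF t(1) hs, of 1 l] t(2) by simp
  qed
  show ?thesis
  proof (rule field_le_epsilon)
    fix e :: real assume e: "0 < e"
    have "?N (DL hs (X i) \<one>) \<le> (wt hs + e * nrm (g i)) * ?C"
      using e nrm_g_pos[OF i] wt_nonneg[of hs] by (intro le) (auto intro: add_nonneg_pos)
    then show "?N (DL hs (X i) \<one>) \<le> wt hs / nrm (g i) + e"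
      using nrm_g_pos[OF i] by (simp add: add_divide_distrib)
  qed
qed

text \<open>If g i is the p-th power of h, expanding X i (h^p) shows that 1 is divisible by p unless
  \<omega> h is small.\<close>

lemma saturated_nrm_g:
  assumes sat: "saturated CARD('p) G \<omega>" and i: "i < d"
  shows "\<kappa> / nrm (g i) \<le> q"
proof (rule ccontr)
  assume "\<not> \<kappa> / nrm (g i) \<le> q"
  then have less: "q * nrm (g i) < \<kappa>" using nrm_g_pos[OF i] by (simp add: field_simps)
  have "\<omega> (g i) > ereal (q / (q - 1))"
  proof (rule ccontr)
    assume "\<not> \<omega> (g i) > ereal (q / (q - 1))"
    then have "pmag q (ereal (q / (q - 1))) \<le> pmag q (\<omega> (g i))" using i by (subst pmag_le_iff) auto
    moreover have "- (q / (q - 1)) = - 1 + - 1 / (q - 1)"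
      using q_gt_1 by (simp add: divide_simps del: q_gt_1)
    moreover from this have "q powr - (q / (q - 1)) = q powr - 1 * \<kappa>"
      by (simp only: powr_add \<kappa>_def)
    ultimately have "\<kappa> / q \<le> nrm (g i)"
      by (simp add: nrm_def powr_minus_divide)
    then show False using less by (simp add: field_simps)
  qed
  then obtain h where h: "h \<in> carrier G" "g i = h [^] CARD('p)"
    using sat i unfolding saturated_def by auto
  let ?N = padic_int_norm and ?D = "\<lambda>j. DL (replicate j h) (X i) \<one>"
  have nh: "nrm h = q * nrm (g i)" using nrm_pow_p[OF h(1)] h(2) by simp
  have "X i (\<one> \<otimes> h [^] CARD('p)) = (\<Sum>j\<le>CARD('p). of_nat (CARD('p) choose j) * ?D j)"
    by (rule DL_pow_expand) (use h in auto)
  then have sum: "X i (g i) = (\<Sum>j\<le>CARD('p). of_nat (CARD('p) choose j) * ?D j)"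
    using h i by simp
  have "?N (of_nat (CARD('p) choose j) * ?D j) \<le> 1 / q" if jle: "j \<le> CARD('p)" for j
  proof -
    consider "j = 0" | "0 < j" "j < CARD('p)" | "j = CARD('p)"
      using jle by (cases "j = CARD('p)"; cases "j = 0"; simp)
    then show ?thesis
    proof cases
      case 1
      then show ?thesis using i by simp
    next
      case 2
      obtain v where v: "?N (of_nat j :: 'p padic_int) = (1 / q) ^ v" "CARD('p) ^ v \<le> j"
        using padic_int_norm_of_nat_lower[OF 2(1), where 'p='p] by auto
      have "v = 0"
      proof (rule ccontr)
        assume "v \<noteq> 0"
        then have "CARD('p) ^ 1 \<le> CARD('p) ^ v" by (intro power_increasing) auto
        then show False using v(2) 2 by simp
      qed
      then have "?N (of_nat (CARD('p) choose j) :: 'p padic_int) \<le> 1 / q"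
        using binomial_norm[OF 2(1), of "CARD('p)"] v(1) norm_p_power[of 1] by simp
      then have "?N (of_nat (CARD('p) choose j) * ?D j) \<le> 1 / q * 1"
        unfolding padic_int_norm_mult by (intro mult_mono padic_int_norm_le_1) auto
      then show ?thesis by simp
    next
      case 3
      \<comment> \<open>As \<open>nrm h\<close> = p \<open>nrm (g i)\<close> < \<kappa>, the
        right-hand side is p \<open>nrm h\<close>^(p-1) < p \<kappa>^(p-1) = 1.\<close>
      have "?N (?D j) \<le> nrm h ^ CARD('p) / nrm (g i)"
        using DL_coordinate_norm_le[OF i, of "replicate j h"] h 3 by auto
      also have "nrm h ^ CARD('p) = nrm h ^ (CARD('p) - 1) * nrm h"
        using power_minus_mult[of "CARD('p)" "nrm h"] by simp
      also have "nrm h ^ (CARD('p) - 1) * nrm h / nrm (g i) = nrm h ^ (CARD('p) - 1) * q"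
        using nrm_g_pos[OF i] nh by simp
      also have "\<dots> < \<kappa> ^ (CARD('p) - 1) * q"
        using less nh by (intro mult_strict_right_mono power_strict_mono) auto
      also have "\<dots> = 1" unfolding \<kappa>_power by simp
      finally have "padic_norm (padic_of (?D j)) < 1" by (simp only: padic_norm_padic_of)
      then have "?N (?D j) \<le> 1 / q" using padic_norm_lt_1_imp_le[of "padic_of (?D j)"] by simp
      then show ?thesis using 3 by simp
    qed
  qed
  then have "?N (X i (g i)) \<le> 1 / q" unfolding sum by (intro padic_int_norm_sum_le) auto
  moreover have "X i (g i) = 1" using i by (simp add: g_eq_E)
  ultimately have "1 \<le> 1 / q" by simp
  then show False using q_gt_1 by (simp add: field_simps del: q_gt_1)
qed

end

section \<open>The Mahler series of a coordinate of a word\<close>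

lemma padic_int_norm_prod: "padic_int_norm (prod f S) = (\<Prod>i\<in>S. padic_int_norm (f i))"
  by (induction S rule: infinite_finite_induct) (simp_all add: padic_int_norm_mult)

lemma binomial_falling:
  "of_nat (fact k) * of_nat (m choose k) = (\<Prod>i<k. of_nat m - (of_nat i :: 'a::comm_ring_1))"
proof (induction k)
  case (Suc k)
  have *: "of_nat (Suc k) * of_nat (m choose Suc k) = (of_nat m - of_nat k :: 'a) * of_nat (m choose k)"
  proof (cases "k \<le> m")
    case True
    have "Suc k * (m choose Suc k) = (m - k) * (m choose k)"
    proof (cases m)
      case (Suc n)
      show ?thesis unfolding Suc Suc_times_binomial binomial_absorb_comp by simp
    qed (use True in simp)
    then have "of_nat (Suc k) * of_nat (m choose Suc k) = (of_nat (m - k) * of_nat (m choose k) :: 'a)"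
      by (metis of_nat_mult)
    then show ?thesis using True by (simp add: of_nat_diff)
  qed (simp add: binomial_eq_0)
  have "of_nat (fact (Suc k)) * of_nat (m choose Suc k)
      = of_nat (fact k) * (of_nat (Suc k) * of_nat (m choose Suc k) :: 'a)"
    by (simp only: fact_Suc of_nat_mult of_nat_id mult.assoc mult.left_commute)
  also have "\<dots> = (of_nat (fact k) * of_nat (m choose k)) * (of_nat m - of_nat k)"
    unfolding * by (simp add: mult_ac)
  finally show ?case by (simp add: Suc)
qed simp

definition mps_binomial :: "'v \<Rightarrow> nat \<Rightarrow> ('v, 'p::prime_card padic) mps" where
  "mps_binomial v k = mps_const (1 / of_nat (fact k)) * (\<Prod>i<k. mps_var v - mps_const (of_nat i))"

context polyradius
begin

lemma mps_binomial_tate: "v \<in> V \<Longrightarrow> mps_binomial v k \<in> tate_algebra V r"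
  unfolding mps_binomial_def by (intro tate_mult tate_const tate_prod tate_diff tate_var)

lemma mps_binomial_norm_le:
  assumes "1 \<le> r v"
  shows "norm_le r (mps_binomial v k :: ('v, 'p::prime_card padic) mps)
    (r v ^ k / padic_norm (of_nat (fact k) :: 'p padic))"
proof -
  have "norm_le r (mps_var v - mps_const (of_nat i) :: ('v, 'p padic) mps) (r v)" for i
    by (intro norm_le_diff norm_le_var norm_le_const order_trans[OF padic_norm_of_nat_le_1 assms])
  then have "norm_le r (\<Prod>i<k. mps_var v - mps_const (of_nat i) :: ('v, 'p padic) mps) (\<Prod>i<k. r v)"
    by (intro norm_le_prod)
  from norm_le_const_mult[OF this, of "1 / of_nat (fact k)"] show ?thesis
    unfolding mps_binomial_def by simp
qed

lemma ev_mps_binomial: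
  assumes v: "v \<in> V" and x: "in_disc x" and m: "x v = of_nat m"
  shows "ev x (mps_binomial v k) = (of_nat (m choose k) :: 'p::prime_card padic)"
proof -
  have t: "(mps_var v - mps_const (of_nat i) :: ('v, 'p padic) mps) \<in> tate_algebra V r" for i
    using v by (intro tate_diff tate_var tate_const)
  have "ev x (mps_binomial v k) = 1 / of_nat (fact k) * (\<Prod>i<k. of_nat m - of_nat i)"
    unfolding mps_binomial_def using v t
    by (simp add: ev_const_mult tate_prod x ev_prod ev_diff m)
  also have "\<dots> = of_nat (m choose k)" unfolding binomial_falling[symmetric] by simp
  finally show ?thesis .
qed

lemma mpow_lipschitz:
  fixes x y :: "'v \<Rightarrow> 'p::prime_card padic"
  assumes x: "\<And>v. padic_norm (x v) \<le> 1" and y: "\<And>v. padic_norm (y v) \<le> 1"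
    and \<delta>: "0 \<le> \<delta>" "\<And>v. v \<in> Poly_Mapping.keys a \<Longrightarrow> padic_norm (x v - y v) \<le> \<delta>"
  shows "padic_norm (mpow x a - mpow y a) \<le> \<delta>"
proof -
  have mult: "padic_norm (a * b - c * e) \<le> \<delta>"
    if "padic_norm a \<le> 1" "padic_norm e \<le> 1" "padic_norm (a - c) \<le> \<delta>" "padic_norm (b - e) \<le> \<delta>"
    for a b c e :: "'p padic"
  proof -
    have "a * b - c * e = a * (b - e) + (a - c) * e" by (simp add: algebra_simps)
    moreover have "padic_norm (a * (b - e)) \<le> 1 * \<delta>" unfolding padic_norm_mult using that by (intro mult_mono) auto
    moreover have "padic_norm ((a - c) * e) \<le> \<delta> * 1" unfolding padic_norm_mult using that \<delta> by (intro mult_mono) auto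
    ultimately show ?thesis by (simp add: padic_norm_add_le)
  qed
  have pow: "padic_norm (x v ^ n - y v ^ n) \<le> \<delta>" if "v \<in> Poly_Mapping.keys a" for v n
  proof (induction n)
    case (Suc n)
    then show ?case using mult[of "x v" "y v ^ n" "y v" "x v ^ n"] x[of v] y[of v] \<delta>(2)[OF that]
      by (simp add: power_le_one)
  qed (use \<delta> in simp)
  have "padic_norm ((\<Prod>v\<in>S. x v ^ poly_mapping.lookup a v) - (\<Prod>v\<in>S. y v ^ poly_mapping.lookup a v)) \<le> \<delta>"
    if "finite S" "S \<subseteq> Poly_Mapping.keys a" for S
    using that
  proof (induction S)
    case (insert v S)
    have "padic_norm (\<Prod>v\<in>S. y v ^ poly_mapping.lookup a v) \<le> 1"
      unfolding padic_norm_prod using y by (intro prod_le_1) (auto simp: power_le_one)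
    then show ?case using insert x[of v] pow[of v] by (auto intro!: mult simp: power_le_one)
  qed (use \<delta> in simp)
  then show ?thesis unfolding mpow_def by simp
qed

text \<open>Lets values known at natural exponents pass to all integral points.\<close>

lemma ev_lipschitz:
  fixes x y :: "'v \<Rightarrow> 'p::prime_card padic"
  assumes r: "\<And>v. v \<in> V \<Longrightarrow> 1 \<le> r v" and f: "f \<in> tate_algebra V r" "norm_le r f C"
    and x: "\<And>v. padic_norm (x v) \<le> 1" and y: "\<And>v. padic_norm (y v) \<le> 1"
    and \<delta>: "0 \<le> \<delta>" "\<And>v. v \<in> V \<Longrightarrow> padic_norm (x v - y v) \<le> \<delta>"
  shows "padic_norm (ev x f - ev y f) \<le> C * \<delta>"
proof -
  have xy: "in_disc x" "in_disc y" unfolding in_disc_def using x y r order_trans by blast+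
  have null: "null_family (\<lambda>a. (-1) * (mps_coeff f a * mpow y a))"
    by (rule null_family_cmult[OF ev_null[OF f(1) xy(2)]])
  have C: "0 \<le> C" using f(2) by (rule norm_le_nonneg)
  have "ev x f - ev y f = nsum (\<lambda>a. mps_coeff f a * mpow x a + (-1) * (mps_coeff f a * mpow y a))"
    unfolding nsum_add[OF ev_null[OF f(1) xy(1)] null] nsum_cmult[OF ev_null[OF f(1) xy(2)]]
    by (simp add: ev_def)
  also have "padic_norm \<dots> \<le> C * \<delta>"
  proof (rule nsum_norm_le[OF null_family_add[OF ev_null[OF f(1) xy(1)] null]])
    fix a
    have eq: "mps_coeff f a * mpow x a + (-1) * (mps_coeff f a * mpow y a) = mps_coeff f a * (mpow x a - mpow y a)"
      by (simp add: right_diff_distrib)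
    show "padic_norm (mps_coeff f a * mpow x a + (-1) * (mps_coeff f a * mpow y a)) \<le> C * \<delta>"
    proof (cases "mps_coeff f a = 0")
      case False
      then have keys: "Poly_Mapping.keys a \<subseteq> V" using tate_keys[OF f(1)] by blast
      have "padic_norm (mps_coeff f a) * 1 \<le> padic_norm (mps_coeff f a) * mpow r a"
        using keys r by (intro mult_left_mono mpow_ge_1) auto
      also have "\<dots> \<le> C" using f(2) by (simp add: norm_le_def)
      finally have "padic_norm (mps_coeff f a) \<le> C" by simp
      then show ?thesis unfolding eq padic_norm_mult
        using keys \<delta> C by (intro mult_mono mpow_lipschitz x y) auto
    qed (use C \<delta> in simp)
  qed (use C \<delta> in simp)
  finally show ?thesis .
qed

end

lemma mpow_powr:
  "(\<And>v. 0 < c v) \<Longrightarrow> mpow (\<lambda>v. c v powr s) a = (mpow c a :: real) powr s"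
proof -
  assume c: "\<And>v. 0 < c v"
  have pow: "(c v powr s) ^ n = (c v ^ n) powr s" for v n
    using c by (induction n) (simp_all add: powr_mult less_imp_le)
  have "(\<Prod>v\<in>S. (c v powr s) ^ poly_mapping.lookup a v) = (\<Prod>v\<in>S. c v ^ poly_mapping.lookup a v) powr s"
    if "finite S" for S
    using that
  proof (induction S)
    case (insert v S)
    have "0 \<le> (\<Prod>v\<in>S. c v ^ poly_mapping.lookup a v)" using c by (intro prod_nonneg) (simp add: less_imp_le)
    then show ?case using insert c by (simp add: pow powr_mult less_imp_le)
  qed simp
  then show ?thesis unfolding mpow_def by simp
qed

lemma mpow_mult_distrib: "mpow (\<lambda>v. x v * y v) a = mpow x a * mpow y a"
  by (simp add: mpow_def power_mult_distrib prod.distrib)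

section \<open>Lower bounds for factorials\<close>

context p_valued_basis
begin

text \<open>Legendre's recursion: up to units, n! is the product of the multiples of p up to n, that
  is p^m m! with m = n div p.\<close>

lemma fact_norm_step:
  "padic_int_norm (of_nat (fact n) :: 'p padic_int) =
    (1 / q) ^ (n div CARD('p)) * padic_int_norm (of_nat (fact (n div CARD('p))) :: 'p padic_int)"
proof (induction n)
  case (Suc n)
  let ?N = "\<lambda>k. padic_int_norm (of_nat k :: 'p padic_int)"
  have fact: "?N (fact (Suc k)) = ?N (Suc k) * ?N (fact k)" for k
    unfolding fact_Suc of_nat_mult of_nat_id by (rule padic_int_norm_mult)
  show ?case
  proof (cases "CARD('p) dvd Suc n")
    case True
    then obtain m where m: "Suc n = CARD('p) * m" ..
    have "m \<noteq> 0" using m by (cases m) auto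
    then obtain k where k: "m = Suc k" by (cases m) auto
    have div: "Suc n div CARD('p) = Suc k" using m k by simp
    have "n div CARD('p) = k"
    proof (rule div_nat_eqI)
      have h: "Suc n = CARD('p) * k + CARD('p)" by (simp add: m k)
      have c: "Suc 0 < CARD('p)" by simp
      show "CARD('p) * k \<le> n" using h c by linarith
      show "n < CARD('p) * Suc k" using h unfolding mult_Suc_right by linarith
    qed
    moreover have "?N (Suc n) = 1 / q * ?N (Suc k)"
      unfolding m k of_nat_mult padic_int_norm_mult using norm_p_power[of 1] by simp
    ultimately show ?thesis using Suc fact[of n] fact[of k] div by (simp add: mult_ac)
  next
    case False
    obtain v where v: "?N (Suc n) = (1 / q) ^ v" "CARD('p) ^ v dvd Suc n"
      using padic_int_norm_of_nat_lower[of "Suc n", where 'p='p] by auto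
    have "v = 0"
    proof (rule ccontr)
      assume "v \<noteq> 0"
      then have "CARD('p) dvd CARD('p) ^ v" by (simp add: dvd_power)
      then show False using v(2) False dvd_trans by blast
    qed
    moreover have "Suc n div CARD('p) = n div CARD('p)" using False by (simp add: div_Suc dvd_eq_mod_eq_0)
    ultimately show ?thesis using Suc fact[of n] v(1) by simp
  qed
qed simp

text \<open>Legendre's recursion with m = n div p: for m > 0, (p-1)m + (m-1) \<le> n - 1, and each
  factor 1/p is \<kappa>^(p-1).\<close>

lemma fact_norm_lower: "\<kappa> ^ (n - 1) \<le> padic_int_norm (of_nat (fact n) :: 'p padic_int)"
proof (induction n rule: less_induct)
  case (less n)
  let ?m = "n div CARD('p)"
  show ?case
  proof (cases "?m = 0")
    case True
    then show ?thesis unfolding fact_norm_step[of n] using \<kappa> by (simp add: power_le_one)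
  next
    case False
    then have "?m < n" by (intro div_less_dividend) (auto intro: Nat.gr0I)
    have "\<kappa> ^ (n - 1) \<le> \<kappa> ^ ((CARD('p) - 1) * ?m + (?m - 1))"
    proof (rule power_decreasing)
      have "(CARD('p) - 1) * ?m + ?m = CARD('p) * ?m"
        by (simp add: diff_mult_distrib)
      also have "\<dots> \<le> n" by simp
      finally show "(CARD('p) - 1) * ?m + (?m - 1) \<le> n - 1" using False by linarith
    qed (use \<kappa> in auto)
    also have "\<dots> = (1 / q) ^ ?m * \<kappa> ^ (?m - 1)" by (simp only: power_add power_mult \<kappa>_power)
    also have "\<dots> \<le> (1 / q) ^ ?m * padic_int_norm (of_nat (fact ?m) :: 'p padic_int)"
      using less[OF \<open>?m < n\<close>] by (intro mult_left_mono) auto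
    finally show ?thesis unfolding fact_norm_step[of n] .
  qed
qed

end

section \<open>Words in powers of group elements and their Mahler expansion\<close>

locale group_word = p_valued_basis P G Top \<omega> gs q \<kappa>
  for P :: "'p::prime_card itself" and G :: "('g, 'b) monoid_scheme" (structure)
    and Top :: "'g topology" and \<omega> :: "'g \<Rightarrow> ereal" and gs :: "'g list" and q \<kappa> :: real +
  fixes vs :: "'v list" and H :: "'v \<Rightarrow> 'g"
  assumes vs: "distinct vs" and H_closed: "\<And>v. v \<in> set vs \<Longrightarrow> H v \<in> carrier G"
begin

text \<open>Multiplication and inversion are both of this form. The variables are kept apart from
  the elements \<open>H\<close> because the product of two points uses every basis element
  twice.\<close>

definition word :: "('v \<Rightarrow> nat) \<Rightarrow> 'g" where
  "word n = foldr (\<lambda>v y. H v [^] n v \<otimes> y) vs \<one>"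

text \<open>Under \<open>DL\<close> this list acts as the product of the (H v - 1)^(n v), in the
  order of \<open>us\<close>.\<close>

definition mono :: "'v list \<Rightarrow> ('v \<Rightarrow>\<^sub>0 nat) \<Rightarrow> 'g list" where
  "mono us n = concat (map (\<lambda>v. replicate (poly_mapping.lookup n v) (H v)) us)"

definition box :: "'v set \<Rightarrow> ('v \<Rightarrow> nat) \<Rightarrow> ('v \<Rightarrow>\<^sub>0 nat) set" where
  "box S m = {n. Poly_Mapping.keys n \<subseteq> S \<and> (\<forall>v. poly_mapping.lookup n v \<le> m v)}"

lemma finite_box: "finite S \<Longrightarrow> finite (box S m)"
proof (rule finite_subset[OF _ finite_total_deg_less[of S "Suc (sum m S)"]])
  assume S: "finite S"
  show "box S m \<subseteq> {a. Poly_Mapping.keys a \<subseteq> S \<and> total_deg a < Suc (sum m S)}"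
  proof
    fix a assume a: "a \<in> box S m"
    then have "total_deg a = (\<Sum>v\<in>S. poly_mapping.lookup a v)"
      unfolding total_deg_def box_def using S by (intro sum.mono_neutral_left) (auto simp: in_keys_iff)
    also have "\<dots> \<le> sum m S" using a by (intro sum_mono) (auto simp: box_def)
    finally show "a \<in> {a. Poly_Mapping.keys a \<subseteq> S \<and> total_deg a < Suc (sum m S)}"
      using a by (simp add: box_def)
  qed
qed

lemma mono_closed: "set us \<subseteq> set vs \<Longrightarrow> set (mono us n) \<subseteq> carrier G"
  using H_closed by (auto simp: mono_def)

lemma expand_word_aux:
  "distinct us \<Longrightarrow> set us \<subseteq> set vs \<Longrightarrow> x \<in> carrier G \<Longrightarrow>
    f (x \<otimes> foldr (\<lambda>v y. H v [^] m v \<otimes> y) us \<one>)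
      = (\<Sum>n\<in>box (set us) m. of_nat (\<Prod>v\<in>set us. m v choose poly_mapping.lookup n v) * DL (mono us n) f x)"
proof (induction us arbitrary: x f)
  case Nil
  have "box {} m = {0}" by (auto simp: box_def)
  then show ?case using Nil by (simp add: mono_def)
next
  case (Cons u us)
  let ?w = "foldr (\<lambda>v y. H v [^] m v \<otimes> y) us \<one>"
  let ?b = "\<lambda>n. \<Prod>v\<in>set us. m v choose poly_mapping.lookup n v"
  have Hu: "H u \<in> carrier G" using Cons.prems H_closed by auto
  have w: "?w \<in> carrier G" using Cons.prems H_closed by (intro foldr_mult_closed) auto
  have "f (x \<otimes> foldr (\<lambda>v y. H v [^] m v \<otimes> y) (u # us) \<one>) = f ((x \<otimes> H u [^] m u) \<otimes> ?w)"
    using Hu w Cons.prems by (simp add: m_assoc)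
  also have "\<dots> = (\<Sum>n\<in>box (set us) m. of_nat (?b n) * DL (mono us n) f (x \<otimes> H u [^] m u))"
    using Cons.prems Hu by (intro Cons.IH) auto
  also have "\<dots> = (\<Sum>n\<in>box (set us) m. \<Sum>j\<le>m u. of_nat (?b n * (m u choose j)) * DL (replicate j (H u) @ mono us n) f x)"
  proof (rule sum.cong[OF refl])
    fix n
    show "of_nat (?b n) * DL (mono us n) f (x \<otimes> H u [^] m u)
        = (\<Sum>j\<le>m u. of_nat (?b n * (m u choose j)) * DL (replicate j (H u) @ mono us n) f x)"
      unfolding DL_pow_expand[OF Hu Cons.prems(3), of "DL (mono us n) f"] DL_append of_nat_mult sum_distrib_left
      by (simp only: mult.assoc)
  qed
  also have "\<dots> = (\<Sum>(n, j)\<in>box (set us) m \<times> {..m u}. of_nat (?b n * (m u choose j)) * DL (replicate j (H u) @ mono us n) f x)"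
    by (rule sum.cartesian_product)
  \<comment> \<open>An exponent on \<open>u # us\<close> is the same as its value at
    \<open>u\<close> together with an exponent on \<open>us\<close>.\<close>
  also have "\<dots> = (\<Sum>n\<in>box (set (u # us)) m. of_nat (\<Prod>v\<in>set (u # us). m v choose poly_mapping.lookup n v) * DL (mono (u # us) n) f x)"
  proof (rule sum.reindex_bij_witness[where j="\<lambda>(n, j). Poly_Mapping.single u j + n"
        and i="\<lambda>n. (n - Poly_Mapping.single u (poly_mapping.lookup n u), poly_mapping.lookup n u)"], goal_cases)
    case (1 a)
    then have "poly_mapping.lookup (fst a) u = 0" using Cons.prems(1) by (auto simp: box_def in_keys_iff)
    then show ?case by (cases a) (simp add: lookup_add)
  next
    case (2 a)
    obtain n j where a: "a = (n, j)" "n \<in> box (set us) m" "j \<le> m u" using 2 by (cases a) auto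
    have nu: "poly_mapping.lookup n u = 0" using a(2) Cons.prems(1) by (auto simp: box_def in_keys_iff)
    have "Poly_Mapping.keys (Poly_Mapping.single u j + n) \<subseteq> set (u # us)"
      using a(2) keys_add[of "Poly_Mapping.single u j" n] by (auto simp: box_def split: if_splits)
    moreover have "poly_mapping.lookup (Poly_Mapping.single u j + n) v \<le> m v" for v
      using a(2,3) nu by (auto simp: lookup_add lookup_single when_def box_def)
    ultimately show ?case by (simp add: a box_def)
  next
    case (3 b)
    show ?case by (rule poly_mapping_eqI) (auto simp: lookup_add lookup_minus lookup_single when_def)
  next
    case (4 b)
    have "v \<in> set us" if "v \<in> Poly_Mapping.keys (b - Poly_Mapping.single u (poly_mapping.lookup b u))" for v
    proof -
      have "v \<noteq> u" "v \<in> Poly_Mapping.keys b"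
        using that by (auto simp: in_keys_iff lookup_minus lookup_single when_def split: if_splits)
      then show ?thesis using 4 by (auto simp: box_def)
    qed
    moreover have "poly_mapping.lookup (b - Poly_Mapping.single u (poly_mapping.lookup b u)) v \<le> m v" for v
      using 4 by (auto simp: lookup_minus box_def intro: order_trans[OF diff_le_self])
    ultimately show ?case using 4 by (auto simp: box_def)
  next
    case (5 a)
    obtain n j where a: "a = (n, j)" "n \<in> box (set us) m" "j \<le> m u" using 5 by (cases a) auto
    have nu: "poly_mapping.lookup n u = 0" using a(2) Cons.prems(1) by (auto simp: box_def in_keys_iff)
    let ?n = "Poly_Mapping.single u j + n"
    have lu: "poly_mapping.lookup ?n u = j" using nu by (simp add: lookup_add)
    have lv: "poly_mapping.lookup ?n v = poly_mapping.lookup n v" if "v \<in> set us" for v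
      using that Cons.prems(1) by (auto simp: lookup_add lookup_single when_def)
    have "mono (u # us) ?n = replicate j (H u) @ mono us n"
      using lv by (simp add: mono_def lu cong: map_cong)
    moreover have "(\<Prod>v\<in>set (u # us). m v choose poly_mapping.lookup ?n v) = ?b n * (m u choose j)"
      using Cons.prems(1) lv by (simp add: lu mult.commute)
    ultimately show ?case by (simp add: a)
  qed
  finally show ?case .
qed

lemma expand_word:
  "f (word m) = (\<Sum>n\<in>box (set vs) m. of_nat (\<Prod>v\<in>set vs. m v choose poly_mapping.lookup n v) * DL (mono vs n) f \<one>)"
proof -
  have "word m \<in> carrier G" unfolding word_def using H_closed by (intro foldr_mult_closed) auto
  then show ?thesis using expand_word_aux[OF vs order_refl one_closed, of f m] by (simp add: word_def)
qed

lemma wt_mono: "Poly_Mapping.keys n \<subseteq> set vs \<Longrightarrow> wt (mono vs n) = mpow (\<lambda>v. nrm (H v)) n"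
proof -
  assume n: "Poly_Mapping.keys n \<subseteq> set vs"
  have "distinct us \<Longrightarrow> wt (mono us n) = (\<Prod>v\<in>set us. nrm (H v) ^ poly_mapping.lookup n v)" for us
    by (induction us) (simp_all add: mono_def)
  then show ?thesis using vs by (simp add: mpow_superset[OF _ n])
qed

definition mahler_coeff :: "nat \<Rightarrow> ('v \<Rightarrow>\<^sub>0 nat) \<Rightarrow> 'p padic_int" where
  "mahler_coeff i n = DL (mono vs n) (X i) \<one>"

text \<open>The coefficient and the binomials see only the variables in \<open>vs\<close>; without
  the cut-off, exponents that differ elsewhere would repeat the same term.\<close>

definition mahler_term :: "nat \<Rightarrow> ('v \<Rightarrow>\<^sub>0 nat) \<Rightarrow> ('v, 'p padic) mps" where
  "mahler_term i n = (if Poly_Mapping.keys n \<subseteq> set vs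
     then mps_const (padic_of (mahler_coeff i n)) * (\<Prod>v\<in>set vs. mps_binomial v (poly_mapping.lookup n v)) else 0)"

definition word_series :: "nat \<Rightarrow> ('v, 'p padic) mps" where
  "word_series i = mps_nsum (mahler_term i)"

end

text \<open>The relation between \<open>\<rho>\<close> and the norms balances one difference along H
  v, taken with its radius, against one factor \<kappa> in the lower bound for factorials.\<close>

locale word_radii = group_word P G Top \<omega> gs q \<kappa> vs H + polyradius "set vs" "\<lambda>v. \<rho> v powr s"
  for P :: "'p::prime_card itself" and G :: "('g, 'b) monoid_scheme" (structure)
    and Top :: "'g topology" and \<omega> :: "'g \<Rightarrow> ereal" and gs :: "'g list" and q \<kappa> :: real
    and vs :: "'v list" and H :: "'v \<Rightarrow> 'g" and \<rho> :: "'v \<Rightarrow> real" and s :: real +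
  assumes \<rho>: "\<And>v. 1 < \<rho> v" "\<And>v. v \<in> set vs \<Longrightarrow> nrm (H v) * \<rho> v = \<kappa>"
    and s: "0 < s" "s < 1"
    and q_bound: "\<And>i. i < d \<Longrightarrow> \<kappa> / nrm (g i) \<le> q"
begin

abbreviation r :: "'v \<Rightarrow> real" where "r \<equiv> \<lambda>v. \<rho> v powr s"

definition \<phi> :: "nat \<Rightarrow> ('v \<Rightarrow>\<^sub>0 nat) \<Rightarrow> real" where
  "\<phi> i n = (if Poly_Mapping.keys n \<subseteq> set vs then padic_int_norm (mahler_coeff i n) *
     (\<Prod>v\<in>set vs. r v ^ poly_mapping.lookup n v / padic_int_norm (of_nat (fact (poly_mapping.lookup n v)) :: 'p padic_int)) else 0)"

lemma r_ge_1: "1 \<le> r v"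
  using \<rho>(1)[of v] s by (intro ge_one_powr_ge_zero) auto

lemma mahler_term_tate: "mahler_term i n \<in> tate_algebra (set vs) r"
  unfolding mahler_term_def by (auto intro!: tate_mult tate_prod mps_binomial_tate)

lemma mahler_term_norm_le: "norm_le r (mahler_term i n) (\<phi> i n)"
proof (cases "Poly_Mapping.keys n \<subseteq> set vs")
  case True
  have N: "padic_norm (of_nat (fact k) :: 'p padic) = padic_int_norm (of_nat (fact k) :: 'p padic_int)" for k
    by (metis padic_norm_padic_of padic_of_of_nat)
  have "norm_le r (\<Prod>v\<in>set vs. mps_binomial v (poly_mapping.lookup n v) :: ('v, 'p padic) mps)
      (\<Prod>v\<in>set vs. r v ^ poly_mapping.lookup n v / padic_int_norm (of_nat (fact (poly_mapping.lookup n v)) :: 'p padic_int))"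
    unfolding N[symmetric] by (intro norm_le_prod mps_binomial_norm_le r_ge_1)
  from norm_le_const_mult[OF this, of "padic_of (mahler_coeff i n)"] show ?thesis
    using True by (simp add: mahler_term_def \<phi>_def)
qed (simp add: mahler_term_def \<phi>_def norm_le_def)

text \<open>A nonzero exponent has a positive entry, so the sum of the n_v - 1 (truncated at 0) is
  at most the total degree minus 1. The factor \<kappa> saved here is the numerator of \<kappa> /
  \<open>nrm (g i)\<close>.\<close>

lemma fact_prod_lower:
  assumes "n \<noteq> 0" and keys: "Poly_Mapping.keys n \<subseteq> set vs"
  shows "\<kappa> ^ (total_deg n - 1) \<le> (\<Prod>v\<in>set vs. padic_int_norm (of_nat (fact (poly_mapping.lookup n v)) :: 'p padic_int))"
proof -
  let ?l = "poly_mapping.lookup n"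
  have deg: "total_deg n = (\<Sum>v\<in>set vs. ?l v)"
    unfolding total_deg_def using keys by (intro sum.mono_neutral_left) (auto simp: in_keys_iff)
  have "\<exists>v. ?l v \<noteq> 0" using assms(1) by (metis poly_mapping_eqI lookup_zero)
  then obtain v0 where v0: "?l v0 \<noteq> 0" by blast
  then have v0s: "v0 \<in> set vs" using keys by (auto simp: in_keys_iff)
  have "(\<Sum>v\<in>set vs. ?l v - 1) + 1 \<le> (\<Sum>v\<in>set vs. ?l v)"
    unfolding sum.remove[OF finite_set v0s, of ?l] sum.remove[OF finite_set v0s, of "\<lambda>v. ?l v - 1"]
    using v0 sum_mono[of "set vs - {v0}" "\<lambda>v. ?l v - 1" ?l] by simp
  then have "\<kappa> ^ (total_deg n - 1) \<le> \<kappa> ^ (\<Sum>v\<in>set vs. ?l v - 1)"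
    using \<kappa> deg by (intro power_decreasing) auto
  also have "\<dots> = (\<Prod>v\<in>set vs. \<kappa> ^ (?l v - 1))" by (rule power_sum)
  also have "\<dots> \<le> (\<Prod>v\<in>set vs. padic_int_norm (of_nat (fact (?l v)) :: 'p padic_int))"
    using \<kappa> fact_norm_lower by (intro prod_mono) auto
  finally show ?thesis .
qed

text \<open>With K the monomial of the \<rho> at n, the coefficient divided by the factorials is at most
  \<rho> i / K, where \<rho> i is \<kappa> / nrm (g i). If K is smaller than \<rho> i, then this quotient is smaller
  than p and therefore at most 1, because the absolute values are powers of p. This is where
  saturation enters.\<close>

lemma \<phi>_bounds:
  assumes i: "i < d"
  shows "\<phi> i n \<le> \<kappa> / nrm (g i) * mpow \<rho> n powr (s - 1)" and "\<phi> i n \<le> (\<kappa> / nrm (g i)) powr s"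
proof -
  let ?R = "\<kappa> / nrm (g i)" and ?K = "mpow \<rho> n"
  have R: "1 < ?R" "0 < ?R" using nrm_less_\<kappa>[OF g_closed[OF i]] nrm_g_pos[OF i] \<kappa> by auto
  have K: "1 \<le> ?K" using \<rho>(1) by (intro mpow_ge_1 less_imp_le)
  have "\<phi> i n \<le> ?R * ?K powr (s - 1) \<and> \<phi> i n \<le> ?R powr s"
  proof (cases "Poly_Mapping.keys n \<subseteq> set vs \<and> n \<noteq> 0")
    case False
    \<comment> \<open>The constant term vanishes, as \<open>X i\<close> is 0 at the neutral
      element.\<close>
    have "mono vs 0 = []" by (simp add: mono_def)
    then have "\<phi> i n = 0" using False i by (auto simp: \<phi>_def mahler_coeff_def)
    then show ?thesis using mult_nonneg_nonneg[OF less_imp_le[OF R(2)], of "?K powr (s - 1)"] by simp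
  next
    case True
    then have keys: "Poly_Mapping.keys n \<subseteq> set vs" and n0: "n \<noteq> 0" by auto
    let ?l = "poly_mapping.lookup n"
    define F where "F = (\<Prod>v\<in>set vs. of_nat (fact (?l v)) :: 'p padic_int)"
    define c where "c = mahler_coeff i n"
    have nF: "padic_int_norm F = (\<Prod>v\<in>set vs. padic_int_norm (of_nat (fact (?l v)) :: 'p padic_int))"
      unfolding F_def by (rule padic_int_norm_prod)
    have "F \<noteq> 0" by (simp add: F_def)
    then have F0: "0 < padic_int_norm F" using padic_int_norm_nonneg[of F] padic_int_norm_eq_0_iff[of F] by linarith
    define Q where "Q = padic_int_norm c / padic_int_norm F"
    have phi: "\<phi> i n = Q * ?K powr s"
    proof -
      have "(\<Prod>v\<in>set vs. r v ^ ?l v) = mpow r n" by (rule mpow_superset[OF _ keys, symmetric]) simp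
      also have "\<dots> = ?K powr s" using \<rho>(1) by (intro mpow_powr) (meson less_trans zero_less_one)
      finally show ?thesis using keys by (simp add: \<phi>_def Q_def c_def nF prod_dividef)
    qed
    have deg: "total_deg n > 0"
    proof -
      have "Poly_Mapping.keys n \<noteq> {}" using n0 by simp
      then obtain v where "v \<in> Poly_Mapping.keys n" by blast
      then have "0 < ?l v" "?l v \<le> total_deg n" unfolding total_deg_def by (auto simp: in_keys_iff intro!: member_le_sum)
      then show ?thesis by simp
    qed
    have Q_le: "Q \<le> ?R / ?K"
    proof -
      have "wt (mono vs n) * ?K = mpow (\<lambda>v. nrm (H v) * \<rho> v) n"
        by (simp add: wt_mono[OF keys] mpow_mult_distrib)
      also have "\<dots> = mpow (\<lambda>_. \<kappa>) n" using keys \<rho>(2) by (intro mpow_cong) auto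
      also have "\<dots> = \<kappa> * \<kappa> ^ (total_deg n - 1)" using deg by (simp add: mpow_const flip: power_Suc)
      finally have w: "wt (mono vs n) * ?K = \<kappa> * \<kappa> ^ (total_deg n - 1)" .
      have "padic_int_norm c \<le> wt (mono vs n) / nrm (g i)"
        unfolding c_def mahler_coeff_def by (intro DL_coordinate_norm_le i mono_closed order_refl)
      then have "padic_int_norm c * ?K \<le> wt (mono vs n) / nrm (g i) * ?K" using K by (intro mult_right_mono) auto
      also have "\<dots> = ?R * \<kappa> ^ (total_deg n - 1)" using w by (simp add: field_simps)
      also have "\<dots> \<le> ?R * padic_int_norm F"
        unfolding nF using R by (intro mult_left_mono fact_prod_lower n0 keys) auto
      finally have "padic_int_norm c * ?K \<le> ?R * padic_int_norm F" .
      moreover have K0: "0 < ?K" using K by linarith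
      ultimately have "padic_int_norm c \<le> ?R * padic_int_norm F / ?K" by (simp only: pos_le_divide_eq[OF K0])
      then show ?thesis unfolding Q_def pos_divide_le_eq[OF F0] by (simp only: times_divide_eq_left)
    qed
    have Q0: "0 \<le> Q" using F0 by (simp add: Q_def)
    have Kpow: "?K powr s = ?K * ?K powr (s - 1)" using powr_mult_base[of ?K "s - 1"] K by simp
    have "Q * ?K powr s \<le> ?R / ?K * ?K powr s" using Q_le by (intro mult_right_mono) auto
    also have "\<dots> = ?R * ?K powr (s - 1)" unfolding Kpow using K by simp
    finally have 1: "\<phi> i n \<le> ?R * ?K powr (s - 1)" by (simp add: phi)
    have "\<phi> i n \<le> ?R powr s"
    proof (cases "?R \<le> ?K")
      case True
      then have "?K powr (s - 1) \<le> ?R powr (s - 1)" using R s by (intro powr_mono2') auto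
      then have "?R * ?K powr (s - 1) \<le> ?R * ?R powr (s - 1)" using R by (intro mult_left_mono) auto
      also have "\<dots> = ?R powr s" using powr_mult_base[OF less_imp_le[OF R(2)], of "s - 1"] by simp
      finally show ?thesis using 1 by linarith
    next
      case False
      \<comment> \<open>Strictness matters: \<kappa> / \<open>nrm (g i)\<close> may equal p, and
        only a quotient strictly below p is forced down to 1.\<close>
      have "1 < ?K"
      proof -
        have "Poly_Mapping.keys n \<noteq> {}" using n0 by simp
        then obtain v where v: "v \<in> Poly_Mapping.keys n" by blast
        have "1 < \<rho> v ^ ?l v" using v \<rho>(1)[of v] by (intro one_less_power) (auto simp: in_keys_iff)
        also have "\<dots> \<le> \<rho> v ^ ?l v * (\<Prod>v\<in>Poly_Mapping.keys n - {v}. \<rho> v ^ ?l v)"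
        proof -
          have "1 \<le> (\<Prod>v\<in>Poly_Mapping.keys n - {v}. \<rho> v ^ ?l v)"
            by (rule prod_ge_1) (rule one_le_power, rule less_imp_le, rule \<rho>(1))
          then show ?thesis using mult_left_mono[of 1 _ "\<rho> v ^ ?l v"] \<open>1 < \<rho> v ^ ?l v\<close> by simp
        qed
        also have "\<dots> = ?K" unfolding mpow_def by (rule prod.remove[OF finite_keys v, symmetric])
        finally show ?thesis .
      qed
      have K0: "0 < ?K" using K by linarith
      have "?R * 1 < ?R * ?K" by (rule mult_strict_left_mono[OF \<open>1 < ?K\<close> R(2)])
      then have "?R / ?K < ?R" by (simp only: pos_divide_less_eq[OF K0] mult_1_right)
      then have "Q < q" using Q_le q_bound[OF i] by linarith
      then have "padic_norm (padic_of c / padic_of F) < real CARD('p)" by (simp add: Q_def)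
      then have "Q \<le> 1" using padic_norm_lt_p_imp_le_1[of "padic_of c / padic_of F"] by (simp add: Q_def)
      then have "Q * ?K powr s \<le> 1 * ?R powr s"
        using False K s Q0 by (intro mult_mono powr_mono2) auto
      then show ?thesis by (simp add: phi)
    qed
    then show ?thesis using 1 by blast
  qed
  then show "\<phi> i n \<le> ?R * ?K powr (s - 1)" "\<phi> i n \<le> ?R powr s" by auto
qed

lemma \<phi>_vanishing:
  assumes i: "i < d"
  shows "vanishing (\<phi> i)"
proof -
  let ?R = "\<kappa> / nrm (g i)"
  have R: "0 < ?R" using nrm_g_pos[OF i] \<kappa> by simp
  define b where "b = Min (insert 2 (\<rho> ` set vs))"
  have b: "1 < b" unfolding b_def using \<rho>(1) by (subst Min_gr_iff) auto
  have b_le: "b \<le> \<rho> v" if "v \<in> set vs" for v unfolding b_def using that by (intro Min_le) auto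
  define c where "c = b powr (s - 1)"
  have c: "0 < c" "c < 1"
  proof -
    have "b powr (s - 1) < b powr 0" using b s by (intro powr_less_mono) auto
    then show "c < 1" using b by (simp add: c_def)
  qed (use b in \<open>simp add: c_def\<close>)
  have le: "\<phi> i n \<le> ?R * c ^ total_deg n" if "Poly_Mapping.keys n \<subseteq> set vs" for n
  proof -
    have "b ^ total_deg n \<le> mpow \<rho> n"
      unfolding mpow_const[symmetric] using that b b_le by (intro mpow_mono) auto
    then have "mpow \<rho> n powr (s - 1) \<le> (b ^ total_deg n) powr (s - 1)"
      using b s by (intro powr_mono2') auto
    also have "\<dots> = c ^ total_deg n"
      unfolding c_def using b by (simp add: powr_powr powr_realpow[symmetric] mult.commute)
    finally have "?R * mpow \<rho> n powr (s - 1) \<le> ?R * c ^ total_deg n" using R by (intro mult_left_mono) auto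
    then show ?thesis using \<phi>_bounds(1)[OF i, of n] by linarith
  qed
  show ?thesis
    unfolding vanishing_def
  proof (intro allI impI)
    fix e :: real assume e: "0 < e"
    then obtain N where N: "c ^ N < e / ?R" using real_arch_pow_inv[OF divide_pos_pos[OF e R] c(2)] by blast
    have "{n. \<phi> i n > e} \<subseteq> {n. Poly_Mapping.keys n \<subseteq> set vs \<and> total_deg n < N}"
    proof
      fix n assume n: "n \<in> {n. \<phi> i n > e}"
      then have keys: "Poly_Mapping.keys n \<subseteq> set vs" using e by (auto simp: \<phi>_def split: if_splits)
      have "total_deg n < N"
      proof (rule ccontr)
        assume "\<not> total_deg n < N"
        then have "c ^ total_deg n \<le> c ^ N" using c by (intro power_decreasing) auto
        then have "?R * c ^ total_deg n \<le> ?R * c ^ N" by (rule mult_left_mono[OF _ less_imp_le[OF R]])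
        also have "\<dots> < e" using N unfolding pos_less_divide_eq[OF R] by (simp only: mult.commute)
        finally show False using le[OF keys] n by simp
      qed
      then show "n \<in> {n. Poly_Mapping.keys n \<subseteq> set vs \<and> total_deg n < N}" using keys by simp
    qed
    then show "finite {n. \<phi> i n > e}" using finite_total_deg_less[OF finite_set] by (rule finite_subset)
  qed
qed

lemma word_series_tate: "i < d \<Longrightarrow> word_series i \<in> tate_algebra (set vs) r"
  unfolding word_series_def by (rule mps_nsum_tate[OF mahler_term_tate mahler_term_norm_le \<phi>_vanishing])

lemma word_series_norm_le: "i < d \<Longrightarrow> norm_le r (word_series i) ((\<kappa> / nrm (g i)) powr s)"
  unfolding word_series_def
  by (rule mps_nsum_norm_le[OF mahler_term_tate mahler_term_norm_le \<phi>_vanishing])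
    (auto intro: norm_le_mono[OF mahler_term_norm_le \<phi>_bounds(2)])

lemma ev_word_series_nat:
  assumes i: "i < d" and x: "in_disc x" and m: "\<And>v. v \<in> set vs \<Longrightarrow> x v = of_nat (m v)"
  shows "ev x (word_series i) = padic_of (X i (word m))"
proof -
  have trm: "ev x (mahler_term i n)
      = (if Poly_Mapping.keys n \<subseteq> set vs then padic_of (mahler_coeff i n) * of_nat (\<Prod>v\<in>set vs. m v choose poly_mapping.lookup n v) else 0)" for n
    using x m by (simp add: mahler_term_def ev_const_mult tate_prod mps_binomial_tate ev_prod ev_mps_binomial)
  have "ev x (word_series i) = nsum (\<lambda>n. ev x (mahler_term i n))"
    unfolding word_series_def
    by (rule ev_mps_nsum[OF mahler_term_tate mahler_term_norm_le \<phi>_vanishing[OF i] x])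
  also have "\<dots> = (\<Sum>n\<in>box (set vs) m. ev x (mahler_term i n))"
  proof (rule nsum_finite[OF finite_box[OF finite_set]])
    fix n assume n: "n \<notin> box (set vs) m"
    show "ev x (mahler_term i n) = 0"
    proof (cases "Poly_Mapping.keys n \<subseteq> set vs")
      case True
      then obtain v where v: "m v < poly_mapping.lookup n v" using n by (auto simp: box_def not_le)
      then have "v \<in> set vs" using True by (auto simp: in_keys_iff)
      then have "(\<Prod>v\<in>set vs. m v choose poly_mapping.lookup n v) = 0" using v by (intro prod_zero) auto
      then show ?thesis by (simp add: trm)
    qed (simp add: trm)
  qed
  also have "\<dots> = padic_of (X i (word m))"
    unfolding expand_word[of "X i"] padic_of_sum
    by (rule sum.cong) (auto simp: trm box_def mahler_coeff_def mult.commute simp del: of_nat_prod)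
  finally show ?thesis .
qed

text \<open>The residues of \<open>z\<close> are natural exponents tending to the point. The series
  follows them by \<open>ev_lipschitz\<close>, and the coordinate of the word by
  \<open>X_lipschitz\<close>.\<close>

lemma ev_word_series:
  assumes i: "i < d" and x: "\<And>v. padic_norm (x v) \<le> 1" and z: "\<And>v. v \<in> set vs \<Longrightarrow> x v = padic_of (z v)"
    and U: "U \<in> carrier G" "\<And>t. 0 < t \<Longrightarrow> \<exists>K. \<forall>k\<ge>K. ceq t U (word (\<lambda>v. nat (padic_residue (z v) k)))"
  shows "ev x (word_series i) = padic_of (X i U)"
proof -
  let ?m = "\<lambda>k v. nat (padic_residue (z v) k)" and ?W = "word_series i"
  obtain C where C: "0 < C" "norm_le r ?W C" by (rule tate_norm_bounded[OF word_series_tate[OF i]])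
  have word: "word m \<in> carrier G" for m unfolding word_def using H_closed by (intro foldr_mult_closed) auto
  have "padic_norm (ev x ?W - padic_of (X i U)) \<le> e" if e: "0 < e" for e
  proof -
    obtain K1 where K1: "(1 / q) ^ K1 < e / C" using p_small[of "e / C"] e C by auto
    obtain K2 where K2: "\<And>k. k \<ge> K2 \<Longrightarrow> ceq (e * nrm (g i)) U (word (?m k))"
      using U(2)[of "e * nrm (g i)"] e nrm_g_pos[OF i] by auto
    define k where "k = max K1 K2"
    define y where "y v = (if v \<in> set vs then of_nat (?m k v) else 0 :: 'p padic)" for v
    have y: "padic_norm (y v) \<le> 1" for v by (simp add: y_def padic_norm_of_nat_le_1)
    have "padic_norm (x v - y v) \<le> (1 / q) ^ k" if "v \<in> set vs" for v
    proof -
      have "x v - y v = padic_of (z v - of_nat (?m k v))" using that z by (simp add: y_def)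
      then show ?thesis using residue_approx[of "z v" k] by (simp only: padic_norm_padic_of)
    qed
    then have "padic_norm (ev x ?W - ev y ?W) \<le> C * (1 / q) ^ k"
      by (intro ev_lipschitz[OF r_ge_1 word_series_tate[OF i] C(2) x y]) auto
    also have "\<dots> \<le> C * (1 / q) ^ K1" using C by (intro mult_left_mono power_decreasing) (auto simp: k_def)
    also have "\<dots> \<le> e" using K1 C by (simp add: field_simps)
    finally have 1: "padic_norm (ev x ?W - ev y ?W) \<le> e" .
    have "ev y ?W = padic_of (X i (word (?m k)))"
    proof (rule ev_word_series_nat[OF i])
      show "in_disc y" unfolding in_disc_def using y r_ge_1 order_trans by blast
    qed (simp add: y_def)
    moreover have "padic_int_norm (X i (word (?m k)) - X i U) \<le> e"
    proof -
      have "word (?m k) = U \<otimes> (inv U \<otimes> word (?m k))" using U(1) word by simp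
      then have "nrm (g i) * padic_int_norm (X i (word (?m k)) - X i U) \<le> nrm (inv U \<otimes> word (?m k))"
        using X_lipschitz[OF i U(1), of "inv U \<otimes> word (?m k)"] U(1) word by simp
      also have "\<dots> \<le> e * nrm (g i)" using K2[of k] by (simp add: ceq_def k_def)
      finally show ?thesis using nrm_g_pos[OF i] by (simp add: mult.commute)
    qed
    ultimately have 2: "padic_norm (ev y ?W - padic_of (X i U)) \<le> e"
      by (simp flip: padic_of_simps(6))
    show ?thesis by (rule padic_norm_trans_le[OF 1 2])
  qed
  from padic_norm_le_all_imp_0[OF this] show ?thesis by simp
qed

end

section \<open>The group law on the polydiscs\<close>

lemma padic_int_of_padic_of [simp]: "padic_int_of_padic (padic_of z) = z"
  unfolding padic_int_of_padic_def padic_of_def[symmetric] by (rule the_equality) auto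

lemma padic_of_int_of_padic: "padic_norm x \<le> 1 \<Longrightarrow> padic_of (padic_int_of_padic x) = x"
  by (erule padic_integral) simp

section \<open>The radii of the dagger disc and of the polydisc\<close>

lemma tate_algebra_antimono:
  fixes r r' :: "'v \<Rightarrow> real"
  assumes V: "finite V" and r: "\<And>v. 0 < r v" "\<And>v. 0 < r' v" and le: "\<And>v. v \<in> V \<Longrightarrow> r' v \<le> r v"
    and f: "f \<in> tate_algebra V r"
  shows "f \<in> tate_algebra V r'"
proof -
  note D = f[unfolded tate_algebra_iff[OF V r(1)]]
  have "vanishing (\<lambda>a. padic_norm (mps_coeff f a) * mpow r' a)"
  proof (rule vanishing_le)
    show "vanishing (\<lambda>a. padic_norm (mps_coeff f a) * mpow r a)" using D by blast
    show "padic_norm (mps_coeff f a) * mpow r' a \<le> padic_norm (mps_coeff f a) * mpow r a" for a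
    proof (cases "mps_coeff f a = 0")
      case False
      then have "Poly_Mapping.keys a \<subseteq> V" using D by blast
      then have "mpow r' a \<le> mpow r a" using le r by (intro mpow_mono) (auto simp: less_imp_le)
      then show ?thesis by (intro mult_left_mono) auto
    qed simp
  qed
  then show ?thesis using D unfolding tate_algebra_iff[OF V r(2)] by blast
qed

lemma small_powr:
  assumes "1 < c" "1 < b"
  obtains s :: real where "0 < s" "s < 1" "(c :: real) powr s \<le> b"
proof (rule that[of "min (1 / 2) (log c b)"])
  have l: "0 < log c b" using assms by simp
  then show "0 < min (1 / 2) (log c b)" by simp
  have "c powr min (1 / 2) (log c b) \<le> c powr log c b" using assms by (intro powr_mono) auto
  then show "c powr min (1 / 2) (log c b) \<le> b" using assms by simp
qed simp

text \<open>As finitely many variables are involved, the polyradii \<rho>_i^s and the constant ones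
  r > 1 are cofinal near 1.\<close>

lemma dagger_disc_family:
  assumes \<rho>: "\<And>i. 1 < \<rho> i"
  shows "disc_family d (dagger_disc_powers d :: nat \<Rightarrow> 'p::prime_card series set) \<rho> {0<..<1}"
proof
  fix k
  have pos: "0 < (\<lambda>(b, i). \<rho> i powr s) v" for s and v :: "nat \<times> nat"
    using \<rho>[of "snd v"] by (simp add: split_def)
  have "(\<Union>r\<in>{1<..}. tate_algebra (coords d k) (\<lambda>_. r)) =
      (\<Union>s\<in>{0<..<1}. tate_algebra (coords d k) (\<lambda>(b, i). \<rho> i powr s) :: 'p series set)" (is "?L = ?R")
  proof (intro equalityI subsetI)
    fix f :: "'p series" assume "f \<in> ?L"
    then obtain r where r: "1 < r" and f: "f \<in> tate_algebra (coords d k) (\<lambda>_. r)" by auto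
    \<comment> \<open>The 2 keeps the maximum defined and above 1 when there are no
      coordinates.\<close>
    define M where "M = Max (insert 2 (\<rho> ` {..<d}))"
    have "2 \<le> M" unfolding M_def by (rule Max_ge) auto
    then have "1 < M" by simp
    then obtain s where s: "0 < s" "s < 1" "M powr s \<le> r" using r by (rule small_powr)
    have "f \<in> tate_algebra (coords d k) (\<lambda>(b, i). \<rho> i powr s)"
    proof (rule tate_algebra_antimono[OF finite_coords _ pos _ f])
      fix v assume "v \<in> coords d k"
      then have "\<rho> (snd v) \<le> M" unfolding M_def by (intro Max_ge) (auto simp: coords_def)
      then have "\<rho> (snd v) powr s \<le> M powr s" using s \<rho>[of "snd v"] by (intro powr_mono2) auto
      then show "(\<lambda>(b, i). \<rho> i powr s) v \<le> r" using s by (simp add: split_def)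
    qed (use r in simp)
    then show "f \<in> ?R" using s by auto
  next
    fix f :: "'p series" assume "f \<in> ?R"
    then obtain s where s: "0 < s" "s < 1" and f: "f \<in> tate_algebra (coords d k) (\<lambda>(b, i). \<rho> i powr s)" by auto
    define r where "r = Min (insert 2 ((\<lambda>i. \<rho> i powr s) ` {..<d}))"
    have r: "1 < r" unfolding r_def using gr_one_powr[OF \<rho> s(1)] by (subst Min_gr_iff) auto
    have "f \<in> tate_algebra (coords d k) (\<lambda>_. r)"
    proof (rule tate_algebra_antimono[OF finite_coords pos _ _ f])
      fix v assume "v \<in> coords d k"
      then show "r \<le> (\<lambda>(b, i). \<rho> i powr s) v" unfolding r_def by (intro Min_le) (auto simp: coords_def)
    qed (use r in simp)
    then show "f \<in> ?L" using r by auto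
  qed
  then show "dagger_disc_powers d k = ?R"
    by (simp only: dagger_disc_powers_def washnitzer_algebra_def coords_def)
qed (use \<rho> in auto)

lemma polydisc_family:
  assumes \<rho>: "\<And>i. 1 < \<rho> i" and s: "0 < s" and r: "\<And>i. i < d \<Longrightarrow> r i = \<rho> i powr s"
  shows "disc_family d (polydisc_powers d r :: nat \<Rightarrow> 'p::prime_card series set) \<rho> {s}"
proof
  fix k
  have "tate_algebra (coords d k) (\<lambda>(b, i). r i) = (tate_algebra (coords d k) (\<lambda>(b, i). \<rho> i powr s) :: 'p series set)"
    by (rule tate_algebra_cong) (auto simp: coords_def r)
  then show "polydisc_powers d r k = (\<Union>s\<in>{s}. tate_algebra (coords d k) (\<lambda>(b, i). \<rho> i powr s) :: 'p series set)"
    by (simp add: polydisc_powers_def coords_def)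
qed (use \<rho> s in auto)

text \<open>The value 2 of \<open>\<rho>\<close> beyond the basis is a default above 1, so that all
  indices can be treated alike.\<close>

locale saturated_basis = p_valued_basis P G Top \<omega> gs q \<kappa>
  for P :: "'p::prime_card itself" and G :: "('g, 'b) monoid_scheme" (structure)
    and Top :: "'g topology" and \<omega> :: "'g \<Rightarrow> ereal" and gs :: "'g list" and q \<kappa> :: real +
  fixes \<rho> :: "nat \<Rightarrow> real"
  assumes sat: "saturated CARD('p) G \<omega>"
    and \<rho>_eq: "\<And>i. \<rho> i = (if i < length gs then \<kappa> / pmag q (\<omega> (gs ! i)) else 2)"
begin

lemma \<rho>_gt_1: "1 < \<rho> i"
  using nrm_less_\<kappa>[OF g_closed[of i]] nrm_g_pos[of i] by (simp add: \<rho>_eq nrm_def)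

lemma \<rho>_nrm: "i < d \<Longrightarrow> \<rho> i = \<kappa> / nrm (g i)"
  by (simp add: \<rho>_eq nrm_def)

section \<open>The power series of multiplication and inversion\<close>

definition mult_vars :: "(nat \<times> nat) list" where
  "mult_vars = map (Pair 0) [0..<d] @ map (Pair 1) [0..<d]"

text \<open>Reversed, since the inverse of a product is the product of the inverses in reverse
  order.\<close>

definition inv_vars :: "(nat \<times> nat) list" where
  "inv_vars = map (Pair 0) (rev [0..<d])"

lemma set_mult_vars: "set mult_vars = coords d 2"
  by (auto simp: mult_vars_def coords_def less_2_cases_iff)

lemma set_inv_vars: "set inv_vars = coords d 1"
  by (auto simp: inv_vars_def coords_def)

sublocale mw: group_word P G Top \<omega> gs q \<kappa> mult_vars "\<lambda>v. g (snd v)"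
proof
  show "distinct mult_vars" by (auto simp: mult_vars_def distinct_map inj_on_def)
  show "g (snd v) \<in> carrier G" if "v \<in> set mult_vars" for v
    using that by (auto simp: set_mult_vars coords_def)
qed

sublocale iw: group_word P G Top \<omega> gs q \<kappa> inv_vars "\<lambda>v. inv (g (snd v))"
proof
  show "distinct inv_vars" by (auto simp: inv_vars_def distinct_map inj_on_def)
  show "inv (g (snd v)) \<in> carrier G" if "v \<in> set inv_vars" for v
    using that by (auto simp: set_inv_vars coords_def)
qed

lemma mult_radii:
  assumes "0 < s" "s < 1"
  shows "word_radii P G Top \<omega> gs q \<kappa> mult_vars (\<lambda>v. g (snd v)) (\<lambda>v. \<rho> (snd v)) s"
proof
  show "0 < \<rho> (snd v) powr s" for v using \<rho>_gt_1[of "snd v"] by simp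
  show "nrm (g (snd v)) * \<rho> (snd v) = \<kappa>" if "v \<in> set mult_vars" for v
    using that nrm_g_pos[of "snd v"] by (auto simp: set_mult_vars coords_def \<rho>_nrm)
  show "\<kappa> / nrm (g i) \<le> q" if "i < d" for i using saturated_nrm_g[OF sat that] .
qed (use assms \<rho>_gt_1 in auto)

lemma inv_radii:
  assumes "0 < s" "s < 1"
  shows "word_radii P G Top \<omega> gs q \<kappa> inv_vars (\<lambda>v. inv (g (snd v))) (\<lambda>v. \<rho> (snd v)) s"
proof
  show "0 < \<rho> (snd v) powr s" for v using \<rho>_gt_1[of "snd v"] by simp
  show "nrm (inv (g (snd v))) * \<rho> (snd v) = \<kappa>" if "v \<in> set inv_vars" for v
    using that nrm_g_pos[of "snd v"] by (auto simp: set_inv_vars coords_def \<rho>_nrm)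
  show "\<kappa> / nrm (g i) \<le> q" if "i < d" for i using saturated_nrm_g[OF sat that] .
qed (use assms \<rho>_gt_1 in auto)

definition cd :: "(nat \<times> nat \<Rightarrow> 'p padic) \<Rightarrow> nat \<Rightarrow> nat \<Rightarrow> 'p padic_int" where
  "cd x b i = padic_int_of_padic (x (b, i))"

definition pt :: "(nat \<times> nat \<Rightarrow> 'p padic) \<Rightarrow> nat \<Rightarrow> 'g" where "pt x b = E (cd x b)"

text \<open>The value 0 away from the coordinates of the first factor makes the point integral in
  every variable.\<close>

definition point_of :: "'g \<Rightarrow> nat \<times> nat \<Rightarrow> 'p padic" where
  "point_of h = (\<lambda>(b, i). if b = 0 \<and> i < d then padic_of (X i h) else 0)"

lemma pt_closed [simp]: "pt x b \<in> carrier G" by (simp add: pt_def)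

lemma integral_point_of [simp]: "integral_pt (point_of h)"
  by (auto simp: integral_pt_def point_of_def padic_int_norm_le_1)

lemma pt_point_of [simp]: "h \<in> carrier G \<Longrightarrow> pt (point_of h) 0 = h"
proof -
  assume "h \<in> carrier G"
  moreover have "pt (point_of h) 0 = E (\<lambda>i. X i h)"
    unfolding pt_def by (rule E_cong) (simp add: cd_def point_of_def)
  ultimately show ?thesis by simp
qed

lemma padic_of_cd: "integral_pt x \<Longrightarrow> padic_of (cd x b i) = x (b, i)"
  unfolding cd_def integral_pt_def by (intro padic_of_int_of_padic) blast

lemma point_of_pt: "integral_pt x \<Longrightarrow> v \<in> coords d 1 \<Longrightarrow> point_of (pt x 0) v = x v"
  by (auto simp: coords_def point_of_def pt_def padic_of_cd)

lemma pt_cong: "(\<And>i. i < d \<Longrightarrow> x (b, i) = y (c, i)) \<Longrightarrow> pt x b = pt y c"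
  unfolding pt_def cd_def by (rule E_cong) simp

lemma ceq_residues:
  assumes "0 < t"
  shows "\<exists>K. \<forall>k\<ge>K. ceq t (E z) (E (\<lambda>i. of_nat (nat (padic_residue (z i) k))))"
proof -
  obtain K where K: "(1 / q) ^ K < t" using p_small[OF assms] by blast
  have "ceq t (E z) (E (\<lambda>i. of_nat (nat (padic_residue (z i) k))))" if "K \<le> k" for k
    unfolding ceq_E_iff[OF less_imp_le[OF assms]]
  proof (intro allI impI)
    fix i assume i: "i < d"
    have "nrm (g i) * padic_int_norm (of_nat (nat (padic_residue (z i) k)) - z i) \<le> 1 * (1 / q) ^ k"
      using nrm_less_1[OF g_closed[OF i]] residue_approx[of "z i" k]
      by (intro mult_mono) (auto simp: padic_int_norm_minus_commute[of _ "z i"])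
    also have "\<dots> \<le> 1 * (1 / q) ^ K" using that by (intro mult_left_mono power_decreasing) auto
    finally show "nrm (g i) * padic_int_norm (of_nat (nat (padic_residue (z i) k)) - z i) \<le> t" using K by simp
  qed
  then show ?thesis by blast
qed

lemma mult_word: "mw.word m = E (\<lambda>i. of_nat (m (0, i))) \<otimes> E (\<lambda>i. of_nat (m (1, i)))"
proof -
  have map: "foldr (\<lambda>v y. g (snd v) [^] m v \<otimes> y) (map (Pair b) is) z
      = foldr (\<lambda>i y. g i [^] m (b, i) \<otimes> y) is z" for b "is" z
    by (induction "is") auto
  show ?thesis
    unfolding mw.word_def unfolding mult_vars_def foldr_append map
    using foldr_mult_right[of "[0..<d]" "\<lambda>i. g i [^] m (0, i)" \<one> "E (\<lambda>i. of_nat (m (1, i)))"]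
    by (simp add: E_of_nat[symmetric])
qed

lemma inv_word: "iw.word m = inv (E (\<lambda>i. of_nat (m (0, i))))"
proof -
  have "foldr (\<lambda>v y. inv (g (snd v)) [^] m v \<otimes> y) (map (Pair 0) (rev is)) z
      = inv (foldr (\<lambda>i y. g i [^] m (0, i) \<otimes> y) is \<one>) \<otimes> z"
    if "set is \<subseteq> {..<d}" "z \<in> carrier G" for "is" z
    using that
  proof (induction "is" arbitrary: z)
    case (Cons i "is")
    have "foldr (\<lambda>i y. g i [^] m (0, i) \<otimes> y) is \<one> \<in> carrier G"
      using Cons.prems by (intro foldr_mult_closed) auto
    then show ?case using Cons by (simp add: nat_pow_inv inv_mult_group m_assoc)
  qed simp
  from this[of "[0..<d]" \<one>] show ?thesis
    unfolding iw.word_def unfolding inv_vars_def by (simp add: E_of_nat[symmetric] lessThan_atLeast0)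
qed

lemma ceq_inv:
  assumes "h \<in> carrier G" "k \<in> carrier G" "ceq t h k"
  shows "ceq t (inv h) (inv k)"
proof -
  have "inv (inv h) \<otimes> inv k = k \<otimes> (inv k \<otimes> h) \<otimes> inv k" using assms by simp
  moreover have "nrm (inv k \<otimes> h) \<le> t" using ceq_sym[OF assms] by (simp add: ceq_def)
  ultimately show ?thesis
    using nrm_conj_le[of k "inv k \<otimes> h"] assms by (simp add: ceq_def)
qed

lemma
  assumes i: "i < d"
  shows mult_series_tate: "0 < s \<Longrightarrow> s < 1 \<Longrightarrow> mw.word_series i \<in> tate_algebra (coords d 2) (\<lambda>v. \<rho> (snd v) powr s)"
    and mult_series_norm_le: "0 < s \<Longrightarrow> s < 1 \<Longrightarrow> norm_le (\<lambda>v. \<rho> (snd v) powr s) (mw.word_series i) (\<rho> i powr s)"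
    and ev_mult_series: "integral_pt x \<Longrightarrow> ev x (mw.word_series i) = padic_of (X i (pt x 0 \<otimes> pt x 1))"
proof -
  show "mw.word_series i \<in> tate_algebra (coords d 2) (\<lambda>v. \<rho> (snd v) powr s)"
    "norm_le (\<lambda>v. \<rho> (snd v) powr s) (mw.word_series i) (\<rho> i powr s)" if s: "0 < s" "s < 1"
  proof -
    interpret R: word_radii P G Top \<omega> gs q \<kappa> mult_vars "\<lambda>v. g (snd v)" "\<lambda>v. \<rho> (snd v)" s
      by (rule mult_radii[OF s])
    show "mw.word_series i \<in> tate_algebra (coords d 2) (\<lambda>v. \<rho> (snd v) powr s)"
      using R.word_series_tate[OF i] by (simp add: set_mult_vars)
    show "norm_le (\<lambda>v. \<rho> (snd v) powr s) (mw.word_series i) (\<rho> i powr s)"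
      using R.word_series_norm_le[OF i] by (simp add: \<rho>_nrm[OF i])
  qed
  assume x: "integral_pt x"
  \<comment> \<open>Any exponent in the open unit interval would do: neither the series nor its
    value at a point involves s.\<close>
  interpret R: word_radii P G Top \<omega> gs q \<kappa> mult_vars "\<lambda>v. g (snd v)" "\<lambda>v. \<rho> (snd v)" "1 / 2"
    by (rule mult_radii) auto
  show "ev x (mw.word_series i) = padic_of (X i (pt x 0 \<otimes> pt x 1))"
  proof (rule R.ev_word_series[OF i, where z="\<lambda>v. cd x (fst v) (snd v)"])
    show "padic_norm (x v) \<le> 1" for v using x unfolding integral_pt_def by blast
    show "x v = padic_of (cd x (fst v) (snd v))" for v using padic_of_cd[OF x, of "fst v" "snd v"] by simp
    fix t :: real assume t: "0 < t"
    obtain K0 where K0: "\<And>k. k \<ge> K0 \<Longrightarrow> ceq t (pt x 0) (E (\<lambda>i. of_nat (nat (padic_residue (cd x 0 i) k))))"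
      using ceq_residues[OF t, of "cd x 0"] unfolding pt_def by blast
    obtain K1 where K1: "\<And>k. k \<ge> K1 \<Longrightarrow> ceq t (pt x 1) (E (\<lambda>i. of_nat (nat (padic_residue (cd x 1 i) k))))"
      using ceq_residues[OF t, of "cd x 1"] unfolding pt_def by blast
    show "\<exists>K. \<forall>k\<ge>K. ceq t (pt x 0 \<otimes> pt x 1) (mw.word (\<lambda>v. nat (padic_residue (cd x (fst v) (snd v)) k)))"
      unfolding mult_word fst_conv snd_conv
      by (intro exI[of _ "max K0 K1"] allI impI ceq_mult K0 K1) auto
  qed simp
qed

lemma
  assumes i: "i < d"
  shows inv_series_tate: "0 < s \<Longrightarrow> s < 1 \<Longrightarrow> iw.word_series i \<in> tate_algebra (coords d 1) (\<lambda>v. \<rho> (snd v) powr s)"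
    and inv_series_norm_le: "0 < s \<Longrightarrow> s < 1 \<Longrightarrow> norm_le (\<lambda>v. \<rho> (snd v) powr s) (iw.word_series i) (\<rho> i powr s)"
    and ev_inv_series: "integral_pt x \<Longrightarrow> ev x (iw.word_series i) = padic_of (X i (inv (pt x 0)))"
proof -
  show "iw.word_series i \<in> tate_algebra (coords d 1) (\<lambda>v. \<rho> (snd v) powr s)"
    "norm_le (\<lambda>v. \<rho> (snd v) powr s) (iw.word_series i) (\<rho> i powr s)" if s: "0 < s" "s < 1"
  proof -
    interpret R: word_radii P G Top \<omega> gs q \<kappa> inv_vars "\<lambda>v. inv (g (snd v))" "\<lambda>v. \<rho> (snd v)" s
      by (rule inv_radii[OF s])
    show "iw.word_series i \<in> tate_algebra (coords d 1) (\<lambda>v. \<rho> (snd v) powr s)"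
      using R.word_series_tate[OF i] by (simp add: set_inv_vars)
    show "norm_le (\<lambda>v. \<rho> (snd v) powr s) (iw.word_series i) (\<rho> i powr s)"
      using R.word_series_norm_le[OF i] by (simp add: \<rho>_nrm[OF i])
  qed
  assume x: "integral_pt x"
  interpret R: word_radii P G Top \<omega> gs q \<kappa> inv_vars "\<lambda>v. inv (g (snd v))" "\<lambda>v. \<rho> (snd v)" "1 / 2"
    by (rule inv_radii) auto
  show "ev x (iw.word_series i) = padic_of (X i (inv (pt x 0)))"
  proof (rule R.ev_word_series[OF i, where z="\<lambda>v. cd x (fst v) (snd v)"])
    show "padic_norm (x v) \<le> 1" for v using x unfolding integral_pt_def by blast
    show "x v = padic_of (cd x (fst v) (snd v))" for v using padic_of_cd[OF x, of "fst v" "snd v"] by simp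
    fix t :: real assume t: "0 < t"
    obtain K where K: "\<And>k. k \<ge> K \<Longrightarrow> ceq t (pt x 0) (E (\<lambda>i. of_nat (nat (padic_residue (cd x 0 i) k))))"
      using ceq_residues[OF t, of "cd x 0"] unfolding pt_def by blast
    show "\<exists>K. \<forall>k\<ge>K. ceq t (inv (pt x 0)) (iw.word (\<lambda>v. nat (padic_residue (cd x (fst v) (snd v)) k)))"
      unfolding inv_word fst_conv snd_conv
      by (intro exI[of _ K] allI impI ceq_inv K) auto
  qed simp
qed

text \<open>The series are the same for every family; only the domains of the three functions
  change. The counit substitutes 0 because the neutral element has coordinates 0.\<close>

definition law :: "(nat \<Rightarrow> 'p series set) \<Rightarrow> 'p group_law" where
  "law A = \<lparr>comult = restrict (mps_subst (\<lambda>v. mw.word_series (snd v))) (A 1),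
     counit = restrict (mps_subst (\<lambda>_. 0)) (A 1),
     antipode = restrict (mps_subst (\<lambda>v. iw.word_series (snd v))) (A 1)\<rparr>"

end

section \<open>The group law on a family of polydiscs\<close>

locale group_family = saturated_basis P G Top \<omega> gs q \<kappa> \<rho> + disc_family "length gs" A \<rho> I
  for P :: "'p::prime_card itself" and G :: "('g, 'b) monoid_scheme" (structure)
    and Top :: "'g topology" and \<omega> :: "'g \<Rightarrow> ereal" and gs :: "'g list" and q \<kappa> :: real
    and \<rho> :: "nat \<Rightarrow> real" and A :: "nat \<Rightarrow> 'p series set" and I :: "real set" +
  assumes I_less_1: "\<And>s. s \<in> I \<Longrightarrow> s < 1"
begin

abbreviation pp :: "(nat \<times> nat \<Rightarrow> 'p padic) \<Rightarrow> (nat \<times> nat \<Rightarrow> 'p padic) \<Rightarrow> nat \<times> nat \<Rightarrow> 'p padic" where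
  "pp \<equiv> pair_point"

lemma rad_eq: "rad s = (\<lambda>v. \<rho> (snd v) powr s)"
  by (simp add: rad_def split_def)

lemma realizes_comult: "realizes 1 2 (comult (law A)) (\<lambda>x. point_of (pt x 0 \<otimes> pt x 1))"
  unfolding law_def group_law.simps
proof (rule realizes_subst)
  show "contracting_tuple 1 2 (\<lambda>v. mw.word_series (snd v))"
    unfolding contracting_tuple_def rad_eq
  proof (intro ballI bexI conjI)
    fix s v assume s: "s \<in> I" and "v \<in> coords d 1"
    then have v: "snd v < d" by (auto simp: coords_def)
    note D = v I_pos[OF s] I_less_1[OF s]
    show "mw.word_series (snd v) \<in> tate_algebra (coords d 2) (\<lambda>v. \<rho> (snd v) powr s)" by (rule mult_series_tate[OF D])
    show "norm_le (\<lambda>v. \<rho> (snd v) powr s) (mw.word_series (snd v)) (\<rho> (snd v) powr s)" by (rule mult_series_norm_le[OF D])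
  qed
  fix x :: "nat \<times> nat \<Rightarrow> 'p padic" and v assume "integral_pt x" "v \<in> coords d 1"
  then show "ev x (mw.word_series (snd v)) = point_of (pt x 0 \<otimes> pt x 1) v"
    by (auto simp: coords_def ev_mult_series point_of_def)
qed simp

lemma realizes_antipode: "realizes 1 1 (antipode (law A)) (\<lambda>x. point_of (inv (pt x 0)))"
  unfolding law_def group_law.simps
proof (rule realizes_subst)
  show "contracting_tuple 1 1 (\<lambda>v. iw.word_series (snd v))"
    unfolding contracting_tuple_def rad_eq
  proof (intro ballI bexI conjI)
    fix s v assume s: "s \<in> I" and "v \<in> coords d 1"
    then have v: "snd v < d" by (auto simp: coords_def)
    note D = v I_pos[OF s] I_less_1[OF s]
    show "iw.word_series (snd v) \<in> tate_algebra (coords d 1) (\<lambda>v. \<rho> (snd v) powr s)" by (rule inv_series_tate[OF D])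
    show "norm_le (\<lambda>v. \<rho> (snd v) powr s) (iw.word_series (snd v)) (\<rho> (snd v) powr s)" by (rule inv_series_norm_le[OF D])
  qed
  fix x :: "nat \<times> nat \<Rightarrow> 'p padic" and v assume "integral_pt x" "v \<in> coords d 1"
  then show "ev x (iw.word_series (snd v)) = point_of (inv (pt x 0)) v"
    by (auto simp: coords_def ev_inv_series point_of_def)
qed simp

lemma realizes_counit: "realizes 1 0 (counit (law A)) (\<lambda>_. point_of \<one>)"
  unfolding law_def group_law.simps
proof (rule realizes_subst)
  show "contracting_tuple 1 0 (\<lambda>_. 0)"
    unfolding contracting_tuple_def using less_imp_le[OF pr.r_pos] by (auto simp: norm_le_def)
  fix x :: "nat \<times> nat \<Rightarrow> 'p padic" and v assume "integral_pt x" "v \<in> coords d 1"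
  then show "ev x 0 = point_of \<one> v"
    by (auto simp: coords_def pr.ev_0 point_of_def)
qed simp

lemma pt_pair_point [simp]:
  "pt (pp x y) 0 = pt x 0" "pt (pp x y) (Suc 0) = pt y 0"
  by (rule pt_cong; simp)+

lemma group_object_law: "group_object A (law A)"
  by (rule group_objectI[OF realizes_comult realizes_counit realizes_antipode])
    (simp_all add: m_assoc point_of_pt)

end

text \<open>On the dagger disc every character has integral coordinates and every morphism is contractive.\<close>

locale dagger_family = group_family P G Top \<omega> gs q \<kappa> \<rho> A "{0<..<1}"
  for P :: "'p::prime_card itself" and G :: "('g, 'b) monoid_scheme" (structure)
    and Top :: "'g topology" and \<omega> :: "'g \<Rightarrow> ereal" and gs :: "'g list" and q \<kappa> :: real
    and \<rho> :: "nat \<Rightarrow> real" and A :: "nat \<Rightarrow> 'p series set"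
begin

lemma rad_powr: "rad s v = \<rho> (snd v) powr s"
  by (simp add: rad_eq)

text \<open>Automatic continuity bounds the value by \<rho>^s for every s in the unit interval, and
  these radii tend to 1.\<close>

lemma hom_point_integral:
  assumes h: "h \<in> alg_homs (A k) (A l)" and x: "integral_pt x" and v: "v \<in> coords d k"
  shows "padic_norm (ev x (h (mps_var v))) \<le> 1"
proof (rule ccontr)
  assume "\<not> ?thesis"
  then have gt: "1 < padic_norm (ev x (h (mps_var v)))" by simp
  define b where "b = (1 + padic_norm (ev x (h (mps_var v)))) / 2"
  have b: "1 < b" "b < padic_norm (ev x (h (mps_var v)))" using gt by (simp_all add: b_def)
  obtain s where s: "0 < s" "s < 1" "\<rho> (snd v) powr s \<le> b" by (rule small_powr[OF \<rho>_gt_1 b(1)])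
  have "padic_norm (ev x (h (mps_var v))) \<le> rad s v"
    using s by (intro alg_hom_point_norm[OF h x _ v]) auto
  then show False using s b by (simp add: rad_powr)
qed

sublocale unit: polyradius "coords d k" "\<lambda>_. 1 :: real" for k
  by standard simp_all

lemma mpow_1 [simp]: "mpow (\<lambda>_. 1 :: real) a = 1"
  by (simp add: mpow_const)

lemma A_subset_unit: "f \<in> A k \<Longrightarrow> f \<in> tate_algebra (coords d k) (\<lambda>_. 1)"
proof -
  assume "f \<in> A k"
  then obtain s where s: "s \<in> {0<..<1}" "f \<in> T k s" unfolding A_iff by blast
  show ?thesis by (rule tate_algebra_antimono[OF finite_coords pr.r_pos _ rad_ge_1[OF s(1)] s(2)]) simp
qed

text \<open>If the Gauss norm of the image f of a coordinate exceeded 1, then 1 - p f^2 would be a unit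
  whose norm is not attained at the constant term.\<close>

lemma hom_var_norm_le_1:
  assumes h: "h \<in> alg_homs (A 1) (A l)" and v: "v \<in> coords d 1"
  shows "norm_le (\<lambda>_. 1) (h (mps_var v)) 1"
proof (rule ccontr)
  let ?f = "h (mps_var v)" and ?p = "mps_const (of_nat CARD('p)) :: 'p series"
  assume "\<not> norm_le (\<lambda>_. 1) ?f 1"
  then obtain a0 where a0: "1 < padic_norm (mps_coeff ?f a0)" by (auto simp: norm_le_def not_le)
  have f: "?f \<in> A l" using alg_homD(1)[OF h A_var[OF v]] .
  have f1: "?f \<in> tate_algebra (coords d l) (\<lambda>_. 1)" by (rule A_subset_unit[OF f])
  have fnz: "?f \<noteq> 0" using a0 by auto
  obtain a b where ab: "norm_le (\<lambda>_. 1) ?f (padic_norm (mps_coeff ?f a) * mpow (\<lambda>_. 1) a)"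
      "norm_le (\<lambda>_. 1) ?f (padic_norm (mps_coeff ?f b) * mpow (\<lambda>_. 1) b)"
      "padic_norm (mps_coeff (?f * ?f) (a + b)) = padic_norm (mps_coeff ?f a) * padic_norm (mps_coeff ?f b)"
    by (rule unit.gauss_dominant[OF f1 fnz f1 fnz]) blast
  \<comment> \<open>A Gauss norm above 1 is at least p, by discreteness of the absolute
    value.\<close>
  have ge_q: "q \<le> padic_norm (mps_coeff ?f c)" if "norm_le (\<lambda>_. 1) ?f (padic_norm (mps_coeff ?f c) * mpow (\<lambda>_. 1) c)" for c
  proof (rule ccontr)
    assume "\<not> q \<le> padic_norm (mps_coeff ?f c)"
    then have "padic_norm (mps_coeff ?f c) \<le> 1"
      by (intro padic_norm_lt_p_imp_le_1) (simp only: not_le card_eq_q)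
    moreover have "padic_norm (mps_coeff ?f a0) \<le> padic_norm (mps_coeff ?f c)"
      using that by (auto simp: norm_le_def)
    ultimately show False using a0 by linarith
  qed
  define c where "c = a + b"
  have big: "q * q \<le> padic_norm (mps_coeff (?f * ?f) c)"
    unfolding c_def ab(3) using ge_q[OF ab(1)] ge_q[OF ab(2)] by (intro mult_mono) auto
  \<comment> \<open>With the square, p f^2 has norm at least p > 1, whereas p f is only known to
    have norm at least 1. The coordinate itself has radius close to 1, so 1 - p X^2 is still
    invertible near the unit disc.\<close>
  define u where "u = 1 - ?p * (?f * ?f)"
  have zero: "integral_pt (\<lambda>_. 0 :: 'p padic)" by (simp add: integral_pt_def)
  have ev0: "ev (\<lambda>_. 0) F = mps_coeff F 0" for F :: "'p series"
  proof -
    have "mpow (\<lambda>_. 0 :: 'p padic) n = 0" if n: "n \<noteq> 0" for n :: "nat \<times> nat \<Rightarrow>\<^sub>0 nat"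
    proof -
      obtain w where "w \<in> Poly_Mapping.keys n" using n by (metis ex_in_conv keys_eq_empty)
      then show ?thesis unfolding mpow_def by (intro prod_zero bexI[of _ w]) (simp_all add: in_keys_iff)
    qed
    then show ?thesis unfolding ev_def by (subst nsum_finite[of "{0}"]) auto
  qed
  have "padic_norm (mps_coeff ?f 0) \<le> 1"
    using hom_point_integral[OF h zero v] by (simp add: ev0)
  moreover have "mps_coeff (?f * ?f) 0 = mps_coeff ?f 0 * mps_coeff ?f 0"
    using evA_mult[OF f f zero] by (simp add: ev0)
  ultimately have const1: "padic_norm (mps_coeff (?f * ?f) 0) \<le> 1"
    by (simp add: mult_le_one)
  have "1 < q * q" using q_gt_1 by (simp add: less_1_mult del: q_gt_1)
  then have "c \<noteq> 0" using big const1 by auto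
  have uc: "q \<le> padic_norm (mps_coeff u c)"
  proof -
    have "q * padic_norm (mps_coeff u c) = padic_norm (mps_coeff (?f * ?f) c)"
      using \<open>c \<noteq> 0\<close> padic_norm_p[where 'p='p] by (simp add: u_def)
    then have "q * q \<le> q * padic_norm (mps_coeff u c)" using big by simp
    then show ?thesis by simp
  qed
  have u0: "padic_norm (mps_coeff u 0) \<le> 1"
  proof -
    have "padic_norm (of_nat CARD('p) * mps_coeff (?f * ?f) 0) \<le> 1 * 1"
      unfolding padic_norm_mult using const1 by (intro mult_mono padic_norm_of_nat_le_1) auto
    then show ?thesis unfolding u_def by (simp add: padic_norm_diff_le)
  qed
  obtain w where w: "w \<in> A l" "w * u = 1"
  proof -
    have qh: "1 < sqrt q" using q_gt_1 by (simp del: q_gt_1)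
    \<comment> \<open>For radius at most p^(1/4), p X^2 has norm at most p^(-1/2) < 1.\<close>
    obtain s where s: "0 < s" "s < 1" "\<rho> (snd v) powr s \<le> sqrt (sqrt q)"
      using small_powr[OF \<rho>_gt_1[of "snd v"], of "sqrt (sqrt q)"] qh by auto
    let ?X = "mps_var v :: 'p series" and ?u = "?p * (mps_var v * mps_var v)"
    have nX: "norm_le (rad s) ?X (sqrt (sqrt q))"
      using norm_le_mono[OF pr.norm_le_var, of s v] s(3) by (simp add: rad_powr)
    have "norm_le (rad s) ?u (padic_norm (of_nat CARD('p) :: 'p padic) * (sqrt (sqrt q) * sqrt (sqrt q)))"
      by (intro pr.norm_le_const_mult pr.norm_le_mult nX)
    then have nu: "norm_le (rad s) ?u (1 / q * sqrt q)" using q_gt_1 by (simp del: q_gt_1)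
    have "1 / q * sqrt q < 1"
    proof -
      have "sqrt q * 1 < sqrt q * sqrt q" using qh by (intro mult_strict_left_mono) auto
      then show ?thesis using q_gt_1 by (simp add: divide_less_eq del: q_gt_1)
    qed
    moreover have "1 \<le> rad s w" for w using s(1,2) by (intro rad_ge_1) auto
    moreover have uT: "?u \<in> T 1 s" using v by (intro pr.tate_mult pr.tate_const pr.tate_var)
    ultimately obtain w0 where w0: "w0 \<in> T 1 s" "w0 * (1 - ?u) = 1"
      using pr.one_minus_inverse[of 1 s ?u "1 / q * sqrt q"] nu by metis
    have sI: "s \<in> {0<..<1}" using s by simp
    have mem: "w0 \<in> A 1" "?u \<in> A 1" "1 - ?u \<in> A 1" "?X \<in> A 1" "?X * ?X \<in> A 1" "?p \<in> A 1"
      using w0 uT pr.tate_diff[OF pr.tate_1 uT] v A_mult[OF A_var[OF v] A_var[OF v]]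
      by (auto intro: T_subset_A[OF sI])
    have h1: "h 1 = 1" using alg_homD(2)[OF h, of 1] by (simp add: mps_const_simps)
    have "h ?u = ?p * (?f * ?f)"
      using alg_homD(4)[OF h mem(6) mem(5)] alg_homD(4)[OF h mem(4) mem(4)] alg_homD(2)[OF h] by simp
    moreover have "h (1 - ?u) + h ?u = h 1" using alg_homD(3)[OF h mem(3) mem(2)] by simp
    ultimately have "h (1 - ?u) = u" using h1 by (simp add: u_def algebra_simps)
    then have "h w0 * u = 1" using alg_homD(4)[OF h mem(1) mem(3)] w0(2) h1 by simp
    then show ?thesis using that alg_homD(1)[OF h mem(1)] by blast
  qed
  have wnz: "w \<noteq> 0" "u \<noteq> 0" using w(2) by auto
  have u1: "u \<in> tate_algebra (coords d l) (\<lambda>_. 1)"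
    unfolding u_def by (intro unit.tate_diff unit.tate_1 unit.tate_mult unit.tate_const f1)
  \<comment> \<open>Gauss's lemma for w u = 1: the dominant exponents of w and u add up to 0, so u
    attains its norm at the constant term, against the coefficient at \<open>c\<close>.\<close>
  obtain a' b' where ab': "mps_coeff w a' \<noteq> 0" "norm_le (\<lambda>_. 1) u (padic_norm (mps_coeff u b') * mpow (\<lambda>_. 1) b')"
      "mps_coeff u b' \<noteq> 0"
      "padic_norm (mps_coeff (w * u) (a' + b')) = padic_norm (mps_coeff w a') * padic_norm (mps_coeff u b')"
    by (rule unit.gauss_dominant[OF A_subset_unit[OF w(1)] wnz(1) u1 wnz(2)]) blast
  have "mps_coeff (1 :: 'p series) (a' + b') \<noteq> 0" using ab' w(2) by (auto simp del: one_mps.rep_eq)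
  then have "a' + b' = 0" by (auto split: if_splits)
  then have "poly_mapping.lookup a' v + poly_mapping.lookup b' v = 0" for v by (metis lookup_add lookup_zero)
  then have "b' = 0" by (intro poly_mapping_eqI) simp
  then have "padic_norm (mps_coeff u c) \<le> padic_norm (mps_coeff u 0)" using ab'(2) by (auto simp: norm_le_def)
  then show False using uc u0 q_gt_1 by linarith
qed

text \<open>At radius index \<open>t0\<close> only finitely many terms exceed 1. Their coefficients
  are at most 1 and their monomials tend to 1 with the index, so a small index brings them below
  \<open>c\<close>.\<close>

lemma norm_le_small_radius:
  assumes f: "f \<in> T l t0" and n: "norm_le (\<lambda>_. 1) f 1" and t0: "0 < t0" and c: "1 < c"
  obtains t where "0 < t" "t \<le> t0" "norm_le (rad t) f c"
proof -
  let ?S = "{a. padic_norm (mps_coeff f a) * mpow (rad t0) a > 1}" and ?B = "mpow (\<lambda>v. \<rho> (snd v))"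
  have "vanishing (\<lambda>a. padic_norm (mps_coeff f a) * mpow (rad t0) a)" using f unfolding pr.tate_iff by blast
  then have fin: "finite ?S" unfolding vanishing_def using zero_less_one by blast
  define M where "M = Max (insert 2 (?B ` ?S))"
  have "2 \<le> M" unfolding M_def using fin by (intro Max_ge) auto
  then have M: "1 < M" by simp
  obtain s where s: "0 < s" "s < 1" "M powr s \<le> c" by (rule small_powr[OF M c])
  have "norm_le (rad (min s t0)) f c"
    unfolding norm_le_def
  proof
    fix a
    show "padic_norm (mps_coeff f a) * mpow (rad (min s t0)) a \<le> c"
    proof (cases "a \<in> ?S")
      case True
      then have B: "?B a \<le> M" unfolding M_def using fin by (intro Max_ge) auto
      have pos: "0 < \<rho> (snd v)" for v using \<rho>_gt_1[of "snd v"] by simp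
      have B0: "0 < ?B a" by (rule mpow_pos) (rule pos)
      have "mpow (rad (min s t0)) a = ?B a powr min s t0"
        unfolding rad_eq using pos by (rule mpow_powr)
      also have "\<dots> \<le> M powr min s t0"
        using B s t0 less_imp_le[OF B0] by (intro powr_mono2) auto
      also have "\<dots> \<le> M powr s" using M by (intro powr_mono) auto
      also have "\<dots> \<le> c" by (rule s(3))
      finally have "mpow (rad (min s t0)) a \<le> c" .
      moreover have "padic_norm (mps_coeff f a) \<le> 1" using n by (simp add: norm_le_def)
      ultimately have "padic_norm (mps_coeff f a) * mpow (rad (min s t0)) a \<le> 1 * c"
        by (intro mult_mono) auto
      then show ?thesis by simp
    next
      case False
      have "padic_norm (mps_coeff f a) * mpow (rad (min s t0)) a \<le> padic_norm (mps_coeff f a) * mpow (rad t0) a"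
        by (intro mult_left_mono mpow_rad_mono) auto
      then show ?thesis using False c by simp
    qed
  qed
  then show ?thesis using s t0 by (intro that[of "min s t0"]) auto
qed

text \<open>The images of the coordinates have Gauss norm at most 1 and the target radii exceed 1,
  so each image admits a small enough index; finitely many coordinates have a common one.\<close>

lemma hom_contracting_tuple:
  assumes h: "h \<in> alg_homs (A 1) (A l)"
  shows "contracting_tuple 1 l (\<lambda>v. h (mps_var v))"
  unfolding contracting_tuple_def
proof
  fix s :: real assume s: "s \<in> {0<..<1}"
  let ?ok = "\<lambda>v t. 0 < t \<and> h (mps_var v) \<in> T l t \<and> norm_le (rad t) (h (mps_var v)) (rad s v)"
  have "\<forall>v\<in>coords d 1. \<exists>t. ?ok v t"
  proof
    fix v assume v: "v \<in> coords d 1"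
    obtain t0 where t0: "t0 \<in> {0<..<1}" "h (mps_var v) \<in> T l t0"
      using alg_homD(1)[OF h A_var[OF v]] unfolding A_iff by blast
    have c: "1 < rad s v" unfolding rad_powr using s by (intro gr_one_powr \<rho>_gt_1) auto
    have "0 < t0" using t0(1) by simp
    then obtain t where t: "0 < t" "t \<le> t0" "norm_le (rad t) (h (mps_var v)) (rad s v)"
      using c by (rule norm_le_small_radius[OF t0(2) hom_var_norm_le_1[OF h v]])
    show "\<exists>t. ?ok v t" using t T_mono[OF order_refl t(2) t0(2)] by blast
  qed
  then obtain t where t: "\<forall>v\<in>coords d 1. ?ok v (t v)" by (rule bchoice[THEN exE])
  define u where "u = Min (insert (1 / 2) (t ` coords d 1))"
  have "0 < u" unfolding u_def using t by (subst Min_gr_iff) auto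
  moreover have "u \<le> 1 / 2" unfolding u_def by (rule Min_le) auto
  ultimately have uI: "u \<in> {0<..<1}" by simp
  have u_le: "u \<le> t v" if "v \<in> coords d 1" for v unfolding u_def using that by (intro Min_le) auto
  show "\<exists>t\<in>{0<..<1}. \<forall>v\<in>coords d 1. h (mps_var v) \<in> T l t \<and> norm_le (rad t) (h (mps_var v)) (rad s v)"
  proof (rule bexI[OF _ uI], intro ballI conjI)
    fix v assume v: "v \<in> coords d 1"
    then have tv: "?ok v (t v)" using t by blast
    show "h (mps_var v) \<in> T l u" by (rule T_mono[OF order_refl u_le[OF v]]) (use tv in blast)
    show "norm_le (rad u) (h (mps_var v)) (rad s v)" by (rule norm_le_rad_mono[OF u_le[OF v]]) (use tv in blast)
  qed
qed

definition hom_map :: "('p series \<Rightarrow> 'p series) \<Rightarrow> (nat \<times> nat \<Rightarrow> 'p padic) \<Rightarrow> nat \<times> nat \<Rightarrow> 'p padic" where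
  "hom_map h x v = (if v \<in> coords d 1 then ev x (h (mps_var v)) else 0)"

text \<open>Brings an arbitrary group law on the dagger disc, whose structure maps are just
  homomorphisms, within reach of the pointwise criteria.\<close>

lemma hom_realizes:
  assumes h: "h \<in> alg_homs (A 1) (A l)"
  shows "realizes 1 l h (hom_map h)"
proof -
  let ?h = "restrict (mps_subst (\<lambda>v. h (mps_var v))) (A 1)"
  have R: "realizes 1 l ?h (hom_map h)"
    by (rule realizes_subst[OF hom_contracting_tuple[OF h]])
      (simp_all add: integral_pt_def hom_map_def hom_point_integral[OF h, unfolded integral_pt_def])
  have "?h = h"
  proof (rule alg_hom_eqI[OF realizesD(1)[OF R] h])
    fix v assume v: "v \<in> coords d 1"
    show "?h (mps_var v) = h (mps_var v)"
    proof (rule A_separated[OF realizesD(5)[OF R A_var[OF v]] alg_homD(1)[OF h A_var[OF v]]])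
      fix x :: "nat \<times> nat \<Rightarrow> 'p padic" assume "integral_pt x"
      then show "ev x (?h (mps_var v)) = ev x (h (mps_var v))"
        using v by (simp only: realizes_var[OF R v] hom_map_def if_True)
    qed
  qed
  then show ?thesis using R by simp
qed

section \<open>Rational points of the dagger disc and uniqueness of its group law\<close>

definition const_hom :: "(nat \<times> nat \<Rightarrow> 'p padic) \<Rightarrow> 'p series \<Rightarrow> 'p series" where
  "const_hom y = restrict (mps_subst (\<lambda>v. mps_const (y v))) (A 1)"

lemma realizes_const_hom:
  assumes y: "integral_pt y"
  shows "realizes 1 0 (const_hom y) (\<lambda>_. y)"
  unfolding const_hom_def
proof (rule realizes_subst)
  show "contracting_tuple 1 0 (\<lambda>v. mps_const (y v))"
    unfolding contracting_tuple_def
  proof (intro ballI bexI conjI)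
    fix s v assume s: "s \<in> {0<..<1 :: real}"
    show "mps_const (y v) \<in> T 0 s" by simp
    have "padic_norm (y v) \<le> rad s v"
      using y rad_ge_1[OF s, of v] unfolding integral_pt_def by (metis order_trans)
    then show "norm_le (rad s) (mps_const (y v)) (rad s v)" by (rule pr.norm_le_const)
  qed
qed (use y in simp_all)

text \<open>The map that \<open>attached_dagger_group\<close> requires to be an isomorphism.\<close>

definition group_pt :: "('p series \<Rightarrow> 'p series) \<Rightarrow> 'g" where
  "group_pt \<phi> = E (\<lambda>i. padic_int_of_padic (mps_coeff (\<phi> (mps_var (0, i))) 0))"

lemma ev_A_0:
  assumes "f \<in> A 0"
  shows "ev x f = mps_coeff f 0"
proof -
  have "f = mps_const (mps_coeff f 0)"
  proof (rule mps_eqI)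
    fix a
    obtain s where "f \<in> T 0 s" using assms unfolding A_iff by blast
    then have "mps_coeff f a \<noteq> 0 \<Longrightarrow> a = 0" using pr.tate_keys[of f 0 s a] by (simp add: coords_def)
    then show "mps_coeff f a = mps_coeff (mps_const (mps_coeff f 0)) a" by auto
  qed
  then show ?thesis by (metis ev_const)
qed

lemma group_pt_eq:
  assumes "realizes 1 0 \<phi> R" "integral_pt x"
  shows "group_pt \<phi> = pt (R x) 0"
  unfolding group_pt_def pt_def
proof (rule E_cong)
  fix i assume "i < d"
  then have v: "(0, i) \<in> coords d 1" by (simp add: coords_def)
  show "padic_int_of_padic (mps_coeff (\<phi> (mps_var (0, i))) 0) = cd (R x) 0 i"
    unfolding cd_def realizes_var[OF assms(1) v assms(2), symmetric]
      ev_A_0[OF realizesD(5)[OF assms(1) A_var[OF v]]] ..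
qed

lemma integral_0: "integral_pt (\<lambda>_. 0 :: 'p padic)"
  by (simp add: integral_pt_def)

lemma realizes_values:
  assumes "realizes 1 l h R" "realizes 1 l h Q" "integral_pt x" "v \<in> coords d 1"
  shows "R x v = Q x v"
  using realizes_var[OF assms(1,4,3)] realizes_var[OF assms(2,4,3)] by simp

lemma eq_point_of:
  assumes "integral_pt y" "pt y 0 = h" "v \<in> coords d 1"
  shows "y v = point_of h v"
  using point_of_pt[OF assms(1,3)] assms(2) by simp

lemma point_of_eqD:
  assumes "\<And>v. v \<in> coords d 1 \<Longrightarrow> y v = point_of h v" "h \<in> carrier G"
  shows "pt y 0 = h"
proof -
  have "pt y 0 = pt (point_of h) 0" by (rule pt_cong, rule assms(1)) (simp add: coords_def)
  then show ?thesis using assms(2) by simp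
qed

lemma group_pt_iso: "group_pt \<in> iso (rational_points A (law A)) G"
proof -
  note R = group_pt_eq[OF hom_realizes integral_0]
  have "group_pt \<in> hom (rational_points A (law A)) G"
  proof (rule homI)
    fix \<phi> \<psi> assume "\<phi> \<in> carrier (rational_points A (law A))" "\<psi> \<in> carrier (rational_points A (law A))"
    then have h: "\<phi> \<in> alg_homs (A 1) (A 0)" "\<psi> \<in> alg_homs (A 1) (A 0)" by (simp_all add: rational_points_def)
    show "group_pt \<phi> \<in> carrier G" unfolding R[OF h(1)] by simp
    have "group_pt (point_mult A (law A) (A 0) \<phi> \<psi>) = group_pt \<phi> \<otimes> group_pt \<psi>"
      unfolding R[OF h(1)] R[OF h(2)]
        group_pt_eq[OF realizes_point_mult[OF realizes_comult hom_realizes[OF h(1)] hom_realizes[OF h(2)]] integral_0]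
      by simp
    then show "group_pt (\<phi> \<otimes>\<^bsub>rational_points A (law A)\<^esub> \<psi>) = group_pt \<phi> \<otimes> group_pt \<psi>"
      by (simp add: rational_points_def)
  qed
  moreover have "inj_on group_pt (carrier (rational_points A (law A)))"
  proof (rule inj_onI)
    fix \<phi> \<psi> assume "\<phi> \<in> carrier (rational_points A (law A))" "\<psi> \<in> carrier (rational_points A (law A))"
      and eq: "group_pt \<phi> = group_pt \<psi>"
    then have h: "\<phi> \<in> alg_homs (A 1) (A 0)" "\<psi> \<in> alg_homs (A 1) (A 0)" by (simp_all add: rational_points_def)
    note H = hom_realizes[OF h(1)] hom_realizes[OF h(2)]
    show "\<phi> = \<psi>"
    proof (rule realizes_unique[OF H])
      fix x :: "nat \<times> nat \<Rightarrow> 'p padic" and v assume x: "integral_pt x" and v: "v \<in> coords d 1"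
      have "pt (hom_map \<phi> x) 0 = pt (hom_map \<psi> x) 0"
        using eq unfolding group_pt_eq[OF H(1) x] group_pt_eq[OF H(2) x] .
      then show "hom_map \<phi> x v = hom_map \<psi> x v"
        unfolding point_of_pt[OF realizesD(3)[OF H(2) x] v, symmetric]
        by (rule eq_point_of[OF realizesD(3)[OF H(1) x] _ v])
    qed
  qed
  moreover have "carrier G \<subseteq> group_pt ` carrier (rational_points A (law A))"
  proof
    fix h assume h: "h \<in> carrier G"
    note H = realizes_const_hom[OF integral_point_of, of h]
    have "group_pt (const_hom (point_of h)) = h" unfolding group_pt_eq[OF H integral_0] using h by simp
    then show "h \<in> group_pt ` carrier (rational_points A (law A))"
      using realizesD(1)[OF H] by (intro image_eqI[OF sym]) (simp_all add: rational_points_def)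
  qed
  ultimately show ?thesis
    unfolding iso_def bij_betw_def by (auto dest: hom_in_carrier)
qed

text \<open>The comultiplication at a point is read off from the product of the two rational points
  that are its components, where the isomorphism with G applies. The unit and inverse axioms then
  determine counit and antipode by cancellation in G.\<close>

lemma law_unique:
  assumes obj: "group_object A S" and iso: "group_pt \<in> iso (rational_points A S) G"
  shows "S = law A"
proof -
  have mem: "comult S \<in> alg_homs (A 1) (A 2)" "counit S \<in> alg_homs (A 1) (A 0)"
      "antipode S \<in> alg_homs (A 1) (A 1)"
    and unit: "point_mult A S (A 1) (counit S) (restrict id (A 1)) = restrict id (A 1)"
    and inverse: "point_mult A S (A 1) (antipode S) (restrict id (A 1)) = counit S"
    using obj unfolding group_object_def by blast+
  note R = hom_realizes[OF mem(1)] hom_realizes[OF mem(2)] hom_realizes[OF mem(3)]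
  have comult: "comult S = comult (law A)"
  proof (rule realizes_unique[OF R(1) realizes_comult])
    fix x :: "nat \<times> nat \<Rightarrow> 'p padic" and v assume x: "integral_pt x" and v: "v \<in> coords d 1"
    \<comment> \<open>\<open>?y b\<close> is the component of x on factor b, as a point of X by
      itself; repeating it on all factors keeps it integral.\<close>
    let ?y = "\<lambda>b (c :: nat, i). x (b :: nat, i)"
    have y: "integral_pt (?y b)" for b using x by (auto simp: integral_pt_def)
    note C = realizes_const_hom[OF y, of 0] realizes_const_hom[OF y, of 1]
    note PM = realizes_point_mult[OF R(1) C]
    let ?z = "hom_map (comult S) (pair_point (?y 0) (?y 1))"
    have "group_pt (point_mult A S (A 0) (const_hom (?y 0)) (const_hom (?y 1)))
        = group_pt (const_hom (?y 0)) \<otimes> group_pt (const_hom (?y 1))"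
      using hom_mult[OF Group.iso_imp_homomorphism[OF iso], of "const_hom (?y 0)" "const_hom (?y 1)"]
        realizesD(1)[OF C(1)] realizesD(1)[OF C(2)] by (simp add: rational_points_def)
    then have "pt ?z 0 = pt (?y 0) 0 \<otimes> pt (?y 1) 0"
      unfolding group_pt_eq[OF PM integral_0] group_pt_eq[OF C(1) integral_0] group_pt_eq[OF C(2) integral_0] .
    moreover have "pt (?y 0) 0 = pt x 0" "pt (?y 1) 0 = pt x 1" by (rule pt_cong; simp)+
    ultimately have "pt ?z 0 = pt x 0 \<otimes> pt x 1" by simp
    from eq_point_of[OF realizesD(3)[OF R(1) integral_pair_point[OF y y]] this v]
    have "?z v = point_of (pt x 0 \<otimes> pt x 1) v" .
    moreover have "?z v = hom_map (comult S) x v"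
    proof -
      have "ev (pair_point (?y 0) (?y 1)) (comult S (mps_var v)) = ev x (comult S (mps_var v))"
        by (rule evA_cong[OF realizesD(5)[OF R(1) A_var[OF v]]]) (auto simp: coords_def pair_point_def less_2_cases_iff)
      then show ?thesis by (simp add: hom_map_def)
    qed
    ultimately show "hom_map (comult S) x v = point_of (pt x 0 \<otimes> pt x 1) v" by simp
  qed
  note M = realizes_comult[folded comult]
  have counit: "counit S = counit (law A)"
  proof (rule realizes_unique[OF R(2) realizes_counit])
    fix x :: "nat \<times> nat \<Rightarrow> 'p padic" and v assume x: "integral_pt x" and v: "v \<in> coords d 1"
    let ?e = "hom_map (counit S) x"
    have "point_of (pt ?e 0 \<otimes> pt x 0) w = x w" if "w \<in> coords d 1" for w
      using realizes_values[OF realizes_point_mult[OF M realizes_mono[OF R(2) zero_le_one] realizes_id, unfolded unit] realizes_id x that]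
      by simp
    then have "pt x 0 = pt ?e 0 \<otimes> pt x 0" by (intro point_of_eqD) auto
    then have "pt ?e 0 = \<one>" by (metis l_cancel_one' pt_closed r_cancel_one)
    then show "?e v = point_of \<one> v" by (rule eq_point_of[OF realizesD(3)[OF R(2) x] _ v])
  qed
  have antipode: "antipode S = antipode (law A)"
  proof (rule realizes_unique[OF R(3) realizes_antipode])
    fix x :: "nat \<times> nat \<Rightarrow> 'p padic" and v assume x: "integral_pt x" and v: "v \<in> coords d 1"
    let ?j = "hom_map (antipode S) x"
    note U = realizes_mono[OF realizes_counit zero_le_one, folded counit]
    have "point_of (pt ?j 0 \<otimes> pt x 0) w = point_of \<one> w" if "w \<in> coords d 1" for w
      using realizes_values[OF realizes_point_mult[OF M R(3) realizes_id, unfolded inverse] U x that]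
      by simp
    then have "pt (point_of (pt ?j 0 \<otimes> pt x 0)) 0 = \<one>" by (intro point_of_eqD) auto
    then have "pt ?j 0 \<otimes> pt x 0 = \<one>" by simp
    then have "pt ?j 0 = inv (pt x 0)" by (intro inv_equality[symmetric]) auto
    then show "?j v = point_of (inv (pt x 0)) v" by (rule eq_point_of[OF realizesD(3)[OF R(3) x] _ v])
  qed
  show ?thesis using comult counit antipode by (intro group_law.equality) simp_all
qed

lemma dagger_group_eq:
  assumes "A = dagger_disc_powers d"
  shows "dagger_group G Top gs = law A"
proof -
  have "attached_dagger_group G Top gs S \<longleftrightarrow> group_object A S \<and> group_pt \<in> iso (rational_points A S) G" for S
    unfolding attached_dagger_group_def assms group_pt_def[abs_def] ..
  then show ?thesis
    unfolding dagger_group_def using group_object_law group_pt_iso law_unique by (intro the_equality) blast+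
qed

end

theorem corollary6p8:
  fixes G :: "('g, 'b) monoid_scheme" and T :: "'g topology"
    and \<omega> :: "'g \<Rightarrow> ereal" and gs :: "'g list" and N :: nat
  assumes "p_valued_group CARD('p::prime_card) G T \<omega>"
    and "saturated CARD('p) G \<omega>"
    and "ordered_basis TYPE('p) G T \<omega> gs"
    and "\<forall>g\<in>carrier G - {\<one>\<^bsub>G\<^esub>}. real_of_ereal (\<omega> g) \<in> \<rat>"
    and "N \<ge> 1"
  shows "\<exists>!S :: 'p group_law.
    group_object
      (polydisc_powers (length gs) (\<lambda>i. real CARD('p) powr radius_exponent CARD('p) \<omega> gs N i)) S \<and>
    restricts_to
      (polydisc_powers (length gs) (\<lambda>i. real CARD('p) powr radius_exponent CARD('p) \<omega> gs N i) 1)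
      (dagger_group G T gs) S"
proof -
  define q where "q = real CARD('p)"
  define \<kappa> where "\<kappa> = q powr (- 1 / (q - 1))"
  define \<rho> where "\<rho> i = (if i < length gs then \<kappa> / pmag q (\<omega> (gs ! i)) else 2)" for i
  define s where "s = 1 / (real N + 1)"
  interpret saturated_basis "TYPE('p)" G T \<omega> gs q \<kappa> \<rho>
    by unfold_locales (fact assms(1) assms(3) q_def \<kappa>_def assms(2) \<rho>_def)+
  \<comment> \<open>Here \<open>N\<close> \<ge> 1 enters: it gives s < 1.\<close>
  have s: "0 < s" "s < 1" using assms(5) by (simp_all add: s_def)
  \<comment> \<open>\<rho>_i is p raised to \<omega>(g_i) - 1/(p-1), so its power with exponent
    1/(N+1) is the radius of the theorem.\<close>
  have r: "real CARD('p) powr radius_exponent CARD('p) \<omega> gs N i = \<rho> i powr s" if i: "i < length gs" for i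
  proof -
    have "\<omega> (gs ! i) \<noteq> \<infinity>" using nrm_g_pos[OF i] by (auto simp: nrm_def)
    then have "\<rho> i = q powr (real_of_ereal (\<omega> (gs ! i)) - 1 / (q - 1))"
      using i by (simp add: \<rho>_def \<kappa>_def pmag_def flip: powr_diff)
    then show ?thesis by (simp add: powr_powr radius_exponent_def s_def flip: q_def)
  qed
  let ?D = "dagger_disc_powers (length gs) :: nat \<Rightarrow> 'p series set"
  let ?B = "polydisc_powers (length gs) (\<lambda>i. real CARD('p) powr radius_exponent CARD('p) \<omega> gs N i) :: nat \<Rightarrow> 'p series set"
  interpret D: dagger_family "TYPE('p)" G T \<omega> gs q \<kappa> \<rho> ?D
    by (intro dagger_family.intro group_family.intro group_family_axioms.intro dagger_disc_family \<rho>_gt_1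
        saturated_basis_axioms) auto
  interpret B: group_family "TYPE('p)" G T \<omega> gs q \<kappa> \<rho> ?B "{s}"
    by (intro group_family.intro group_family_axioms.intro polydisc_family \<rho>_gt_1 r s(1) saturated_basis_axioms)
      (use s in auto)
  \<comment> \<open>The polydisc has one of the radii whose union defines the overconvergent
    functions, so its functions restrict to the dagger disc.\<close>
  have sub: "?B 1 \<subseteq> ?D 1"
    using s unfolding B.A_iff D.A_iff subset_iff by auto
  have eq: "comult (law ?D) f = comult (law ?B) f" "counit (law ?D) f = counit (law ?B) f"
    "antipode (law ?D) f = antipode (law ?B) f" if "f \<in> ?B 1" for f
    using that subsetD[OF sub that] by (simp_all add: law_def)
  have obj: "group_object ?B (law ?B)" by (rule B.group_object_law)
  show ?thesis
    unfolding D.dagger_group_eq[OF refl]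
  proof (intro ex1I conjI)
    show "group_object ?B (law ?B)" by (rule obj)
    show "restricts_to (?B 1) (law ?D) (law ?B)"
      unfolding restricts_to_def by (intro ballI conjI eq[symmetric])
    fix S assume S: "group_object ?B S \<and> restricts_to (?B 1) (law ?D) S"
    then have f: "comult S f = comult (law ?B) f" "counit S f = counit (law ?B) f"
      "antipode S f = antipode (law ?B) f" if "f \<in> ?B 1" for f
      using that eq unfolding restricts_to_def by simp_all
    \<comment> \<open>Structure maps are \<open>undefined\<close> outside the algebra, so agreement
      on the algebra is equality of functions.\<close>
    have ext: "h = h'" if "h \<in> alg_homs (?B 1) (?B k)" "h' \<in> alg_homs (?B 1) (?B k)" "\<And>f. f \<in> ?B 1 \<Longrightarrow> h f = h' f" for h h' k
    proof
      show "h f = h' f" for f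
        using that(3) B.alg_homD(5)[OF that(1)] B.alg_homD(5)[OF that(2)] by (cases "f \<in> ?B 1") simp_all
    qed
    have mem: "comult R \<in> alg_homs (?B 1) (?B 2)" "counit R \<in> alg_homs (?B 1) (?B 0)"
      "antipode R \<in> alg_homs (?B 1) (?B 1)" if "group_object ?B R" for R
      using that unfolding group_object_def by blast+
    note S' = mem[OF conjunct1[OF S]] and L = mem[OF obj]
    show "S = law ?B"
      by (intro group_law.equality ext[OF S'(1) L(1) f(1)] ext[OF S'(2) L(2) f(2)] ext[OF S'(3) L(3) f(3)])
        simp_all
  qed
qed

end
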